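(* Let $k$ be an algebraically closed field of characteristic zero. Let $X\subset\mathbb{P}^N$ be a nondegenerate reduced quadratic scheme satisfying property $\mathbf{N}_{2,p}$ for some $p\ge 2$, and let $q\in X$ be a smooth point. Then the inner projection $X_q=\overline{\pi_q(X\setminus\{q\})}\subset\mathbb{P}^{N-1}$ is also quadratic and satisfies property $\mathbf{N}_{2,p-1}$.
   Context: $\pi_q$ is the linear projection from the point $q$. $X$ is nondegenerate if it is contained in no hyperplane. Let $R$ be the homogeneous coordinate ring of the ambient projective space. A closed subscheme $X$ is quadratic if there is a homogeneous ideal $I\subset R$ generated by forms of degree 2 that defines $X$ scheme-theoretically (the sheafification of $I$ is the ideal sheaf of $X$; $I$ need not be saturated). $X$ satisfies property $\mathbf{N}_{2,p}$ (scheme-theoretically) if it is quadratic and such a quadratic ideal $I$ has only linear syzygies at least up to the first $p$ steps, i.e. $\mathrm{Tor}_i^R(R/I,k)_{i+j}=0$ for all $0\le i\le p$ and $j\ge 2$. With $q=(1:0:\cdots:0)$ and $S=k[x_1,\ldots,x_N]$, the scheme structure on $X_q$ is the one given by $J=I\cap S$. *)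

theory Defs
  imports
    Complex_Main
    "HOL-Library.Poly_Mapping"
    "HOL-Computational_Algebra.Polynomial"
begin

section \<open>Polynomial rings\<close>

text \<open>
  Polynomials in the variables \<open>x\<^sub>0, x\<^sub>1, \<dots>\<close> over \<open>'k\<close>. The polynomial ring \<open>k[x\<^sub>i : i \<in> V]\<close> in a
  finite set \<open>V\<close> of variables is the subring \<open>polys V\<close>, so that \<open>k[x\<^sub>1,\<dots>,x\<^sub>N]\<close> is literally
  contained in \<open>k[x\<^sub>0,\<dots>,x\<^sub>N]\<close>.
\<close>

type_synonym 'k mpoly = "(nat \<Rightarrow>\<^sub>0 nat) \<Rightarrow>\<^sub>0 'k"

definition polys :: "nat set \<Rightarrow> 'k::field mpoly set" where
  "polys V = {f. \<forall>m\<in>Poly_Mapping.keys f. Poly_Mapping.keys m \<subseteq> V}"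

definition var :: "nat \<Rightarrow> 'k::field mpoly" where
  "var i = Poly_Mapping.single (Poly_Mapping.single i 1) 1"

definition const :: "'k::field \<Rightarrow> 'k mpoly" where
  "const c = Poly_Mapping.single 0 c"

definition mdeg :: "(nat \<Rightarrow>\<^sub>0 nat) \<Rightarrow> nat" where
  "mdeg m = (\<Sum>i\<in>Poly_Mapping.keys m. Poly_Mapping.lookup m i)"

definition homogeneous :: "nat \<Rightarrow> 'k::field mpoly \<Rightarrow> bool" where
  "homogeneous d f \<longleftrightarrow> (\<forall>m\<in>Poly_Mapping.keys f. mdeg m = d)"

definition forms :: "nat set \<Rightarrow> nat \<Rightarrow> 'k::field mpoly set" where
  "forms V d = {f \<in> polys V. homogeneous d f}"

definition eval_via :: "('k::field \<Rightarrow> 'a::comm_ring_1) \<Rightarrow> (nat \<Rightarrow> 'a) \<Rightarrow> 'k mpoly \<Rightarrow> 'a" where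
  "eval_via h x f = (\<Sum>m\<in>Poly_Mapping.keys f. h (Poly_Mapping.lookup f m) *
      (\<Prod>i\<in>Poly_Mapping.keys m. x i ^ Poly_Mapping.lookup m i))"

definition eval :: "(nat \<Rightarrow> 'k::field) \<Rightarrow> 'k mpoly \<Rightarrow> 'k" where
  "eval = eval_via (\<lambda>c. c)"

definition subst :: "(nat \<Rightarrow> 'k::field mpoly) \<Rightarrow> 'k mpoly \<Rightarrow> 'k mpoly" where
  "subst = eval_via const"

definition partial_deriv :: "nat \<Rightarrow> 'k::field mpoly \<Rightarrow> 'k mpoly" where
  "partial_deriv i f = (\<Sum>m\<in>Poly_Mapping.keys f.
      Poly_Mapping.single (m - Poly_Mapping.single i 1)
        (of_nat (Poly_Mapping.lookup m i) * Poly_Mapping.lookup f m))"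

definition is_ideal :: "nat set \<Rightarrow> 'k::field mpoly set \<Rightarrow> bool" where
  "is_ideal V I \<longleftrightarrow> I \<subseteq> polys V \<and> 0 \<in> I \<and> (\<forall>f\<in>I. \<forall>g\<in>I. f + g \<in> I) \<and>
     (\<forall>r\<in>polys V. \<forall>f\<in>I. r * f \<in> I)"

definition ideal_gen :: "nat set \<Rightarrow> 'k::field mpoly set \<Rightarrow> 'k mpoly set" where
  "ideal_gen V G = is_ideal V hull G"

definition homogeneous_ideal :: "nat set \<Rightarrow> 'k::field mpoly set \<Rightarrow> bool" where
  "homogeneous_ideal V I \<longleftrightarrow> is_ideal V I \<and> (\<exists>G \<subseteq> (\<Union>d. forms V d). I = ideal_gen V G)"

section \<open>Projective space and closed subschemes\<close>

text \<open>
  The projective space with homogeneous coordinates \<open>x\<^sub>i\<close>, \<open>i \<in> V\<close>. Points are given by their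
  nonzero coordinate vectors, and a set of points by the set of \<^emph>\<open>all\<close> coordinate vectors of its
  members.
\<close>

definition proj_space :: "nat set \<Rightarrow> (nat \<Rightarrow> 'k::field) set" where
  "proj_space V = {x. (\<exists>i\<in>V. x i \<noteq> 0) \<and> (\<forall>i. i \<notin> V \<longrightarrow> x i = 0)}"

definition same_point :: "(nat \<Rightarrow> 'k::field) \<Rightarrow> (nat \<Rightarrow> 'k) \<Rightarrow> bool" where
  "same_point x y \<longleftrightarrow> (\<exists>c. c \<noteq> 0 \<and> x = (\<lambda>i. c * y i))"

definition zeros :: "nat set \<Rightarrow> 'k::field mpoly set \<Rightarrow> (nat \<Rightarrow> 'k) set" where
  "zeros V F = {x \<in> proj_space V. \<forall>f\<in>F. eval x f = 0}"

definition zariski_closed :: "nat set \<Rightarrow> (nat \<Rightarrow> 'k::field) set \<Rightarrow> bool" where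
  "zariski_closed V X \<longleftrightarrow> (\<exists>F \<subseteq> (\<Union>d. forms V d). X = zeros V F)"

definition zariski_closure :: "nat set \<Rightarrow> (nat \<Rightarrow> 'k::field) set \<Rightarrow> (nat \<Rightarrow> 'k) set" where
  "zariski_closure V Y = \<Inter>{X. zariski_closed V X \<and> Y \<subseteq> X}"

text \<open>
  A closed subscheme is given by a homogeneous ideal up to equality of the associated ideal
  sheaves. Over an algebraically closed field the reduced closed subschemes are the Zariski closed
  sets \<open>X\<close>, with the following ideal.
\<close>

definition vanishing_ideal :: "nat set \<Rightarrow> (nat \<Rightarrow> 'k::field) set \<Rightarrow> 'k mpoly set" where
  "vanishing_ideal V X = {f \<in> polys V. \<forall>x\<in>X. eval x f = 0}"

text \<open>
  The contraction to \<open>k[x\<^sub>j : j \<in> V]\<close> of the localized ideal \<open>I[1/x\<^sub>i]\<close>. For homogeneous ideals it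
  determines, and is determined by, the degree-\<open>0\<close> part of \<open>I[1/x\<^sub>i]\<close>, which is the ideal of the
  subscheme in the chart \<open>x\<^sub>i \<noteq> 0\<close>.
\<close>

definition chart_ideal :: "nat set \<Rightarrow> nat \<Rightarrow> 'k::field mpoly set \<Rightarrow> 'k mpoly set" where
  "chart_ideal V i I = {f \<in> polys V. \<exists>n. var i ^ n * f \<in> I}"

definition same_ideal_sheaf :: "nat set \<Rightarrow> 'k::field mpoly set \<Rightarrow> 'k mpoly set \<Rightarrow> bool" where
  "same_ideal_sheaf V I K \<longleftrightarrow> (\<forall>i\<in>V. chart_ideal V i I = chart_ideal V i K)"

definition nondegenerate :: "nat set \<Rightarrow> (nat \<Rightarrow> 'k::field) set \<Rightarrow> bool" where
  "nondegenerate V X \<longleftrightarrow> \<not> (\<exists>l \<in> forms V 1. l \<noteq> 0 \<and> X \<subseteq> zeros V {l})"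

text \<open>
  Smoothness at \<open>q\<close> of the subscheme with ideal \<open>K\<close>, as in Bosch--Luetkebohmert--Raynaud,
  \<^emph>\<open>Neron Models\<close>, 2.2, Definition 3: near \<open>q\<close> the ideal sheaf is generated by sections
  \<open>g\<^sub>0,\<dots>,g\<^bsub>c-1\<^esub>\<close> whose differentials at \<open>q\<close> are linearly independent. After multiplication by units
  the sections are forms in \<open>K\<close>, and by Euler's formula their differentials in an affine chart
  around \<open>q\<close> are independent iff their gradients in the homogeneous coordinates are.
\<close>

definition smooth_point :: "nat set \<Rightarrow> 'k::field mpoly set \<Rightarrow> (nat \<Rightarrow> 'k) \<Rightarrow> bool" where
  "smooth_point V K q \<longleftrightarrow> q \<in> zeros V K \<and>
     (\<exists>(c::nat) g. (\<forall>j<c. g j \<in> K \<and> (\<exists>d. g j \<in> forms V d)) \<and>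
        (\<forall>f\<in>K. \<exists>h\<in>polys V. eval q h \<noteq> 0 \<and> h * f \<in> ideal_gen V (g ` {..<c})) \<and>
        (\<forall>a. (\<forall>i\<in>V. (\<Sum>j<c. a j * eval q (partial_deriv i (g j))) = 0) \<longrightarrow> (\<forall>j<c. a j = 0)))"

section \<open>Graded free resolutions and Tor\<close>

text \<open>
  With \<open>R = polys V\<close>, the free module on a set \<open>B\<close> of basis elements consists of the finitely
  supported functions \<open>B \<rightarrow> R\<close>, extended by \<open>0\<close>. It is graded by giving the basis element \<open>b\<close> a
  degree \<open>d b\<close>, i.e. it is the sum of the \<open>R(-d b)\<close>. A linear map is given by the images \<open>M b\<close> of
  the basis elements.
\<close>

definition free_module :: "nat set \<Rightarrow> nat set \<Rightarrow> (nat \<Rightarrow> 'k::field mpoly) set" where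
  "free_module V B = {u. (\<forall>b. u b \<in> polys V) \<and> finite {b. u b \<noteq> 0} \<and> {b. u b \<noteq> 0} \<subseteq> B}"

definition free_map :: "(nat \<Rightarrow> nat \<Rightarrow> 'a::comm_ring_1) \<Rightarrow> (nat \<Rightarrow> 'a) \<Rightarrow> nat \<Rightarrow> 'a" where
  "free_map M u = (\<lambda>c. \<Sum>b\<in>{b. u b \<noteq> 0}. u b * M b c)"

definition graded_map ::
  "nat set \<Rightarrow> nat set \<Rightarrow> (nat \<Rightarrow> nat) \<Rightarrow> nat set \<Rightarrow> (nat \<Rightarrow> nat) \<Rightarrow> (nat \<Rightarrow> nat \<Rightarrow> 'k::field mpoly) \<Rightarrow> bool"
where
  "graded_map V B d B' d' M \<longleftrightarrow> (\<forall>b\<in>B. M b \<in> free_module V B' \<and>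
     (\<forall>c. M b c \<noteq> 0 \<longrightarrow> d' c \<le> d b \<and> homogeneous (d b - d' c) (M b c)))"

text \<open>
  \<open>\<cdots> \<rightarrow> F\<^sub>2 \<rightarrow> F\<^sub>1 \<rightarrow> F\<^sub>0 \<rightarrow> R/I \<rightarrow> 0\<close> is exact, where \<open>F\<^sub>i\<close> is free on \<open>B i\<close> with degrees \<open>d i\<close>, the map
  \<open>F\<^bsub>i+1\<^esub> \<rightarrow> F\<^sub>i\<close> is \<open>M i\<close>, and the augmentation sends \<open>b \<in> B 0\<close> to the class of \<open>a b\<close>.
\<close>

definition graded_free_resolution ::
  "nat set \<Rightarrow> 'k::field mpoly set \<Rightarrow> (nat \<Rightarrow> nat set) \<Rightarrow> (nat \<Rightarrow> nat \<Rightarrow> nat) \<Rightarrow>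
   (nat \<Rightarrow> nat \<Rightarrow> nat \<Rightarrow> 'k mpoly) \<Rightarrow> (nat \<Rightarrow> 'k mpoly) \<Rightarrow> bool"
where
  "graded_free_resolution V I B d M a \<longleftrightarrow>
     (\<forall>b\<in>B 0. a b \<in> forms V (d 0 b)) \<and>
     (\<forall>i. graded_map V (B (Suc i)) (d (Suc i)) (B i) (d i) (M i)) \<and>
     (\<forall>f\<in>polys V. \<exists>u\<in>free_module V (B 0). f - (\<Sum>b\<in>{b. u b \<noteq> 0}. u b * a b) \<in> I) \<and>
     {u \<in> free_module V (B 0). (\<Sum>b\<in>{b. u b \<noteq> 0}. u b * a b) \<in> I}
       = free_map (M 0) ` free_module V (B 1) \<and>
     (\<forall>i. {u \<in> free_module V (B (Suc i)). free_map (M i) u = (\<lambda>_. 0)}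
       = free_map (M (Suc i)) ` free_module V (B (Suc (Suc i))))"

text \<open>
  Tensoring the resolution with \<open>k = R/(x\<^sub>j : j \<in> V)\<close> replaces the free modules by \<open>k\<close>-vector spaces on the same
  bases and the matrix entries by their constant terms. The part of degree \<open>e\<close> of \<open>F\<^sub>i \<otimes> k\<close> is
  spanned by the basis elements of degree \<open>e\<close>.
\<close>

definition strand :: "(nat \<Rightarrow> nat set) \<Rightarrow> (nat \<Rightarrow> nat \<Rightarrow> nat) \<Rightarrow> nat \<Rightarrow> nat \<Rightarrow> (nat \<Rightarrow> 'k::field) set" where
  "strand B d i e = {v. finite {b. v b \<noteq> 0} \<and> {b. v b \<noteq> 0} \<subseteq> {b \<in> B i. d i b = e}}"

definition mod_vars :: "(nat \<Rightarrow> nat \<Rightarrow> 'k::field mpoly) \<Rightarrow> nat \<Rightarrow> nat \<Rightarrow> 'k" where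
  "mod_vars M = (\<lambda>b c. Poly_Mapping.lookup (M b c) 0)"

definition tor_cycles ::
  "(nat \<Rightarrow> nat set) \<Rightarrow> (nat \<Rightarrow> nat \<Rightarrow> nat) \<Rightarrow> (nat \<Rightarrow> nat \<Rightarrow> nat \<Rightarrow> 'k::field mpoly) \<Rightarrow>
   nat \<Rightarrow> nat \<Rightarrow> (nat \<Rightarrow> 'k) set"
where
  "tor_cycles B d M i e = {v \<in> strand B d i e.
     case i of 0 \<Rightarrow> True | Suc l \<Rightarrow> free_map (mod_vars (M l)) v = (\<lambda>_. 0)}"

definition tor_boundaries ::
  "(nat \<Rightarrow> nat set) \<Rightarrow> (nat \<Rightarrow> nat \<Rightarrow> nat) \<Rightarrow> (nat \<Rightarrow> nat \<Rightarrow> nat \<Rightarrow> 'k::field mpoly) \<Rightarrow>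
   nat \<Rightarrow> nat \<Rightarrow> (nat \<Rightarrow> 'k) set"
where
  "tor_boundaries B d M i e = free_map (mod_vars (M i)) ` strand B d (Suc i) e"

text \<open>
  \<open>Tor\<^sub>i(R/I, k)\<close> in degree \<open>e\<close> is cycles modulo boundaries for any graded free resolution; it does
  not depend on the resolution.
\<close>

definition tor_vanishes :: "nat set \<Rightarrow> 'k::field mpoly set \<Rightarrow> nat \<Rightarrow> nat \<Rightarrow> bool" where
  "tor_vanishes V I i e \<longleftrightarrow> (\<exists>B d M a. graded_free_resolution V I B d M a \<and>
     tor_cycles B d M i e = tor_boundaries B d M i e)"

section \<open>Quadratic schemes, property \<open>N\<^bsub>2,p\<^esub>\<close>, inner projections\<close>

definition quadratic_ideal :: "nat set \<Rightarrow> 'k::field mpoly set \<Rightarrow> bool" where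
  "quadratic_ideal V I \<longleftrightarrow> (\<exists>G \<subseteq> forms V 2. I = ideal_gen V G)"

text \<open>Here \<open>K\<close> is any homogeneous ideal defining the scheme; the quadratic ideal \<open>I\<close> need not be saturated.\<close>

definition quadratic_scheme :: "nat set \<Rightarrow> 'k::field mpoly set \<Rightarrow> bool" where
  "quadratic_scheme V K \<longleftrightarrow> (\<exists>I. quadratic_ideal V I \<and> same_ideal_sheaf V I K)"

definition property_N2 :: "nat set \<Rightarrow> nat \<Rightarrow> 'k::field mpoly set \<Rightarrow> bool" where
  "property_N2 V p K \<longleftrightarrow> (\<exists>I. quadratic_ideal V I \<and> same_ideal_sheaf V I K \<and>
     (\<forall>i\<le>p. \<forall>j\<ge>2. tor_vanishes V I i (i + j)))"

text \<open>
  The linear projection \<open>\<pi>\<^sub>q = (y\<^sub>1 : \<dots> : y\<^sub>N)\<close> from \<open>q\<close> to the projective space with coordinates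
  \<open>x\<^sub>1,\<dots>,x\<^sub>N\<close>: the \<open>y\<^sub>j\<close> are linear forms whose only common zero is \<open>q\<close>. For \<open>q = (1:0:\<dots>:0)\<close> one may
  take \<open>y\<^sub>j = x\<^sub>j\<close>.
\<close>

definition projection_from :: "nat \<Rightarrow> (nat \<Rightarrow> 'k::field) \<Rightarrow> (nat \<Rightarrow> 'k mpoly) \<Rightarrow> bool" where
  "projection_from N q y \<longleftrightarrow> (\<forall>j\<in>{1..N}. y j \<in> forms {0..N} 1) \<and>
     (\<forall>x\<in>proj_space {0..N}. (\<forall>j\<in>{1..N}. eval x (y j) = 0) \<longleftrightarrow> same_point x q)"

definition proj_map :: "nat \<Rightarrow> (nat \<Rightarrow> 'k::field mpoly) \<Rightarrow> (nat \<Rightarrow> 'k) \<Rightarrow> nat \<Rightarrow> 'k" where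
  "proj_map N y x = (\<lambda>j. if j \<in> {1..N} then eval x (y j) else 0)"

definition inner_projection ::
  "nat \<Rightarrow> (nat \<Rightarrow> 'k::field mpoly) \<Rightarrow> (nat \<Rightarrow> 'k) set \<Rightarrow> (nat \<Rightarrow> 'k) \<Rightarrow> (nat \<Rightarrow> 'k) set"
where
  "inner_projection N y X q =
     zariski_closure {1..N} (proj_map N y ` {x \<in> X. \<not> same_point x q})"

text \<open>
  With \<open>k[x\<^sub>1,\<dots>,x\<^sub>N]\<close> regarded as the subring \<open>k[y\<^sub>1,\<dots>,y\<^sub>N]\<close> of \<open>k[x\<^sub>0,\<dots>,x\<^sub>N]\<close>, this is the intersection of
  \<open>I\<close> with \<open>k[x\<^sub>1,\<dots>,x\<^sub>N]\<close>; literally so for \<open>y\<^sub>j = x\<^sub>j\<close>.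
\<close>

definition elimination_ideal ::
  "nat \<Rightarrow> (nat \<Rightarrow> 'k::field mpoly) \<Rightarrow> 'k mpoly set \<Rightarrow> 'k mpoly set"
where
  "elimination_ideal N y I = {f \<in> polys {1..N}. subst y f \<in> I}"

end

theory Submission
  imports "HOL-Library.Function_Algebras" "HOL-Library.Product_Lexorder"
    "Jordan_Normal_Form.Determinant" Defs
begin

text \<open>
  Write \<open>R = k[x\<^sub>0,\<dots>,x\<^sub>N]\<close>, \<open>S = k[x\<^sub>1,\<dots>,x\<^sub>N]\<close> and choose coordinates with \<open>q = (1:0:\<dots>:0)\<close> in which the
  tangent space of \<open>X\<close> at \<open>q\<close> is \<open>x\<^sub>1 = \<dots> = x\<^sub>c = 0\<close>. Smoothness says that the leading coefficients with
  respect to \<open>x\<^sub>0\<close> of the elements of \<open>I\<close> of positive \<open>x\<^sub>0\<close>-degree generate the ideal \<open>(x\<^sub>1,\<dots>,x\<^sub>c)\<close>, and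
  that \<open>I\<close> contains quadrics \<open>x\<^sub>0 x\<^sub>j + Q\<^sub>j\<close> with \<open>Q\<^sub>j \<in> S\<close> for \<open>1 \<le> j \<le> c\<close>.

  Tor is Koszul homology. As a mapping cone, the Koszul complex of \<open>R/I\<close> on all variables shows that
  \<open>N\<^bsub>2,p\<^esub>\<close> makes multiplication by \<open>x\<^sub>0\<close> injective on the relevant part of \<open>H\<^sub>k(x\<^sub>1,\<dots>,x\<^sub>N; R/I)\<close>. Let \<open>u\<close> be
  a cycle over \<open>S/J\<close>. Since the Koszul homology of \<open>S/(x\<^sub>1,\<dots>,x\<^sub>c)\<close> vanishes in positive degrees, \<open>x\<^sub>0\<^sup>t u\<close> is
  homologous over \<open>R/I\<close> to a cycle over \<open>S/J\<close>, which is a boundary for large \<open>t\<close> because the homology of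
  \<open>S/J\<close> is finitely generated and annihilated by the variables. Hence \<open>u\<close> is a boundary over \<open>R/I\<close>, and
  lowering the \<open>x\<^sub>0\<close>-degree once more makes it a boundary over \<open>S/J\<close>. This gives the vanishing of Tor
  for \<open>J\<close>. The case of \<open>Tor\<^sub>1\<close>, together with nondegeneracy, shows that \<open>J\<close> is generated by quadrics.

  For the sheaves, \<open>f\<close> vanishes on the projection iff \<open>y\<^sub>j f(y)\<close> vanishes on \<open>X\<close> for all \<open>j\<close>, because the
  linear forms \<open>y\<^sub>j\<close> vanish at \<open>q\<close>.
\<close>

text \<open>\<open>tor_vanishes\<close> asks for one free resolution, so Koszul homology is used in
  both directions: dimension shifting turns a given resolution into Koszul vanishing, and Koszul
  vanishing bounds the degrees of a resolution built from scratch. A Koszul i-chain with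
  coefficients of degree d has total degree i + d, so j >= 2 always reads: coefficient degree at
  least 2.

  One syzygy step is lost because a primitive must be corrected. If w over R/I bounds a k-cycle of
  S/J, then x_0^t w differs from a chain of low x_0-degree by a (k+1)-cycle; dividing this cycle by
  x_0^t up to boundaries needs surjectivity of x_0 on H_{k+1}, hence k + 1 <= p.

  I need not be saturated, while smoothness supplies local equations g_j only in the saturated ideal
  of X. Just a multiple x_i^m g_j with q_i nonzero lies in I, and the quadrics x_0 x_j + Q_j are
  recovered from the quadratic generators of I by comparing linear parts at q. For the leading
  coefficients one sets x_0 = 1: they become initial forms at q, which the g_j control.\<close>

section \<open>Polynomials\<close>

abbreviation supp :: "('a \<Rightarrow>\<^sub>0 'b::zero) \<Rightarrow> 'a set" where
  "supp \<equiv> Poly_Mapping.keys"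

abbreviation coef :: "('a \<Rightarrow>\<^sub>0 'b::zero) \<Rightarrow> 'a \<Rightarrow> 'b" where
  "coef \<equiv> Poly_Mapping.lookup"

lemma mdeg_superset: "finite A \<Longrightarrow> supp m \<subseteq> A \<Longrightarrow> mdeg m = (\<Sum>i\<in>A. coef m i)"
  unfolding mdeg_def by (intro sum.mono_neutral_left) (auto simp: in_keys_iff)

lemma mdeg_add: "mdeg (a + b) = mdeg a + mdeg b"
proof -
  let ?A = "supp a \<union> supp b"
  have "mdeg (a + b) = (\<Sum>i\<in>?A. coef (a + b) i)"
    using Poly_Mapping.keys_add[of a b] by (intro mdeg_superset) auto
  moreover have "mdeg a = (\<Sum>i\<in>?A. coef a i)" by (intro mdeg_superset) auto
  moreover have "mdeg b = (\<Sum>i\<in>?A. coef b i)" by (intro mdeg_superset) auto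
  ultimately show ?thesis by (simp add: lookup_add sum.distrib)
qed

lemma mdeg_zero [simp]: "mdeg 0 = 0"
  by (simp add: mdeg_def)

lemma mdeg_single [simp]: "mdeg (Poly_Mapping.single i n) = n"
  by (simp add: mdeg_def)

lemma mdeg_eq_0_iff: "mdeg m = 0 \<longleftrightarrow> m = 0"
proof
  assume "mdeg m = 0"
  then have "\<forall>i\<in>supp m. coef m i = 0" by (simp add: mdeg_def)
  then have "supp m = {}" by (meson all_not_in_conv in_keys_iff)
  then show "m = 0" using keys_eq_empty[of m] by simp
qed simp

lemma supp_monom_add: "supp (a + b) = supp a \<union> supp b" for a b :: "nat \<Rightarrow>\<^sub>0 nat"
  by (auto simp: in_keys_iff lookup_add)

text \<open>One truncation serves for homogeneous components, for the monomials divisible by a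
  variable, and for the top part in x_0.\<close>

definition part :: "('a \<Rightarrow> bool) \<Rightarrow> ('a \<Rightarrow>\<^sub>0 'b::zero) \<Rightarrow> ('a \<Rightarrow>\<^sub>0 'b)" where
  "part P f = Poly_Mapping.mapp (\<lambda>k v. v when P k) f"

lemma coef_part: "coef (part P f) m = (if P m then coef f m else 0)"
  by (auto simp: part_def lookup_mapp in_keys_iff when_def)

lemma supp_part: "supp (part P f) = {m \<in> supp f. P m}"
  by (auto simp: in_keys_iff coef_part split: if_splits)

lemma part_zero [simp]: "part P 0 = 0"
  by (intro poly_mapping_eqI) (simp add: coef_part)

lemma part_add: "part P (f + g) = part P f + part P (g :: _ \<Rightarrow>\<^sub>0 _::monoid_add)"
  by (intro poly_mapping_eqI) (simp add: coef_part lookup_add)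

lemma part_diff: "part P (f - g) = part P f - part P (g :: _ \<Rightarrow>\<^sub>0 _::ab_group_add)"
  by (intro poly_mapping_eqI) (simp add: coef_part lookup_minus)

lemma part_sum: "part P (sum f A) = (\<Sum>a\<in>A. part P (f a :: _ \<Rightarrow>\<^sub>0 _::comm_monoid_add))"
  by (induction A rule: infinite_finite_induct) (auto simp: part_add)

lemma part_id: "(\<And>m. m \<in> supp f \<Longrightarrow> P m) \<Longrightarrow> part P f = f"
  by (intro poly_mapping_eqI) (auto simp: coef_part in_keys_iff)

lemma part_none: "(\<And>m. m \<in> supp f \<Longrightarrow> \<not> P m) \<Longrightarrow> part P f = 0"
  by (intro poly_mapping_eqI) (auto simp: coef_part in_keys_iff)

lemma part_split: "f = part P f + part (\<lambda>m. \<not> P m) (f :: _ \<Rightarrow>\<^sub>0 _::monoid_add)"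
  by (intro poly_mapping_eqI) (auto simp: coef_part lookup_add)

lemma sum_monomials: "f = (\<Sum>m\<in>supp f. Poly_Mapping.single m (coef f m))"
  by (intro poly_mapping_eqI) (auto simp: lookup_sum lookup_single when_def sum.delta in_keys_iff)

text \<open>Zero is covered by the first case, as a monomial with coefficient 0.\<close>

lemma mpoly_induct [case_names monom add]:
  assumes "\<And>m c. P (Poly_Mapping.single m c)" and "\<And>f g. P f \<Longrightarrow> P g \<Longrightarrow> P (f + g)"
  shows "P (f :: _ \<Rightarrow>\<^sub>0 _::comm_monoid_add)"
proof -
  have "P (\<Sum>m\<in>A. Poly_Mapping.single m (coef f m))" if "finite A" for A
    using that
  proof induction
    case empty
    then show ?case using assms(1)[of undefined 0] by simp
  qed (auto intro: assms)
  then show ?thesis using sum_monomials[of f] by (metis finite_keys)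
qed

lemma coef_single_mult:
  "coef (Poly_Mapping.single a c * g) (a + m) = c * coef (g :: 'k::field mpoly) m"
proof (induction g rule: mpoly_induct)
  case (monom m' c')
  then show ?case by (auto simp: mult_single lookup_single when_def)
qed (simp add: distrib_left lookup_add)

lemma coef_single_mult_not:
  "(\<And>m'. m \<noteq> a + m') \<Longrightarrow> coef (Poly_Mapping.single a c * g) m = 0" for g :: "'k::field mpoly"
proof (induction g rule: mpoly_induct)
  case (monom m' c')
  then show ?case by (auto simp: mult_single lookup_single when_def)
qed (simp add: distrib_left lookup_add)

lemma coef_mult_0: "coef (f * g) 0 = coef f 0 * coef (g :: 'k::field mpoly) 0"
proof (induction f rule: mpoly_induct)
  case (monom m c)
  show ?case
  proof (cases "m = 0")
    case True
    then show ?thesis using coef_single_mult[of 0 c g 0] by simp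
  next
    case False
    then have "\<And>m'. 0 \<noteq> m + m'" by (metis add_is_0 lookup_add lookup_zero poly_mapping_eqI)
    then show ?thesis using False by (simp add: coef_single_mult_not lookup_single)
  qed
qed (simp add: distrib_right lookup_add)

lemma supp_mult_elim:
  assumes "m \<in> supp (f * g)"
  obtains a b where "a \<in> supp f" "b \<in> supp g" "m = a + b"
  using keys_mult[of f g] assms by auto

subsection \<open>The rings \<open>k[x\<^sub>i : i \<in> V]\<close> and their grading\<close>

lemma polys_zero [simp]: "0 \<in> polys V"
  by (simp add: polys_def)

lemma polys_one [simp]: "1 \<in> polys V"
  by (simp add: polys_def)

lemma polys_add: "f \<in> polys V \<Longrightarrow> g \<in> polys V \<Longrightarrow> f + g \<in> polys V"
  using Poly_Mapping.keys_add[of f g] by (fastforce simp: polys_def)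

lemma polys_uminus [simp]: "- f \<in> polys V \<longleftrightarrow> f \<in> polys V"
  by (simp add: polys_def in_keys_iff)

lemma polys_mult: "f \<in> polys V \<Longrightarrow> g \<in> polys V \<Longrightarrow> f * g \<in> polys V"
  unfolding polys_def by (force elim!: supp_mult_elim simp: supp_monom_add)

lemma polys_sum: "(\<And>a. a \<in> A \<Longrightarrow> f a \<in> polys V) \<Longrightarrow> sum f A \<in> polys V"
  by (induction A rule: infinite_finite_induct) (auto intro: polys_add)

lemma polys_power: "f \<in> polys V \<Longrightarrow> f ^ n \<in> polys V"
  by (induction n) (auto intro: polys_mult)

lemma polys_prod: "(\<And>a. a \<in> A \<Longrightarrow> f a \<in> polys V) \<Longrightarrow> prod f A \<in> polys V"
  by (induction A rule: infinite_finite_induct) (auto intro: polys_mult)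

lemma polys_const [simp]: "const c \<in> polys V"
  by (simp add: polys_def const_def)

lemma polys_var [simp]: "i \<in> V \<Longrightarrow> var i \<in> polys V"
  by (simp add: polys_def var_def)

lemma polys_mono: "V \<subseteq> W \<Longrightarrow> f \<in> polys V \<Longrightarrow> f \<in> polys W"
  by (auto simp: polys_def)

lemma polys_part: "f \<in> polys V \<Longrightarrow> part P f \<in> polys V"
  by (auto simp: polys_def supp_part)

lemma const_zero [simp]: "const 0 = 0" by (simp add: const_def)
lemma const_one [simp]: "const 1 = 1" by (simp add: const_def)
lemma const_add: "const (a + b) = const a + const b" by (simp add: const_def single_add)
lemma const_mult: "const (a * b) = const a * const b" by (simp add: const_def mult_single)

lemma coef_const_mult: "coef (const c * f) m = c * coef f m"
  using coef_single_mult[of 0 c f m] by (simp add: const_def)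

text \<open>Integer degrees keep shifts such as \<open>d - 1\<close> and \<open>e - int t\<close>
  free of truncation; negative degrees give the zero space.\<close>

definition gr :: "nat set \<Rightarrow> int \<Rightarrow> 'k::field mpoly set" where
  "gr V d = {f \<in> polys V. \<forall>m\<in>supp f. int (mdeg m) = d}"

lemma gr_polys: "f \<in> gr V d \<Longrightarrow> f \<in> polys V"
  by (simp add: gr_def)

lemma gr_of_nat: "gr V (int d) = forms V d"
  by (auto simp: gr_def forms_def homogeneous_def)

lemma gr_neg: "d < 0 \<Longrightarrow> gr V d = {0}"
proof -
  assume "d < 0"
  have "f = 0" if "f \<in> gr V d" for f
  proof -
    have "supp f = {}" using that \<open>d < 0\<close> by (force simp: gr_def)
    then show ?thesis by simp
  qed
  then show ?thesis by (auto simp: gr_def)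
qed

lemma gr_zero [simp]: "0 \<in> gr V d"
  by (simp add: gr_def)

lemma gr_add: "f \<in> gr V d \<Longrightarrow> g \<in> gr V d \<Longrightarrow> f + g \<in> gr V d"
  using Poly_Mapping.keys_add[of f g] by (auto simp: gr_def polys_add)

lemma gr_uminus: "f \<in> gr V d \<Longrightarrow> - f \<in> gr V d"
  by (simp add: gr_def in_keys_iff)

lemma gr_diff: "f \<in> gr V d \<Longrightarrow> g \<in> gr V d \<Longrightarrow> f - g \<in> gr V d"
  using gr_add[of f V d "- g"] gr_uminus[of g V d] by simp

lemma gr_mult: "f \<in> gr V d \<Longrightarrow> g \<in> gr V e \<Longrightarrow> f * g \<in> gr V (d + e)"
  by (auto simp: gr_def polys_mult mdeg_add elim!: supp_mult_elim)

lemma gr_sum: "(\<And>a. a \<in> A \<Longrightarrow> f a \<in> gr V d) \<Longrightarrow> sum f A \<in> gr V d"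
  by (induction A rule: infinite_finite_induct) (auto intro: gr_add)

lemma gr_const [simp]: "const c \<in> gr V 0"
  by (simp add: gr_def const_def polys_def)

lemma gr_var [simp]: "i \<in> V \<Longrightarrow> var i \<in> gr V 1"
  by (simp add: gr_def var_def polys_def)

lemma gr_var_mult: "i \<in> V \<Longrightarrow> f \<in> gr V d \<Longrightarrow> var i * f \<in> gr V (d + 1)"
  using gr_mult[of "var i" V 1 f d] by (simp add: add.commute)

lemma gr_const_mult: "f \<in> gr V d \<Longrightarrow> const c * f \<in> gr V d"
  using gr_mult[of "const c" V 0 f d] by simp

lemma gr_power: "f \<in> gr V d \<Longrightarrow> f ^ n \<in> gr V (int n * d)"
proof (induction n)
  case 0
  then show ?case using gr_const[of 1 V] by simp
next
  case (Suc n)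
  then show ?case using gr_mult[of f V d "f ^ n" "int n * d"] by (simp add: algebra_simps)
qed

lemma gr_part: "f \<in> gr V d \<Longrightarrow> part P f \<in> gr V d"
  by (auto simp: gr_def supp_part polys_part)

lemma gr_mono: "V \<subseteq> W \<Longrightarrow> f \<in> gr V d \<Longrightarrow> f \<in> gr W d"
  by (auto simp: gr_def intro: polys_mono)

lemma gr_0_eq: "f \<in> gr V 0 \<Longrightarrow> f = const (coef f 0)"
  by (intro poly_mapping_eqI)
    (auto simp: gr_def const_def lookup_single when_def mdeg_eq_0_iff in_keys_iff)

definition hc :: "int \<Rightarrow> 'k::field mpoly \<Rightarrow> 'k mpoly" where
  "hc d f = part (\<lambda>m. int (mdeg m) = d) f"

lemma hc_gr: "f \<in> polys V \<Longrightarrow> hc d f \<in> gr V d"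
  by (auto simp: gr_def hc_def supp_part polys_part)

lemma hc_zero [simp]: "hc d 0 = 0" by (simp add: hc_def)
lemma hc_add: "hc d (f + g) = hc d f + hc d g" by (simp add: hc_def part_add)
lemma hc_diff: "hc d (f - g) = hc d f - hc d g" by (simp add: hc_def part_diff)
lemma hc_sum: "hc d (sum f A) = (\<Sum>a\<in>A. hc d (f a))" by (simp add: hc_def part_sum)

lemma hc_id: "f \<in> gr V d \<Longrightarrow> hc d f = f"
  unfolding hc_def by (intro part_id) (auto simp: gr_def)

lemma hc_other: "f \<in> gr V e \<Longrightarrow> e \<noteq> d \<Longrightarrow> hc d f = 0"
  unfolding hc_def by (intro part_none) (auto simp: gr_def)

lemma hc_mult:
  assumes "g \<in> gr V a"
  shows "hc d (g * f) = g * hc (d - a) f"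
proof -
  let ?r = "part (\<lambda>m. int (mdeg m) \<noteq> d - a) f"
  have f: "f = hc (d - a) f + ?r"
    unfolding hc_def by (rule part_split)
  have "hc d (g * ?r) = 0"
    unfolding hc_def using assms
    by (intro part_none) (auto elim!: supp_mult_elim simp: supp_part mdeg_add gr_def)
  moreover have "hc d (g * hc (d - a) f) = g * hc (d - a) f"
    unfolding hc_def using assms
    by (intro part_id) (auto elim!: supp_mult_elim simp: supp_part mdeg_add gr_def)
  ultimately show ?thesis
    by (subst f) (simp add: distrib_left hc_add)
qed

lemma sum_hc:
  assumes "finite D" "\<And>m. m \<in> supp f \<Longrightarrow> int (mdeg m) \<in> D"
  shows "f = (\<Sum>d\<in>D. hc d f)"
proof (intro poly_mapping_eqI)
  fix m
  have "(\<Sum>d\<in>D. coef (hc d f) m) = (\<Sum>d\<in>D. if d = int (mdeg m) then coef f m else 0)"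
    by (intro sum.cong) (auto simp: hc_def coef_part)
  also have "\<dots> = coef f m" using assms by (auto simp: sum.delta in_keys_iff)
  finally show "coef f m = coef (\<Sum>d\<in>D. hc d f) m" by (simp add: lookup_sum)
qed

subsection \<open>Division by a variable\<close>

lemma monom_split: "0 < coef m v \<Longrightarrow> \<exists>m'. m = Poly_Mapping.single v (Suc 0) + (m' :: nat \<Rightarrow>\<^sub>0 nat)"
  by (intro exI[of _ "m - Poly_Mapping.single v (Suc 0)"] poly_mapping_eqI)
    (auto simp: lookup_add lookup_minus lookup_single when_def)

lemma coef_var_mult: "coef (var v * f) (Poly_Mapping.single v (Suc 0) + m) = coef f m"
  by (simp add: var_def coef_single_mult)

lemma coef_var_mult_0: "coef m v = 0 \<Longrightarrow> coef (var v * f) m = 0"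
  unfolding var_def by (intro coef_single_mult_not) (auto simp: lookup_add)

lemma supp_var_mult: "supp (var v * f) = (\<lambda>m. Poly_Mapping.single v (Suc 0) + m) ` supp f"
proof -
  have "m \<in> (\<lambda>m. Poly_Mapping.single v (Suc 0) + m) ` supp f" if "m \<in> supp (var v * f)" for m
  proof -
    have "0 < coef m v" using that coef_var_mult_0[of m v f] by (auto simp: in_keys_iff)
    then obtain m' where "m = Poly_Mapping.single v (Suc 0) + m'" using monom_split by blast
    then show ?thesis using that by (auto simp: in_keys_iff coef_var_mult)
  qed
  then show ?thesis by (auto simp: in_keys_iff coef_var_mult)
qed

text \<open>Monomials without x_v are dropped, so this is the quotient by x_v of the part of f that
  x_v divides.\<close>

definition dv :: "nat \<Rightarrow> 'k::field mpoly \<Rightarrow> 'k mpoly" where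
  "dv v f = Poly_Mapping.map_key (\<lambda>m. Poly_Mapping.single v (Suc 0) + m) f"

lemma coef_dv: "coef (dv v f) m = coef f (Poly_Mapping.single v (Suc 0) + m)"
  unfolding dv_def by (simp add: map_key.rep_eq inj_def)

lemma var_mult_dv:
  assumes "\<And>m. m \<in> supp f \<Longrightarrow> 0 < coef m v"
  shows "var v * dv v f = f"
proof (intro poly_mapping_eqI)
  fix m
  show "coef (var v * dv v f) m = coef f m"
  proof (cases "0 < coef m v")
    case True
    then show ?thesis using monom_split[of m v] by (auto simp: coef_var_mult coef_dv)
  next
    case False
    then show ?thesis using assms[of m] by (auto simp: coef_var_mult_0 in_keys_iff)
  qed
qed

lemma dv_supp: "m \<in> supp (dv v f) \<Longrightarrow> Poly_Mapping.single v (Suc 0) + m \<in> supp f"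
  by (simp add: in_keys_iff coef_dv)

lemma dv_polys: "f \<in> polys V \<Longrightarrow> dv v f \<in> polys V"
  unfolding polys_def by (fastforce dest!: dv_supp simp: supp_monom_add)

lemma dv_gr: "f \<in> gr V d \<Longrightarrow> dv v f \<in> gr V (d - 1)"
  unfolding gr_def by (auto dest!: dv_supp simp: dv_polys mdeg_add)

section \<open>Koszul complexes\<close>

text \<open>
  The chains of the Koszul complex of operators \<open>X v\<close>, \<open>v \<in> set vs\<close>, are families indexed by the
  subsets of \<open>vs\<close>, encoded as characteristic lists. Recursion over \<open>vs\<close> builds the complex as an
  iterated mapping cone, which fixes all signs.
\<close>

definition cells :: "nat \<Rightarrow> nat \<Rightarrow> bool list set" where
  "cells n i = {T. length T = n \<and> length (filter id T) = i}"

lemma cells_simps [simp]: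
  "[] \<in> cells n i \<longleftrightarrow> n = 0 \<and> i = 0"
  "False # T \<in> cells n i \<longleftrightarrow> (\<exists>m. n = Suc m \<and> T \<in> cells m i)"
  "True # T \<in> cells n i \<longleftrightarrow> (\<exists>m j. n = Suc m \<and> i = Suc j \<and> T \<in> cells m j)"
  by (auto simp: cells_def)

lemma finite_cells: "finite (cells n i)"
proof -
  have "cells n i \<subseteq> {T. set T \<subseteq> UNIV \<and> length T = n}" by (auto simp: cells_def)
  then show ?thesis using finite_lists_length_eq[of "UNIV :: bool set" n] finite_subset by auto
qed

lemma cells_0_0 [simp]: "cells 0 0 = {[]}" "cells 0 (Suc i) = {}"
  by (auto simp: cells_def)

lemma cells_cases:
  assumes "T \<in> cells (Suc n) i"
  obtains S where "T = False # S" "S \<in> cells n i"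
        | S j where "T = True # S" "i = Suc j" "S \<in> cells n j"
proof (cases T)
  case (Cons b S)
  then show ?thesis using that assms by (cases b) auto
qed (use assms in auto)

text \<open>A chain is a pair: alpha (first entry \<open>False\<close>) without the basis vector of
  v, and beta (first entry \<open>True\<close>) with it. The cone differential is (alpha, beta) |->
  (d alpha + X v beta, - d beta). Chains are total functions, but only their values on
  \<open>cells\<close> matter.\<close>

fun kd :: "(nat \<Rightarrow> 'a \<Rightarrow> 'a) \<Rightarrow> nat list \<Rightarrow> (bool list \<Rightarrow> 'a) \<Rightarrow> bool list \<Rightarrow> 'a::ab_group_add" where
  "kd X [] \<omega> T = 0"
| "kd X (v # vs) \<omega> [] = 0"
| "kd X (v # vs) \<omega> (False # T) = kd X vs (\<lambda>S. \<omega> (False # S)) T + X v (\<omega> (True # T))"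
| "kd X (v # vs) \<omega> (True # T) = - kd X vs (\<lambda>S. \<omega> (True # S)) T"

definition ops :: "(nat \<Rightarrow> 'a \<Rightarrow> 'a::ab_group_add) \<Rightarrow> bool" where
  "ops X \<longleftrightarrow> (\<forall>v a b. X v (a + b) = X v a + X v b) \<and> (\<forall>v w a. X v (X w a) = X w (X v a))"

lemma ops_add: "ops X \<Longrightarrow> X v (a + b) = X v a + X v b"
  by (simp add: ops_def)

lemma ops_comm: "ops X \<Longrightarrow> X v (X w a) = X w (X v a)"
  by (simp add: ops_def)

lemma ops_zero: "ops X \<Longrightarrow> X v 0 = 0"
  using ops_add[of X v 0 0] by simp

lemma ops_uminus: "ops X \<Longrightarrow> X v (- a) = - X v a"
  using ops_add[of X v a "- a"] by (simp add: ops_zero eq_neg_iff_add_eq_0 add.commute)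

lemma ops_diff: "ops X \<Longrightarrow> X v (a - b) = X v a - X v b"
  using ops_add[of X v a "- b"] by (simp add: ops_uminus)

lemmas ops_simps = ops_add ops_zero ops_uminus ops_diff

text \<open>The Koszul complex involves only sums and the operators of \<open>vs\<close>. Hence also
  the pieces of bounded x_0-degree qualify, or one ideal repeated in every degree.\<close>

definition gmod :: "(nat \<Rightarrow> 'a \<Rightarrow> 'a::ab_group_add) \<Rightarrow> nat list \<Rightarrow> (int \<Rightarrow> 'a set) \<Rightarrow> bool" where
  "gmod X vs A \<longleftrightarrow> (\<forall>d. 0 \<in> A d \<and> (\<forall>a\<in>A d. \<forall>b\<in>A d. a + b \<in> A d) \<and> (\<forall>a\<in>A d. - a \<in> A d) \<and>
     (\<forall>v\<in>set vs. \<forall>a\<in>A d. X v a \<in> A (d + 1)))"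

lemma gmodI:
  assumes "\<And>d. 0 \<in> A d" "\<And>d a b. a \<in> A d \<Longrightarrow> b \<in> A d \<Longrightarrow> a + b \<in> A d"
    "\<And>d a. a \<in> A d \<Longrightarrow> - a \<in> A d" "\<And>d v a. v \<in> set vs \<Longrightarrow> a \<in> A d \<Longrightarrow> X v a \<in> A (d + 1)"
  shows "gmod X vs A"
  using assms by (simp add: gmod_def)

lemma gmod_zero: "gmod X vs A \<Longrightarrow> 0 \<in> A d"
  and gmod_add: "gmod X vs A \<Longrightarrow> a \<in> A d \<Longrightarrow> b \<in> A d \<Longrightarrow> a + b \<in> A d"
  and gmod_uminus: "gmod X vs A \<Longrightarrow> a \<in> A d \<Longrightarrow> - a \<in> A d"
  and gmod_X: "gmod X vs A \<Longrightarrow> v \<in> set vs \<Longrightarrow> a \<in> A d \<Longrightarrow> X v a \<in> A (d + 1)"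
  by (auto simp: gmod_def)

lemma gmod_diff: "gmod X vs A \<Longrightarrow> a \<in> A d \<Longrightarrow> b \<in> A d \<Longrightarrow> a - b \<in> A d"
  using gmod_add[of X vs A a d "- b"] gmod_uminus[of X vs A b d] by simp

lemma gmod_subset: "gmod X vs A \<Longrightarrow> set ws \<subseteq> set vs \<Longrightarrow> gmod X ws A"
  by (auto simp: gmod_def)

lemma gmod_zero_module: "ops X \<Longrightarrow> gmod X vs (\<lambda>_. {0})"
  by (simp add: gmod_def ops_zero)

definition chn :: "nat \<Rightarrow> nat \<Rightarrow> 'a set \<Rightarrow> (bool list \<Rightarrow> 'a) \<Rightarrow> bool" where
  "chn n i A \<omega> \<longleftrightarrow> (\<forall>T\<in>cells n i. \<omega> T \<in> A)"

text \<open>Quotients are never formed: a cycle over A/B is a chain whose boundary lies in B. In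
  degree 0 there is no condition, whence the guard \<open>i = Suc j\<close>.\<close>

definition cyc :: "(nat \<Rightarrow> 'a \<Rightarrow> 'a::ab_group_add) \<Rightarrow> nat list \<Rightarrow> nat \<Rightarrow> 'a set \<Rightarrow> (bool list \<Rightarrow> 'a) \<Rightarrow> bool" where
  "cyc X vs i B \<omega> \<longleftrightarrow> (\<forall>j. i = Suc j \<longrightarrow> chn (length vs) j B (kd X vs \<omega>))"

text \<open>
  \<open>hzero X vs A B i d\<close>: the part of \<open>H\<^sub>i(vs; A/B)\<close> represented by chains with coefficients of
  degree \<open>d\<close>, i.e. of total degree \<open>i + d\<close>, vanishes.
\<close>

definition hzero :: "(nat \<Rightarrow> 'a \<Rightarrow> 'a::ab_group_add) \<Rightarrow> nat list \<Rightarrow> (int \<Rightarrow> 'a set) \<Rightarrow> (int \<Rightarrow> 'a set) \<Rightarrow>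
    nat \<Rightarrow> int \<Rightarrow> bool" where
  "hzero X vs A B i d \<longleftrightarrow> (\<forall>\<omega>. chn (length vs) i (A d) \<omega> \<longrightarrow> cyc X vs i (B (d + 1)) \<omega> \<longrightarrow>
     (\<exists>\<eta>. chn (length vs) (Suc i) (A (d - 1)) \<eta> \<and>
          chn (length vs) i (B d) (\<lambda>T. \<omega> T - kd X vs \<eta> T)))"

lemma chnD: "chn n i A \<omega> \<Longrightarrow> T \<in> cells n i \<Longrightarrow> \<omega> T \<in> A"
  by (simp add: chn_def)

lemma chn_mono: "chn n i A \<omega> \<Longrightarrow> A \<subseteq> B \<Longrightarrow> chn n i B \<omega>"
  by (auto simp: chn_def)


lemma kd_add: "ops X \<Longrightarrow> kd X vs (\<lambda>S. \<omega> S + \<eta> S) T = kd X vs \<omega> T + kd X vs \<eta> T"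
  by (induction X vs \<omega> T arbitrary: \<eta> rule: kd.induct) (simp_all add: ops_add)

lemma kd_uminus: "ops X \<Longrightarrow> kd X vs (\<lambda>S. - \<omega> S) T = - kd X vs \<omega> T"
  by (induction X vs \<omega> T rule: kd.induct) (simp_all add: ops_uminus)

lemma kd_diff: "ops X \<Longrightarrow> kd X vs (\<lambda>S. \<omega> S - \<eta> S) T = kd X vs \<omega> T - kd X vs \<eta> T"
  using kd_add[of X vs \<omega> "\<lambda>S. - \<eta> S" T] kd_uminus[of X vs \<eta> T] by simp

text \<open>Used for multiplication by a polynomial, for the operators themselves, and for the
  coordinates of a free module.\<close>

lemma kd_hom:
  assumes "\<And>a b. \<pi> (a + b) = \<pi> a + \<pi> b" "\<And>v a. v \<in> set vs \<Longrightarrow> \<pi> (X v a) = Y v (\<pi> a)"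
  shows "\<pi> (kd X vs \<omega> T) = kd Y vs (\<lambda>S. \<pi> (\<omega> S)) T"
proof -
  have 0: "\<pi> 0 = 0" using assms(1)[of 0 0] by simp
  have "\<pi> (- a) = - \<pi> a" for a
    using assms(1)[of a "- a"] by (simp add: 0 eq_neg_iff_add_eq_0 add.commute)
  then show ?thesis
    using assms by (induction X vs \<omega> T rule: kd.induct) (simp_all add: 0)
qed

lemma kd_X: "ops X \<Longrightarrow> kd X vs (\<lambda>S. X v (\<omega> S)) T = X v (kd X vs \<omega> T)"
  using kd_hom[of "X v" vs X X \<omega> T] by (simp add: ops_add ops_comm)

text \<open>The mixed terms d (X v beta) and X v (- d beta) cancel because the operators
  commute.\<close>

lemma kd_kd:
  assumes "ops X"
  shows "kd X vs (kd X vs \<omega>) T = 0"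
proof (induction vs arbitrary: \<omega> T)
  case (Cons v vs)
  show ?case
  proof (cases T)
    case T: (Cons b S)
    have "kd X vs (\<lambda>S. X v (\<omega> (True # S))) S = X v (kd X vs (\<lambda>S. \<omega> (True # S)) S)"
      by (rule kd_X[OF assms])
    then show ?thesis
      using T Cons.IH assms by (cases b) (simp_all add: kd_add kd_uminus ops_uminus)
  qed simp
qed simp

lemma kd_chn:
  assumes "gmod X vs A" "chn (length vs) (Suc i) (A d) \<omega>"
  shows "chn (length vs) i (A (d + 1)) (kd X vs \<omega>)"
proof -
  have "kd X vs \<omega> T \<in> A (d + 1)" if "T \<in> cells (length vs) i" for T
    using assms that
  proof (induction vs arbitrary: \<omega> T i)
    case (Cons v vs)
    have g: "gmod X vs A" by (rule gmod_subset[OF Cons.prems(1)]) auto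
    from Cons.prems(3) have "T \<in> cells (Suc (length vs)) i" by simp
    then show ?case
    proof (cases rule: cells_cases)
      case (1 S)
      have "chn (length vs) (Suc i) (A d) (\<lambda>S. \<omega> (False # S))"
        using Cons.prems(2) by (simp add: chn_def)
      then have "kd X vs (\<lambda>S. \<omega> (False # S)) S \<in> A (d + 1)"
        using Cons.IH g 1 by blast
      moreover have "X v (\<omega> (True # S)) \<in> A (d + 1)"
        using Cons.prems(2) 1 by (intro gmod_X[OF Cons.prems(1)]) (simp_all add: chn_def)
      ultimately show ?thesis using 1 gmod_add[OF g] by simp
    next
      case (2 S j)
      have "chn (length vs) (Suc j) (A d) (\<lambda>S. \<omega> (True # S))"
        using Cons.prems(2) 2 by (simp add: chn_def)
      then have "kd X vs (\<lambda>S. \<omega> (True # S)) S \<in> A (d + 1)"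
        using Cons.IH g 2 by blast
      then show ?thesis using 2 gmod_uminus[OF g] by simp
    qed
  qed (simp add: gmod_zero)
  then show ?thesis by (simp add: chn_def)
qed

text \<open>The difference of the two chains has coefficients in the zero module, so
  \<open>kd_chn\<close> puts its boundary there too.\<close>

lemma kd_cong:
  assumes "ops X" "\<And>S. S \<in> cells (length vs) (Suc i) \<Longrightarrow> \<omega> S = \<eta> S" "T \<in> cells (length vs) i"
  shows "kd X vs \<omega> T = kd X vs \<eta> T"
proof -
  have "chn (length vs) i {0} (kd X vs (\<lambda>S. \<omega> S - \<eta> S))"
    using assms(2) by (intro kd_chn[OF gmod_zero_module[OF assms(1)]]) (simp add: chn_def)
  then show ?thesis using assms by (simp add: chn_def kd_diff)
qed

lemma chn_kd_diff:
  assumes "ops X" "gmod X vs B" "chn (length vs) (Suc i) (B d) (\<lambda>T. \<omega> T - \<eta> T)"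
  shows "chn (length vs) i (B (d + 1)) (\<lambda>T. kd X vs \<omega> T - kd X vs \<eta> T)"
  using kd_chn[OF assms(2,3)] assms(1) by (simp add: chn_def kd_diff)

lemma chn_add: "gmod X vs A \<Longrightarrow> chn n i (A d) \<omega> \<Longrightarrow> chn n i (A d) \<eta> \<Longrightarrow> chn n i (A d) (\<lambda>T. \<omega> T + \<eta> T)"
  by (simp add: chn_def gmod_add)

lemma chn_diff: "gmod X vs A \<Longrightarrow> chn n i (A d) \<omega> \<Longrightarrow> chn n i (A d) \<eta> \<Longrightarrow> chn n i (A d) (\<lambda>T. \<omega> T - \<eta> T)"
  by (simp add: chn_def gmod_diff)

lemma chn_uminus: "gmod X vs A \<Longrightarrow> chn n i (A d) \<omega> \<Longrightarrow> chn n i (A d) (\<lambda>T. - \<omega> T)"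
  by (simp add: chn_def gmod_uminus)

lemma chn_cong_mod:
  assumes "gmod X vs B" "chn n i (B d) (\<lambda>T. \<omega> T - \<eta> T)" "chn n i (B d) \<eta>"
  shows "chn n i (B d) \<omega>"
  using chn_add[OF assms(1,2,3)] by simp

lemma hzeroI:
  assumes "\<And>\<omega>. chn (length vs) i (A d) \<omega> \<Longrightarrow> cyc X vs i (B (d + 1)) \<omega> \<Longrightarrow>
    \<exists>\<eta>. chn (length vs) (Suc i) (A (d - 1)) \<eta> \<and> chn (length vs) i (B d) (\<lambda>T. \<omega> T - kd X vs \<eta> T)"
  shows "hzero X vs A B i d"
  using assms by (simp add: hzero_def)

lemma hzeroD:
  assumes "hzero X vs A B i d" "chn (length vs) i (A d) \<omega>" "cyc X vs i (B (d + 1)) \<omega>"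
  obtains \<eta> where "chn (length vs) (Suc i) (A (d - 1)) \<eta>"
    "chn (length vs) i (B d) (\<lambda>T. \<omega> T - kd X vs \<eta> T)"
  using assms by (auto simp: hzero_def)

lemma cyc_Suc: "cyc X vs (Suc j) B \<omega> \<longleftrightarrow> chn (length vs) j B (kd X vs \<omega>)"
  by (simp add: cyc_def)

lemma cyc_0 [simp]: "cyc X vs 0 B \<omega>"
  by (simp add: cyc_def)

lemma cyc_mod:
  assumes "ops X" "gmod X vs B" "cyc X vs i (B (d + 1)) \<omega>" "chn (length vs) i (B d) (\<lambda>T. \<eta> T - \<omega> T)"
  shows "cyc X vs i (B (d + 1)) \<eta>"
proof (cases i)
  case (Suc j)
  then show ?thesis
    using chn_cong_mod[OF assms(2) chn_kd_diff[OF assms(1,2)]] assms(3,4) by (auto simp: cyc_Suc)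
qed simp

lemma cyc_kd:
  assumes "ops X" "gmod X vs B"
  shows "cyc X vs i (B d) (kd X vs \<omega>)"
  unfolding cyc_def chn_def using assms by (simp add: kd_kd gmod_zero)

lemma cyc_diff:
  assumes "ops X" "gmod X vs B" "cyc X vs i (B d) \<omega>" "cyc X vs i (B d) \<eta>"
  shows "cyc X vs i (B d) (\<lambda>T. \<omega> T - \<eta> T)"
  using assms unfolding cyc_def chn_def by (simp add: kd_diff gmod_diff)

lemma cyc_X:
  assumes "ops X" "gmod X vs B" "\<And>b. b \<in> B d \<Longrightarrow> X v b \<in> B (d + 1)" "cyc X vs i (B d) \<omega>"
  shows "cyc X vs i (B (d + 1)) (\<lambda>T. X v (\<omega> T))"
  using assms unfolding cyc_def chn_def by (simp add: kd_X)

subsection \<open>The mapping cone of one operator\<close>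

definition cone :: "(bool list \<Rightarrow> 'a) \<Rightarrow> (bool list \<Rightarrow> 'a) \<Rightarrow> bool list \<Rightarrow> 'a::zero" where
  "cone \<alpha> \<beta> T = (case T of [] \<Rightarrow> 0 | b # S \<Rightarrow> if b then \<beta> S else \<alpha> S)"

lemma cone_simps [simp]: "cone \<alpha> \<beta> (False # S) = \<alpha> S" "cone \<alpha> \<beta> (True # S) = \<beta> S"
  by (simp_all add: cone_def)

lemma chn_cone:
  "chn (Suc n) i A \<omega> \<longleftrightarrow> chn n i A (\<lambda>S. \<omega> (False # S)) \<and> (\<forall>j. i = Suc j \<longrightarrow> chn n j A (\<lambda>S. \<omega> (True # S)))"
  unfolding chn_def by (auto elim!: cells_cases)

lemma cyc_cone:
  assumes "gmod X (v # vs) B"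
  shows "cyc X (v # vs) (Suc j) (B d) \<omega> \<longleftrightarrow>
    chn (length vs) j (B d) (\<lambda>S. kd X vs (\<lambda>S. \<omega> (False # S)) S + X v (\<omega> (True # S))) \<and>
    cyc X vs j (B d) (\<lambda>S. \<omega> (True # S))"
proof -
  have "- b \<in> B d \<longleftrightarrow> b \<in> B d" for b
    using gmod_uminus[OF assms, of b d] gmod_uminus[OF assms, of "- b" d] by auto
  then show ?thesis by (simp add: cyc_Suc chn_cone cyc_def) (simp add: chn_def)
qed

text \<open>The pairs (alpha, beta) are the cycles of the mapping cone of X v; the plus sign in the
  last clause comes from the component - d delta of its differential.\<close>

lemma hzero_ConsI:
  assumes "gmod X (v # vs) B"
    "\<And>\<alpha> \<beta>. chn (length vs) (Suc j) (A d) \<alpha> \<Longrightarrow> chn (length vs) j (A d) \<beta> \<Longrightarrow>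
      chn (length vs) j (B (d + 1)) (\<lambda>S. kd X vs \<alpha> S + X v (\<beta> S)) \<Longrightarrow> cyc X vs j (B (d + 1)) \<beta> \<Longrightarrow>
      \<exists>\<gamma> \<delta>. chn (length vs) (Suc (Suc j)) (A (d - 1)) \<gamma> \<and> chn (length vs) (Suc j) (A (d - 1)) \<delta> \<and>
        chn (length vs) (Suc j) (B d) (\<lambda>S. \<alpha> S - (kd X vs \<gamma> S + X v (\<delta> S))) \<and>
        chn (length vs) j (B d) (\<lambda>S. \<beta> S + kd X vs \<delta> S)"
  shows "hzero X (v # vs) A B (Suc j) d"
proof (rule hzeroI)
  fix \<omega> assume *: "chn (length (v # vs)) (Suc j) (A d) \<omega>" "cyc X (v # vs) (Suc j) (B (d + 1)) \<omega>"
  obtain \<gamma> \<delta> where "chn (length vs) (Suc (Suc j)) (A (d - 1)) \<gamma>" "chn (length vs) (Suc j) (A (d - 1)) \<delta>"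
    "chn (length vs) (Suc j) (B d) (\<lambda>S. \<omega> (False # S) - (kd X vs \<gamma> S + X v (\<delta> S)))"
    "chn (length vs) j (B d) (\<lambda>S. \<omega> (True # S) + kd X vs \<delta> S)"
    using assms(2)[of "\<lambda>S. \<omega> (False # S)" "\<lambda>S. \<omega> (True # S)"] *
    by (auto simp: cyc_cone[OF assms(1)] chn_cone)
  then have "chn (length (v # vs)) (Suc (Suc j)) (A (d - 1)) (cone \<gamma> \<delta>) \<and>
    chn (length (v # vs)) (Suc j) (B d) (\<lambda>T. \<omega> T - kd X (v # vs) (cone \<gamma> \<delta>) T)"
    by (simp add: chn_cone)
  then show "\<exists>\<eta>. chn (length (v # vs)) (Suc (Suc j)) (A (d - 1)) \<eta> \<and>
    chn (length (v # vs)) (Suc j) (B d) (\<lambda>T. \<omega> T - kd X (v # vs) \<eta> T)" by blast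
qed

lemma hzero_ConsD:
  assumes "hzero X (v # vs) A B (Suc j) d" "gmod X (v # vs) B"
    "chn (length vs) (Suc j) (A d) \<alpha>" "chn (length vs) j (A d) \<beta>"
    "chn (length vs) j (B (d + 1)) (\<lambda>S. kd X vs \<alpha> S + X v (\<beta> S))" "cyc X vs j (B (d + 1)) \<beta>"
  obtains \<gamma> \<delta> where "chn (length vs) (Suc (Suc j)) (A (d - 1)) \<gamma>" "chn (length vs) (Suc j) (A (d - 1)) \<delta>"
        "chn (length vs) (Suc j) (B d) (\<lambda>S. \<alpha> S - (kd X vs \<gamma> S + X v (\<delta> S)))"
        "chn (length vs) j (B d) (\<lambda>S. \<beta> S + kd X vs \<delta> S)"
proof -
  have "chn (length (v # vs)) (Suc j) (A d) (cone \<alpha> \<beta>)" using assms(3,4) by (simp add: chn_cone)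
  moreover have "cyc X (v # vs) (Suc j) (B (d + 1)) (cone \<alpha> \<beta>)"
    using assms(5,6) by (simp add: cyc_cone[OF assms(2)])
  ultimately obtain \<eta> where "chn (length (v # vs)) (Suc (Suc j)) (A (d - 1)) \<eta>"
    "chn (length (v # vs)) (Suc j) (B d) (\<lambda>T. cone \<alpha> \<beta> T - kd X (v # vs) \<eta> T)"
    using hzeroD[OF assms(1)] by metis
  then show ?thesis
    using that[of "\<lambda>S. \<eta> (False # S)" "\<lambda>S. \<eta> (True # S)"] by (simp add: chn_cone)
qed

lemma hzero_0_ConsD:
  assumes "hzero X (v # vs) A B 0 d" "chn (length vs) 0 (A d) \<alpha>"
  obtains \<gamma> \<delta> where "chn (length vs) 1 (A (d - 1)) \<gamma>" "chn (length vs) 0 (A (d - 1)) \<delta>"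
        "chn (length vs) 0 (B d) (\<lambda>S. \<alpha> S - (kd X vs \<gamma> S + X v (\<delta> S)))"
proof -
  have "chn (length (v # vs)) 0 (A d) (cone \<alpha> (\<lambda>_. 0))" using assms(2) by (simp add: chn_cone)
  then obtain \<eta> where "chn (length (v # vs)) (Suc 0) (A (d - 1)) \<eta>"
    "chn (length (v # vs)) 0 (B d) (\<lambda>T. cone \<alpha> (\<lambda>_. 0) T - kd X (v # vs) \<eta> T)"
    using hzeroD[OF assms(1)] by (metis cyc_0)
  then show ?thesis
    using that[of "\<lambda>S. \<eta> (False # S)" "\<lambda>S. \<eta> (True # S)"] by (simp add: chn_cone)
qed

subsection \<open>The operators act as zero on Koszul homology\<close>

text \<open>Exterior multiplication by the basis vector of v, at the first occurrence of v in the
  list, with the signs of the iterated cone.\<close>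

fun wedge :: "nat \<Rightarrow> nat list \<Rightarrow> (bool list \<Rightarrow> 'a) \<Rightarrow> bool list \<Rightarrow> 'a::ab_group_add" where
  "wedge v [] \<omega> T = 0"
| "wedge v (w # vs) \<omega> [] = 0"
| "wedge v (w # vs) \<omega> (False # T) = (if w = v then 0 else wedge v vs (\<lambda>S. \<omega> (False # S)) T)"
| "wedge v (w # vs) \<omega> (True # T) =
     (if w = v then \<omega> (False # T) else - wedge v vs (\<lambda>S. \<omega> (True # S)) T)"

lemma wedge_add: "wedge v vs (\<lambda>S. \<omega> S + \<eta> S) T = wedge v vs \<omega> T + wedge v vs \<eta> T"
  by (induction v vs \<omega> T arbitrary: \<eta> rule: wedge.induct) simp_all

lemma wedge_uminus: "wedge v vs (\<lambda>S. - \<omega> S) T = - wedge v vs \<omega> T"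
  by (induction v vs \<omega> T rule: wedge.induct) simp_all

lemma wedge_X: "ops X \<Longrightarrow> wedge v vs (\<lambda>S. X w (\<omega> S)) T = X w (wedge v vs \<omega> T)"
  by (induction v vs \<omega> T rule: wedge.induct) (simp_all add: ops_simps)

lemma kd_zero: "ops X \<Longrightarrow> kd X vs (\<lambda>S. 0) T = 0"
  using kd_diff[of X vs "\<lambda>_. 0" "\<lambda>_. 0" T] by simp

text \<open>Exterior multiplication is a homotopy from X v to zero; this is why each variable
  annihilates Koszul homology.\<close>

lemma kd_wedge:
  assumes "ops X" "v \<in> set vs" "length T = length vs"
  shows "kd X vs (wedge v vs \<omega>) T + wedge v vs (kd X vs \<omega>) T = X v (\<omega> T)"
  using assms(2,3)
proof (induction vs arbitrary: \<omega> T)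
  case (Cons w vs)
  then obtain b S where T: "T = b # S" "length S = length vs" by (cases T) auto
  show ?case
  proof (cases "w = v")
    case True
    then show ?thesis using assms(1) T by (cases b) (simp_all add: kd_zero)
  next
    case False
    have IH: "kd X vs (wedge v vs \<omega>') S + wedge v vs (kd X vs \<omega>') S = X v (\<omega>' S)" for \<omega>'
      using Cons False T by simp
    show ?thesis
    proof (cases b)
      case True
      then show ?thesis
        using IH[of "\<lambda>S. \<omega> (True # S)"] T False assms(1) by (simp add: kd_uminus wedge_uminus)
    next
      case b: False
      then show ?thesis
        using IH[of "\<lambda>S. \<omega> (False # S)"] T False assms(1)
        by (simp add: wedge_add wedge_X[OF assms(1)] ops_uminus algebra_simps)
    qed
  qed
qed simp

lemma wedge_0: "T \<in> cells (length vs) 0 \<Longrightarrow> wedge v vs \<omega> T = 0"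
proof (induction vs arbitrary: \<omega> T)
  case (Cons w vs)
  from Cons.prems have "T \<in> cells (Suc (length vs)) 0" by simp
  then show ?case by (cases rule: cells_cases) (auto simp: Cons.IH)
qed simp

lemma wedge_chn:
  assumes "0 \<in> A" "\<And>a. a \<in> A \<Longrightarrow> - a \<in> A" "chn (length vs) i A \<omega>"
  shows "chn (length vs) (Suc i) A (wedge v vs \<omega>)"
proof -
  have "wedge v vs \<omega> T \<in> A" if "T \<in> cells (length vs) (Suc i)" for T
    using that assms(3)
  proof (induction vs arbitrary: \<omega> T i)
    case (Cons w vs)
    have F: "chn (length vs) i A (\<lambda>S. \<omega> (False # S))"
      using Cons.prems(2) by (simp add: chn_cone)
    from Cons.prems(1) have "T \<in> cells (Suc (length vs)) (Suc i)" by simp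
    then show ?case
    proof (cases rule: cells_cases)
      case (1 S)
      then show ?thesis using Cons.IH[OF 1(2) F] assms(1) by simp
    next
      case (2 S j)
      then have S: "S \<in> cells (length vs) i" by simp
      show ?thesis
      proof (cases i)
        case 0
        then show ?thesis using 2 S F assms(1) by (auto simp: wedge_0 chn_def)
      next
        case (Suc j)
        have "chn (length vs) j A (\<lambda>S. \<omega> (True # S))"
          using Cons.prems(2) Suc by (simp add: chn_cone)
        then show ?thesis using Cons.IH[of S j] S Suc 2 F assms(2) by (auto simp: chn_def)
      qed
    qed
  qed (use assms(1) in simp)
  then show ?thesis by (simp add: chn_def)
qed

lemma replicate_False_cells: "replicate n False \<in> cells n 0"
  by (simp add: cells_def)

lemma cells_n_0: "cells n 0 = {replicate n False}"
proof -
  have "T = replicate n False" if "T \<in> cells n 0" for T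
    using that
  proof (induction n arbitrary: T)
    case (Suc n)
    from Suc.prems show ?case by (cases rule: cells_cases) (auto simp: Suc.IH)
  qed simp
  then show ?thesis using replicate_False_cells by auto
qed

section \<open>Koszul homology of polynomial rings\<close>

definition xv :: "nat \<Rightarrow> 'k::field mpoly \<Rightarrow> 'k mpoly" where
  "xv v f = var v * f"

lemma ops_xv: "ops xv"
  by (simp add: ops_def xv_def algebra_simps)

lemma gmod_gr: "set vs \<subseteq> V \<Longrightarrow> gmod xv vs (gr V)"
  by (auto simp: gmod_def gr_add gr_uminus xv_def intro: gr_var_mult)

text \<open>The ideal generated by the variables in U, described monomial by monomial: membership
  passes to every \<open>part\<close>, and variables outside U can be cancelled.\<close>

definition mon :: "nat set \<Rightarrow> 'k::field mpoly set" where
  "mon U = {f. \<forall>m\<in>supp f. \<exists>u\<in>U. 0 < coef m u}"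

lemma mon_zero [simp]: "0 \<in> mon U"
  by (simp add: mon_def)

lemma mon_add: "f \<in> mon U \<Longrightarrow> g \<in> mon U \<Longrightarrow> f + g \<in> mon U"
  using Poly_Mapping.keys_add[of f g] unfolding mon_def by blast

lemma mon_uminus: "f \<in> mon U \<Longrightarrow> - f \<in> mon U"
  by (simp add: mon_def in_keys_iff)

lemma mon_diff: "f \<in> mon U \<Longrightarrow> g \<in> mon U \<Longrightarrow> f - g \<in> mon U"
  using mon_add[of f U "- g"] mon_uminus[of g U] by simp

lemma mon_sum: "(\<And>a. a \<in> A \<Longrightarrow> f a \<in> mon U) \<Longrightarrow> sum f A \<in> mon U"
  by (induction A rule: infinite_finite_induct) (auto intro: mon_add)

lemma mon_mult: "f \<in> mon U \<Longrightarrow> g * f \<in> mon U"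
  unfolding mon_def by (auto elim!: supp_mult_elim simp: lookup_add) (meson add_pos_nonneg le0 trans_less_add2)

lemma mon_mono: "U \<subseteq> W \<Longrightarrow> f \<in> mon U \<Longrightarrow> f \<in> mon W"
  unfolding mon_def by blast

lemma mon_var: "u \<in> U \<Longrightarrow> var u * f \<in> mon U"
  unfolding mon_def by (auto simp: supp_var_mult lookup_add intro!: bexI[of _ u])

lemma mon_var_cancel:
  assumes "v \<notin> U" "var v * f \<in> mon U"
  shows "f \<in> mon U"
proof -
  have "\<exists>u\<in>U. 0 < coef m u" if "m \<in> supp f" for m
  proof -
    have "Poly_Mapping.single v (Suc 0) + m \<in> supp (var v * f)" using that by (simp add: supp_var_mult)
    then obtain u where "u \<in> U" "0 < coef (Poly_Mapping.single v (Suc 0) + m) u"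
      using assms(2) unfolding mon_def by blast
    then show ?thesis using assms(1) by (auto simp: lookup_add lookup_single when_def split: if_splits)
  qed
  then show ?thesis by (simp add: mon_def)
qed

lemma mon_empty: "mon {} = {0 :: 'k::field mpoly}"
proof -
  have "f = 0" if "f \<in> mon {}" for f :: "'k mpoly"
  proof -
    have "supp f = {}" using that by (auto simp: mon_def)
    then show ?thesis by simp
  qed
  then show ?thesis by auto
qed

abbreviation mgr :: "nat set \<Rightarrow> nat set \<Rightarrow> int \<Rightarrow> 'k::field mpoly set" where
  "mgr V U d \<equiv> gr V d \<inter> mon U"

lemma gmod_mgr: "set vs \<subseteq> V \<Longrightarrow> gmod xv vs (mgr V U)"
  by (auto simp: gmod_def gr_add gr_uminus xv_def mon_add mon_uminus mon_mult intro: gr_var_mult)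

lemma kd_mon: "kd xv vs \<omega> T \<in> mon (set vs)" for \<omega> :: "bool list \<Rightarrow> 'k::field mpoly"
proof (induction vs arbitrary: \<omega> T)
  case (Cons v vs)
  have *: "kd xv vs \<omega> S \<in> mon (set (v # vs))" for \<omega> :: "bool list \<Rightarrow> 'k mpoly" and S
    using mon_mono[of "set vs" "set (v # vs)"] Cons.IH by auto
  show ?case
  proof (cases T)
    case (Cons b S)
    then show ?thesis 
      by (cases b) (auto intro!: mon_add mon_uminus *[simplified] mon_var[folded xv_def])
  qed simp
qed simp

text \<open>Peeling off the monomials divisible by one variable after another writes f as a sum of
  x_v a_v modulo (U), which is the boundary of the 1-chain with entries a_v.\<close>

lemma mon_imp_boundary:
  assumes "set vs \<subseteq> V" "f \<in> gr V d" "f \<in> mon (set vs \<union> U)" "T \<in> cells (length vs) 0"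
  shows "\<exists>\<gamma>. chn (length vs) 1 (gr V (d - 1)) \<gamma> \<and> f - kd xv vs \<gamma> T \<in> mon U"
  using assms
proof (induction vs arbitrary: f T)
  case (Cons v vs)
  define f1 where "f1 = part (\<lambda>m. \<not> 0 < coef m v) f"
  define f2 where "f2 = part (\<lambda>m. 0 < coef m v) f"
  from Cons.prems(4) obtain S where T: "T = False # S" "S \<in> cells (length vs) 0"
    using cells_cases[of T "length vs" 0] by auto
  have f: "f = f2 + f1" unfolding f1_def f2_def by (rule part_split)
  have f2: "var v * dv v f2 = f2" by (rule var_mult_dv) (simp add: f2_def supp_part)
  have "f1 \<in> mon (set vs \<union> U)" using Cons.prems(3) by (auto simp: f1_def mon_def supp_part)
  moreover have "f1 \<in> gr V d" using Cons.prems by (simp add: f1_def gr_part)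
  ultimately obtain \<gamma> where \<gamma>: "chn (length vs) 1 (gr V (d - 1)) \<gamma>" "f1 - kd xv vs \<gamma> S \<in> mon U"
    using Cons.IH[of f1 S] Cons.prems T by auto
  have "dv v f2 \<in> gr V (d - 1)" using Cons.prems by (simp add: f2_def gr_part dv_gr)
  then have "chn (length (v # vs)) 1 (gr V (d - 1)) (cone \<gamma> (\<lambda>_. dv v f2))"
    using \<gamma> by (simp add: chn_cone) (simp add: chn_def)
  moreover have "f - kd xv (v # vs) (cone \<gamma> (\<lambda>_. dv v f2)) T = f1 - kd xv vs \<gamma> S"
    using T f f2 by (simp add: xv_def)
  ultimately show ?case using \<gamma>(2) by metis
qed (auto simp: chn_def)

text \<open>Distinct variables outside U form a regular sequence modulo (U), and the Koszul complex
  of a regular sequence is acyclic in positive degrees.\<close>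

lemma hzero_mon_regular:
  assumes "distinct vs" "set vs \<subseteq> V" "set vs \<inter> U = {}"
  shows "hzero xv vs (gr V) (mgr V U :: int \<Rightarrow> 'k::field mpoly set) (Suc j) d"
  using assms
proof (induction vs arbitrary: j d)
  case Nil
  then show ?case by (auto simp: hzero_def chn_def)
next
  case (Cons v vs j d)
  have V: "v \<in> V" "set vs \<subseteq> V" and v: "v \<notin> set vs \<union> U" and dj: "distinct vs" "set vs \<inter> U = {}"
    using Cons.prems by auto
  note gB = gmod_mgr[OF V(2), of U] and gA = gmod_gr[OF V(2)]
  show ?case
  proof (rule hzero_ConsI)
    show "gmod xv (v # vs) (mgr V U)" using Cons.prems by (intro gmod_mgr) auto
  next
    fix \<alpha> \<beta> :: "bool list \<Rightarrow> 'k mpoly"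
    assume \<alpha>: "chn (length vs) (Suc j) (gr V d) \<alpha>" and \<beta>: "chn (length vs) j (gr V d) \<beta>"
      and c1: "chn (length vs) j (mgr V U (d + 1)) (\<lambda>S. kd xv vs \<alpha> S + xv v (\<beta> S))"
      and c2: "cyc xv vs j (mgr V U (d + 1)) \<beta>"
    \<comment> \<open>beta is a boundary: for j > 0 by induction, for j = 0 because x_v can be
      cancelled modulo the ideal generated by \<open>vs\<close> and U.\<close>
    obtain \<gamma> where \<gamma>: "chn (length vs) (Suc j) (gr V (d - 1)) \<gamma>"
      "chn (length vs) j (mgr V U d) (\<lambda>S. \<beta> S - kd xv vs \<gamma> S)"
    proof (cases j)
      case 0
      define T where "T = replicate (length vs) False"
      have T: "T \<in> cells (length vs) 0" by (simp add: T_def replicate_False_cells)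
      have "kd xv vs \<alpha> T + var v * \<beta> T \<in> mon U" using c1 T 0 by (simp add: chn_def xv_def)
      then have "kd xv vs \<alpha> T + var v * \<beta> T - kd xv vs \<alpha> T \<in> mon (set vs \<union> U)"
        by (intro mon_diff) (auto intro: mon_mono[OF _ kd_mon] mon_mono[of U])
      then have "\<beta> T \<in> mon (set vs \<union> U)"
        using mon_var_cancel[OF v, of "\<beta> T"] by simp
      moreover have "\<beta> T \<in> gr V d" using \<beta> T 0 by (simp add: chn_def)
      ultimately obtain \<gamma> where \<gamma>: "chn (length vs) 1 (gr V (d - 1)) \<gamma>" "\<beta> T - kd xv vs \<gamma> T \<in> mon U"
        using mon_imp_boundary V T by metis
      have "kd xv vs \<gamma> T \<in> gr V d"
        using kd_chn[OF gA, of 0 "d - 1" \<gamma>] \<gamma>(1) T by (simp add: chn_def)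
      with \<gamma> show ?thesis using 0 \<open>\<beta> T \<in> gr V d\<close>
        by (intro that[of \<gamma>]) (auto simp: chn_def cells_n_0 T_def intro: gr_diff)
    next
      case (Suc i)
      show ?thesis
        using \<beta> c2 unfolding Suc by (rule hzeroD[OF Cons.IH[OF dj(1) V(2) dj(2), of i d]])
          (rule that, simp_all add: Suc)
    qed
    \<comment> \<open>With beta = d \<gamma> modulo (U), the chain \<alpha> + x_v \<gamma> is a
      cycle for the shorter list.\<close>
    have "chn (length vs) (Suc j) (gr V d) (\<lambda>S. \<alpha> S + xv v (\<gamma> S))"
      using \<alpha> \<gamma>(1) V(1) gr_var_mult[of v V _ "d - 1"] by (auto simp: chn_def xv_def intro!: gr_add)
    moreover have "cyc xv vs (Suc j) (mgr V U (d + 1)) (\<lambda>S. \<alpha> S + xv v (\<gamma> S))"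
    proof -
      have "chn (length vs) j (mgr V U (d + 1)) (\<lambda>S. xv v (\<beta> S - kd xv vs \<gamma> S))"
        using \<gamma>(2) V(1) by (auto simp: chn_def xv_def mon_mult intro!: gr_var_mult)
      from chn_diff[OF gB c1 this] show ?thesis
        by (simp add: cyc_Suc chn_def kd_add[OF ops_xv] kd_X[OF ops_xv] ops_diff[OF ops_xv] algebra_simps)
    qed
    ultimately obtain \<delta> where \<delta>: "chn (length vs) (Suc (Suc j)) (gr V (d - 1)) \<delta>"
      "chn (length vs) (Suc j) (mgr V U d) (\<lambda>S. \<alpha> S + xv v (\<gamma> S) - kd xv vs \<delta> S)"
      by (rule hzeroD[OF Cons.IH[OF dj(1) V(2) dj(2), of j d]])
    show "\<exists>\<gamma> \<delta>. chn (length vs) (Suc (Suc j)) (gr V (d - 1)) \<gamma> \<and> chn (length vs) (Suc j) (gr V (d - 1)) \<delta> \<and>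
        chn (length vs) (Suc j) (mgr V U d) (\<lambda>S. \<alpha> S - (kd xv vs \<gamma> S + xv v (\<delta> S))) \<and>
        chn (length vs) j (mgr V U d) (\<lambda>S. \<beta> S + kd xv vs \<delta> S)"
      by (rule exI[of _ \<delta>], rule exI[of _ "\<lambda>S. - \<gamma> S"])
        (use \<delta> \<gamma> chn_uminus[OF gA \<gamma>(1)] in
          \<open>simp add: ops_uminus[OF ops_xv] kd_uminus[OF ops_xv] algebra_simps\<close>)
  qed
qed

text \<open>The variables \<open>us\<close> act as zero modulo (U), and \<open>ws\<close> is a
  regular sequence with quotient k. The homology is therefore an exterior algebra over k,
  concentrated in coefficient degree 0; this is the origin of d > 0.\<close>

lemma hzero_mon:
  assumes "distinct (us @ ws)" "set us \<subseteq> U" "U \<inter> set ws = {}" "U \<union> set ws = V" "d > 0"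
  shows "hzero xv (us @ ws) (gr V) (mgr V U :: int \<Rightarrow> 'k::field mpoly set) i d"
  using assms
proof (induction us arbitrary: i)
  case Nil
  have ws: "set ws \<subseteq> V" using Nil.prems(4) by blast
  show ?case
  proof (cases i)
    case 0
    show ?thesis unfolding 0
    proof (rule hzeroI)
      fix \<omega> :: "bool list \<Rightarrow> 'k mpoly"
      assume \<omega>: "chn (length ([] @ ws)) 0 (gr V d) \<omega>"
      define T where "T = replicate (length ws) False"
      have T: "T \<in> cells (length ws) 0" by (simp add: T_def replicate_False_cells)
      have *: "\<omega> T \<in> gr V d" using \<omega> T by (simp add: chn_def)
      have "\<exists>u\<in>set ws \<union> U. 0 < coef m u" if "m \<in> supp (\<omega> T)" for m
      proof -
        have "int (mdeg m) = d" "supp m \<subseteq> V" using * that by (auto simp: gr_def polys_def)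
        then have "supp m \<noteq> {}" using Nil.prems(5) by (auto simp: mdeg_def)
        then obtain u where u: "u \<in> supp m" by blast
        then have "u \<in> set ws \<union> U" using \<open>supp m \<subseteq> V\<close> Nil.prems(4) by blast
        moreover have "0 < coef m u" using u by (simp add: in_keys_iff)
        ultimately show ?thesis by blast
      qed
      then have "\<omega> T \<in> mon (set ws \<union> U)" by (simp add: mon_def)
      then obtain \<gamma> where \<gamma>: "chn (length ws) 1 (gr V (d - 1)) \<gamma>" "\<omega> T - kd xv ws \<gamma> T \<in> mon U"
        using mon_imp_boundary[OF ws * _ T] by blast
      have "kd xv ws \<gamma> T \<in> gr V d"
        using kd_chn[OF gmod_gr[OF ws], of 0 "d - 1" \<gamma>] \<gamma>(1) T by (simp add: chn_def)
      with \<gamma> * show "\<exists>\<eta>. chn (length ([] @ ws)) (Suc 0) (gr V (d - 1)) \<eta> \<and>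
          chn (length ([] @ ws)) 0 (mgr V U d) (\<lambda>T. \<omega> T - kd xv ([] @ ws) \<eta> T)"
        by (intro exI[of _ \<gamma>]) (auto simp: chn_def cells_n_0 T_def intro: gr_diff)
    qed
  next
    case (Suc j)
    have "distinct ws" "set ws \<inter> U = {}" using Nil.prems(1,3) by auto
    then show ?thesis using hzero_mon_regular[OF _ ws] Suc by simp
  qed
next
  case (Cons u us)
  let ?vs = "us @ ws"
  have u: "u \<in> U" "u \<in> V" and V: "set ?vs \<subseteq> V" using Cons.prems by auto
  have IH: "hzero xv ?vs (gr V) (mgr V U :: int \<Rightarrow> 'k mpoly set) i d" for i
    using Cons.prems by (intro Cons.IH) auto
  note gB = gmod_mgr[OF V, of U] and gA = gmod_gr[OF V]
  show ?case
  proof (cases i)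
    case 0
    show ?thesis unfolding 0
    proof (rule hzeroI)
      fix \<omega> :: "bool list \<Rightarrow> 'k mpoly"
      assume "chn (length ((u # us) @ ws)) 0 (gr V d) \<omega>"
      then have F: "chn (length ?vs) 0 (gr V d) (\<lambda>S. \<omega> (False # S))" by (simp add: chn_cone)
      obtain \<gamma> where "chn (length ?vs) (Suc 0) (gr V (d - 1)) \<gamma>"
        "chn (length ?vs) 0 (mgr V U d) (\<lambda>S. \<omega> (False # S) - kd xv ?vs \<gamma> S)" by (rule hzeroD[OF IH F cyc_0])
      then have "chn (length ((u # us) @ ws)) (Suc 0) (gr V (d - 1)) (cone \<gamma> (\<lambda>_. 0)) \<and>
          chn (length ((u # us) @ ws)) 0 (mgr V U d) (\<lambda>T. \<omega> T - kd xv ((u # us) @ ws) (cone \<gamma> (\<lambda>_. 0)) T)"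
        by (simp add: chn_cone ops_zero[OF ops_xv]) (simp add: chn_def)
      then show "\<exists>\<eta>. chn (length ((u # us) @ ws)) (Suc 0) (gr V (d - 1)) \<eta> \<and>
          chn (length ((u # us) @ ws)) 0 (mgr V U d) (\<lambda>T. \<omega> T - kd xv ((u # us) @ ws) \<eta> T)" by blast
    qed
  next
    case (Suc j)
    have "hzero xv (u # ?vs) (gr V) (mgr V U :: int \<Rightarrow> 'k mpoly set) (Suc j) d"
    proof (rule hzero_ConsI)
      show "gmod xv (u # ?vs) (mgr V U)" using u V by (intro gmod_mgr) auto
    next
      fix \<alpha> \<beta> :: "bool list \<Rightarrow> 'k mpoly"
      assume \<alpha>: "chn (length ?vs) (Suc j) (gr V d) \<alpha>" and \<beta>: "chn (length ?vs) j (gr V d) \<beta>"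
        and c1: "chn (length ?vs) j (mgr V U (d + 1)) (\<lambda>S. kd xv ?vs \<alpha> S + xv u (\<beta> S))"
        and c2: "cyc xv ?vs j (mgr V U (d + 1)) \<beta>"
      \<comment> \<open>The term with x_u lies in (U), so \<alpha> and \<beta> are cycles separately
        and are bounded separately.\<close>
      have X: "chn (length ?vs) l (mgr V U (e + 1)) (\<lambda>S. xv u (\<omega> S))"
        if "chn (length ?vs) l (gr V e) \<omega>" for l e and \<omega> :: "bool list \<Rightarrow> 'k mpoly"
        using that u by (auto simp: chn_def xv_def mon_var gr_var_mult)
      have "cyc xv ?vs (Suc j) (mgr V U (d + 1)) \<alpha>"
        using chn_diff[OF gB c1 X[OF \<beta>]] by (simp add: cyc_Suc)
      note c1' = this
      obtain \<gamma> where \<gamma>: "chn (length ?vs) (Suc (Suc j)) (gr V (d - 1)) \<gamma>"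
        "chn (length ?vs) (Suc j) (mgr V U d) (\<lambda>S. \<alpha> S - kd xv ?vs \<gamma> S)" by (rule hzeroD[OF IH \<alpha> c1'])
      obtain \<delta> where \<delta>: "chn (length ?vs) (Suc j) (gr V (d - 1)) \<delta>"
        "chn (length ?vs) j (mgr V U d) (\<lambda>S. \<beta> S - kd xv ?vs \<delta> S)" by (rule hzeroD[OF IH \<beta> c2])
      show "\<exists>\<gamma> \<delta>. chn (length ?vs) (Suc (Suc j)) (gr V (d - 1)) \<gamma> \<and>
          chn (length ?vs) (Suc j) (gr V (d - 1)) \<delta> \<and>
          chn (length ?vs) (Suc j) (mgr V U d) (\<lambda>S. \<alpha> S - (kd xv ?vs \<gamma> S + xv u (\<delta> S))) \<and>
          chn (length ?vs) j (mgr V U d) (\<lambda>S. \<beta> S + kd xv ?vs \<delta> S)"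
        by (rule exI[of _ \<gamma>], rule exI[of _ "\<lambda>S. - \<delta> S"])
          (use chn_add[OF gB \<gamma>(2) X[OF \<delta>(1), unfolded diff_add_cancel]] \<gamma>(1) \<delta>(2) chn_uminus[OF gA \<delta>(1)] in
            \<open>simp add: ops_uminus[OF ops_xv] kd_uminus[OF ops_xv] algebra_simps\<close>)
    qed
    then show ?thesis using Suc by simp
  qed
qed

section \<open>Dimension shifting\<close>

text \<open>
  For \<open>0 \<rightarrow> Z \<rightarrow> F \<rightarrow> C/B \<rightarrow> 0\<close> exact, \<open>snake\<close> says that \<open>H\<^sub>k(Z) \<rightarrow> H\<^sub>k(F)\<close> is injective
  (\<open>d\<close> is the degree of the coefficients of the \<open>(k+1)\<close>-chains).
\<close>

definition snake :: "(nat \<Rightarrow> 'a \<Rightarrow> 'a::ab_group_add) \<Rightarrow> nat list \<Rightarrow> (int \<Rightarrow> 'a set) \<Rightarrow> (int \<Rightarrow> 'a set) \<Rightarrow>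
    nat \<Rightarrow> int \<Rightarrow> bool" where
  "snake X vs F Z k d \<longleftrightarrow> (\<forall>w. chn (length vs) (Suc k) (F d) w \<longrightarrow> chn (length vs) k (Z (d + 1)) (kd X vs w) \<longrightarrow>
     (\<exists>w'. chn (length vs) (Suc k) (Z d) w' \<and> (\<forall>T\<in>cells (length vs) k. kd X vs w' T = kd X vs w T)))"

text \<open>Injectivity is automatic when the source H_k(Z) is zero.\<close>

lemma snakeI_hzero:
  assumes "ops X" "gmod X vs Z" "hzero X vs Z (\<lambda>_. {0}) k (d + 1)"
  shows "snake X vs F Z k d"
  unfolding snake_def
proof (intro allI impI)
  fix w assume w: "chn (length vs) k (Z (d + 1)) (kd X vs w)"
  have "cyc X vs k {0} (kd X vs w)"
    using cyc_kd[OF assms(1) gmod_zero_module[OF assms(1)]] by simp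
  then obtain \<eta> where "chn (length vs) (Suc k) (Z (d + 1 - 1)) \<eta>"
    "chn (length vs) k {0} (\<lambda>T. kd X vs w T - kd X vs \<eta> T)"
    using hzeroD[OF assms(3) w] by blast
  then show "\<exists>w'. chn (length vs) (Suc k) (Z d) w' \<and> (\<forall>T\<in>cells (length vs) k. kd X vs w' T = kd X vs w T)"
    by (intro exI[of _ \<eta>]) (simp add: chn_def)
qed

text \<open>H_k(Z) injects into H_k(F) = 0.\<close>

lemma hzeroI_snake:
  assumes "\<And>d. Z d \<subseteq> F d" "hzero X vs F (\<lambda>_. {0}) k d" "snake X vs F Z k (d - 1)"
  shows "hzero X vs Z (\<lambda>_. {0}) k d"
proof (rule hzeroI)
  fix \<omega> assume \<omega>: "chn (length vs) k (Z d) \<omega>" "cyc X vs k {0} \<omega>"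
  obtain \<eta> where \<eta>: "chn (length vs) (Suc k) (F (d - 1)) \<eta>" "chn (length vs) k {0} (\<lambda>T. \<omega> T - kd X vs \<eta> T)"
    using hzeroD[OF assms(2) chn_mono[OF \<omega>(1) assms(1)] \<omega>(2)] by blast
  have eq: "\<omega> T = kd X vs \<eta> T" if "T \<in> cells (length vs) k" for T
    using \<eta>(2) that by (simp add: chn_def)
  have "chn (length vs) k (Z (d - 1 + 1)) (kd X vs \<eta>)"
    using \<omega>(1) eq by (simp add: chn_def)
  then obtain w' where w': "chn (length vs) (Suc k) (Z (d - 1)) w'"
    "\<forall>T\<in>cells (length vs) k. kd X vs w' T = kd X vs \<eta> T"
    using assms(3) \<eta>(1) unfolding snake_def by blast
  then show "\<exists>\<eta>. chn (length vs) (Suc k) (Z (d - 1)) \<eta> \<and> chn (length vs) k {0} (\<lambda>T. \<omega> T - kd X vs \<eta> T)"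
    using eq by (intro exI[of _ w']) (simp add: chn_def)
qed

text \<open>Additivity is asked only within one graded piece, because \<open>free_map\<close> is
  additive only on finitely supported families.\<close>

lemma kd_hom_chn:
  assumes F: "gmod X vs F"
    and add: "\<And>a b d. a \<in> F d \<Longrightarrow> b \<in> F d \<Longrightarrow> \<pi> (a + b) = \<pi> a + \<pi> b"
    and X: "\<And>v a d. v \<in> set vs \<Longrightarrow> a \<in> F d \<Longrightarrow> \<pi> (X v a) = Y v (\<pi> a)"
    and w: "chn (length vs) (Suc i) (F d) \<omega>" "T \<in> cells (length vs) i"
  shows "\<pi> (kd X vs \<omega> T) = kd Y vs (\<lambda>S. \<pi> (\<omega> S)) T"
proof -
  have 0: "\<pi> 0 = 0" using add[of 0 0 0] gmod_zero[OF F] by simp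
  have minus: "\<pi> (- a) = - \<pi> a" if "a \<in> F d" for a d
    using add[OF that gmod_uminus[OF F that]] by (simp add: 0 eq_neg_iff_add_eq_0 add.commute)
  show ?thesis
    using F X w
  proof (induction vs arbitrary: \<omega> T i)
    case (Cons v vs)
    have g: "gmod X vs F" by (rule gmod_subset[OF Cons.prems(1)]) auto
    have X': "\<pi> (X v a) = Y v (\<pi> a)" if "v \<in> set vs" "a \<in> F d" for v a d
      using Cons.prems(2) that by simp
    from Cons.prems(4) have "T \<in> cells (Suc (length vs)) i" by simp
    then show ?case
    proof (cases rule: cells_cases)
      case (1 S)
      have c: "chn (length vs) (Suc i) (F d) (\<lambda>S. \<omega> (False # S))"
        using Cons.prems(3) by (simp add: chn_def)
      have t: "\<omega> (True # S) \<in> F d" using Cons.prems(3) 1 by (simp add: chn_def)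
      have "X v (\<omega> (True # S)) \<in> F (d + 1)" by (rule gmod_X[OF Cons.prems(1) _ t]) simp
      moreover have "kd X vs (\<lambda>S. \<omega> (False # S)) S \<in> F (d + 1)"
        using kd_chn[OF g c] 1 by (simp add: chn_def)
      ultimately show ?thesis
        using 1 Cons.IH[OF g X' c 1(2)] Cons.prems(2)[OF _ t, of v] by (simp add: add)
    next
      case (2 S j)
      have c: "chn (length vs) (Suc j) (F d) (\<lambda>S. \<omega> (True # S))"
        using Cons.prems(3) 2 by (simp add: chn_def)
      have "kd X vs (\<lambda>S. \<omega> (True # S)) S \<in> F (d + 1)"
        using kd_chn[OF g c] 2 by (simp add: chn_def)
      then show ?thesis using 2 Cons.IH[OF g X' c 2(3)] by (simp add: minus)
    qed
  qed (simp add: 0)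
qed

text \<open>An exact sequence 0 -> Z -> F -> C/Bs -> 0. Its long exact sequence is used in two
  directions: \<open>hzero_C\<close> goes from syzygies to the module presented,
  \<open>snake_Z\<close> from the module to its syzygies.\<close>

locale graded_presentation =
  fixes X :: "nat \<Rightarrow> 'a::ab_group_add \<Rightarrow> 'a" and Y :: "nat \<Rightarrow> 'b::ab_group_add \<Rightarrow> 'b"
    and vs :: "nat list" and F :: "int \<Rightarrow> 'a set" and C Bs :: "int \<Rightarrow> 'b set" and \<pi> :: "'a \<Rightarrow> 'b"
  assumes opsX: "ops X" and opsY: "ops Y"
    and F: "gmod X vs F" and C: "gmod Y vs C" and Bs: "gmod Y vs Bs"
    and pi_add: "a \<in> F d \<Longrightarrow> b \<in> F d \<Longrightarrow> \<pi> (a + b) = \<pi> a + \<pi> b"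
    and pi_X: "v \<in> set vs \<Longrightarrow> a \<in> F d \<Longrightarrow> \<pi> (X v a) = Y v (\<pi> a)"
    and pi_C: "a \<in> F d \<Longrightarrow> \<pi> a \<in> C d"
    and surj: "c \<in> C d \<Longrightarrow> \<exists>u\<in>F d. c - \<pi> u \<in> Bs d"
begin

definition Z :: "int \<Rightarrow> 'a set" where
  "Z d = {u \<in> F d. \<pi> u \<in> Bs d}"

lemma pi_zero: "\<pi> 0 = 0"
  using pi_add[of 0 0 0] gmod_zero[OF F] by simp

lemma pi_uminus: "a \<in> F d \<Longrightarrow> \<pi> (- a) = - \<pi> a"
  using pi_add[of a d "- a"] gmod_uminus[OF F] by (simp add: pi_zero eq_neg_iff_add_eq_0 add.commute)

lemma pi_diff: "a \<in> F d \<Longrightarrow> b \<in> F d \<Longrightarrow> \<pi> (a - b) = \<pi> a - \<pi> b"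
  using pi_add[of a d "- b"] gmod_uminus[OF F] by (simp add: pi_uminus)

lemma pi_kd:
  "chn (length vs) (Suc i) (F d) w \<Longrightarrow> T \<in> cells (length vs) i \<Longrightarrow>
    \<pi> (kd X vs w T) = kd Y vs (\<lambda>S. \<pi> (w S)) T"
  by (rule kd_hom_chn[of X vs F \<pi> Y i d w T]) (assumption | rule F | erule (1) pi_add | erule (1) pi_X)+

lemma Z_subset: "Z d \<subseteq> F d"
  by (auto simp: Z_def)

lemma gmod_Z: "gmod X vs Z"
proof (rule gmodI)
  show "0 \<in> Z d" for d
    using gmod_zero[OF F] gmod_zero[OF Bs] by (simp add: Z_def pi_zero)
  show "a + b \<in> Z d" if "a \<in> Z d" "b \<in> Z d" for a b d
    using that gmod_add[OF F] gmod_add[OF Bs] pi_add[of a d b] by (simp add: Z_def)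
  show "- a \<in> Z d" if "a \<in> Z d" for a d
    using that gmod_uminus[OF F] gmod_uminus[OF Bs] pi_uminus[of a d] by (simp add: Z_def)
  show "X v a \<in> Z (d + 1)" if "v \<in> set vs" "a \<in> Z d" for v a d
    using that gmod_X[OF F] gmod_X[OF Bs] pi_X[of v a d] by (simp add: Z_def)
qed

lemma lift_chain:
  assumes "chn n i (C d) \<omega>"
  obtains w where "chn n i (F d) w" "chn n i (Bs d) (\<lambda>T. \<omega> T - \<pi> (w T))"
proof -
  have "\<forall>T\<in>cells n i. \<exists>u. u \<in> F d \<and> \<omega> T - \<pi> u \<in> Bs d"
    using assms surj unfolding chn_def by blast
  then obtain w where "\<forall>T\<in>cells n i. w T \<in> F d \<and> \<omega> T - \<pi> (w T) \<in> Bs d"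
    by (rule bchoice[THEN exE])
  then show ?thesis using that[of w] by (simp add: chn_def)
qed

text \<open>Exactness at H_{k+1}(C/Bs): a cycle lifts to F, the boundary of the lift lies in Z, and
  subtracting a chain of Z with the same boundary leaves a cycle of F, hence a boundary.\<close>

lemma hzero_C:
  assumes "snake X vs F Z k d" "hzero X vs F (\<lambda>_. {0}) (Suc k) d"
  shows "hzero Y vs C Bs (Suc k) d"
proof (rule hzeroI)
  fix \<omega> assume \<omega>: "chn (length vs) (Suc k) (C d) \<omega>" "cyc Y vs (Suc k) (Bs (d + 1)) \<omega>"
  obtain w where w: "chn (length vs) (Suc k) (F d) w" "chn (length vs) (Suc k) (Bs d) (\<lambda>T. \<omega> T - \<pi> (w T))"
    using lift_chain[OF \<omega>(1)] .
  have "chn (length vs) k (Bs (d + 1)) (\<lambda>T. kd Y vs \<omega> T - kd Y vs (\<lambda>S. \<pi> (w S)) T)"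
    using chn_kd_diff[OF opsY Bs w(2)] .
  from chn_diff[OF Bs \<omega>(2)[unfolded cyc_Suc] this]
  have "chn (length vs) k (Z (d + 1)) (kd X vs w)"
    using kd_chn[OF F w(1)] by (simp add: chn_def Z_def pi_kd[OF w(1)])
  then obtain w' where w': "chn (length vs) (Suc k) (Z d) w'"
    "\<forall>T\<in>cells (length vs) k. kd X vs w' T = kd X vs w T"
    using assms(1) w(1) unfolding snake_def by blast
  have "chn (length vs) (Suc k) (F d) (\<lambda>T. w T - w' T)"
    using chn_diff[OF F w(1) chn_mono[OF w'(1) Z_subset]] .
  moreover have "cyc X vs (Suc k) {0} (\<lambda>T. w T - w' T)"
    using w'(2) by (simp add: cyc_Suc chn_def kd_diff[OF opsX])
  ultimately obtain \<eta> where \<eta>: "chn (length vs) (Suc (Suc k)) (F (d - 1)) \<eta>"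
    "chn (length vs) (Suc k) {0} (\<lambda>T. w T - w' T - kd X vs \<eta> T)"
    by (rule hzeroD[OF assms(2)])
  have "\<omega> T - kd Y vs (\<lambda>S. \<pi> (\<eta> S)) T \<in> Bs d" if T: "T \<in> cells (length vs) (Suc k)" for T
  proof -
    have "w T - w' T = kd X vs \<eta> T" using \<eta>(2) T by (simp add: chn_def)
    then have "\<pi> (w T) - \<pi> (w' T) = kd Y vs (\<lambda>S. \<pi> (\<eta> S)) T"
      using pi_diff[of "w T" d "w' T"] pi_kd[OF \<eta>(1) T] w(1) w'(1) T by (simp add: chn_def Z_def)
    then have eq: "\<omega> T - kd Y vs (\<lambda>S. \<pi> (\<eta> S)) T = (\<omega> T - \<pi> (w T)) + \<pi> (w' T)"
      by (metis add_diff_cancel diff_diff_eq2 diff_add_eq)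
    have "\<omega> T - \<pi> (w T) \<in> Bs d" "\<pi> (w' T) \<in> Bs d"
      using w(2) w'(1) T by (simp_all add: chn_def Z_def)
    then show ?thesis unfolding eq by (intro gmod_add[OF Bs])
  qed
  then show "\<exists>\<eta>. chn (length vs) (Suc (Suc k)) (C (d - 1)) \<eta> \<and>
      chn (length vs) (Suc k) (Bs d) (\<lambda>T. \<omega> T - kd Y vs \<eta> T)"
    using \<eta>(1) by (intro exI[of _ "\<lambda>S. \<pi> (\<eta> S)"]) (simp add: chn_def pi_C)
qed

text \<open>Exactness at H_k(Z): a class that dies in F comes from H_{k+1}(C/Bs), which is
  zero.\<close>

lemma snake_Z:
  assumes "hzero Y vs C Bs (Suc k) d"
  shows "snake X vs F Z k d"
  unfolding snake_def
proof (intro allI impI)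
  fix w assume w: "chn (length vs) (Suc k) (F d) w" "chn (length vs) k (Z (d + 1)) (kd X vs w)"
  have "chn (length vs) (Suc k) (C d) (\<lambda>S. \<pi> (w S))" using w(1) by (simp add: chn_def pi_C)
  moreover have "cyc Y vs (Suc k) (Bs (d + 1)) (\<lambda>S. \<pi> (w S))"
    using w(2) by (simp add: cyc_Suc chn_def Z_def pi_kd[OF w(1)])
  ultimately obtain \<eta> where \<eta>: "chn (length vs) (Suc (Suc k)) (C (d - 1)) \<eta>"
    "chn (length vs) (Suc k) (Bs d) (\<lambda>T. \<pi> (w T) - kd Y vs \<eta> T)"
    by (rule hzeroD[OF assms])
  obtain h where h: "chn (length vs) (Suc (Suc k)) (F (d - 1)) h"
    "chn (length vs) (Suc (Suc k)) (Bs (d - 1)) (\<lambda>T. \<eta> T - \<pi> (h T))"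
    using lift_chain[OF \<eta>(1)] .
  have "chn (length vs) (Suc k) (Bs (d - 1 + 1)) (\<lambda>T. kd Y vs \<eta> T - kd Y vs (\<lambda>S. \<pi> (h S)) T)"
    using chn_kd_diff[OF opsY Bs h(2)] .
  from chn_add[OF Bs \<eta>(2) this[unfolded diff_add_cancel]]
  have "chn (length vs) (Suc k) (Bs d) (\<lambda>T. \<pi> (w T - kd X vs h T))"
    using w(1) kd_chn[OF F h(1)] by (simp add: chn_def pi_diff[of _ d] pi_kd[OF h(1)])
  moreover have "chn (length vs) (Suc k) (F d) (\<lambda>T. w T - kd X vs h T)"
    using chn_diff[OF F w(1) kd_chn[OF F h(1), unfolded diff_add_cancel]] .
  ultimately have "chn (length vs) (Suc k) (Z d) (\<lambda>T. w T - kd X vs h T)"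
    by (simp add: chn_def Z_def)
  then show "\<exists>w'. chn (length vs) (Suc k) (Z d) w' \<and> (\<forall>T\<in>cells (length vs) k. kd X vs w' T = kd X vs w T)"
    by (intro exI[of _ "\<lambda>T. w T - kd X vs h T"]) (simp add: kd_diff[OF opsX] kd_kd[OF opsX])
qed

end

section \<open>Free modules\<close>

definition xf :: "nat \<Rightarrow> (nat \<Rightarrow> 'k::field mpoly) \<Rightarrow> nat \<Rightarrow> 'k mpoly" where
  "xf v u = (\<lambda>b. var v * u b)"

lemma xf_apply: "xf v u b = xv v (u b)"
  by (simp add: xf_def xv_def)

lemma ops_xf: "ops xf"
  by (simp add: ops_def xf_def algebra_simps fun_eq_iff)

lemma free_module_zero: "0 \<in> free_module V B"
  by (simp add: free_module_def)

lemma free_module_add: "u \<in> free_module V B \<Longrightarrow> w \<in> free_module V B \<Longrightarrow> u + w \<in> free_module V B"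
proof -
  assume *: "u \<in> free_module V B" "w \<in> free_module V B"
  have "{b. (u + w) b \<noteq> 0} \<subseteq> {b. u b \<noteq> 0} \<union> {b. w b \<noteq> 0}" by auto
  then show ?thesis using * unfolding free_module_def
    by (auto simp: polys_add intro: finite_subset)
qed

lemma free_module_mult: "r \<in> polys V \<Longrightarrow> u \<in> free_module V B \<Longrightarrow> (\<lambda>b. r * u b) \<in> free_module V B"
proof -
  assume *: "r \<in> polys V" "u \<in> free_module V B"
  have "{b. r * u b \<noteq> 0} \<subseteq> {b. u b \<noteq> 0}" by auto
  then show ?thesis using * unfolding free_module_def
    by (auto simp: polys_mult intro: finite_subset)
qed

lemma free_module_uminus: "u \<in> free_module V B \<Longrightarrow> - u \<in> free_module V B"
  by (simp add: free_module_def)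

lemma free_module_diff: "u \<in> free_module V B \<Longrightarrow> w \<in> free_module V B \<Longrightarrow> u - w \<in> free_module V B"
  using free_module_add[of u V B "- w"] free_module_uminus[of w V B] by simp

lemma free_module_sum: "(\<And>a. a \<in> A \<Longrightarrow> f a \<in> free_module V B) \<Longrightarrow> sum f A \<in> free_module V B"
  by (induction A rule: infinite_finite_induct) (simp_all add: free_module_zero free_module_add)

lemma sum_fun_apply: "sum f A b = (\<Sum>a\<in>A. f a b)"
  by (induction A rule: infinite_finite_induct) simp_all

lemma free_moduleD: "u \<in> free_module V B \<Longrightarrow> u b \<in> polys V" "u \<in> free_module V B \<Longrightarrow> finite {b. u b \<noteq> 0}"
  "u \<in> free_module V B \<Longrightarrow> u b \<noteq> 0 \<Longrightarrow> b \<in> B"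
  by (auto simp: free_module_def)

definition gF :: "nat set \<Rightarrow> nat set \<Rightarrow> (nat \<Rightarrow> nat) \<Rightarrow> int \<Rightarrow> (nat \<Rightarrow> 'k::field mpoly) set" where
  "gF V B dg d = {u \<in> free_module V B. \<forall>b. u b \<in> gr V (d - int (dg b))}"

lemma gFI: "u \<in> free_module V B \<Longrightarrow> (\<And>b. u b \<in> gr V (d - int (dg b))) \<Longrightarrow> u \<in> gF V B dg d"
  by (simp add: gF_def)

lemma gFD: "u \<in> gF V B dg d \<Longrightarrow> u \<in> free_module V B" "u \<in> gF V B dg d \<Longrightarrow> u b \<in> gr V (d - int (dg b))"
  by (simp_all add: gF_def)

lemma gF_mult: "r \<in> gr V e \<Longrightarrow> u \<in> gF V B dg d \<Longrightarrow> (\<lambda>b. r * u b) \<in> gF V B dg (e + d)"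
  using gr_mult[of r V e] by (auto simp: gF_def gr_polys add_diff_eq[symmetric] intro!: free_module_mult)

lemma gF_zero: "0 \<in> gF V B dg d"
  by (simp add: gF_def free_module_zero)

lemma gF_add: "u \<in> gF V B dg d \<Longrightarrow> w \<in> gF V B dg d \<Longrightarrow> u + w \<in> gF V B dg d"
  by (simp add: gF_def free_module_add gr_add)

lemma gF_uminus: "u \<in> gF V B dg d \<Longrightarrow> - u \<in> gF V B dg d"
  by (simp add: gF_def free_module_uminus gr_uminus)

lemma gF_diff: "u \<in> gF V B dg d \<Longrightarrow> w \<in> gF V B dg d \<Longrightarrow> u - w \<in> gF V B dg d"
  by (simp add: gF_def free_module_diff gr_diff)

lemma gmod_gF:
  assumes "set vs \<subseteq> V"
  shows "gmod xf vs (gF V B dg :: int \<Rightarrow> (nat \<Rightarrow> 'k::field mpoly) set)"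
proof -
  have "xf v u \<in> gF V B dg (d + 1)" if "v \<in> set vs" "u \<in> gF V B dg d"
    for v d and u :: "nat \<Rightarrow> 'k mpoly"
    using gF_mult[of "var v" V 1 u B dg d] that assms by (auto simp: xf_def add.commute)
  then show ?thesis by (simp add: gmod_def gF_zero gF_add gF_uminus)
qed

lemma kd_apply: "kd xf vs \<omega> T b = kd xv vs (\<lambda>S. \<omega> S b) T"
  using kd_hom[of "\<lambda>u. u b" vs xf xv \<omega> T] by (simp add: xf_apply)

text \<open>Coordinatewise this is regularity of the variables on the polynomial ring
  (\<open>hzero_mon_regular\<close> with U empty); the primitives of the coordinates must then be
  cut down to one finite support.\<close>

lemma hzero_free:
  fixes V :: "nat set"
  assumes "distinct vs" "set vs \<subseteq> V"
  shows "hzero xf vs (gF V B dg) (\<lambda>_. {0 :: nat \<Rightarrow> 'k::field mpoly}) (Suc j) d"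
proof (rule hzeroI)
  fix \<omega> :: "bool list \<Rightarrow> nat \<Rightarrow> 'k mpoly"
  let ?n = "length vs"
  assume \<omega>: "chn ?n (Suc j) (gF V B dg d) \<omega>" "cyc xf vs (Suc j) {0} \<omega>"
  have "\<exists>\<eta>. chn ?n (Suc (Suc j)) (gr V (d - int (dg b) - 1)) \<eta> \<and>
      (\<forall>T\<in>cells ?n (Suc j). \<omega> T b = kd xv vs \<eta> T)" for b
  proof -
    have h: "hzero xv vs (gr V) (mgr V {} :: int \<Rightarrow> 'k mpoly set) (Suc j) (d - int (dg b))"
      using assms by (intro hzero_mon_regular) auto
    have "chn ?n (Suc j) (gr V (d - int (dg b))) (\<lambda>S. \<omega> S b)"
      using \<omega>(1) by (simp add: chn_def gF_def)
    moreover have "cyc xv vs (Suc j) (mgr V {} (d - int (dg b) + 1)) (\<lambda>S. \<omega> S b)"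
      using \<omega>(2) by (simp add: cyc_Suc chn_def mon_empty kd_apply[symmetric])
    ultimately obtain \<eta> where "chn ?n (Suc (Suc j)) (gr V (d - int (dg b) - 1)) \<eta>"
      "chn ?n (Suc j) (mgr V {} (d - int (dg b))) (\<lambda>T. \<omega> T b - kd xv vs \<eta> T)"
      by (rule hzeroD[OF h])
    then show ?thesis by (intro exI[of _ \<eta>]) (simp add: chn_def mon_empty)
  qed
  then obtain \<eta> where \<eta>: "\<And>b. chn ?n (Suc (Suc j)) (gr V (d - int (dg b) - 1)) (\<eta> b)"
    "\<And>b T. T \<in> cells ?n (Suc j) \<Longrightarrow> \<omega> T b = kd xv vs (\<eta> b) T"
    by metis
  define S where "S = (\<Union>T\<in>cells ?n (Suc j). {b. \<omega> T b \<noteq> 0})"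
  have S: "finite S" "S \<subseteq> B"
    using \<omega>(1) by (auto simp: S_def finite_cells chn_def gF_def dest: free_moduleD)
  define h where "h = (\<lambda>T b. if b \<in> S \<and> T \<in> cells ?n (Suc (Suc j)) then \<eta> b T else 0)"
  have "h T \<in> gF V B dg (d - 1)" for T
  proof (rule gFI)
    show b: "h T b \<in> gr V (d - 1 - int (dg b))" for b
      using \<eta>(1)[of b] by (simp add: h_def chn_def algebra_simps)
    have "{b. h T b \<noteq> 0} \<subseteq> S" by (auto simp: h_def)
    then show "h T \<in> free_module V B"
      using S gr_polys[OF b] finite_subset by (auto simp: free_module_def)
  qed
  moreover have "\<omega> T = kd xf vs h T" if T: "T \<in> cells ?n (Suc j)" for T
  proof
    fix b
    show "\<omega> T b = kd xf vs h T b"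
    proof (cases "b \<in> S")
      case True
      have "kd xv vs (\<eta> b) T = kd xv vs (\<lambda>S. h S b) T"
        by (rule kd_cong[OF ops_xv _ T]) (simp add: h_def True)
      then show ?thesis using \<eta>(2)[OF T, of b] by (simp add: kd_apply)
    next
      case False
      then show ?thesis using T by (auto simp: kd_apply h_def S_def kd_zero[OF ops_xv])
    qed
  qed
  ultimately show "\<exists>\<eta>. chn ?n (Suc (Suc j)) (gF V B dg (d - 1)) \<eta> \<and> chn ?n (Suc j) {0} (\<lambda>T. \<omega> T - kd xf vs \<eta> T)"
    by (intro exI[of _ h]) (simp add: chn_def)
qed

text \<open>Entries without constant term lie in the ideal of all variables, so every coordinate is
  a sum of x_v a_v.\<close>

lemma min_imp_boundary:
  fixes u :: "nat \<Rightarrow> 'k::field mpoly"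
  assumes "set vs = V" "u \<in> gF V B dg d" "\<And>b. coef (u b) 0 = 0" "T \<in> cells (length vs) 0"
  shows "\<exists>\<gamma>. chn (length vs) 1 (gF V B dg (d - 1)) \<gamma> \<and> u = kd xf vs \<gamma> T"
proof -
  let ?n = "length vs"
  have "\<exists>\<gamma>. chn ?n 1 (gr V (d - int (dg b) - 1)) \<gamma> \<and> u b = kd xv vs \<gamma> T" for b
  proof -
    have *: "u b \<in> gr V (d - int (dg b))" by (rule gFD(2)[OF assms(2)])
    have "\<exists>v\<in>set vs. 0 < coef m v" if m: "m \<in> supp (u b)" for m
    proof -
      have "m \<noteq> 0" using m assms(3)[of b] by (auto simp: in_keys_iff)
      then obtain v where "v \<in> supp m" by (metis all_not_in_conv keys_eq_empty)
      moreover have "supp m \<subseteq> V" using * m by (auto simp: gr_def polys_def)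
      ultimately show ?thesis using assms(1) by (intro bexI[of _ v]) (auto simp: in_keys_iff)
    qed
    then have "u b \<in> mon (set vs \<union> {})" by (simp add: mon_def)
    from mon_imp_boundary[OF _ * this assms(4)] show ?thesis using assms(1) by (auto simp: mon_empty)
  qed
  then obtain \<gamma> where \<gamma>: "\<And>b. chn ?n 1 (gr V (d - int (dg b) - 1)) (\<gamma> b)" "\<And>b. u b = kd xv vs (\<gamma> b) T"
    by metis
  define h where "h = (\<lambda>T b. if u b \<noteq> 0 \<and> T \<in> cells ?n (Suc 0) then \<gamma> b T else 0)"
  have "h S \<in> gF V B dg (d - 1)" for S
  proof (rule gFI)
    show b: "h S b \<in> gr V (d - 1 - int (dg b))" for b
      using \<gamma>(1)[of b] by (simp add: h_def chn_def algebra_simps)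
    have "{b. h S b \<noteq> 0} \<subseteq> {b. u b \<noteq> 0}" by (auto simp: h_def)
    then show "h S \<in> free_module V B"
      using gFD(1)[OF assms(2)] gr_polys[OF b] finite_subset by (fastforce simp: free_module_def)
  qed
  moreover have "u = kd xf vs h T"
  proof
    fix b
    show "u b = kd xf vs h T b"
    proof (cases "u b = 0")
      case False
      have "kd xv vs (\<gamma> b) T = kd xv vs (\<lambda>S. h S b) T"
        by (rule kd_cong[OF ops_xv _ assms(4)]) (simp add: h_def False)
      then show ?thesis using \<gamma>(2)[of b] by (simp add: kd_apply)
    next
      case True
      then show ?thesis by (auto simp: kd_apply h_def kd_zero[OF ops_xv])
    qed
  qed
  ultimately show ?thesis by (intro exI[of _ h]) (simp add: chn_def)
qed

section \<open>Linear maps of free modules and homogeneous components\<close>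

lemma free_map_superset:
  "finite S \<Longrightarrow> {b. u b \<noteq> 0} \<subseteq> S \<Longrightarrow> free_map M u c = (\<Sum>b\<in>S. u b * M b c)"
  unfolding free_map_def by (intro sum.mono_neutral_left) auto

lemma free_map_add:
  assumes "u \<in> free_module V B" "w \<in> free_module V B'"
  shows "free_map M (u + w) = free_map M u + free_map M w"
proof
  fix c
  let ?S = "{b. u b \<noteq> 0} \<union> {b. w b \<noteq> 0}"
  have S: "finite ?S" "{b. (u + w) b \<noteq> 0} \<subseteq> ?S"
    using assms by (auto dest: free_moduleD(2))
  have "free_map M (u + w) c = (\<Sum>b\<in>?S. (u + w) b * M b c)" by (rule free_map_superset[OF S])
  then show "free_map M (u + w) c = (free_map M u + free_map M w) c"
    using free_map_superset[OF S(1), of u M c] free_map_superset[OF S(1), of w M c]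
    by (simp add: distrib_right sum.distrib)
qed

lemma free_map_zero: "free_map M 0 = 0"
  by (simp add: free_map_def fun_eq_iff)

lemma free_map_mult:
  assumes "u \<in> free_module V B"
  shows "free_map M (\<lambda>b. r * u b) = (\<lambda>c. r * free_map M u c)"
proof
  fix c
  have "free_map M (\<lambda>b. r * u b) c = (\<Sum>b\<in>{b. u b \<noteq> 0}. r * u b * M b c)"
    using assms by (intro free_map_superset) (auto dest: free_moduleD)
  then show "free_map M (\<lambda>b. r * u b) c = r * free_map M u c"
    by (simp add: free_map_def sum_distrib_left mult.assoc)
qed

lemma free_map_uminus: "free_map M (- u) = - free_map M u"
  by (simp add: free_map_def fun_eq_iff sum_negf)

lemma free_map_diff:
  assumes "u \<in> free_module V B" "w \<in> free_module V B'"
  shows "free_map M (u - w) = free_map M u - free_map M w"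
  using free_map_add[OF assms(1) free_module_uminus[OF assms(2)]] by (simp add: free_map_uminus)

lemma graded_mapD:
  assumes "graded_map V B d B' d' M" "b \<in> B"
  shows "M b \<in> free_module V B'" "M b c \<in> gr V (int (d b) - int (d' c))"
proof -
  show *: "M b \<in> free_module V B'" using assms by (auto simp: graded_map_def)
  show "M b c \<in> gr V (int (d b) - int (d' c))"
  proof (cases "M b c = 0")
    case False
    then have "d' c \<le> d b" "homogeneous (d b - d' c) (M b c)" using assms by (auto simp: graded_map_def)
    then show ?thesis using free_moduleD(1)[OF *] by (auto simp: gr_def homogeneous_def of_nat_diff)
  qed simp
qed

lemma graded_mapI:
  assumes "\<And>b. b \<in> B \<Longrightarrow> M b \<in> gF V B' d' (int (d b))"
  shows "graded_map V B d B' d' M"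
  unfolding graded_map_def
proof (intro ballI conjI allI impI)
  fix b assume b: "b \<in> B"
  show "M b \<in> free_module V B'" using assms[OF b] by (simp add: gF_def)
  fix c assume c: "M b c \<noteq> 0"
  have *: "M b c \<in> gr V (int (d b) - int (d' c))" using assms[OF b] by (simp add: gF_def)
  with c show "d' c \<le> d b" using gr_neg[of "int (d b) - int (d' c)" V] by force
  then show "homogeneous (d b - d' c) (M b c)"
    using * by (auto simp: gr_def homogeneous_def)
qed

lemma free_map_in:
  assumes "\<And>b. b \<in> B \<Longrightarrow> M b \<in> free_module V B'" "u \<in> free_module V B"
  shows "free_map M u \<in> free_module V B'"
proof -
  have "free_map M u = (\<Sum>b\<in>{b. u b \<noteq> 0}. (\<lambda>c. u b * M b c))"
    by (simp add: fun_eq_iff free_map_def sum_fun_apply)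
  also have "\<dots> \<in> free_module V B'"
    using assms(2) by (intro free_module_sum free_module_mult assms(1)) (auto dest: free_moduleD)
  finally show ?thesis .
qed

lemma free_map_gF:
  assumes "graded_map V B d B' d' M" "u \<in> gF V B d e"
  shows "free_map M u \<in> gF V B' d' e"
proof (rule gFI)
  show "free_map M u \<in> free_module V B'"
    using free_map_in[of B M V B' u] graded_mapD(1)[OF assms(1)] gFD(1)[OF assms(2)] by blast
  fix c
  have "u b * M b c \<in> gr V (e - int (d' c))" if "u b \<noteq> 0" for b
  proof -
    have "b \<in> B" using that free_moduleD(3)[OF gFD(1)[OF assms(2)]] by blast
    then have "u b * M b c \<in> gr V (e - int (d b) + (int (d b) - int (d' c)))"
      by (intro gr_mult gFD(2)[OF assms(2)] graded_mapD(2)[OF assms(1)])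
    then show ?thesis by simp
  qed
  then show "free_map M u c \<in> gr V (e - int (d' c))"
    unfolding free_map_def by (intro gr_sum) auto
qed

definition hcF :: "(nat \<Rightarrow> nat) \<Rightarrow> int \<Rightarrow> (nat \<Rightarrow> 'k::field mpoly) \<Rightarrow> nat \<Rightarrow> 'k mpoly" where
  "hcF dg e u = (\<lambda>b. hc (e - int (dg b)) (u b))"

lemma hcF_gF:
  assumes "u \<in> free_module V B"
  shows "hcF dg e u \<in> gF V B dg e"
proof (rule gFI)
  show b: "hcF dg e u b \<in> gr V (e - int (dg b))" for b
    using free_moduleD(1)[OF assms] by (simp add: hcF_def hc_gr)
  have "{b. hcF dg e u b \<noteq> 0} \<subseteq> {b. u b \<noteq> 0}" by (auto simp: hcF_def)
  then show "hcF dg e u \<in> free_module V B"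
    using assms gr_polys[OF b] unfolding free_module_def by (auto intro: finite_subset)
qed

lemma hcF_id: "u \<in> gF V B dg e \<Longrightarrow> hcF dg e u = u"
  using gFD(2)[of u V B dg e] hc_id by (fastforce simp: hcF_def)

lemma hcF_free_map:
  assumes "graded_map V B d B' d' M" "u \<in> free_module V B"
  shows "free_map M (hcF d e u) = hcF d' e (free_map M u)"
proof
  fix c
  have "free_map M (hcF d e u) c = (\<Sum>b\<in>{b. u b \<noteq> 0}. hcF d e u b * M b c)"
    using free_moduleD(2)[OF assms(2)] by (intro free_map_superset) (auto simp: hcF_def)
  also have "\<dots> = (\<Sum>b\<in>{b. u b \<noteq> 0}. hc (e - int (d' c)) (u b * M b c))"
  proof (rule sum.cong)
    fix b assume "b \<in> {b. u b \<noteq> 0}"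
    then have "b \<in> B" using free_moduleD(3)[OF assms(2)] by blast
    then have "hc (e - int (d' c)) (M b c * u b) = M b c * hc (e - int (d' c) - (int (d b) - int (d' c))) (u b)"
      by (intro hc_mult[OF graded_mapD(2)[OF assms(1)]])
    then show "hcF d e u b * M b c = hc (e - int (d' c)) (u b * M b c)"
      by (simp add: hcF_def mult.commute)
  qed simp
  also have "\<dots> = hcF d' e (free_map M u) c"
    by (simp add: hcF_def free_map_def hc_sum)
  finally show "free_map M (hcF d e u) c = hcF d' e (free_map M u) c" .
qed

lemma sum_hcF:
  assumes "u \<in> free_module V B"
  obtains D where "finite D" "u = (\<Sum>e\<in>D. hcF dg e u)"
proof -
  define D where "D = (\<Union>b\<in>{b. u b \<noteq> 0}. (\<lambda>m. int (mdeg m) + int (dg b)) ` supp (u b))"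
  have D: "finite D" using free_moduleD(2)[OF assms] by (simp add: D_def)
  have "u b = (\<Sum>e\<in>D. hc (e - int (dg b)) (u b))" for b
  proof (cases "u b = 0")
    case False
    have "u b = (\<Sum>e\<in>(\<lambda>e. e - int (dg b)) ` D. hc e (u b))"
    proof (rule sum_hc)
      fix m assume "m \<in> supp (u b)"
      then have "int (mdeg m) + int (dg b) \<in> D" using False by (auto simp: D_def)
      then show "int (mdeg m) \<in> (\<lambda>e. e - int (dg b)) ` D" by force
    qed (use D in simp)
    also have "\<dots> = (\<Sum>e\<in>D. hc (e - int (dg b)) (u b))"
      by (subst sum.reindex) (auto simp: inj_on_def)
    finally show ?thesis .
  qed simp
  then have "u = (\<Sum>e\<in>D. hcF dg e u)" by (simp add: fun_eq_iff sum_fun_apply hcF_def)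
  then show ?thesis using that D by blast
qed

text \<open>Closure under homogeneous components, rather than generation by forms, passes at once to
  intersections with subrings and to images under linear substitutions; \<open>hom_ideal_gen\<close>
  gives the link.\<close>

definition hom_ideal :: "nat set \<Rightarrow> 'k::field mpoly set \<Rightarrow> bool" where
  "hom_ideal V I \<longleftrightarrow> is_ideal V I \<and> (\<forall>f\<in>I. \<forall>d. hc d f \<in> I)"

lemma is_idealD:
  assumes "is_ideal V I"
  shows "I \<subseteq> polys V" "0 \<in> I" "f \<in> I \<Longrightarrow> g \<in> I \<Longrightarrow> f + g \<in> I" "r \<in> polys V \<Longrightarrow> f \<in> I \<Longrightarrow> r * f \<in> I"
  using assms by (auto simp: is_ideal_def)

lemma is_ideal_uminus: "is_ideal V I \<Longrightarrow> f \<in> I \<Longrightarrow> - f \<in> I"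
  using is_idealD(4)[of V I "- 1" f] by simp

lemma is_ideal_diff: "is_ideal V I \<Longrightarrow> f \<in> I \<Longrightarrow> g \<in> I \<Longrightarrow> f - g \<in> I"
  using is_idealD(3)[of V I f "- g"] is_ideal_uminus[of V I g] by simp

lemma is_ideal_sum: "is_ideal V I \<Longrightarrow> (\<And>a. a \<in> A \<Longrightarrow> f a \<in> I) \<Longrightarrow> sum f A \<in> I"
  by (induction A rule: infinite_finite_induct) (simp_all add: is_idealD)

lemma hom_idealD: "hom_ideal V I \<Longrightarrow> is_ideal V I" "hom_ideal V I \<Longrightarrow> f \<in> I \<Longrightarrow> hc d f \<in> I"
  by (simp_all add: hom_ideal_def)

abbreviation igr :: "nat set \<Rightarrow> 'k::field mpoly set \<Rightarrow> int \<Rightarrow> 'k mpoly set" where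
  "igr V I d \<equiv> I \<inter> gr V d"

lemma gmod_igr:
  fixes I :: "'k::field mpoly set"
  assumes "set vs \<subseteq> V" "is_ideal V I"
  shows "gmod xv vs (igr V I)"
proof (rule gmodI)
  show "xv v a \<in> igr V I (d + 1)" if "v \<in> set vs" "a \<in> igr V I d" for v d a
    using assms that is_idealD(4)[OF assms(2), of "var v" a] gr_var_mult[of v V a d] by (auto simp: xv_def)
qed (use is_idealD(2,3)[OF assms(2)] is_ideal_uminus[OF assms(2)] in \<open>simp_all add: gr_add gr_uminus\<close>)

section \<open>Koszul homology from a free resolution\<close>

definition aug :: "(nat \<Rightarrow> 'k::field mpoly) \<Rightarrow> (nat \<Rightarrow> 'k mpoly) \<Rightarrow> 'k mpoly" where
  "aug a u = (\<Sum>b\<in>{b. u b \<noteq> 0}. u b * a b)"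

text \<open>The augmentation is a matrix into the free module on the single basis element 0, so the
  facts on \<open>free_map\<close> apply to it.\<close>

lemma aug_free_map: "aug a u = free_map (\<lambda>b c. if c = 0 then a b else 0) u 0"
  by (simp add: aug_def free_map_def)

lemma graded_map_aug:
  assumes "\<And>b. b \<in> B \<Longrightarrow> a b \<in> forms V (d b)"
  shows "graded_map V B d {0} (\<lambda>_. 0) (\<lambda>b c. if c = 0 then a b else 0)"
proof (rule graded_mapI)
  fix b assume "b \<in> B"
  then have "a b \<in> gr V (int (d b))" using assms by (simp add: gr_of_nat)
  then show "(\<lambda>c. if c = 0 then a b else 0) \<in> gF V {0} (\<lambda>_. 0) (int (d b))"
    by (auto simp: gF_def free_module_def gr_polys)
qed

locale tor_resolution =
  fixes V :: "nat set" and vs :: "nat list" and I :: "'k::field mpoly set" and B d M a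
  assumes vs: "distinct vs" "set vs = V" and I: "hom_ideal V I"
    and res: "graded_free_resolution V I B d M a"
begin

abbreviation Fg :: "nat \<Rightarrow> int \<Rightarrow> (nat \<Rightarrow> 'k mpoly) set" where
  "Fg n \<equiv> gF V (B n) (d n)"

text \<open>The modules Z of the successive presentations; membership in \<open>{0}\<close> matches
  the relation module \<open>Bs\<close> of \<open>graded_presentation\<close>.\<close>

fun syz :: "nat \<Rightarrow> int \<Rightarrow> (nat \<Rightarrow> 'k mpoly) set" where
  "syz 0 e = {u \<in> Fg 0 e. aug a u \<in> igr V I e}"
| "syz (Suc n) e = {u \<in> Fg (Suc n) e. free_map (M n) u \<in> {0}}"

lemma a_forms: "b \<in> B 0 \<Longrightarrow> a b \<in> forms V (d 0 b)"
  using res by (simp add: graded_free_resolution_def)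

lemma graded_M: "graded_map V (B (Suc n)) (d (Suc n)) (B n) (d n) (M n)"
  using res by (simp add: graded_free_resolution_def)

lemma exact_0: "u \<in> free_module V (B 0) \<Longrightarrow> aug a u \<in> I \<Longrightarrow> u \<in> free_map (M 0) ` free_module V (B 1)"
  and exact_0': "w \<in> free_module V (B 1) \<Longrightarrow> aug a (free_map (M 0) w) \<in> I"
  using res unfolding graded_free_resolution_def aug_def by blast+

lemma exact_Suc: "u \<in> free_module V (B (Suc n)) \<Longrightarrow> free_map (M n) u = 0 \<Longrightarrow>
    u \<in> free_map (M (Suc n)) ` free_module V (B (Suc (Suc n)))"
  and exact_Suc': "w \<in> free_module V (B (Suc (Suc n))) \<Longrightarrow> free_map (M n) (free_map (M (Suc n)) w) = 0"
  using res unfolding graded_free_resolution_def zero_fun_def by blast+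

lemma aug_gr: "u \<in> Fg 0 e \<Longrightarrow> aug a u \<in> gr V e"
  using gFD(2)[OF free_map_gF[OF graded_map_aug], of "B 0" a V "d 0" u e 0] a_forms
  by (simp add: aug_free_map)

lemma presentation_0: "graded_presentation xf xv vs (Fg 0) (gr V) (igr V I) (aug a)"
proof
  show "ops xf" "ops xv" "gmod xf vs (Fg 0)" "gmod xv vs (gr V)" "gmod xv vs (igr V I)"
    using vs hom_idealD(1)[OF I] by (simp_all add: ops_xf ops_xv gmod_gF gmod_gr gmod_igr)
  show "aug a (u + w) = aug a u + aug a w" if "u \<in> Fg 0 e" "w \<in> Fg 0 e" for u w e
    using free_map_add[OF gFD(1)[OF that(1)] gFD(1)[OF that(2)]] by (simp add: aug_free_map)
  show "aug a (xf v u) = xv v (aug a u)" if "u \<in> Fg 0 e" for v u e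
    using free_map_mult[OF gFD(1)[OF that]] by (simp add: aug_free_map xf_def xv_def)
  show "aug a u \<in> gr V e" if "u \<in> Fg 0 e" for u e
    by (rule aug_gr[OF that])
  show "\<exists>u\<in>Fg 0 e. f - aug a u \<in> igr V I e" if f: "f \<in> gr V e" for f e
  proof -
    obtain u where u: "u \<in> free_module V (B 0)" "f - aug a u \<in> I"
      using res gr_polys[OF f] unfolding graded_free_resolution_def aug_def by blast
    have "aug a (hcF (d 0) e u) = hc e (aug a u)"
      using hcF_free_map[OF graded_map_aug u(1), of a "d 0" e] a_forms
      by (simp add: aug_free_map hcF_def)
    then have "f - aug a (hcF (d 0) e u) = hc e (f - aug a u)"
      by (simp add: hc_diff hc_id[OF f])
    then have "f - aug a (hcF (d 0) e u) \<in> I" using hom_idealD(2)[OF I u(2)] by simp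
    moreover have "hcF (d 0) e u \<in> Fg 0 e" by (rule hcF_gF[OF u(1)])
    ultimately show ?thesis using gr_diff[OF f aug_gr] by blast
  qed
qed

lemma syz_0: "syz 0 = graded_presentation.Z (Fg 0) (igr V I) (aug a)"
  by (simp add: fun_eq_iff graded_presentation.Z_def[OF presentation_0])

lemma gmod_syz: "gmod xf vs (syz n)"
proof (cases n)
  case 0
  then show ?thesis using graded_presentation.gmod_Z[OF presentation_0] syz_0 by simp
next
  case (Suc m)
  have g: "gmod xf vs (Fg (Suc m))" using gmod_gF[of vs V] vs by simp
  show ?thesis
    unfolding Suc
  proof (rule gmodI)
    show "0 \<in> syz (Suc m) e" for e using gmod_zero[OF g] by (simp add: free_map_zero)
    show "u + w \<in> syz (Suc m) e" if "u \<in> syz (Suc m) e" "w \<in> syz (Suc m) e" for u w e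
      using that gmod_add[OF g] free_map_add[of u V "B (Suc m)" w "B (Suc m)" "M m"] by (auto dest: gFD(1))
    show "- u \<in> syz (Suc m) e" if "u \<in> syz (Suc m) e" for u e
      using that gmod_uminus[OF g] by (simp add: free_map_uminus)
    show "xf v u \<in> syz (Suc m) (e + 1)" if "v \<in> set vs" "u \<in> syz (Suc m) e" for u e v
      using that gmod_X[OF g] free_map_mult[of u V "B (Suc m)" "M m" "var v"]
      by (auto dest: gFD(1) simp: xf_def zero_fun_def)
  qed
qed

lemma presentation_Suc: "graded_presentation xf xf vs (Fg (Suc n)) (syz n) (\<lambda>_. {0}) (free_map (M n))"
proof
  show "ops (xf :: nat \<Rightarrow> (nat \<Rightarrow> 'k mpoly) \<Rightarrow> nat \<Rightarrow> 'k mpoly)" by (rule ops_xf)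
  show "gmod xf vs (Fg (Suc n))" "gmod xf vs (syz n)"
    using vs by (simp_all add: gmod_gF gmod_syz)
  show "gmod xf vs (\<lambda>_. {0})" by (rule gmod_zero_module[OF ops_xf])
  show "free_map (M n) (u + w) = free_map (M n) u + free_map (M n) w"
    if "u \<in> Fg (Suc n) e" "w \<in> Fg (Suc n) e" for u w e
    using free_map_add[OF gFD(1)[OF that(1)] gFD(1)[OF that(2)]] .
  show "free_map (M n) (xf v u) = xf v (free_map (M n) u)" if "u \<in> Fg (Suc n) e" for v u e
    using free_map_mult[OF gFD(1)[OF that]] by (simp add: xf_def)
  show "free_map (M n) u \<in> syz n e" if "u \<in> Fg (Suc n) e" for u e
    using free_map_gF[OF graded_M that] exact_0' exact_Suc' gFD(1)[OF that] aug_gr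
    by (cases n) auto
  show "\<exists>u\<in>Fg (Suc n) e. z - free_map (M n) u \<in> {0}" if z: "z \<in> syz n e" for z e
  proof -
    have zF: "z \<in> Fg n e" using z by (cases n) auto
    have "z \<in> free_map (M n) ` free_module V (B (Suc n))"
      using z exact_0 exact_Suc gFD(1)[OF zF] by (cases n) auto
    then obtain u where u: "u \<in> free_module V (B (Suc n))" "z = free_map (M n) u" by blast
    have "z = free_map (M n) (hcF (d (Suc n)) e u)"
      using hcF_free_map[OF graded_M u(1), of e] hcF_id[OF zF] u(2) by simp
    then show ?thesis using hcF_gF[OF u(1)] by (intro bexI[of _ "hcF (d (Suc n)) e u"]) simp_all
  qed
qed

lemma syz_Suc: "syz (Suc n) = graded_presentation.Z (Fg (Suc n)) (\<lambda>_. {0}) (free_map (M n))"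
  by (simp add: fun_eq_iff graded_presentation.Z_def[OF presentation_Suc])

text \<open>The constant part of any lift is a Tor cycle, since z has no constant terms. Being a Tor
  boundary, it is removed by subtracting the image of an element with constant coefficients. This
  does the work of minimality, which an arbitrary resolution lacks.\<close>

lemma minimal_lift:
  assumes tor: "tor_cycles B d M (Suc n) e = tor_boundaries B d M (Suc n) e"
    and z: "z \<in> syz n (int e)" "\<And>c. coef (z c) 0 = 0"
  obtains u where "u \<in> Fg (Suc n) (int e)" "free_map (M n) u = z" "\<And>b. coef (u b) 0 = 0"
proof -
  obtain u where u: "u \<in> Fg (Suc n) (int e)" "z = free_map (M n) u"
    using graded_presentation.surj[OF presentation_Suc z(1)] by auto
  define v where "v = (\<lambda>b. coef (u b) 0)"
  have vu: "{b. v b \<noteq> 0} \<subseteq> {b. u b \<noteq> 0}" by (auto simp: v_def)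
  have finu: "finite {b. u b \<noteq> 0}" using free_moduleD(2)[OF gFD(1)[OF u(1)]] .
  have "d (Suc n) b = e \<and> b \<in> B (Suc n)" if "v b \<noteq> 0" for b
  proof -
    have "0 \<in> supp (u b)" using that by (simp add: v_def in_keys_iff)
    then show ?thesis using gFD(2)[OF u(1), of b] that vu free_moduleD(3)[OF gFD(1)[OF u(1)], of b]
      by (auto simp: gr_def)
  qed
  then have "v \<in> strand B d (Suc n) e"
    using finite_subset[OF vu finu] by (auto simp: strand_def)
  moreover have "free_map (mod_vars (M n)) v = (\<lambda>_. 0)"
  proof
    fix c
    have "free_map (mod_vars (M n)) v c = (\<Sum>b\<in>{b. u b \<noteq> 0}. v b * mod_vars (M n) b c)"
      by (rule free_map_superset[OF finu vu])
    also have "\<dots> = coef (free_map (M n) u c) 0"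
      by (simp add: free_map_def lookup_sum coef_mult_0 v_def mod_vars_def)
    finally show "free_map (mod_vars (M n)) v c = 0" using z(2) u(2) by simp
  qed
  ultimately have "v \<in> tor_boundaries B d M (Suc n) e"
    using tor by (auto simp: tor_cycles_def)
  then obtain t where t: "t \<in> strand B d (Suc (Suc n)) e" "v = free_map (mod_vars (M (Suc n))) t"
    by (auto simp: tor_boundaries_def)
  define t' where "t' = (\<lambda>b. const (t b))"
  have tsupp: "{b. t' b \<noteq> 0} \<subseteq> {b. t b \<noteq> 0}" by (auto simp: t'_def)
  have tfin: "finite {b. t b \<noteq> 0}" using t(1) by (simp add: strand_def)
  have t': "t' \<in> Fg (Suc (Suc n)) (int e)"
  proof (rule gFI)
    show "t' \<in> free_module V (B (Suc (Suc n)))"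
      using t(1) tsupp finite_subset[OF tsupp tfin] by (auto simp: free_module_def strand_def t'_def)
    show "t' b \<in> gr V (int e - int (d (Suc (Suc n)) b))" for b
    proof (cases "t b = 0")
      case False
      then have "d (Suc (Suc n)) b = e" using t(1) by (auto simp: strand_def)
      then show ?thesis by (simp add: t'_def)
    qed (simp add: t'_def)
  qed
  define u' where "u' = u - free_map (M (Suc n)) t'"
  have "u' \<in> Fg (Suc n) (int e)"
    unfolding u'_def by (rule gF_diff[OF u(1) free_map_gF[OF graded_M t']])
  moreover have "free_map (M n) u' = z"
    using free_map_diff[OF gFD(1)[OF u(1)] gFD(1)[OF free_map_gF[OF graded_M t']], of "M n"]
      exact_Suc'[OF gFD(1)[OF t']] u(2) by (simp add: u'_def)
  moreover have "coef (u' b) 0 = 0" for b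
  proof -
    have "free_map (M (Suc n)) t' b = (\<Sum>c\<in>{c. t c \<noteq> 0}. t' c * M (Suc n) c b)"
      by (rule free_map_superset[OF tfin tsupp])
    then have "coef (free_map (M (Suc n)) t' b) 0 = free_map (mod_vars (M (Suc n))) t b"
      by (simp add: free_map_def lookup_sum coef_mult_0 mod_vars_def t'_def const_def)
    also have "\<dots> = coef (u b) 0" using t(2) by (metis v_def)
    finally show ?thesis by (simp add: u'_def lookup_minus)
  qed
  ultimately show ?thesis by (rule that)
qed

text \<open>A Koszul boundary has no constant terms, so \<open>minimal_lift\<close> lifts it to an
  element that is again a Koszul boundary; applying the map of the resolution to a primitive gives a
  chain of syzygies.\<close>

lemma snake_base:
  assumes "tor_cycles B d M (Suc n) e = tor_boundaries B d M (Suc n) e"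
  shows "snake xf vs (Fg n) (syz n) 0 (int e - 1)"
  unfolding snake_def
proof (intro allI impI)
  fix w assume w: "chn (length vs) (Suc 0) (Fg n (int e - 1)) w"
    "chn (length vs) 0 (syz n (int e - 1 + 1)) (kd xf vs w)"
  define T where "T = replicate (length vs) False"
  have T: "T \<in> cells (length vs) 0" by (simp add: T_def replicate_False_cells)
  have "kd xf vs w T \<in> syz n (int e)" using w(2) T by (simp add: chn_def)
  moreover have "coef (kd xf vs w T c) 0 = 0" for c
    using kd_mon[of vs "\<lambda>S. w S c" T] by (force simp: kd_apply mon_def in_keys_iff)
  ultimately obtain u where u: "u \<in> Fg (Suc n) (int e)" "free_map (M n) u = kd xf vs w T"
    "\<And>b. coef (u b) 0 = 0"
    using minimal_lift[OF assms] by blast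
  obtain \<gamma> where \<gamma>: "chn (length vs) 1 (Fg (Suc n) (int e - 1)) \<gamma>" "u = kd xf vs \<gamma> T"
    using min_imp_boundary[OF vs(2) u(1,3) T] by blast
  have "free_map (M n) (kd xf vs \<gamma> T) = kd xf vs (\<lambda>S. free_map (M n) (\<gamma> S)) T"
    using graded_presentation.pi_kd[OF presentation_Suc _ T] \<gamma>(1) by simp
  then have "kd xf vs (\<lambda>S. free_map (M n) (\<gamma> S)) T = kd xf vs w T" using u(2) \<gamma>(2) by simp
  moreover have "chn (length vs) (Suc 0) (syz n (int e - 1)) (\<lambda>S. free_map (M n) (\<gamma> S))"
    using \<gamma>(1) graded_presentation.pi_C[OF presentation_Suc] by (simp add: chn_def)
  ultimately show "\<exists>w'. chn (length vs) (Suc 0) (syz n (int e - 1)) w' \<and>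
      (\<forall>T\<in>cells (length vs) 0. kd xf vs w' T = kd xf vs w T)"
    by (intro exI[of _ "\<lambda>S. free_map (M n) (\<gamma> S)"]) (simp add: cells_n_0 T_def)
qed

text \<open>Each dimension shift trades one homological degree of the resolution for one of the
  Koszul complex. The coefficients lose a degree each time, because Koszul basis vectors have degree
  1.\<close>

lemma snake_all:
  assumes "tor_cycles B d M (Suc i) e = tor_boundaries B d M (Suc i) e" "n + k = i"
  shows "snake xf vs (Fg n) (syz n) k (int e - int k - 1)"
  using assms(2)
proof (induction k arbitrary: n)
  case 0
  then show ?case using snake_base assms(1) by simp
next
  case (Suc k)
  have "snake xf vs (Fg (Suc n)) (syz (Suc n)) k (int e - int k - 1)" using Suc by simp
  then have "hzero xf vs (syz n) (\<lambda>_. {0}) (Suc k) (int e - int k - 1)"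
    unfolding syz_Suc using vs
    by (intro graded_presentation.hzero_C[OF presentation_Suc] hzero_free) simp_all
  then show ?case
    by (intro snakeI_hzero[OF ops_xf gmod_syz]) (simp add: algebra_simps)
qed

lemma koszul_vanishes:
  assumes "tor_cycles B d M (Suc i) e = tor_boundaries B d M (Suc i) e"
  shows "hzero xv vs (gr V) (igr V I) (Suc i) (int e - int (Suc i))"
proof -
  have "snake xf vs (Fg 0) (syz 0) i (int e - int i - 1)" by (rule snake_all[OF assms]) simp
  then have "hzero xv vs (gr V) (igr V I) (Suc i) (int e - int i - 1)"
    unfolding syz_0 using vs
    by (intro graded_presentation.hzero_C[OF presentation_0] hzero_free) simp_all
  then show ?thesis by (simp add: algebra_simps)
qed

end

text \<open>Total degree minus homological degree is the degree of the coefficients.\<close>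

lemma tor_vanishes_hzero:
  assumes "tor_vanishes V I (Suc i) e" "hom_ideal V I" "distinct vs" "set vs = V"
  shows "hzero xv vs (gr V) (igr V I) (Suc i) (int e - int (Suc i))"
proof -
  obtain B d M a where *: "graded_free_resolution V I B d M a"
    "tor_cycles B d M (Suc i) e = tor_boundaries B d M (Suc i) e"
    using assms(1) by (auto simp: tor_vanishes_def)
  interpret tor_resolution V vs I B d M a
    by unfold_locales (use assms * in auto)
  show ?thesis by (rule koszul_vanishes[OF *(2)])
qed

section \<open>Finite generation of graded submodules\<close>

text \<open>A monotone subsequence exists, and a decreasing one is constant from the index at which
  its minimum is attained.\<close>

lemma mono_subsequence_nat:
  fixes f :: "nat \<Rightarrow> nat"
  shows "\<exists>\<phi> :: nat \<Rightarrow> nat. strict_mono \<phi> \<and> (\<forall>i j. i \<le> j \<longrightarrow> f (\<phi> i) \<le> f (\<phi> j))"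
proof -
  obtain g :: "nat \<Rightarrow> nat" where g: "strict_mono g" "monoseq (\<lambda>n. f (g n))"
    using seq_monosub[of f] by (auto simp: o_def)
  show ?thesis
  proof (cases "incseq (\<lambda>n. f (g n))")
    case True
    then show ?thesis using g(1) by (intro exI[of _ g]) (simp add: incseq_def)
  next
    case False
    then have dec: "decseq (\<lambda>n. f (g n))" using g(2) by (auto simp: monoseq_iff)
    obtain n0 where n0: "\<And>n. f (g n0) \<le> f (g n)"
      using ex_has_least_nat[of "\<lambda>_. True" 0 "\<lambda>n. f (g n)"] by blast
    have con: "f (g (n0 + n)) = f (g n0)" for n
      using n0[of "n0 + n"] decseqD[OF dec, of n0 "n0 + n"] by simp
    have "strict_mono (\<lambda>n. g (n0 + n))" using g(1) by (simp add: strict_mono_def)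
    then show ?thesis by (intro exI[of _ "\<lambda>n. g (n0 + n)"]) (simp add: con)
  qed
qed

lemma mono_subsequence_nats:
  fixes F :: "nat \<Rightarrow> nat \<Rightarrow> nat"
  assumes "finite V"
  shows "\<exists>\<phi> :: nat \<Rightarrow> nat. strict_mono \<phi> \<and> (\<forall>v\<in>V. \<forall>i j. i \<le> j \<longrightarrow> F v (\<phi> i) \<le> F v (\<phi> j))"
  using assms
proof (induction V)
  case empty
  show ?case by (intro exI[of _ id]) (simp add: strict_mono_def)
next
  case (insert v V)
  obtain \<phi> :: "nat \<Rightarrow> nat" where \<phi>: "strict_mono \<phi>" "\<forall>v\<in>V. \<forall>i j. i \<le> j \<longrightarrow> F v (\<phi> i) \<le> F v (\<phi> j)"
    using insert.IH by (elim exE conjE)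
  obtain \<psi> :: "nat \<Rightarrow> nat" where \<psi>: "strict_mono \<psi>" "\<forall>i j. i \<le> j \<longrightarrow> F v (\<phi> (\<psi> i)) \<le> F v (\<phi> (\<psi> j))"
    using mono_subsequence_nat[of "\<lambda>n. F v (\<phi> n)"] by (elim exE conjE)
  have "strict_mono (\<lambda>n. \<phi> (\<psi> n))"
    by (rule strict_monoI) (intro strict_monoD[OF \<phi>(1)] strict_monoD[OF \<psi>(1)])
  moreover have "F w (\<phi> (\<psi> i)) \<le> F w (\<phi> (\<psi> j))" if "w \<in> insert v V" "i \<le> j" for w i j
  proof (cases "w = v")
    case True
    show ?thesis unfolding True by (rule \<psi>(2)[rule_format, OF that(2)])
  next
    case False
    then have w: "w \<in> V" using that(1) by blast
    show ?thesis by (rule \<phi>(2)[rule_format, OF w strict_mono_leD[OF \<psi>(1) that(2)]])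
  qed
  ultimately show ?case by (intro exI[of _ "\<lambda>n. \<phi> (\<psi> n)"]) simp
qed

text \<open>The pigeonhole principle fixes the basis element; then the exponents are made weakly
  increasing for all variables of V at once.\<close>

lemma dickson:
  fixes s :: "nat \<Rightarrow> nat \<times> (nat \<Rightarrow>\<^sub>0 nat)"
  assumes "finite B" "finite V" "\<And>n. fst (s n) \<in> B" "\<And>n. supp (snd (s n)) \<subseteq> V"
  obtains i j c where "i < j" "fst (s i) = fst (s j)" "snd (s j) = c + snd (s i)"
proof -
  have "finite ((fst \<circ> s) ` UNIV)" using assms(1,3) by (auto intro: finite_subset)
  then obtain n0 where "infinite {n \<in> UNIV. (fst \<circ> s) n = (fst \<circ> s) n0}"
    using pigeonhole_infinite[of UNIV "fst \<circ> s"] by auto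
  then have inf: "infinite {n. fst (s n) = fst (s n0)}" by simp
  define e where "e = enumerate {n. fst (s n) = fst (s n0)}"
  have e: "strict_mono e" "\<And>n. fst (s (e n)) = fst (s n0)"
    using inf enumerate_in_set[OF inf] by (auto simp: e_def strict_mono_enumerate)
  obtain \<phi> :: "nat \<Rightarrow> nat" where \<phi>: "strict_mono \<phi>"
    "\<forall>v\<in>V. \<forall>i j. i \<le> j \<longrightarrow> coef (snd (s (e (\<phi> i)))) v \<le> coef (snd (s (e (\<phi> j)))) v"
    using mono_subsequence_nats[OF assms(2), of "\<lambda>v n. coef (snd (s (e n))) v"] by (elim exE conjE)
  let ?i = "e (\<phi> 0)" and ?j = "e (\<phi> 1)"
  have "coef (snd (s ?i)) v \<le> coef (snd (s ?j)) v" for v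
  proof (cases "v \<in> V")
    case True
    then show ?thesis using \<phi>(2) by simp
  next
    case False
    then have "v \<notin> supp (snd (s ?i))" using assms(4)[of ?i] by blast
    then show ?thesis by (simp add: in_keys_iff)
  qed
  then have "snd (s ?j) = (snd (s ?j) - snd (s ?i)) + snd (s ?i)"
    by (intro poly_mapping_eqI) (simp add: lookup_add lookup_minus)
  moreover have "?i < ?j" using e(1) \<phi>(1) by (simp add: strict_mono_def)
  moreover have "fst (s ?i) = fst (s ?j)" using e(2) by simp
  ultimately show ?thesis by (intro that)
qed

lemma finite_monomials:
  assumes "finite V"
  shows "finite {m :: nat \<Rightarrow>\<^sub>0 nat. supp m \<subseteq> V \<and> mdeg m = n}"
proof -
  let ?F = "{f :: nat \<Rightarrow> nat. \<forall>x. (x \<in> V \<longrightarrow> f x \<in> {..n}) \<and> (x \<notin> V \<longrightarrow> f x = 0)}"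
  have "finite ?F" using assms by (intro finite_set_of_finite_funs) auto
  moreover have "coef ` {m. supp m \<subseteq> V \<and> mdeg m = n} \<subseteq> ?F"
  proof -
    have le: "coef m x \<le> mdeg m" for m :: "nat \<Rightarrow>\<^sub>0 nat" and x
    proof (cases "x \<in> supp m")
      case True
      then show ?thesis by (auto simp: mdeg_def intro!: member_le_sum)
    qed (simp add: in_keys_iff)
    have zero: "coef m x = 0" if "supp m \<subseteq> V" "x \<notin> V" for m :: "nat \<Rightarrow>\<^sub>0 nat" and x
      using that by (meson in_keys_iff subsetD)
    show ?thesis by (rule image_subsetI) (use le zero in blast)
  qed
  ultimately have "finite (coef ` {m. supp m \<subseteq> V \<and> mdeg m = n})" by (rule finite_subset[rotated])
  then show ?thesis
    by (rule finite_imageD) (auto simp: inj_on_def intro: poly_mapping_eqI)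
qed

definition gsub :: "nat set \<Rightarrow> nat set \<Rightarrow> (nat \<Rightarrow> nat) \<Rightarrow> (nat \<Rightarrow> 'k::field mpoly) set \<Rightarrow> bool" where
  "gsub V B dg Z \<longleftrightarrow> Z \<subseteq> free_module V B \<and> 0 \<in> Z \<and> (\<forall>u\<in>Z. \<forall>w\<in>Z. u + w \<in> Z) \<and>
     (\<forall>r\<in>polys V. \<forall>u\<in>Z. (\<lambda>b. r * u b) \<in> Z) \<and> (\<forall>u\<in>Z. \<forall>e. hcF dg e u \<in> Z)"

lemma gsubD:
  assumes "gsub V B dg Z"
  shows "Z \<subseteq> free_module V B" "0 \<in> Z" "u \<in> Z \<Longrightarrow> w \<in> Z \<Longrightarrow> u + w \<in> Z"
    "r \<in> polys V \<Longrightarrow> u \<in> Z \<Longrightarrow> (\<lambda>b. r * u b) \<in> Z" "u \<in> Z \<Longrightarrow> hcF dg e u \<in> Z"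
  using assms by (auto simp: gsub_def)

lemma gsub_uminus: "gsub V B dg Z \<Longrightarrow> u \<in> Z \<Longrightarrow> - u \<in> Z"
  using gsubD(4)[of V B dg Z "- 1" u] by (simp add: fun_Compl_def)

lemma gsub_diff: "gsub V B dg Z \<Longrightarrow> u \<in> Z \<Longrightarrow> w \<in> Z \<Longrightarrow> u - w \<in> Z"
  using gsubD(3)[of V B dg Z u "- w"] gsub_uminus[of V B dg Z w] by simp

lemma gsub_sum: "gsub V B dg Z \<Longrightarrow> (\<And>a. a \<in> A \<Longrightarrow> f a \<in> Z) \<Longrightarrow> sum f A \<in> Z"
  by (induction A rule: infinite_finite_induct) (simp_all add: gsubD)

section \<open>Leading terms and division in free modules\<close>

definition terms :: "(nat \<Rightarrow> 'k::field mpoly) \<Rightarrow> (nat \<times> (nat \<Rightarrow>\<^sub>0 nat)) set" where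
  "terms u = {(b, m). m \<in> supp (u b)}"

text \<open>Pairs are compared lexicographically, basis index first; the order on monomials enters
  through totality and compatibility with addition.\<close>

definition lead :: "(nat \<Rightarrow> 'k::field mpoly) \<Rightarrow> nat \<times> (nat \<Rightarrow>\<^sub>0 nat)" where
  "lead u = Max (terms u)"

lemma finite_terms: "u \<in> free_module V B \<Longrightarrow> finite (terms u)"
proof -
  assume u: "u \<in> free_module V B"
  have "terms u = Sigma {b. u b \<noteq> 0} (\<lambda>b. supp (u b))" by (auto simp: terms_def)
  then show ?thesis using free_moduleD(2)[OF u] by simp
qed

lemma terms_empty: "terms u = {} \<longleftrightarrow> u = 0"
proof
  assume "terms u = {}"
  then have "supp (u b) = {}" for b by (auto simp: terms_def)
  then show "u = 0" by (simp add: fun_eq_iff)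
qed (simp add: terms_def)

lemma lead_in: "u \<in> free_module V B \<Longrightarrow> u \<noteq> 0 \<Longrightarrow> lead u \<in> terms u"
  unfolding lead_def using finite_terms terms_empty by (intro Max_in) auto

lemma lead_ge: "u \<in> free_module V B \<Longrightarrow> p \<in> terms u \<Longrightarrow> p \<le> lead u"
  unfolding lead_def using finite_terms by (intro Max_ge) auto

lemma supp_single_mult: "supp (Poly_Mapping.single c k * f) \<subseteq> (\<lambda>m. c + m) ` supp (f :: 'k::field mpoly)"
  using keys_mult[of "Poly_Mapping.single c k" f] by (auto split: if_splits)

text \<open>One division step: k is the quotient of the leading coefficients, so the leading terms
  cancel, and all other terms are smaller.\<close>

lemma reduce_lead:
  fixes u g :: "nat \<Rightarrow> 'k::field mpoly"
  assumes u: "u \<in> free_module V B" "u \<noteq> 0" "lead u = (b, c + m)"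
    and g: "g \<in> free_module V B" "g \<noteq> 0" "lead g = (b, m)"
    and k: "k = coef (u b) (c + m) / coef (g b) m"
    and u': "u' = u - (\<lambda>b. Poly_Mapping.single c k * g b)"
    and p: "p \<in> terms u'"
  shows "p < lead u"
proof -
  obtain b' m' where p': "p = (b', m')" "m' \<in> supp (u' b')" using p by (auto simp: terms_def)
  have gm: "coef (g b) m \<noteq> 0" using lead_in[OF g(1,2)] g(3) by (auto simp: terms_def in_keys_iff)
  have "coef (u' b) (c + m) = 0"
    using gm by (simp add: u' lookup_minus coef_single_mult k)
  then have ne: "p \<noteq> lead u" using p' u(3) by (auto simp: in_keys_iff)
  have "supp (u' b') \<subseteq> supp (u b') \<union> supp (Poly_Mapping.single c k * g b')"
    by (auto simp: u' in_keys_iff lookup_minus)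
  then consider "m' \<in> supp (u b')" | "m' \<in> (\<lambda>m. c + m) ` supp (g b')"
    using p'(2) supp_single_mult[of c k "g b'"] by blast
  then have "p \<le> lead u"
  proof cases
    case 1
    then show ?thesis using p' by (intro lead_ge[OF u(1)]) (simp add: terms_def)
  next
    case 2
    then obtain m'' where m'': "m' = c + m''" "m'' \<in> supp (g b')" by blast
    then have "(b', m'') \<le> (b, m)" using lead_ge[OF g(1), of "(b', m'')"] g(3) by (simp add: terms_def)
    then have "(b', c + m'') \<le> (b, c + m)" by (auto simp: less_eq_prod_simp add_left_mono)
    then show ?thesis using p' m'' u(3) by simp
  qed
  then show ?thesis using ne by simp
qed

lemma terms_gF:
  assumes "u \<in> gF V B dg e" "(b, m) \<in> terms u"
  shows "b \<in> B" "supp m \<subseteq> V" "e = int (mdeg m + dg b)"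
proof -
  have m: "m \<in> supp (u b)" using assms(2) by (simp add: terms_def)
  then have "u b \<noteq> 0" by auto
  then show "b \<in> B" using free_moduleD(3)[OF gFD(1)[OF assms(1)]] by blast
  show "supp m \<subseteq> V" "e = int (mdeg m + dg b)"
    using gFD(2)[OF assms(1), of b] m by (auto simp: gr_def polys_def)
qed

text \<open>Elements whose leading terms are minimal for divisibility form a Groebner basis:
  Dickson's lemma makes it finite, division makes it generate.\<close>

theorem graded_submodule_fin_gen:
  fixes Z :: "(nat \<Rightarrow> 'k::field mpoly) set"
  assumes V: "finite V" and B: "finite B" and Z: "gsub V B dg Z"
  obtains n :: nat and g :: "nat \<Rightarrow> nat \<Rightarrow> 'k mpoly" and dd :: "nat \<Rightarrow> nat"
  where "\<And>i. i < n \<Longrightarrow> g i \<in> Z \<inter> gF V B dg (int (dd i))"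
    "\<And>e u. u \<in> Z \<inter> gF V B dg e \<Longrightarrow> \<exists>w\<in>gF V {..<n} dd e. u = free_map g w"
proof -
  define P where "P = {lead u | u e. u \<in> Z \<inter> gF V B dg e \<and> u \<noteq> 0}"
  define Min where "Min = {(b, m). (b, m) \<in> P \<and> (\<forall>m' c. (b, m') \<in> P \<longrightarrow> m = c + m' \<longrightarrow> m = m')}"
  have P: "b \<in> B \<and> supp m \<subseteq> V" if bmP: "(b, m) \<in> P" for b m
  proof -
    obtain u :: "nat \<Rightarrow> 'k mpoly" and e where u: "(b, m) = lead u" "u \<in> gF V B dg e" "u \<noteq> 0"
      using bmP unfolding P_def by blast
    show ?thesis using terms_gF(1,2)[OF u(2)] lead_in[OF gFD(1)[OF u(2)] u(3)] u(1) by metis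
  qed
  have "finite Min"
  proof (rule ccontr)
    assume "infinite Min"
    then obtain s :: "nat \<Rightarrow> _" where s: "inj s" "range s \<subseteq> Min"
      using infinite_countable_subset by blast
    have sM: "s n \<in> Min" for n using s(2) by blast
    have "(fst (s n), snd (s n)) \<in> P" for n using sM[of n] by (auto simp: Min_def)
    then have "fst (s n) \<in> B" "supp (snd (s n)) \<subseteq> V" for n
      using P by blast+
    then obtain i j c where ij: "i < j" "fst (s i) = fst (s j)" "snd (s j) = c + snd (s i)"
      using dickson[OF B V] by blast
    have "snd (s j) = snd (s i)" using sM[of i] sM[of j] ij(2,3) by (auto simp: Min_def split: prod.splits)
    then have "s i = s j" using ij(2) by (simp add: prod_eq_iff)
    then show False using s(1) ij(1) by (auto simp: inj_def)
  qed
  have ex_min: "\<exists>m' c. (b, m') \<in> Min \<and> m = c + m'" if "(b, m) \<in> P" for b m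
    using that
  proof (induction "mdeg m" arbitrary: m rule: less_induct)
    case less
    show ?case
    proof (cases "(b, m) \<in> Min")
      case True
      then show ?thesis by (intro exI[of _ m] exI[of _ 0]) simp
    next
      case False
      then obtain m' c where m': "(b, m') \<in> P" "m = c + m'" "m \<noteq> m'" using less.prems by (auto simp: Min_def)
      then have "mdeg m' < mdeg m" using mdeg_add[of c m'] mdeg_eq_0_iff[of c] by auto
      then obtain m'' c' where "(b, m'') \<in> Min" "m' = c' + m''" using less.hyps m'(1) by blast
      then show ?thesis using m'(2) by (intro exI[of _ m''] exI[of _ "c + c'"]) (simp add: add.assoc)
    qed
  qed
  have "\<forall>p\<in>Min. \<exists>u e. u \<in> Z \<inter> gF V B dg (int e) \<and> u \<noteq> 0 \<and> lead u = p"
  proof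
    fix p assume "p \<in> Min"
    then have "p \<in> P" by (auto simp: Min_def)
    then obtain u e where u: "u \<in> Z \<inter> gF V B dg e" "u \<noteq> 0" "lead u = p" by (auto simp: P_def)
    have "e = int (mdeg (snd p) + dg (fst p))"
      using terms_gF(3)[of u V B dg e "fst p" "snd p"] lead_in[of u V B] u by (auto dest: gFD(1))
    then show "\<exists>u e. u \<in> Z \<inter> gF V B dg (int e) \<and> u \<noteq> 0 \<and> lead u = p" using u by blast
  qed
  then obtain G E where G: "\<And>p. p \<in> Min \<Longrightarrow> G p \<in> Z \<inter> gF V B dg (int (E p)) \<and> G p \<noteq> 0 \<and> lead (G p) = p"
    by metis
  obtain h where h: "bij_betw h {..<card Min} Min"
    using ex_bij_betw_nat_finite[OF \<open>finite Min\<close>] by (auto simp: atLeast0LessThan)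
  define n where "n = card Min"
  have hM: "h i \<in> Min" if "i < n" for i using h that by (auto simp: bij_betw_def n_def)
  define g where "g = (\<lambda>i. G (h i))"
  define dd where "dd = (\<lambda>i. E (h i))"
  have gZ: "g i \<in> Z \<inter> gF V B dg (int (dd i))" if "i < n" for i
    using G[OF hM[OF that]] by (simp add: g_def dd_def)
  have "\<exists>w\<in>gF V {..<n} dd e. u = free_map g w" if "u \<in> Z \<inter> gF V B dg e" for u e
  proof -
    define Te where "Te = {(b, m). b \<in> B \<and> supp m \<subseteq> V \<and> e = int (mdeg m + dg b)}"
    have "Te \<subseteq> Sigma B (\<lambda>b. {m. supp m \<subseteq> V \<and> mdeg m = nat (e - int (dg b))})"
      by (auto simp: Te_def)
    then have Te: "finite Te"
      by (rule finite_subset) (intro finite_SigmaI B finite_monomials V)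
    have tT: "terms u \<subseteq> Te" if "u \<in> gF V B dg e" for u
      using terms_gF[OF that] by (fastforce simp: Te_def)
    \<comment> \<open>Termination is measured inside the finite set of terms of degree e, by
      counting those up to the leading term; the value 0 is reserved for u = 0.\<close>
    define rk where "rk = (\<lambda>u :: nat \<Rightarrow> 'k mpoly. if u = 0 then 0 else card {q \<in> Te. q \<le> lead u})"
    show ?thesis
      using that
    proof (induction "rk u" arbitrary: u rule: less_induct)
      case less
      have uF: "u \<in> gF V B dg e" and uZ: "u \<in> Z" using less.prems by auto
      show ?case
      proof (cases "u = 0")
        case True
        then show ?thesis by (intro bexI[of _ 0]) (simp_all add: free_map_zero gF_zero)
      next
        case False
        obtain b m where bm: "lead u = (b, m)" by force
        then have "(b, m) \<in> P" using less.prems False unfolding P_def by (metis (mono_tags, lifting) mem_Collect_eq)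
        then obtain m' c where m': "(b, m') \<in> Min" "m = c + m'" using ex_min by blast
        then obtain i where i: "i < n" "h i = (b, m')"
          using bij_betw_imp_surj_on[OF h] unfolding n_def by (metis imageE lessThan_iff)
        have gi: "g i \<in> Z" "g i \<in> gF V B dg (int (dd i))" "g i \<noteq> 0" "lead (g i) = (b, m')"
          using G[OF m'(1)] i by (auto simp: g_def dd_def)
        have bmu: "(b, m) \<in> terms u" using lead_in[OF gFD(1)[OF uF] False] bm by simp
        have bmg: "(b, m') \<in> terms (g i)" using lead_in[OF gFD(1)[OF gi(2)] gi(3)] gi(4) by simp
        define k where "k = coef (u b) (c + m') / coef (g i b) m'"
        define u' where "u' = u - (\<lambda>b. Poly_Mapping.single c k * g i b)"
        have "supp c \<subseteq> V" using terms_gF(2)[OF uF bmu] m'(2) by (simp add: supp_monom_add)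
        moreover have deg: "e = int (mdeg c) + int (dd i)"
          using terms_gF(3)[OF uF bmu] terms_gF(3)[OF gi(2) bmg] m'(2) by (simp add: mdeg_add)
        ultimately have s: "Poly_Mapping.single c k \<in> gr V (e - int (dd i))"
          by (simp add: gr_def polys_def)
        have u'F: "u' \<in> gF V B dg e"
          unfolding u'_def using gF_mult[OF s gi(2)] by (intro gF_diff[OF uF]) simp
        have u'Z: "u' \<in> Z"
          unfolding u'_def by (intro gsub_diff[OF Z uZ] gsubD(4)[OF Z] gr_polys[OF s] gi(1))
        have "rk u' < rk u"
        proof -
          have red: "p < lead u" if "p \<in> terms u'" for p
            using reduce_lead[OF gFD(1)[OF uF] False _ gFD(1)[OF gi(2)] gi(3,4) k_def u'_def that] bm m'(2) by simp
          have luT: "lead u \<in> Te" using bm bmu tT[OF uF] by auto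
          show ?thesis
          proof (cases "u' = 0")
            case True
            have "{q \<in> Te. q \<le> lead u} \<noteq> {}" using luT by blast
            then have "card {q \<in> Te. q \<le> lead u} > 0" using Te by (simp add: card_gt_0_iff)
            then show ?thesis using True False by (simp add: rk_def)
          next
            case u'0: False
            have "lead u' < lead u" using red lead_in[OF gFD(1)[OF u'F] u'0] by blast
            then have "{q \<in> Te. q \<le> lead u'} \<subseteq> {q \<in> Te. q \<le> lead u}" "\<not> lead u \<le> lead u'"
              by (blast intro: order.trans less_imp_le, simp add: not_le)
            then have "{q \<in> Te. q \<le> lead u'} \<subset> {q \<in> Te. q \<le> lead u}" using luT by blast
            then have "card {q \<in> Te. q \<le> lead u'} < card {q \<in> Te. q \<le> lead u}"
              using Te by (intro psubset_card_mono) auto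
            then show ?thesis using u'0 False by (simp add: rk_def)
          qed
        qed
        then obtain w where w: "w \<in> gF V {..<n} dd e" "u' = free_map g w" using less.hyps u'F u'Z by blast
        define w1 where "w1 = (\<lambda>j. if j = i then Poly_Mapping.single c k else 0)"
        have w1: "w1 \<in> gF V {..<n} dd e"
          using s i(1) gr_polys[OF s] by (auto simp: gF_def w1_def free_module_def)
        have "{b. w1 b \<noteq> 0} \<subseteq> {i}" by (auto simp: w1_def split: if_splits)
        then have "free_map g w1 b = Poly_Mapping.single c k * g i b" for b
          using free_map_superset[of "{i}" w1 g b] by (simp add: w1_def)
        then have "u = free_map g (w + w1)"
          using w(2) free_map_add[OF gFD(1)[OF w(1)] gFD(1)[OF w1], of g]
          by (simp add: u'_def fun_eq_iff algebra_simps)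
        then show ?thesis using gF_add[OF w(1) w1] by blast
      qed
    qed
  qed
  with gZ show ?thesis using that by blast
qed

text \<open>At the empty cell the boundary of a 1-chain is just the sum of the values of the X v on
  its entries.\<close>

lemma kd_cell_0:
  assumes "chn (length vs) 1 A \<theta>" "T \<in> cells (length vs) 0"
    "\<And>v a. v \<in> set vs \<Longrightarrow> a \<in> A \<Longrightarrow> X v a \<in> C" "0 \<in> C" "\<And>a b. a \<in> C \<Longrightarrow> b \<in> C \<Longrightarrow> a + b \<in> C"
  shows "kd X vs \<theta> T \<in> C"
  using assms(1-3)
proof (induction vs arbitrary: \<theta> T)
  case (Cons v vs)
  from Cons.prems(2) have "T \<in> cells (Suc (length vs)) 0" by simp
  then show ?case
  proof (cases rule: cells_cases)
    case (1 S)
    have c: "chn (length vs) 1 A (\<lambda>S. \<theta> (False # S))" "\<theta> (True # S) \<in> A"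
      using Cons.prems(1) 1 by (simp_all add: chn_def)
    have "kd X vs (\<lambda>S. \<theta> (False # S)) S \<in> C"
      by (rule Cons.IH[OF c(1) 1(2)]) (rule Cons.prems(3), simp)
    moreover have "X v (\<theta> (True # S)) \<in> C" by (rule Cons.prems(3)[OF _ c(2)]) simp
    ultimately show ?thesis using 1 assms(5) by simp
  qed simp
qed (simp add: assms(4))

lemma gF_mod:
  assumes "u \<in> gF V B dg e" "\<And>b. b \<in> B \<Longrightarrow> e \<noteq> int (dg b)"
  shows "coef (u b) 0 = 0"
proof (rule ccontr)
  assume "coef (u b) 0 \<noteq> 0"
  then have 0: "0 \<in> supp (u b)" by (simp add: in_keys_iff)
  then have "u b \<noteq> 0" by auto
  then have "b \<in> B" using free_moduleD(3)[OF gFD(1)[OF assms(1)]] by blast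
  moreover have "e = int (dg b)" using gFD(2)[OF assms(1), of b] 0 by (auto simp: gr_def)
  ultimately show False using assms(2) by blast
qed

text \<open>Constant terms occur only in the degrees of basis elements; in any other degree the free
  module consists of sums of x_v a_v.\<close>

lemma hzero_free_0:
  assumes "set vs = V" "\<And>b. b \<in> B \<Longrightarrow> e \<noteq> int (dg b)"
  shows "hzero xf vs (gF V B dg :: int \<Rightarrow> (nat \<Rightarrow> 'k::field mpoly) set) (\<lambda>_. {0}) 0 e"
proof (rule hzeroI)
  fix \<omega> :: "bool list \<Rightarrow> nat \<Rightarrow> 'k mpoly"
  assume \<omega>: "chn (length vs) 0 (gF V B dg e) \<omega>"
  define T where "T = replicate (length vs) False"
  have T: "T \<in> cells (length vs) 0" by (simp add: T_def replicate_False_cells)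
  then have w: "\<omega> T \<in> gF V B dg e" using \<omega> by (simp add: chn_def)
  have "coef (\<omega> T b) 0 = 0" for b by (rule gF_mod[OF w assms(2)])
  then obtain \<gamma> where "chn (length vs) 1 (gF V B dg (e - 1)) \<gamma>" "\<omega> T = kd xf vs \<gamma> T"
    using min_imp_boundary[OF assms(1) w _ T] by blast
  then show "\<exists>\<eta>. chn (length vs) (Suc 0) (gF V B dg (e - 1)) \<eta> \<and>
      chn (length vs) 0 {0} (\<lambda>T. \<omega> T - kd xf vs \<eta> T)"
    by (intro exI[of _ \<gamma>]) (simp add: chn_def cells_n_0 T_def)
qed

lemma gmod_gsub:
  fixes Z :: "(nat \<Rightarrow> 'k::field mpoly) set"
  assumes "gsub V B dg Z" "set vs \<subseteq> V"
  shows "gmod xf vs (\<lambda>e. Z \<inter> gF V B dg e)"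
proof (rule gmodI)
  have g: "gmod xf vs (gF V B dg :: int \<Rightarrow> (nat \<Rightarrow> 'k mpoly) set)" by (rule gmod_gF[OF assms(2)])
  show "0 \<in> Z \<inter> gF V B dg d" for d using gsubD(2)[OF assms(1)] by (simp add: gF_zero)
  show "a + b \<in> Z \<inter> gF V B dg d" if "a \<in> Z \<inter> gF V B dg d" "b \<in> Z \<inter> gF V B dg d" for d a b
    using that gsubD(3)[OF assms(1)] by (simp add: gF_add)
  show "- a \<in> Z \<inter> gF V B dg d" if "a \<in> Z \<inter> gF V B dg d" for d a
    using that gsub_uminus[OF assms(1)] by (simp add: gF_uminus)
  show "xf v a \<in> Z \<inter> gF V B dg (d + 1)" if "v \<in> set vs" "a \<in> Z \<inter> gF V B dg d" for d v a
    using that gsubD(4)[OF assms(1), of "var v" a] gmod_X[OF g, of v a d] assms(2) by (auto simp: xf_def)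
qed

lemma graded_map_gens:
  assumes "\<And>b. b \<in> B' \<Longrightarrow> g b \<in> Z \<inter> gF V B dg (int (dg' b))"
  shows "graded_map V B' dg' B dg g"
  using assms by (intro graded_mapI) auto

lemma free_map_gens_in:
  assumes "gsub V B dg Z" "\<And>b. b \<in> B' \<Longrightarrow> g b \<in> Z" "w \<in> free_module V B'"
  shows "free_map g w \<in> Z"
proof -
  have "free_map g w = (\<Sum>b\<in>{b. w b \<noteq> 0}. (\<lambda>c. w b * g b c))"
    by (simp add: fun_eq_iff free_map_def sum_fun_apply)
  also have "\<dots> \<in> Z"
    using free_moduleD(1,3)[OF assms(3)] by (intro gsub_sum[OF assms(1)] gsubD(4)[OF assms(1)] assms(2)) auto
  finally show ?thesis .
qed

lemma kd_free_map:
  fixes \<gamma> :: "bool list \<Rightarrow> nat \<Rightarrow> 'k::field mpoly"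
  assumes "set vs \<subseteq> V" "chn (length vs) (Suc i) (gF V B dg d) \<gamma>" "T \<in> cells (length vs) i"
  shows "free_map g (kd xf vs \<gamma> T) = kd xf vs (\<lambda>S. free_map g (\<gamma> S)) T"
proof (rule kd_hom_chn[where \<pi> = "free_map g", OF gmod_gF[OF assms(1)] _ _ assms(2,3)])
  show "free_map g (a + b) = free_map g a + free_map g b"
    if "a \<in> gF V B dg d" "b \<in> gF V B dg d" for a b :: "nat \<Rightarrow> 'k mpoly" and d
    using free_map_add[OF gFD(1)[OF that(1)] gFD(1)[OF that(2)]] .
  show "free_map g (xf v a) = xf v (free_map g a)" if "a \<in> gF V B dg d" for v d and a :: "nat \<Rightarrow> 'k mpoly"
    using free_map_mult[OF gFD(1)[OF that]] by (simp add: xf_def)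
qed

text \<open>H_0(Z) is Z modulo the variables times Z, so it lives in the degrees of generators, of
  which there are finitely many.\<close>

lemma eventually_generated:
  fixes Z :: "(nat \<Rightarrow> 'k::field mpoly) set"
  assumes "set vs = V" "finite B" "gsub V B dg Z"
  obtains t0 :: int where "\<And>e. e \<ge> t0 \<Longrightarrow> hzero xf vs (\<lambda>e. Z \<inter> gF V B dg e) (\<lambda>_. {0}) 0 e"
proof -
  have "finite V" using assms(1) by auto
  then obtain n g dd where gens: "\<And>i. i < n \<Longrightarrow> g i \<in> Z \<inter> gF V B dg (int (dd i))"
    "\<And>e u. u \<in> Z \<inter> gF V B dg e \<Longrightarrow> \<exists>w\<in>gF V {..<n} dd e. u = free_map g w"
    by (rule graded_submodule_fin_gen[OF _ assms(2,3)]) blast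
  have gm: "graded_map V {..<n} dd B dg g" using gens(1) by (intro graded_map_gens) auto
  define t0 where "t0 = int (Suc (\<Sum>i<n. dd i))"
  have "hzero xf vs (\<lambda>e. Z \<inter> gF V B dg e) (\<lambda>_. {0}) 0 e" if "e \<ge> t0" for e
  proof (rule hzeroI)
    fix \<omega> assume \<omega>: "chn (length vs) 0 (Z \<inter> gF V B dg e) \<omega>"
    define T where "T = replicate (length vs) False"
    have T: "T \<in> cells (length vs) 0" by (simp add: T_def replicate_False_cells)
    then have "\<omega> T \<in> Z \<inter> gF V B dg e" using \<omega> by (simp add: chn_def)
    then obtain w where w: "w \<in> gF V {..<n} dd e" "\<omega> T = free_map g w" using gens(2) by blast
    have "e \<noteq> int (dd b)" if "b \<in> {..<n}" for b
    proof -
      have "dd b \<le> (\<Sum>i<n. dd i)" using that by (intro member_le_sum) auto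
      then have "int (dd b) < t0" unfolding t0_def by (simp only: of_nat_less_iff)
      then show ?thesis using \<open>e \<ge> t0\<close> by simp
    qed
    then have "coef (w b) 0 = 0" for b by (rule gF_mod[OF w(1)])
    then obtain \<gamma> where \<gamma>: "chn (length vs) 1 (gF V {..<n} dd (e - 1)) \<gamma>" "w = kd xf vs \<gamma> T"
      using min_imp_boundary[OF assms(1) w(1) _ T] by blast
    have "chn (length vs) (Suc 0) (Z \<inter> gF V B dg (e - 1)) (\<lambda>S. free_map g (\<gamma> S))"
      unfolding chn_def
    proof
      fix S assume "S \<in> cells (length vs) (Suc 0)"
      then have S: "\<gamma> S \<in> gF V {..<n} dd (e - 1)" using \<gamma>(1) by (simp add: chn_def)
      have "free_map g (\<gamma> S) \<in> Z"
        using gens(1) by (intro free_map_gens_in[OF assms(3) _ gFD(1)[OF S]]) auto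
      then show "free_map g (\<gamma> S) \<in> Z \<inter> gF V B dg (e - 1)" using free_map_gF[OF gm S] by simp
    qed
    moreover have "free_map g (kd xf vs \<gamma> T) = kd xf vs (\<lambda>S. free_map g (\<gamma> S)) T"
      using \<gamma>(1) T assms(1) by (intro kd_free_map[of vs V 0 "{..<n}" dd "e - 1"]) simp_all
    ultimately show "\<exists>\<eta>. chn (length vs) (Suc 0) (Z \<inter> gF V B dg (e - 1)) \<eta> \<and>
        chn (length vs) 0 {0} (\<lambda>T. \<omega> T - kd xf vs \<eta> T)"
      using w(2) \<gamma>(2) by (intro exI[of _ "\<lambda>S. free_map g (\<gamma> S)"]) (simp add: chn_def cells_n_0 T_def)
  qed
  then show ?thesis by (rule that)
qed

section \<open>Resolutions with generators in prescribed degrees\<close>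

text \<open>Coefficient degree e in H_k is total degree k + e. So the condition bounds a resolution
  of Z: for k < r, step k needs generators only in degrees below s + k.\<close>

definition lin :: "nat set \<Rightarrow> nat list \<Rightarrow> nat set \<Rightarrow> (nat \<Rightarrow> nat) \<Rightarrow> nat \<Rightarrow> nat \<Rightarrow> (nat \<Rightarrow> 'k::field mpoly) set \<Rightarrow> bool" where
  "lin V vs B dg r s Z \<longleftrightarrow>
     (\<forall>k<r. \<forall>e\<ge>int s. hzero xf vs (\<lambda>e. Z \<inter> gF V B dg e) (\<lambda>_. {0}) k e)"

text \<open>Graded Nakayama: no new generators are needed where H_0(Z) vanishes. For r = 0 nothing
  is known about H_0, and all generators are kept.\<close>

lemma gens_bounded:
  fixes Z :: "(nat \<Rightarrow> 'k::field mpoly) set"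
  assumes "set vs = V" "finite B" "gsub V B dg Z" "lin V vs B dg r s Z"
  obtains B' dg' and g :: "nat \<Rightarrow> nat \<Rightarrow> 'k mpoly"
  where "finite B'" "\<And>b. b \<in> B' \<Longrightarrow> g b \<in> Z \<inter> gF V B dg (int (dg' b))"
    "\<And>b. 0 < r \<Longrightarrow> b \<in> B' \<Longrightarrow> dg' b < s"
    "\<And>e u. u \<in> Z \<inter> gF V B dg e \<Longrightarrow> \<exists>w\<in>gF V B' dg' e. u = free_map g w"
proof -
  have "finite V" using assms(1) by auto
  then obtain n g dd where gens: "\<And>i. i < n \<Longrightarrow> g i \<in> Z \<inter> gF V B dg (int (dd i))"
    "\<And>e u. u \<in> Z \<inter> gF V B dg e \<Longrightarrow> \<exists>w\<in>gF V {..<n} dd e. u = free_map g w"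
    by (rule graded_submodule_fin_gen[OF _ assms(2,3)]) blast
  show ?thesis
  proof (cases "r = 0")
    case True
    show ?thesis
      by (rule that[of "{..<n}" g dd]) (use gens True in auto)
  next
    case False
    define B' where "B' = {b. b < n \<and> dd b < s}"
    have low: "\<exists>w\<in>gF V B' dd e. u = free_map g w" if u: "u \<in> Z \<inter> gF V B dg e" "e < int s" for u e
    proof -
      obtain w where w: "w \<in> gF V {..<n} dd e" "u = free_map g w" using gens(2)[OF u(1)] by blast
      have "w b = 0" if "b \<notin> B'" for b
      proof (cases "b < n")
        case True
        then have "e - int (dd b) < 0" using that u(2) by (simp add: B'_def)
        then show ?thesis using gFD(2)[OF w(1), of b] gr_neg by blast
      next
        case False
        then show ?thesis using free_moduleD(3)[OF gFD(1)[OF w(1)], of b] by auto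
      qed
      then have "w \<in> gF V B' dd e" using w(1) by (auto simp: gF_def free_module_def)
      then show ?thesis using w(2) by blast
    qed
    have gZ: "g b \<in> Z \<inter> gF V B dg (int (dd b))" if "b \<in> B'" for b using gens(1) that by (simp add: B'_def)
    have gm: "graded_map V B' dd B dg g" using gZ by (rule graded_map_gens)
    \<comment> \<open>Induction upwards from degree s - 1: beyond it, u is a sum of x_v a_v with a_v
      in Z of one degree less.\<close>
    have all: "\<exists>w\<in>gF V B' dd (int s - 1 + int k). u = free_map g w"
      if "u \<in> Z \<inter> gF V B dg (int s - 1 + int k)" for u k
      using that
    proof (induction k arbitrary: u)
      case 0
      then show ?case using low[of u "int s - 1"] by simp
    next
      case (Suc k)
      let ?e = "int s - 1 + int (Suc k)"
      let ?Q = "\<lambda>e. free_map g ` gF V B' dd e"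
      define T where "T = replicate (length vs) False"
      have T: "T \<in> cells (length vs) 0" by (simp add: T_def replicate_False_cells)
      have "hzero xf vs (\<lambda>e. Z \<inter> gF V B dg e) (\<lambda>_. {0}) 0 ?e"
        using assms(4) False by (simp add: lin_def)
      moreover have "chn (length vs) 0 (Z \<inter> gF V B dg ?e) (\<lambda>_. u)" using Suc.prems by (simp add: chn_def)
      ultimately obtain \<eta> where \<eta>: "chn (length vs) (Suc 0) (Z \<inter> gF V B dg (?e - 1)) \<eta>"
        "chn (length vs) 0 {0} (\<lambda>T. u - kd xf vs \<eta> T)"
        by (rule hzeroD[OF _ _ cyc_0])
      have e1: "?e - 1 = int s - 1 + int k" by simp
      have "chn (length vs) 1 (?Q (?e - 1)) \<eta>"
        unfolding chn_def
      proof
        fix S assume "S \<in> cells (length vs) 1"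
        then have "\<eta> S \<in> Z \<inter> gF V B dg (?e - 1)" using \<eta>(1) by (simp add: chn_def)
        then show "\<eta> S \<in> ?Q (?e - 1)" unfolding e1 using Suc.IH by blast
      qed
      then have "kd xf vs \<eta> T \<in> ?Q ?e"
      proof (rule kd_cell_0[OF _ T])
        show "0 \<in> ?Q ?e" using gF_zero free_map_zero by (metis image_eqI)
        show "a + b \<in> ?Q ?e" if ab: "a \<in> ?Q ?e" "b \<in> ?Q ?e" for a b
        proof -
          obtain x y where xy: "x \<in> gF V B' dd ?e" "y \<in> gF V B' dd ?e" "a = free_map g x" "b = free_map g y"
            using ab by blast
          have "a + b = free_map g (x + y)"
            unfolding xy(3,4) by (rule free_map_add[symmetric, OF gFD(1)[OF xy(1)] gFD(1)[OF xy(2)]])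
          then show ?thesis using gF_add[OF xy(1,2)] by blast
        qed
        show "xf v a \<in> ?Q ?e" if v: "v \<in> set vs" and a: "a \<in> ?Q (?e - 1)" for v a
        proof -
          obtain x where x: "x \<in> gF V B' dd (?e - 1)" "a = free_map g x" using a by blast
          have "xf v x \<in> gF V B' dd (?e - 1 + 1)"
            using gmod_X[OF gmod_gF[of vs V] v x(1)] assms(1) by simp
          moreover have "xf v a = free_map g (xf v x)"
            using free_map_mult[OF gFD(1)[OF x(1)], of g "var v"] x(2) by (simp add: xf_def)
          ultimately show ?thesis by (metis diff_add_cancel image_eqI)
        qed
      qed
      moreover have "u = kd xf vs \<eta> T" using \<eta>(2) T by (simp add: chn_def)
      ultimately show ?case by blast
    qed
    show ?thesis
    proof (rule that[of B' g dd])
      show "finite B'" by (simp add: B'_def)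
      show "dd b < s" if "b \<in> B'" for b using that by (simp add: B'_def)
      show "\<exists>w\<in>gF V B' dd e. u = free_map g w" if u: "u \<in> Z \<inter> gF V B dg e" for e u
      proof (cases "e < int s")
        case False
        then have "e = int s - 1 + int (nat (e - int s + 1))" by simp
        then show ?thesis using all[of u "nat (e - int s + 1)"] u by simp
      qed (use low u in blast)
    qed (use gZ in auto)
  qed
qed

lemma gsub_kernel:
  assumes gm: "graded_map V B' dg' B dg g"
  shows "gsub V B' dg' {w \<in> free_module V B'. free_map g w = 0}"
  unfolding gsub_def
proof (intro conjI ballI allI)
  show "0 \<in> {w \<in> free_module V B'. free_map g w = 0}" by (simp add: free_module_zero free_map_zero)
  show "u + w \<in> {w \<in> free_module V B'. free_map g w = 0}"
    if "u \<in> {w \<in> free_module V B'. free_map g w = 0}" "w \<in> {w \<in> free_module V B'. free_map g w = 0}" for u w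
    using that free_map_add[of u V B' w B' g] by (simp add: free_module_add)
  show "(\<lambda>b. r * u b) \<in> {w \<in> free_module V B'. free_map g w = 0}"
    if "r \<in> polys V" "u \<in> {w \<in> free_module V B'. free_map g w = 0}" for r u
    using that free_map_mult[of u V B' g r] by (simp add: free_module_mult zero_fun_def)
  show "hcF dg' e u \<in> {w \<in> free_module V B'. free_map g w = 0}"
    if "u \<in> {w \<in> free_module V B'. free_map g w = 0}" for u e
    using that hcF_free_map[OF gm, of u e] gFD(1)[OF hcF_gF[of u V B' dg' e]]
    by (simp add: hcF_def zero_fun_def)
qed simp

text \<open>For 0 -> K -> F -> Z -> 0, the vanishing of H_{k+1}(Z) in degree e - 1 and of H_k(F) in
  degree e give that of H_k(K) in degree e. For k = 0 the second holds because the generators have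
  degree below s.\<close>

lemma resolution_step:
  fixes Z :: "(nat \<Rightarrow> 'k::field mpoly) set"
  assumes vs: "distinct vs" "set vs = V" and B: "finite B" "gsub V B dg Z" and lin: "lin V vs B dg r s Z"
  obtains B' dg' and g :: "nat \<Rightarrow> nat \<Rightarrow> 'k mpoly"
  where "finite B'" "graded_map V B' dg' B dg g" "\<And>b. 0 < r \<Longrightarrow> b \<in> B' \<Longrightarrow> dg' b < s"
    "free_map g ` free_module V B' = Z"
    "gsub V B' dg' {w \<in> free_module V B'. free_map g w = 0}"
    "lin V vs B' dg' (r - 1) (Suc s) {w \<in> free_module V B'. free_map g w = 0}"
proof -
  obtain B' dg' and g :: "nat \<Rightarrow> nat \<Rightarrow> 'k mpoly" where g: "finite B'" "\<And>b. b \<in> B' \<Longrightarrow> g b \<in> Z \<inter> gF V B dg (int (dg' b))"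
    "\<And>b. 0 < r \<Longrightarrow> b \<in> B' \<Longrightarrow> dg' b < s"
    "\<And>e u. u \<in> Z \<inter> gF V B dg e \<Longrightarrow> \<exists>w\<in>gF V B' dg' e. u = free_map g w"
    by (rule gens_bounded[OF vs(2) B lin]) blast
  have gm: "graded_map V B' dg' B dg g" using g(2) by (rule graded_map_gens)
  let ?K = "{w \<in> free_module V B'. free_map g w = 0}"
  note K = gsub_kernel[OF gm]
  have onto: "free_map g ` free_module V B' = Z"
  proof
    show "free_map g ` free_module V B' \<subseteq> Z"
      using free_map_gens_in[OF B(2), of B' g] g(2) by blast
    show "Z \<subseteq> free_map g ` free_module V B'"
    proof
      fix u assume u: "u \<in> Z"
      then have uF: "u \<in> free_module V B" using gsubD(1)[OF B(2)] by blast
      obtain D where D: "finite D" "u = (\<Sum>e\<in>D. hcF dg e u)" using sum_hcF[OF uF] .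
      have "\<exists>w\<in>free_module V B'. hcF dg e u = free_map g w" for e
        using g(4)[of "hcF dg e u" e] gsubD(5)[OF B(2) u] hcF_gF[OF uF] gFD(1) by blast
      then obtain w where w: "\<And>e. w e \<in> free_module V B'" "\<And>e. hcF dg e u = free_map g (w e)"
        by metis
      have "(\<Sum>e\<in>E. hcF dg e u) = free_map g (\<Sum>e\<in>E. w e)" if "finite E" for E
        using that
      proof induction
        case (insert e E)
        have S: "(\<Sum>e\<in>E. w e) \<in> free_module V B'" by (intro free_module_sum w(1))
        show ?case
          by (simp only: sum.insert[OF insert.hyps] insert.IH free_map_add[OF w(1) S]) (simp only: w(2))
      qed (simp only: sum.empty free_map_zero)
      then have "u = free_map g (\<Sum>e\<in>D. w e)" using D by metis
      moreover have "(\<Sum>e\<in>D. w e) \<in> free_module V B'" by (intro free_module_sum w(1))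
      ultimately show "u \<in> free_map g ` free_module V B'" by blast
    qed
  qed
  interpret pres: graded_presentation xf xf vs "gF V B' dg'" "\<lambda>e. Z \<inter> gF V B dg e" "\<lambda>_. {0}" "free_map g"
  proof
    show "ops (xf :: nat \<Rightarrow> (nat \<Rightarrow> 'k mpoly) \<Rightarrow> nat \<Rightarrow> 'k mpoly)" by (rule ops_xf)
    show "gmod xf vs (gF V B' dg' :: int \<Rightarrow> (nat \<Rightarrow> 'k mpoly) set)" using vs(2) by (intro gmod_gF) simp
    show "gmod xf vs (\<lambda>e. Z \<inter> gF V B dg e)" using vs(2) by (intro gmod_gsub[OF B(2)]) simp
    show "gmod xf vs (\<lambda>_. {0 :: nat \<Rightarrow> 'k mpoly})" by (rule gmod_zero_module[OF ops_xf])
    show "free_map g (u + w) = free_map g u + free_map g w"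
      if "u \<in> gF V B' dg' e" "w \<in> gF V B' dg' e" for u w e
      using free_map_add[OF gFD(1)[OF that(1)] gFD(1)[OF that(2)]] .
    show "free_map g (xf v u) = xf v (free_map g u)" if "u \<in> gF V B' dg' e" for v u e
      using free_map_mult[OF gFD(1)[OF that]] by (simp add: xf_def)
    show "free_map g u \<in> Z \<inter> gF V B dg e" if "u \<in> gF V B' dg' e" for u e
      using free_map_gF[OF gm that] free_map_gens_in[OF B(2) _ gFD(1)[OF that], of g] g(2) by auto
    show "\<exists>u\<in>gF V B' dg' e. z - free_map g u \<in> {0}" if "z \<in> Z \<inter> gF V B dg e" for z e
      using g(4)[OF that] by auto
  qed
  have Zeq: "pres.Z = (\<lambda>e. ?K \<inter> gF V B' dg' e)"
  proof
    fix e
    show "pres.Z e = ?K \<inter> gF V B' dg' e" unfolding pres.Z_def using gFD(1) by blast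
  qed
  have "lin V vs B' dg' (r - 1) (Suc s) ?K"
    unfolding lin_def
  proof (intro allI impI)
    fix k e assume k: "k < r - 1" and e: "int (Suc s) \<le> e"
    have "hzero xf vs pres.Z (\<lambda>_. {0}) k e"
    proof (rule hzeroI_snake[OF pres.Z_subset])
      show "snake xf vs (gF V B' dg') pres.Z k (e - 1)"
        using lin k e by (intro pres.snake_Z) (simp add: lin_def)
      show "hzero xf vs (gF V B' dg' :: int \<Rightarrow> (nat \<Rightarrow> 'k mpoly) set) (\<lambda>_. {0}) k e"
      proof (cases k)
        case (Suc j)
        then show ?thesis using vs by (simp add: hzero_free)
      next
        case 0
        have "0 < r" using k by simp
        then have "e \<noteq> int (dg' b)" if "b \<in> B'" for b using g(3)[OF _ that] e by auto
        then show ?thesis unfolding 0 by (rule hzero_free_0[OF vs(2)])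
      qed
    qed
    then show "hzero xf vs (\<lambda>e. ?K \<inter> gF V B' dg' e) (\<lambda>_. {0}) k e" by (simp only: Zeq)
  qed
  from that[OF g(1) gm g(3) onto K this] show ?thesis .
qed

text \<open>One resolution suffices. In the one constructed here, F_i with i < p has generators of
  degree at most i + 1 only, hence none in degree i + j.\<close>

lemma tor_vanishes_of_koszul:
  fixes J :: "'k::field mpoly set"
  assumes vs: "distinct vs" "set vs = V" and J: "hom_ideal V J"
    and kos: "\<And>k e. k < p \<Longrightarrow> 2 \<le> e \<Longrightarrow> hzero xv vs (gr V) (igr V J) k e"
    and i: "i < p" "2 \<le> j"
  shows "tor_vanishes V J i (i + j)"
proof -
  note J' = is_idealD[OF hom_idealD(1)[OF J]]
  define Z0 where "Z0 = {u \<in> free_module V {0}. u 0 \<in> J}"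
  define dg0 :: "nat \<Rightarrow> nat" where "dg0 = (\<lambda>_. 0)"
  have g0: "gsub V {0} dg0 Z0"
    unfolding gsub_def
  proof (intro conjI ballI allI)
    show "Z0 \<subseteq> free_module V {0}" "0 \<in> Z0" using J'(2) by (auto simp: Z0_def free_module_zero)
    show "u + w \<in> Z0" if "u \<in> Z0" "w \<in> Z0" for u w
      using that J'(3) by (simp add: Z0_def free_module_add)
    show "(\<lambda>b. r * u b) \<in> Z0" if "r \<in> polys V" "u \<in> Z0" for r u
      using that J'(4) by (simp add: Z0_def free_module_mult)
    show "hcF dg0 e u \<in> Z0" if "u \<in> Z0" for u e
    proof -
      have u: "u \<in> free_module V {0}" "u 0 \<in> J" using that by (simp_all add: Z0_def)
      then show ?thesis
        using gFD(1)[OF hcF_gF[OF u(1), of dg0 e]] hom_idealD(2)[OF J u(2), of e]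
        by (simp add: Z0_def hcF_def dg0_def)
    qed
  qed
  interpret pres: graded_presentation xf xv vs "gF V {0} dg0" "gr V" "igr V J" "\<lambda>u. u 0"
  proof
    show "ops (xf :: nat \<Rightarrow> (nat \<Rightarrow> 'k mpoly) \<Rightarrow> nat \<Rightarrow> 'k mpoly)" by (rule ops_xf)
    show "ops (xv :: nat \<Rightarrow> 'k mpoly \<Rightarrow> 'k mpoly)" by (rule ops_xv)
    show "gmod xf vs (gF V {0} dg0 :: int \<Rightarrow> (nat \<Rightarrow> 'k mpoly) set)" using vs(2) by (intro gmod_gF) simp
    show "gmod xv vs (gr V :: int \<Rightarrow> 'k mpoly set)" using vs(2) by (intro gmod_gr) simp
    show "gmod xv vs (igr V J)" using vs(2) by (intro gmod_igr hom_idealD(1)[OF J]) simp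
    show "(u + w) 0 = u 0 + w 0" for u w :: "nat \<Rightarrow> 'k mpoly" by simp
    show "xf v u 0 = xv v (u 0)" for v and u :: "nat \<Rightarrow> 'k mpoly" by (simp add: xf_apply)
    show "u 0 \<in> gr V e" if "u \<in> gF V {0} dg0 e" for u e
      using gFD(2)[OF that, of 0] by (simp add: dg0_def)
    show "\<exists>u\<in>gF V {0} dg0 e. f - u 0 \<in> igr V J e" if f: "f \<in> gr V e" for f e
      using f J'(2) gr_polys[OF f]
      by (intro bexI[of _ "\<lambda>b. if b = 0 then f else 0"]) (auto simp: gF_def free_module_def dg0_def)
  qed
  have pZ: "pres.Z = (\<lambda>e. Z0 \<inter> gF V {0} dg0 e)"
  proof
    fix e
    show "pres.Z e = Z0 \<inter> gF V {0} dg0 e"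
      unfolding pres.Z_def Z0_def using gFD(1) pres.pi_C by blast
  qed
  \<comment> \<open>J is the first syzygy module of the quotient by J: H_{k+1} of the quotient in
    degree e - 1 controls H_k(J) in degree e. So p becomes p - 1, and 2 becomes 3.\<close>
  have lin0: "lin V vs {0} dg0 (p - 1) 3 Z0"
    unfolding lin_def
  proof (intro allI impI)
    fix k e assume k: "k < p - 1" and e: "int 3 \<le> e"
    have "hzero xf vs pres.Z (\<lambda>_. {0}) k e"
    proof (rule hzeroI_snake[OF pres.Z_subset])
      show "snake xf vs (gF V {0} dg0) pres.Z k (e - 1)"
        using k e by (intro pres.snake_Z kos) auto
      show "hzero xf vs (gF V {0} dg0 :: int \<Rightarrow> (nat \<Rightarrow> 'k mpoly) set) (\<lambda>_. {0}) k e"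
      proof (cases k)
        case 0
        show ?thesis unfolding 0 using e by (intro hzero_free_0[OF vs(2)]) (simp add: dg0_def)
      next
        case (Suc l)
        then show ?thesis using vs by (simp add: hzero_free)
      qed
    qed
    then show "hzero xf vs (\<lambda>e. Z0 \<inter> gF V {0} dg0 e) (\<lambda>_. {0}) k e" by (simp only: pZ)
  qed
  define P :: "nat \<Rightarrow> nat set \<times> (nat \<Rightarrow> nat) \<times> (nat \<Rightarrow> 'k mpoly) set \<Rightarrow> bool" where
    "P = (\<lambda>n (B, dg, Z). (n = 0 \<longrightarrow> (B, dg, Z) = ({0}, dg0, Z0)) \<and> finite B \<and> gsub V B dg Z \<and>
       lin V vs B dg (p - 1 - n) (3 + n) Z)"
  define Q :: "nat \<Rightarrow> nat set \<times> (nat \<Rightarrow> nat) \<times> (nat \<Rightarrow> 'k mpoly) set \<Rightarrow>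
      nat set \<times> (nat \<Rightarrow> nat) \<times> (nat \<Rightarrow> 'k mpoly) set \<Rightarrow> (nat \<Rightarrow> nat \<Rightarrow> 'k mpoly) \<Rightarrow> bool" where
    "Q = (\<lambda>n (B, dg, Z) (B', dg', Z') g. graded_map V B' dg' B dg g \<and> free_map g ` free_module V B' = Z \<and>
       Z' = {w \<in> free_module V B'. free_map g w = 0} \<and> (n < p - 1 \<longrightarrow> (\<forall>b\<in>B'. dg' b < 3 + n)))"
  \<comment> \<open>Dependent choice: a state is a free module with a graded submodule still to be
    resolved; a transition chooses generators of the submodule and passes to their
    relations.\<close>
  have "\<exists>f. \<forall>n. P n (f n) \<and> (\<exists>g. Q n (f n) (f (Suc n)) g)"
  proof (rule dependent_nat_choice)
    show "\<exists>x. P 0 x" using g0 lin0 by (intro exI[of _ "({0}, dg0, Z0)"]) (simp add: P_def)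
    show "\<exists>y. P (Suc n) y \<and> (\<exists>g. Q n x y g)" if "P n x" for x n
    proof -
      obtain B dg Z where x: "x = (B, dg, Z)" by (cases x) auto
      then have h: "finite B" "gsub V B dg Z" "lin V vs B dg (p - 1 - n) (3 + n) Z"
        using that by (simp_all add: P_def)
      obtain B' dg' g where g: "finite B'" "graded_map V B' dg' B dg g"
        "\<And>b. 0 < p - 1 - n \<Longrightarrow> b \<in> B' \<Longrightarrow> dg' b < 3 + n" "free_map g ` free_module V B' = Z"
        "gsub V B' dg' {w \<in> free_module V B'. free_map g w = 0}"
        "lin V vs B' dg' (p - 1 - n - 1) (Suc (3 + n)) {w \<in> free_module V B'. free_map g w = 0}"
        by (rule resolution_step[OF vs h]) blast
      have "p - 1 - Suc n = p - 1 - n - 1" "3 + Suc n = Suc (3 + n)" by simp_all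
      with g(6) have "lin V vs B' dg' (p - 1 - Suc n) (3 + Suc n) {w \<in> free_module V B'. free_map g w = 0}"
        by simp
      then have "P (Suc n) (B', dg', {w \<in> free_module V B'. free_map g w = 0})"
        using g(1,5) by (simp add: P_def)
      moreover have "Q n x (B', dg', {w \<in> free_module V B'. free_map g w = 0}) g"
        using g(2,3,4) x by (simp add: Q_def)
      ultimately show ?thesis by blast
    qed
  qed
  then obtain f M where f: "\<And>n. P n (f n)" "\<And>n. Q n (f n) (f (Suc n)) (M n)" by metis
  define B where "B = (\<lambda>n. fst (f n))"
  define d where "d = (\<lambda>n. fst (snd (f n)))"
  define Z where "Z = (\<lambda>n. snd (snd (f n)))"
  have fn: "f n = (B n, d n, Z n)" for n by (simp add: B_def d_def Z_def)
  have f0: "B 0 = {0}" "d 0 = dg0" "Z 0 = Z0"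
    using f(1)[of 0] fn[of 0] by (simp_all add: P_def)
  have gm: "graded_map V (B (Suc n)) (d (Suc n)) (B n) (d n) (M n)"
    and onto: "free_map (M n) ` free_module V (B (Suc n)) = Z n"
    and ker: "Z (Suc n) = {w \<in> free_module V (B (Suc n)). free_map (M n) w = 0}"
    and low: "n < p - 1 \<Longrightarrow> b \<in> B (Suc n) \<Longrightarrow> d (Suc n) b < 3 + n" for n b
    using f(2)[of n] by (simp_all add: Q_def fn)
  have augm: "(\<Sum>b\<in>{b. u b \<noteq> 0}. u b * 1) = u 0" if "u \<in> free_module V {0}" for u :: "nat \<Rightarrow> 'k mpoly"
  proof -
    have "(\<Sum>b\<in>{b. u b \<noteq> 0}. u b * 1) = (\<Sum>b\<in>{0}. u b * 1)"
      using that by (intro sum.mono_neutral_left) (auto simp: free_module_def)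
    then show ?thesis by simp
  qed
  have res: "graded_free_resolution V J B d M (\<lambda>_. 1)"
    unfolding graded_free_resolution_def
  proof (intro conjI ballI allI)
    have "(1 :: 'k mpoly) \<in> gr V (int 0)" using gr_const[of "1 :: 'k" V] by simp
    then show "(1 :: 'k mpoly) \<in> forms V (d 0 b)" for b
      unfolding gr_of_nat by (simp add: f0 dg0_def)
    show "graded_map V (B (Suc n)) (d (Suc n)) (B n) (d n) (M n)" for n by (rule gm)
    show "\<exists>u\<in>free_module V (B 0). h - (\<Sum>b\<in>{b. u b \<noteq> 0}. u b * 1) \<in> J" if h: "h \<in> polys V" for h
    proof -
      have u: "(\<lambda>b. if b = 0 then h else 0) \<in> free_module V {0 :: nat}" 
        using h by (auto simp: free_module_def split: if_splits)
      show ?thesis unfolding f0(1)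
        by (rule bexI[OF _ u], subst augm[OF u]) (simp add: J'(2))
    qed
    show "{u \<in> free_module V (B 0). (\<Sum>b\<in>{b. u b \<noteq> 0}. u b * 1) \<in> J} = free_map (M 0) ` free_module V (B 1)"
      using onto[of 0] augm by (auto simp: f0 Z0_def)
    show "{u \<in> free_module V (B (Suc n)). free_map (M n) u = (\<lambda>_. 0)} =
        free_map (M (Suc n)) ` free_module V (B (Suc (Suc n)))" for n
      using onto[of "Suc n"] ker[of n] by (simp add: zero_fun_def)
  qed
  have nodeg: "d i b \<noteq> i + j" if "b \<in> B i" for b
  proof (cases i)
    case 0
    then show ?thesis using i(2) by (simp add: f0 dg0_def)
  next
    case (Suc n)
    then have "n < p - 1" using i(1) by simp
    then show ?thesis using low[of n b] that i(2) Suc by auto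
  qed
  then have strand0: "strand B d i (i + j) = {\<lambda>_. 0 :: 'k}"
    by (auto simp: strand_def fun_eq_iff)
  have "tor_cycles B d M i (i + j) = {\<lambda>_. 0}"
    unfolding tor_cycles_def strand0 by (cases i) (auto simp: free_map_def)
  moreover have "tor_boundaries B d M i (i + j) = {\<lambda>_. 0}"
  proof -
    \<comment> \<open>F_{i+1} may well have generators in degree i + j, but a nonzero constant entry
      of \<open>M i\<close> would need a generator of F_i in that same degree.\<close>
    have "free_map (mod_vars (M i)) t = (\<lambda>_. 0)" if t: "t \<in> strand B d (Suc i) (i + j)" for t
    proof
      fix c
      have "mod_vars (M i) b c = 0" if b: "t b \<noteq> 0" for b
      proof (rule ccontr)
        assume "mod_vars (M i) b c \<noteq> 0"
        then have 0: "0 \<in> supp (M i b c)" by (simp add: mod_vars_def in_keys_iff)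
        have bB: "b \<in> B (Suc i)" "d (Suc i) b = i + j" using t b by (auto simp: strand_def)
        have "d i c = i + j" using graded_mapD(2)[OF gm bB(1), of c] 0 bB(2) by (auto simp: gr_def)
        moreover have "c \<in> B i"
          by (rule free_moduleD(3)[OF graded_mapD(1)[OF gm bB(1)]]) (use 0 in auto)
        ultimately show False using nodeg by blast
      qed
      then show "free_map (mod_vars (M i)) t c = 0" by (simp add: free_map_def)
    qed
    moreover have "(\<lambda>_. 0) \<in> strand B d (Suc i) (i + j)" by (simp add: strand_def)
    ultimately show ?thesis unfolding tor_boundaries_def by (auto intro: rev_image_eqI)
  qed
  ultimately show ?thesis using res unfolding tor_vanishes_def by blast
qed

section \<open>Koszul homology in large degrees\<close>

lemma kd_hc: "kd xv vs (\<lambda>S. hc e (\<omega> S)) T = hc (e + 1) (kd xv vs \<omega> T)"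
  if "T \<in> cells (length vs) i" for \<omega> :: "bool list \<Rightarrow> 'k::field mpoly"
  using that
proof (induction vs arbitrary: \<omega> T i)
  case (Cons v vs)
  have v: "hc (e + 1) (xv v f) = xv v (hc e f)" for f :: "'k mpoly"
    using hc_mult[of "var v" UNIV 1 "e + 1" f] by (simp add: xv_def)
  have u: "hc d (- f) = - hc d f" for d and f :: "'k mpoly"
    using hc_diff[of d 0 f] by simp
  from Cons.prems have "T \<in> cells (Suc (length vs)) i" by simp
  then show ?case
    by (cases rule: cells_cases) (simp_all add: Cons.IH hc_add u v)
qed simp

text \<open>The k-cycles modulo J form a finitely generated module, so in large degree each is a sum
  of variables times cycles, and \<open>kd_wedge\<close> makes such a sum a boundary modulo
  J.\<close>

lemma koszul_large_degree:
  fixes J :: "'k::field mpoly set"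
  assumes vs: "set vs = V" and J: "hom_ideal V J"
  obtains t0 where "\<And>e. e \<ge> t0 \<Longrightarrow> hzero xv vs (gr V) (igr V J) k e"
proof -
  let ?n = "length vs"
  note J' = is_idealD[OF hom_idealD(1)[OF J]]
  define n where "n = card (cells ?n k)"
  obtain h where h: "bij_betw h (cells ?n k) {..<n}"
    using ex_bij_betw_finite_nat[OF finite_cells] unfolding n_def atLeast0LessThan by blast
  \<comment> \<open>The k-cycles modulo J, read as vectors through the numbering h of the
    k-cells.\<close>
  define Z where "Z = {u \<in> free_module V {..<n}. \<forall>l T. k = Suc l \<longrightarrow> T \<in> cells ?n l \<longrightarrow> kd xv vs (\<lambda>S. u (h S)) T \<in> J}"
  let ?dg = "\<lambda>_ :: nat. 0 :: nat"
  have gs: "gsub V {..<n} ?dg Z"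
    unfolding gsub_def
  proof (intro conjI ballI allI)
    show "Z \<subseteq> free_module V {..<n}" by (auto simp: Z_def)
    show "0 \<in> Z" using J'(2) by (simp add: Z_def free_module_zero kd_zero[OF ops_xv])
    show "u + w \<in> Z" if "u \<in> Z" "w \<in> Z" for u w
      using that J'(3) by (simp add: Z_def free_module_add kd_add[OF ops_xv])
    show "(\<lambda>b. r * u b) \<in> Z" if "r \<in> polys V" "u \<in> Z" for r u
    proof -
      have "kd xv vs (\<lambda>S. r * u (h S)) T = r * kd xv vs (\<lambda>S. u (h S)) T" for T
        by (rule kd_hom[symmetric]) (simp_all add: xv_def algebra_simps)
      then show ?thesis using that J'(4) by (simp add: Z_def free_module_mult)
    qed
    show "hcF ?dg e u \<in> Z" if u: "u \<in> Z" for u e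
    proof -
      have "hcF ?dg e u \<in> free_module V {..<n}"
        using u by (intro gFD(1)[OF hcF_gF]) (simp add: Z_def)
      moreover have "kd xv vs (\<lambda>S. hc e (u (h S))) T \<in> J" if "k = Suc l" "T \<in> cells ?n l" for l T
        using u that hom_idealD(2)[OF J] by (simp add: Z_def kd_hc)
      ultimately show ?thesis by (simp add: Z_def hcF_def)
    qed
  qed
  obtain t0 where t0: "\<And>e. e \<ge> t0 \<Longrightarrow> hzero xf vs (\<lambda>e. Z \<inter> gF V {..<n} ?dg e) (\<lambda>_. {0}) 0 e"
    using eventually_generated[OF vs _ gs] by blast
  have "hzero xv vs (gr V) (igr V J) k e" if e: "e \<ge> t0" for e
  proof (rule hzeroI)
    fix \<omega> assume \<omega>: "chn ?n k (gr V e) \<omega>" "cyc xv vs k (igr V J (e + 1)) \<omega>"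
    define g where "g = the_inv_into (cells ?n k) h"
    have gh: "g (h T) = T" if "T \<in> cells ?n k" for T
      unfolding g_def using h that by (intro the_inv_into_f_f) (auto simp: bij_betw_def)
    have gc: "g b \<in> cells ?n k" if "b < n" for b
      unfolding g_def using h that by (intro the_inv_into_into) (auto simp: bij_betw_def)
    have hn: "h T < n" if "T \<in> cells ?n k" for T
      using h that by (auto simp: bij_betw_def)
    define u where "u = (\<lambda>b. if b < n then \<omega> (g b) else 0)"
    have uh: "u (h T) = \<omega> T" if "T \<in> cells ?n k" for T
      using that by (simp add: u_def hn gh)
    have uF: "u \<in> gF V {..<n} ?dg e"
    proof (rule gFI)
      show "u b \<in> gr V (e - int 0)" for b using \<omega>(1) gc[of b] by (simp add: u_def chn_def)
      then have "u b \<in> polys V" for b by (rule gr_polys)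
      moreover have "{b. u b \<noteq> 0} \<subseteq> {..<n}" by (auto simp: u_def split: if_splits)
      ultimately show "u \<in> free_module V {..<n}" using finite_subset by (auto simp: free_module_def)
    qed
    have "u \<in> Z"
    proof -
      have "kd xv vs (\<lambda>S. u (h S)) T \<in> J" if kl: "k = Suc l" "T \<in> cells ?n l" for l T
      proof -
        have "kd xv vs (\<lambda>S. u (h S)) T = kd xv vs \<omega> T"
          by (rule kd_cong[OF ops_xv _ kl(2)]) (simp add: uh kl(1))
        then show ?thesis using \<omega>(2) kl by (simp add: cyc_Suc chn_def)
      qed
      then show ?thesis using gFD(1)[OF uF] by (simp add: Z_def)
    qed
    then have "chn ?n 0 (Z \<inter> gF V {..<n} ?dg e) (\<lambda>_. u)" using uF by (simp add: chn_def)
    then obtain \<theta> where \<theta>: "chn ?n (Suc 0) (Z \<inter> gF V {..<n} ?dg (e - 1)) \<theta>"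
      "chn ?n 0 {0} (\<lambda>T. u - kd xf vs \<theta> T)"
      by (rule hzeroD[OF t0[OF e] _ cyc_0])
    \<comment> \<open>The vectors that are boundaries modulo J. C is closed under sums and contains
      x_v a for every cycle a in degree e - 1.\<close>
    define C where "C = {a. \<exists>\<eta>. chn ?n (Suc k) (gr V (e - 1)) \<eta> \<and> (\<forall>T\<in>cells ?n k. a (h T) - kd xv vs \<eta> T \<in> J)}"
    define T0 where "T0 = replicate ?n False"
    have T0: "T0 \<in> cells ?n 0" by (simp add: T0_def replicate_False_cells)
    have gm: "gmod xv vs (gr V :: int \<Rightarrow> 'k mpoly set)" using vs by (intro gmod_gr) simp
    have "kd xf vs \<theta> T0 \<in> C"
    proof (rule kd_cell_0[OF _ T0])
      show "chn ?n 1 (Z \<inter> gF V {..<n} ?dg (e - 1)) \<theta>" using \<theta>(1) by simp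
      show "0 \<in> C"
        using J'(2) by (auto simp: C_def chn_def kd_zero[OF ops_xv] intro!: exI[of _ "\<lambda>_. 0"])
      show "a + b \<in> C" if ab: "a \<in> C" "b \<in> C" for a b
      proof -
        obtain \<eta> \<zeta> where "chn ?n (Suc k) (gr V (e - 1)) \<eta>" "\<forall>T\<in>cells ?n k. a (h T) - kd xv vs \<eta> T \<in> J"
          "chn ?n (Suc k) (gr V (e - 1)) \<zeta>" "\<forall>T\<in>cells ?n k. b (h T) - kd xv vs \<zeta> T \<in> J"
          using ab unfolding C_def by blast
        then have "chn ?n (Suc k) (gr V (e - 1)) (\<lambda>S. \<eta> S + \<zeta> S)"
          "\<forall>T\<in>cells ?n k. (a + b) (h T) - kd xv vs (\<lambda>S. \<eta> S + \<zeta> S) T \<in> J"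
          using J'(3) by (auto simp: chn_def gr_add kd_add[OF ops_xv] add_diff_add)
        then show ?thesis unfolding C_def by blast
      qed
      show "xf v a \<in> C" if v: "v \<in> set vs" and a: "a \<in> Z \<inter> gF V {..<n} ?dg (e - 1)" for v a
      proof -
        define \<alpha> where "\<alpha> = (\<lambda>S. a (h S))"
        have "chn ?n k (gr V (e - 1)) \<alpha>"
          using a gFD(2)[of a V "{..<n}" ?dg "e - 1"] by (simp add: chn_def \<alpha>_def)
        then have w: "chn ?n (Suc k) (gr V (e - 1)) (wedge v vs \<alpha>)"
          by (intro wedge_chn) (auto simp: gr_uminus)
        have "xf v a (h T) - kd xv vs (wedge v vs \<alpha>) T \<in> J" if T: "T \<in> cells ?n k" for T
        proof -
          have "kd xv vs (wedge v vs \<alpha>) T + wedge v vs (kd xv vs \<alpha>) T = xv v (\<alpha> T)"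
            using T by (intro kd_wedge[OF ops_xv v]) (simp add: cells_def)
          then have "xf v a (h T) - kd xv vs (wedge v vs \<alpha>) T = wedge v vs (kd xv vs \<alpha>) T"
            by (simp add: xf_apply \<alpha>_def[symmetric] algebra_simps) (simp add: \<alpha>_def)
          moreover have "wedge v vs (kd xv vs \<alpha>) T \<in> J"
          proof (cases k)
            case 0
            then show ?thesis using T J'(2) by (simp add: wedge_0)
          next
            case (Suc l)
            have "chn ?n l J (kd xv vs \<alpha>)" using a Suc by (simp add: Z_def chn_def \<alpha>_def)
            then have "chn ?n (Suc l) J (wedge v vs (kd xv vs \<alpha>))"
              by (intro wedge_chn) (auto simp: J'(2) is_ideal_uminus[OF hom_idealD(1)[OF J]])
            then show ?thesis using T Suc by (simp add: chn_def)
          qed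
          ultimately show ?thesis by simp
        qed
        then show ?thesis using w unfolding C_def by blast
      qed
    qed
    moreover have "u = kd xf vs \<theta> T0" using \<theta>(2) T0 by (simp add: chn_def)
    ultimately obtain \<eta> where \<eta>: "chn ?n (Suc k) (gr V (e - 1)) \<eta>" "\<forall>T\<in>cells ?n k. u (h T) - kd xv vs \<eta> T \<in> J"
      unfolding C_def by blast
    have "\<omega> T - kd xv vs \<eta> T \<in> igr V J e" if T: "T \<in> cells ?n k" for T
    proof -
      have "kd xv vs \<eta> T \<in> gr V e" using kd_chn[OF gm \<eta>(1)] T by (simp add: chn_def)
      then show ?thesis using \<eta>(2) T uh[OF T] \<omega>(1) by (auto simp: chn_def intro: gr_diff)
    qed
    then show "\<exists>\<eta>. chn ?n (Suc k) (gr V (e - 1)) \<eta> \<and> chn ?n k (igr V J e) (\<lambda>T. \<omega> T - kd xv vs \<eta> T)"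
      using \<eta>(1) by (intro exI[of _ \<eta>]) (simp add: chn_def)
  qed
  then show ?thesis by (rule that)
qed

section \<open>The degree in the variable to be eliminated\<close>

definition Dx :: "nat \<Rightarrow> 'k::field mpoly set" where
  "Dx t = {f. \<forall>m\<in>supp f. coef m 0 \<le> t}"

lemma Dx_zero [simp]: "0 \<in> Dx t" by (simp add: Dx_def)

lemma Dx_add: "f \<in> Dx t \<Longrightarrow> g \<in> Dx t \<Longrightarrow> f + g \<in> Dx t"
  using Poly_Mapping.keys_add[of f g] by (auto simp: Dx_def)

lemma Dx_uminus: "f \<in> Dx t \<Longrightarrow> - f \<in> Dx t"
  by (simp add: Dx_def in_keys_iff)

lemma Dx_diff: "f \<in> Dx t \<Longrightarrow> g \<in> Dx t \<Longrightarrow> f - g \<in> Dx t"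
  using Dx_add[of f t "- g"] Dx_uminus[of g t] by simp

lemma Dx_mono: "f \<in> Dx s \<Longrightarrow> s \<le> t \<Longrightarrow> f \<in> Dx t"
  by (auto simp: Dx_def)

lemma Dx_mult: "f \<in> Dx s \<Longrightarrow> g \<in> Dx t \<Longrightarrow> f * g \<in> Dx (s + t)"
  unfolding Dx_def by (auto elim!: supp_mult_elim simp: lookup_add add_mono)

lemma Dx_var: "v \<noteq> 0 \<Longrightarrow> var v \<in> Dx 0" "var 0 \<in> Dx 1"
  by (auto simp: Dx_def var_def lookup_single when_def)

lemma Dx_power: "var 0 ^ t \<in> (Dx t :: 'k::field mpoly set)"
proof (induction t)
  case (Suc t)
  then show ?case using Dx_mult[OF Dx_var(2) Suc] by simp
qed (simp add: Dx_def)

lemma polys_Dx: "f \<in> polys {1..N} \<Longrightarrow> f \<in> Dx 0"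
  by (fastforce simp: polys_def Dx_def in_keys_iff)

lemma gr_Dx: "f \<in> gr V e \<Longrightarrow> f \<in> Dx (nat e)"
  unfolding Dx_def
proof (intro CollectI ballI)
  fix m assume "f \<in> gr V e" "m \<in> supp f"
  then have "int (mdeg m) = e" by (simp add: gr_def)
  moreover have "coef m 0 \<le> mdeg m"
  proof (cases "0 \<in> supp m")
    case True
    then show ?thesis by (auto simp: mdeg_def intro!: member_le_sum)
  qed (simp add: in_keys_iff)
  ultimately show "coef m 0 \<le> nat e" by simp
qed

lemma gr_Dx_0: "f \<in> gr {0..N} e \<Longrightarrow> f \<in> Dx 0 \<Longrightarrow> f \<in> gr {1..N} e"
proof -
  assume f: "f \<in> gr {0..N} e" "f \<in> Dx 0"
  have "supp m \<subseteq> {1..N}" if "m \<in> supp f" for m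
  proof
    fix i assume i: "i \<in> supp m"
    have "coef m 0 = 0" using f(2) that by (simp add: Dx_def)
    then have "i \<noteq> 0" using i by (metis in_keys_iff)
    moreover have "i \<in> {0..N}" using f(1) that i unfolding gr_def polys_def by blast
    ultimately show "i \<in> {1..N}" by simp
  qed
  then show ?thesis using f(1) by (auto simp: gr_def polys_def)
qed

lemma gr_var_power: "f \<in> gr {0..N} e \<Longrightarrow> var 0 ^ t * f \<in> gr {0..N} (e + int t)"
proof -
  assume "f \<in> gr {0..N} e"
  moreover have "var 0 ^ t \<in> gr {0..N} (int t * 1)" by (rule gr_power) simp
  ultimately show ?thesis using gr_mult[of "var 0 ^ t" "{0..N}" "int t" f e] by (simp add: add.commute)
qed

lemma var_power_div:
  assumes "f \<in> gr {0..N} e" "\<And>m. m \<in> supp f \<Longrightarrow> t \<le> coef m 0"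
  shows "\<exists>g\<in>gr {0..N} (e - int t). f = var 0 ^ t * g \<and>
    (\<forall>m\<in>supp g. Poly_Mapping.single 0 t + m \<in> supp f)"
  using assms
proof (induction t arbitrary: f e)
  case (Suc t)
  have f: "f = var 0 * dv 0 f" using Suc.prems(2) by (intro var_mult_dv[symmetric]) fastforce
  have "t \<le> coef m 0" if "m \<in> supp (dv 0 f)" for m
    using Suc.prems(2)[OF dv_supp[OF that]] by (simp add: lookup_add)
  then obtain g where g: "g \<in> gr {0..N} (e - 1 - int t)" "dv 0 f = var 0 ^ t * g"
    "\<forall>m\<in>supp g. Poly_Mapping.single 0 t + m \<in> supp (dv 0 f)"
    using Suc.IH[OF dv_gr[OF Suc.prems(1)]] by blast
  have "f = var 0 ^ Suc t * g" using f g(2) by (simp add: mult.assoc)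
  moreover have "Poly_Mapping.single 0 (Suc t) + m \<in> supp f" if "m \<in> supp g" for m
  proof -
    have "Poly_Mapping.single 0 (Suc 0) + (Poly_Mapping.single 0 t + m) \<in> supp f"
      using g(3) that by (intro dv_supp) blast
    then show ?thesis by (simp add: add.assoc[symmetric] single_add[symmetric])
  qed
  ultimately show ?case using g(1) by (intro bexI[of _ g]) (auto simp: algebra_simps)
qed auto

lemma split_power:
  assumes "f \<in> gr {0..N} e"
  shows "\<exists>g\<in>gr {0..N} (e - int t). \<exists>h\<in>gr {0..N} e \<inter> Dx t. f = var 0 ^ t * g + h"
proof -
  let ?f = "part (\<lambda>m. t \<le> coef m 0) f"
  obtain g where g: "g \<in> gr {0..N} (e - int t)" "?f = var 0 ^ t * g"
    using var_power_div[OF gr_part[OF assms], of "\<lambda>m. t \<le> coef m 0" t] by (auto simp: supp_part)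
  have h: "part (\<lambda>m. \<not> t \<le> coef m 0) f \<in> gr {0..N} e \<inter> Dx t"
    using gr_part[OF assms] by (auto simp: Dx_def supp_part)
  have "f = var 0 ^ t * g + part (\<lambda>m. \<not> t \<le> coef m 0) f"
    unfolding g(2)[symmetric] by (rule part_split)
  with g(1) h show ?thesis by (intro bexI)
qed

text \<open>The coefficient of the top power of x_0 is free of x_0. It is the leading coefficient
  that smoothness controls.\<close>

lemma split_lead:
  assumes "f \<in> gr {0..N} e" "f \<in> Dx (Suc t)"
  shows "\<exists>g\<in>gr {1..N} (e - int (Suc t)). \<exists>h\<in>gr {0..N} e \<inter> Dx t. f = var 0 ^ Suc t * g + h"
proof -
  let ?f = "part (\<lambda>m. Suc t \<le> coef m 0) f"
  have p: "Suc t \<le> coef m 0" if "m \<in> supp ?f" for m using that by (simp add: supp_part)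
  obtain g where g: "g \<in> gr {0..N} (e - int (Suc t))" "?f = var 0 ^ Suc t * g"
    "\<forall>m\<in>supp g. Poly_Mapping.single 0 (Suc t) + m \<in> supp ?f"
    using var_power_div[OF gr_part[OF assms(1)] p] by blast
  have "g \<in> Dx 0"
    using g(3) assms(2) by (fastforce simp: Dx_def supp_part lookup_add)
  then have g': "g \<in> gr {1..N} (e - int (Suc t))" by (rule gr_Dx_0[OF g(1)])
  have h: "part (\<lambda>m. \<not> Suc t \<le> coef m 0) f \<in> gr {0..N} e \<inter> Dx t"
    using gr_part[OF assms(1)] by (auto simp: Dx_def supp_part)
  have "f = var 0 ^ Suc t * g + part (\<lambda>m. \<not> Suc t \<le> coef m 0) f"
    unfolding g(2)[symmetric] by (rule part_split)
  with g' h show ?thesis by (intro bexI)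
qed

lemma mon_decomp:
  assumes "finite U" "f \<in> gr W e" "f \<in> mon U"
  shows "\<exists>s. (\<forall>u\<in>U. s u \<in> gr W (e - 1)) \<and> f = (\<Sum>u\<in>U. var u * s u)"
  using assms
proof (induction U arbitrary: f)
  case empty
  then show ?case by (simp add: mon_empty)
next
  case (insert u U)
  let ?f = "part (\<lambda>m. 0 < coef m u) f" and ?g = "part (\<lambda>m. \<not> 0 < coef m u) f"
  have "?g \<in> mon U" using insert.prems(2) by (auto simp: mon_def supp_part)
  then obtain s where s: "\<forall>u\<in>U. s u \<in> gr W (e - 1)" "?g = (\<Sum>u\<in>U. var u * s u)"
    using insert.IH gr_part[OF insert.prems(1)] by blast
  have "var u * dv u ?f = ?f" by (rule var_mult_dv) (simp add: supp_part)
  then have "f = var u * dv u ?f + (\<Sum>u\<in>U. var u * s u)"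
    using part_split[of f "\<lambda>m. 0 < coef m u"] s(2) by simp
  also have "(\<Sum>u\<in>U. var u * s u) = (\<Sum>w\<in>U. var w * (s(u := dv u ?f)) w)"
    using insert.hyps by (intro sum.cong) auto
  finally have "f = (\<Sum>w\<in>insert u U. var w * (s(u := dv u ?f)) w)"
    using insert.hyps by simp
  moreover have "\<forall>w\<in>insert u U. (s(u := dv u ?f)) w \<in> gr W (e - 1)"
    using s(1) dv_gr[OF gr_part[OF insert.prems(1)]] by simp
  ultimately show ?case by blast
qed

section \<open>Elimination of one variable\<close>

lemma hom_ideal_restrict:
  assumes I: "hom_ideal V I" and VW: "W \<subseteq> V"
  shows "hom_ideal W (I \<inter> polys W)"
  unfolding hom_ideal_def is_ideal_def
proof (intro conjI ballI allI)
  note I' = is_idealD[OF hom_idealD(1)[OF I]]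
  show "I \<inter> polys W \<subseteq> polys W" "0 \<in> I \<inter> polys W" using I'(2) by simp_all
  show "f + g \<in> I \<inter> polys W" if "f \<in> I \<inter> polys W" "g \<in> I \<inter> polys W" for f g :: "'a mpoly"
    using that I'(3) by (simp add: polys_add)
  show "r * f \<in> I \<inter> polys W" if "r \<in> polys W" "f \<in> I \<inter> polys W" for r f :: "'a mpoly"
    using that I'(4)[of r f] polys_mono[OF VW, of r] by (simp add: polys_mult)
  show "hc d f \<in> I \<inter> polys W" if "f \<in> I \<inter> polys W" for f :: "'a mpoly" and d
    using that hom_idealD(2)[OF I, of f d] by (simp add: hc_def polys_part)
qed

text \<open>
  Here \<open>q = (1:0:\<dots>:0)\<close> and the tangent space at \<open>q\<close> is \<open>x\<^sub>1 = \<dots> = x\<^sub>c = 0\<close>. The leading coefficients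
  with respect to \<open>x\<^sub>0\<close> of the elements of \<open>I\<close> of positive \<open>x\<^sub>0\<close>-degree generate the ideal
  \<open>(x\<^sub>1,\<dots>,x\<^sub>c)\<close>: this is what smoothness of \<open>q\<close> provides.
\<close>

locale elimination =
  fixes N :: nat and I :: "'k::field mpoly set" and c p :: nat
  assumes I: "hom_ideal {0..N} I" and c: "c \<le> N"
    and tangent: "j \<in> {1..c} \<Longrightarrow> \<exists>Q\<in>gr {1..N} 2. var 0 * var j + Q \<in> I"
    and lead: "g \<in> gr {1..N} (e - int (Suc t)) \<Longrightarrow> h \<in> gr {0..N} e \<Longrightarrow> h \<in> Dx t \<Longrightarrow>
      var 0 ^ Suc t * g + h \<in> I \<Longrightarrow> g \<in> mon {1..c}"
    and kos: "Suc i \<le> p \<Longrightarrow> 2 \<le> e \<Longrightarrow> hzero xv [0..<Suc N] (gr {0..N}) (igr {0..N} I) (Suc i) e"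
begin

abbreviation "V \<equiv> {0..N}"
abbreviation "W \<equiv> {1..N}"
definition "ws = [1..<Suc N]"
abbreviation "n \<equiv> length ws"
abbreviation G :: "int \<Rightarrow> 'k mpoly set" where "G \<equiv> gr V"
abbreviation S :: "int \<Rightarrow> 'k mpoly set" where "S \<equiv> gr W"
abbreviation II :: "int \<Rightarrow> 'k mpoly set" where "II \<equiv> igr V I"
abbreviation "x0 \<equiv> (xv 0 :: 'k mpoly \<Rightarrow> 'k mpoly)"

lemma vs_Cons: "[0..<Suc N] = 0 # ws"
  by (simp add: ws_def upt_conv_Cons del: upt_Suc)

lemma distinct_ws: "distinct ws"
  by (simp add: ws_def del: upt_Suc)

lemma set_ws: "set ws = W" "set (0 # ws) = V"
  by (auto simp: ws_def simp del: upt_Suc)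

lemmas I' = is_idealD[OF hom_idealD(1)[OF I]]
lemmas I_diff = is_ideal_diff[OF hom_idealD(1)[OF I]]

lemma gmG: "gmod xv ws G" and gmG0: "gmod xv (0 # ws) G" and gmS: "gmod xv ws S"
  and gmI: "gmod xv ws II" and gmI0: "gmod xv (0 # ws) II"
proof -
  show "gmod xv (0 # ws) G" by (rule gmod_gr) (simp only: set_ws)
  then show "gmod xv ws G" by (rule gmod_subset) auto
  show "gmod xv ws S" by (rule gmod_gr) (simp only: set_ws)
  show "gmod xv (0 # ws) II" by (rule gmod_igr[OF _ hom_idealD(1)[OF I]]) (simp only: set_ws)
  then show "gmod xv ws II" by (rule gmod_subset) auto
qed

lemma SG: "S e \<subseteq> G e"
  using gr_mono[of W V] by auto

lemma gmDx: "gmod xv ws (\<lambda>e. G e \<inter> Dx t)"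
proof (rule gmodI)
  show "xv v a \<in> G (d + 1) \<inter> Dx t" if "v \<in> set ws" "a \<in> G d \<inter> Dx t" for v d a
    using that Dx_mult[of "var v" 0 a t] Dx_var(1)[of v] gmod_X[OF gmG, of v a d] set_ws(1)
    by (auto simp: xv_def)
qed (auto simp: gr_add gr_uminus Dx_add Dx_uminus)

lemma x0_power: "(x0 ^^ t) f = var 0 ^ t * f"
  by (induction t) (simp_all add: xv_def mult.assoc)

section \<open>Lowering the x_0-degree modulo I, and multiplication by x_0 on Koszul
  homology\<close>

lemma X0G: "a \<in> G e \<Longrightarrow> x0 a \<in> G (e + 1)"
  using gmod_X[OF gmG0, of 0 a e] by simp

lemma X0I: "a \<in> II e \<Longrightarrow> x0 a \<in> II (e + 1)"
  using gmod_X[OF gmI0, of 0 a e] by simp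

lemma powI: "a \<in> I \<Longrightarrow> var 0 ^ t * a \<in> I"
  by (intro I'(4) polys_power) simp_all

text \<open>The tangent quadrics replace x_0 x_j by - Q_j, so a leading coefficient in (x_1, ...,
  x_c) can be traded for terms of lower x_0-degree.\<close>

lemma reduce_lead_coeff:
  assumes "g \<in> S d" "g \<in> mon {1..c}"
  shows "\<exists>f\<in>G (d + 1 + int t) \<inter> Dx t. var 0 ^ Suc t * g - f \<in> I"
proof -
  obtain s where s: "\<And>j. j \<in> {1..c} \<Longrightarrow> s j \<in> S (d - 1)" "g = (\<Sum>j\<in>{1..c}. var j * s j)"
    using mon_decomp[OF _ assms] by blast
  obtain Q where Q: "\<And>j. j \<in> {1..c} \<Longrightarrow> Q j \<in> S 2" "\<And>j. j \<in> {1..c} \<Longrightarrow> var 0 * var j + Q j \<in> I"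
    using tangent by metis
  define f where "f = - (var 0 ^ t * (\<Sum>j\<in>{1..c}. s j * Q j))"
  have sum: "(\<Sum>j\<in>{1..c}. s j * Q j) \<in> S (d + 1)"
  proof (rule gr_sum)
    fix j assume j: "j \<in> {1..c}"
    show "s j * Q j \<in> S (d + 1)" using gr_mult[OF s(1)[OF j] Q(1)[OF j]] by (simp add: add.commute)
  qed
  have "var 0 ^ t * (\<Sum>j\<in>{1..c}. s j * Q j) \<in> G (d + 1 + int t)"
    using gr_var_power sum SG by blast
  moreover have "var 0 ^ t * (\<Sum>j\<in>{1..c}. s j * Q j) \<in> Dx (t + 0)"
    by (intro Dx_mult Dx_power polys_Dx[of _ N] gr_polys[OF sum])
  ultimately have "f \<in> G (d + 1 + int t) \<inter> Dx t" by (simp add: f_def gr_uminus Dx_uminus)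
  moreover have "var 0 ^ Suc t * g - f \<in> I"
  proof -
    have "var 0 ^ Suc t * g - f = (\<Sum>j\<in>{1..c}. var 0 ^ t * s j * (var 0 * var j + Q j))"
      by (simp add: s(2) f_def sum_distrib_left sum.distrib[symmetric] algebra_simps)
    also have "\<dots> \<in> I"
    proof (rule is_ideal_sum[OF hom_idealD(1)[OF I]])
      fix j assume j: "j \<in> {1..c}"
      have "s j \<in> polys V" using gr_polys s(1)[OF j] SG by blast
      then show "var 0 ^ t * s j * (var 0 * var j + Q j) \<in> I"
        by (intro I'(4) Q(2)[OF j] polys_mult polys_power) auto
    qed
    finally show ?thesis .
  qed
  ultimately show ?thesis by blast
qed

text \<open>As long as f involves x_0, its leading coefficient is also one of x_0^t f - h, an
  element of I of positive x_0-degree. So it lies in (x_1, ..., x_c), and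
  \<open>reduce_lead_coeff\<close> lowers f.\<close>

lemma filtration_strict:
  assumes "f \<in> G e" "h \<in> G (e + int t) \<inter> Dx t" "var 0 ^ t * f - h \<in> I"
  shows "\<exists>s\<in>S e. f - s \<in> I"
proof -
  have "\<exists>s\<in>S e. f - s \<in> I" if "f \<in> Dx a" "f \<in> G e" "var 0 ^ t * f - h \<in> I" for a f
    using that
  proof (induction a arbitrary: f)
    case 0
    then have "f \<in> S e" by (intro gr_Dx_0)
    then show ?case using I'(2) by (intro bexI[of _ f]) simp_all
  next
    case (Suc a)
    obtain g h' where g: "g \<in> S (e - int (Suc a))" and h': "h' \<in> G e \<inter> Dx a" and f: "f = var 0 ^ Suc a * g + h'"
      using split_lead[OF Suc.prems(2,1)] by blast
    \<comment> \<open>h has x_0-degree at most t and h' at most a, so the top term in x_0 comes from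
      g alone.\<close>
    have "var 0 ^ Suc (a + t) * g + (var 0 ^ t * h' - h) \<in> I"
      using Suc.prems(3) by (simp add: f power_add algebra_simps)
    moreover have "var 0 ^ t * h' - h \<in> G (e + int t)"
      using h' assms(2) gr_var_power by (intro gr_diff) auto
    moreover have "var 0 ^ t * h' - h \<in> Dx (a + t)"
    proof (rule Dx_diff)
      show "var 0 ^ t * h' \<in> Dx (a + t)" using Dx_mult[OF Dx_power[of t], of h' a] h' by (simp add: add.commute)
      show "h \<in> Dx (a + t)" using assms(2) by (auto intro: Dx_mono)
    qed
    moreover have "e + int t - int (Suc (a + t)) = e - int (Suc a)" by simp
    with g have "g \<in> S (e + int t - int (Suc (a + t)))" by (simp only:)
    ultimately have "g \<in> mon {1..c}" using lead by blast
    then obtain f1 where f1: "f1 \<in> G (e - int (Suc a) + 1 + int a) \<inter> Dx a" "var 0 ^ Suc a * g - f1 \<in> I"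
      using reduce_lead_coeff[OF g] by blast
    define f' where "f' = f1 + h'"
    have ff: "f - f' \<in> I" using f1(2) by (simp add: f f'_def)
    have "f' \<in> Dx a" "f' \<in> G e" using f1(1) h' by (auto simp: f'_def intro: Dx_add gr_add)
    moreover have "var 0 ^ t * f' - h \<in> I"
      using I_diff[OF Suc.prems(3) powI[OF ff, of t]] by (simp add: algebra_simps)
    ultimately obtain s where "s \<in> S e" "f' - s \<in> I" using Suc.IH by blast
    then show ?case using I'(3)[OF ff, of "f' - s"] by auto
  qed
  then show ?thesis using assms gr_Dx by blast
qed

text \<open>The pair (u, 0) is a cycle of the cone of x_0, whose homology vanishes by
  \<open>kos\<close>; for k = 0 one uses instead that forms of positive degree lie in the ideal of
  the variables.\<close>

lemma koszul_surj:
  assumes u: "chn n k (G (e + 1)) u" "cyc xv ws k (II (e + 2)) u" and k: "k \<le> p" and e: "1 \<le> e"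
  shows "\<exists>\<gamma> \<delta>. chn n (Suc k) (G e) \<gamma> \<and> chn n k (G e) \<delta> \<and> cyc xv ws k (II (e + 1)) \<delta> \<and>
    chn n k (II (e + 1)) (\<lambda>T. u T - (kd xv ws \<gamma> T + x0 (\<delta> T)))"
proof (cases k)
  case 0
  have "0 \<notin> set ws" using set_ws(1) by auto
  then have "hzero xv ([] @ (0 # ws)) (gr V) (mgr V {} :: int \<Rightarrow> 'k mpoly set) 0 (e + 1)"
    using e distinct_ws set_ws by (intro hzero_mon) auto
  then have h: "hzero xv (0 # ws) G (mgr V {}) 0 (e + 1)" by simp
  have u0: "chn n 0 (G (e + 1)) u" using u(1) 0 by simp
  obtain \<gamma> \<delta> where gd: "chn n 1 (G (e + 1 - 1)) \<gamma>" "chn n 0 (G (e + 1 - 1)) \<delta>"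
    "chn n 0 (mgr V {} (e + 1)) (\<lambda>S. u S - (kd xv ws \<gamma> S + x0 (\<delta> S)))"
    by (rule hzero_0_ConsD[OF h u0])
  have "mgr V {} (e + 1) \<subseteq> II (e + 1)" using I'(2) by (auto simp: mon_empty)
  note m = chn_mono[OF gd(3) this]
  show ?thesis
    by (rule exI[of _ \<gamma>], rule exI[of _ \<delta>]) (use m gd(1,2) 0 in simp)
next
  case (Suc l)
  have h: "hzero xv (0 # ws) G II (Suc l) (e + 1)" 
    using kos[of l "e + 1", unfolded vs_Cons] e k Suc by simp
  have z: "chn n l (G (e + 1)) (\<lambda>_. 0)" by (simp add: chn_def)
  have c1: "chn n l (II (e + 1 + 1)) (\<lambda>S. kd xv ws u S + x0 0)"
    using u(2) Suc by (simp add: cyc_Suc ops_zero[OF ops_xv] add.commute)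
  have c2: "cyc xv ws l (II (e + 1 + 1)) (\<lambda>_. 0)"
    by (simp add: cyc_def chn_def kd_zero[OF ops_xv] I'(2))
  have u1: "chn n (Suc l) (G (e + 1)) u" using u(1) Suc by simp
  obtain \<gamma> \<delta> where gd: "chn n (Suc (Suc l)) (G (e + 1 - 1)) \<gamma>" "chn n (Suc l) (G (e + 1 - 1)) \<delta>"
        "chn n (Suc l) (II (e + 1)) (\<lambda>S. u S - (kd xv ws \<gamma> S + x0 (\<delta> S)))"
        "chn n l (II (e + 1)) (\<lambda>S. 0 + kd xv ws \<delta> S)"
    by (rule hzero_ConsD[OF h gmI0 u1 z c1 c2])
  show ?thesis
    by (rule exI[of _ \<gamma>], rule exI[of _ \<delta>]) (use gd Suc in \<open>simp add: cyc_Suc\<close>)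
qed

text \<open>The relation x_0 u = d w makes (- w, u) a (k+1)-cycle of the cone; the second component
  of a primitive bounds u up to sign.\<close>

lemma koszul_inj:
  assumes u: "chn n k (G e) u" "cyc xv ws k (II (e + 1)) u"
    and w: "chn n (Suc k) (G e) w" "chn n k (II (e + 1)) (\<lambda>T. x0 (u T) - kd xv ws w T)"
    and k: "Suc k \<le> p" and e: "2 \<le> e"
  shows "\<exists>\<eta>. chn n (Suc k) (G (e - 1)) \<eta> \<and> chn n k (II e) (\<lambda>T. u T - kd xv ws \<eta> T)"
proof -
  have h: "hzero xv (0 # ws) G II (Suc k) e" using kos[OF k e] by (simp only: vs_Cons)
  have w1: "chn n (Suc k) (G e) (\<lambda>T. - w T)" using w(1) by (simp add: chn_def gr_uminus)
  have u1: "chn n k (G e) u" using u(1) by simp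
  have c1: "chn n k (II (e + 1)) (\<lambda>S. kd xv ws (\<lambda>T. - w T) S + x0 (u S))"
    using w(2) by (simp add: kd_uminus[OF ops_xv])
  obtain \<gamma> \<delta> where gd: "chn n (Suc k) (G (e - 1)) \<delta>" "chn n k (II e) (\<lambda>S. u S + kd xv ws \<delta> S)"
    by (rule hzero_ConsD[OF h gmI0 w1 u1 c1 u(2)])
  then show ?thesis
    by (intro exI[of _ "\<lambda>S. - \<delta> S"]) (simp add: kd_uminus[OF ops_xv] chn_def gr_uminus)
qed

lemma cyc_x0:
  assumes "cyc xv ws k (II e) u"
  shows "cyc xv ws k (II (e + 1)) (\<lambda>T. x0 (u T))"
  using cyc_X[OF ops_xv gmI X0I assms] by simp

lemma koszul_inj_power:
  assumes u: "chn n k (G e) u" "cyc xv ws k (II (e + 1)) u"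
    and w: "chn n (Suc k) (G (e + int t - 1)) w" "chn n k (II (e + int t)) (\<lambda>T. (x0 ^^ t) (u T) - kd xv ws w T)"
    and k: "Suc k \<le> p" and e: "2 \<le> e"
  shows "\<exists>\<eta>. chn n (Suc k) (G (e - 1)) \<eta> \<and> chn n k (II e) (\<lambda>T. u T - kd xv ws \<eta> T)"
  using w
proof (induction t arbitrary: w)
  case 0
  then show ?case by (intro exI[of _ w]) simp
next
  case (Suc t)
  have xu: "chn n k (G (e + int t)) (\<lambda>T. (x0 ^^ t) (u T)) \<and> cyc xv ws k (II (e + int t + 1)) (\<lambda>T. (x0 ^^ t) (u T))"
  proof (induction t)
    case 0
    then show ?case using u by simp
  next
    case (Suc t)
    have "chn n k (G (e + int t + 1)) (\<lambda>T. x0 ((x0 ^^ t) (u T)))"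
      using Suc X0G by (simp add: chn_def)
    moreover have "cyc xv ws k (II (e + int t + 1 + 1)) (\<lambda>T. x0 ((x0 ^^ t) (u T)))"
      using Suc by (intro cyc_x0) simp
    ultimately show ?case by (simp add: algebra_simps)
  qed
  have w1: "chn n (Suc k) (G (e + int t)) w" using Suc.prems(1) by simp
  have w2: "chn n k (II (e + int t + 1)) (\<lambda>T. x0 ((x0 ^^ t) (u T)) - kd xv ws w T)"
    using Suc.prems(2) by (simp add: algebra_simps)
  obtain \<eta> where "chn n (Suc k) (G (e + int t - 1)) \<eta>"
    "chn n k (II (e + int t)) (\<lambda>T. (x0 ^^ t) (u T) - kd xv ws \<eta> T)"
    using koszul_inj[OF conjunct1[OF xu] conjunct2[OF xu] w1 w2 k] e by auto
  then show ?case by (rule Suc.IH)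
qed

lemma koszul_surj_power:
  assumes "chn n k (G (e + int t)) u" "cyc xv ws k (II (e + int t + 1)) u" and k: "k \<le> p" and e: "1 \<le> e"
  shows "\<exists>v z. chn n k (G e) v \<and> cyc xv ws k (II (e + 1)) v \<and> chn n (Suc k) (G (e + int t - 1)) z \<and>
    chn n k (II (e + int t)) (\<lambda>T. u T - (kd xv ws z T + (x0 ^^ t) (v T)))"
  using assms(1,2)
proof (induction t arbitrary: u)
  case 0
  show ?case
    by (rule exI[of _ u], rule exI[of _ "\<lambda>_. 0"])
      (use 0 in \<open>simp add: chn_def kd_zero[OF ops_xv] I'(2)\<close>)
next
  case (Suc t)
  have "chn n k (G (e + int t + 1)) u" "cyc xv ws k (II (e + int t + 2)) u" "1 \<le> e + int t"
    using Suc.prems e by (simp_all add: algebra_simps)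
  from koszul_surj[OF this(1,2) k this(3)] obtain \<gamma> \<delta> where gd: "chn n (Suc k) (G (e + int t)) \<gamma>"
    "chn n k (G (e + int t)) \<delta>" "cyc xv ws k (II (e + int t + 1)) \<delta>"
    "chn n k (II (e + int t + 1)) (\<lambda>T. u T - (kd xv ws \<gamma> T + x0 (\<delta> T)))" by blast
  obtain v z where vz: "chn n k (G e) v" "cyc xv ws k (II (e + 1)) v" "chn n (Suc k) (G (e + int t - 1)) z"
    "chn n k (II (e + int t)) (\<lambda>T. \<delta> T - (kd xv ws z T + (x0 ^^ t) (v T)))"
    using Suc.IH[OF gd(2,3)] by blast
  have r1: "chn n (Suc k) (G (e + int t)) (\<lambda>S. \<gamma> S + x0 (z S))"
    using gd(1) vz(3) X0G[of _ "e + int t - 1"] by (simp add: chn_def gr_add)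
  have "chn n k (II (e + int t + 1)) (\<lambda>T. x0 (\<delta> T - (kd xv ws z T + (x0 ^^ t) (v T))))"
    using vz(4) X0I unfolding chn_def by blast
  from chn_add[OF gmI gd(4) this]
  have r2: "chn n k (II (e + int t + 1)) (\<lambda>T. u T - (kd xv ws (\<lambda>S. \<gamma> S + x0 (z S)) T + (x0 ^^ Suc t) (v T)))"
    by (simp add: kd_add[OF ops_xv] kd_X[OF ops_xv] ops_simps[OF ops_xv] algebra_simps)
  have e: "e + int (Suc t) = e + int t + 1" by simp
  show ?case unfolding e add_diff_cancel_right' using vz(1,2) r1 r2 by (intro exI conjI)
qed

end

section \<open>Transfer of cycles from R/I to S/J\<close>

context elimination
begin

definition J :: "'k mpoly set" where
  "J = I \<inter> polys W"

lemma J_hom_ideal: "hom_ideal W J"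
  unfolding J_def by (rule hom_ideal_restrict[OF I]) auto

lemma S_I: "a \<in> S e \<Longrightarrow> a \<in> I \<Longrightarrow> a \<in> igr W J e"
  using gr_polys[of a W e] by (simp add: J_def)

text \<open>Write u = x_0^{t+1} g + h. As the boundary of u lies in I, \<open>lead\<close> makes g a
  cycle modulo (x_1, ..., x_c), and \<open>hzero_mon\<close> bounds it there. Subtracting the
  boundary of x_0^{t+1} times a primitive leaves leading coefficients in (x_1, ..., x_c), which can
  be lowered. The bound on t puts g in positive degree, as \<open>hzero_mon\<close> demands.\<close>

lemma chn_reduce_step:
  assumes cc: "chn n k (G e \<inter> Dx (Suc t)) u" "cyc xv ws k (II (e + 1)) u" and e: "int (Suc t) < e"
  shows "\<exists>b u'. chn n (Suc k) (G (e - 1) \<inter> Dx (Suc t)) b \<and> chn n k (G e \<inter> Dx t) u' \<and>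
    chn n k (II e) (\<lambda>T. u T - kd xv ws b T - u' T)"
proof -
  have "\<forall>T\<in>cells n k. \<exists>gh. fst gh \<in> S (e - int (Suc t)) \<and> snd gh \<in> G e \<inter> Dx t \<and>
      u T = var 0 ^ Suc t * fst gh + snd gh"
  proof
    fix T assume "T \<in> cells n k"
    then have "u T \<in> G e" "u T \<in> Dx (Suc t)" using cc(1) by (auto simp: chn_def)
    then obtain g h where "g \<in> S (e - int (Suc t))" "h \<in> G e \<inter> Dx t" "u T = var 0 ^ Suc t * g + h"
      using split_lead by blast
    then show "\<exists>gh. fst gh \<in> S (e - int (Suc t)) \<and> snd gh \<in> G e \<inter> Dx t \<and> u T = var 0 ^ Suc t * fst gh + snd gh"
      by (intro exI[of _ "(g, h)"]) simp
  qed
  then obtain gh where gh: "\<forall>T\<in>cells n k. fst (gh T) \<in> S (e - int (Suc t)) \<and> snd (gh T) \<in> G e \<inter> Dx t \<and>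
      u T = var 0 ^ Suc t * fst (gh T) + snd (gh T)"
    by (rule bchoice[THEN exE])
  define g where "g = (\<lambda>T. fst (gh T))"
  define h where "h = (\<lambda>T. snd (gh T))"
  have g: "chn n k (S (e - int (Suc t))) g" and h: "chn n k (G e \<inter> Dx t) h"
    and ugh: "\<And>T. T \<in> cells n k \<Longrightarrow> u T = var 0 ^ Suc t * g T + h T"
    using gh by (simp_all add: g_def h_def chn_def)
  have mult: "kd xv ws (\<lambda>S. r * \<omega> S) T = r * kd xv ws \<omega> T" for r T and \<omega> :: "bool list \<Rightarrow> 'k mpoly"
    by (rule kd_hom[symmetric]) (simp_all add: xv_def algebra_simps)
  have "cyc xv ws k (mgr W {1..c} (e - int (Suc t) + 1)) g"
    unfolding cyc_def
  proof (intro allI impI)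
    fix l assume k: "k = Suc l"
    have gk: "chn n l (S (e - int (Suc t) + 1)) (kd xv ws g)" using kd_chn[OF gmS g[unfolded k]] .
    have hk: "chn n l (G (e + 1) \<inter> Dx t) (kd xv ws h)" using kd_chn[OF gmDx] h k by simp
    show "chn n l (mgr W {1..c} (e - int (Suc t) + 1)) (kd xv ws g)"
      unfolding chn_def
    proof
      fix T assume T: "T \<in> cells n l"
      have "kd xv ws u T = kd xv ws (\<lambda>T. var 0 ^ Suc t * g T + h T) T"
        by (rule kd_cong[OF ops_xv _ T]) (simp add: ugh k)
      also have "\<dots> = var 0 ^ Suc t * kd xv ws g T + kd xv ws h T"
        by (simp only: kd_add[OF ops_xv] mult)
      finally have "var 0 ^ Suc t * kd xv ws g T + kd xv ws h T \<in> I"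
        using cc(2) k T by (auto simp: cyc_Suc chn_def)
      moreover have gT: "kd xv ws g T \<in> S (e - int (Suc t) + 1)" using gk T by (simp add: chn_def)
      have "e - int (Suc t) + 1 = (e + 1) - int (Suc t)" by simp
      with gT have "kd xv ws g T \<in> S ((e + 1) - int (Suc t))" by (simp only:)
      moreover have "kd xv ws h T \<in> G (e + 1)" "kd xv ws h T \<in> Dx t" using hk T by (simp_all add: chn_def)
      ultimately have "kd xv ws g T \<in> mon {1..c}" using lead by blast
      then show "kd xv ws g T \<in> mgr W {1..c} (e - int (Suc t) + 1)" using gT by blast
    qed
  qed
  moreover have "hzero xv ws (gr W) (mgr W {1..c} :: int \<Rightarrow> 'k mpoly set) k (e - int (Suc t))"
  proof -
    have "ws = [1..<Suc c] @ [Suc c..<Suc N]"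
      unfolding ws_def using c upt_add_eq_append[of 1 "Suc c" "N - c"] by (simp del: upt_Suc)
    moreover have "hzero xv ([1..<Suc c] @ [Suc c..<Suc N]) (gr W) (mgr W {1..c} :: int \<Rightarrow> 'k mpoly set) k (e - int (Suc t))"
      using e c by (intro hzero_mon) (auto simp del: upt_Suc)
    ultimately show ?thesis by simp
  qed
  ultimately obtain \<gamma> where \<gamma>: "chn n (Suc k) (S (e - int (Suc t) - 1)) \<gamma>"
    "chn n k (mgr W {1..c} (e - int (Suc t))) (\<lambda>T. g T - kd xv ws \<gamma> T)"
    using g hzeroD by blast
  have "\<forall>T\<in>cells n k. \<exists>f. f \<in> G e \<inter> Dx t \<and> var 0 ^ Suc t * (g T - kd xv ws \<gamma> T) - f \<in> I"
  proof
    fix T assume "T \<in> cells n k"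
    then have "g T - kd xv ws \<gamma> T \<in> S (e - int (Suc t))" "g T - kd xv ws \<gamma> T \<in> mon {1..c}"
      using \<gamma>(2) by (auto simp: chn_def)
    from reduce_lead_coeff[OF this, of t]
    obtain f where f: "f \<in> G (e - int (Suc t) + 1 + int t) \<inter> Dx t" "var 0 ^ Suc t * (g T - kd xv ws \<gamma> T) - f \<in> I"
      by blast
    have "e - int (Suc t) + 1 + int t = e" by simp
    then show "\<exists>f. f \<in> G e \<inter> Dx t \<and> var 0 ^ Suc t * (g T - kd xv ws \<gamma> T) - f \<in> I" using f by auto
  qed
  then obtain f where f: "\<forall>T\<in>cells n k. f T \<in> G e \<inter> Dx t \<and> var 0 ^ Suc t * (g T - kd xv ws \<gamma> T) - f T \<in> I"
    by (rule bchoice[THEN exE])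
  define b where "b = (\<lambda>S. var 0 ^ Suc t * \<gamma> S)"
  define u' where "u' = (\<lambda>T. f T + h T)"
  have bG: "chn n (Suc k) (G (e - 1) \<inter> Dx (Suc t)) b"
    unfolding chn_def
  proof
    fix T assume "T \<in> cells n (Suc k)"
    then have \<gamma>T: "\<gamma> T \<in> S (e - int (Suc t) - 1)" using \<gamma>(1) by (simp add: chn_def)
    have "b T \<in> G (e - int (Suc t) - 1 + int (Suc t))"
      unfolding b_def by (rule gr_var_power) (use \<gamma>T SG in blast)
    moreover have "b T \<in> Dx (Suc t + 0)"
      unfolding b_def by (intro Dx_mult Dx_power polys_Dx[of _ N] gr_polys[OF \<gamma>T])
    ultimately show "b T \<in> G (e - 1) \<inter> Dx (Suc t)" by simp
  qed
  moreover have u'G: "chn n k (G e \<inter> Dx t) u'"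
    using f h by (simp add: chn_def u'_def gr_add Dx_add)
  moreover have "chn n k (II e) (\<lambda>T. u T - kd xv ws b T - u' T)"
    unfolding chn_def
  proof
    fix T assume T: "T \<in> cells n k"
    have "u T - kd xv ws b T - u' T = var 0 ^ Suc t * (g T - kd xv ws \<gamma> T) - f T"
      by (simp only: ugh[OF T] b_def mult u'_def) (simp add: algebra_simps)
    moreover have "kd xv ws b T \<in> G e"
      using kd_chn[OF gmDx bG] T by (simp add: chn_def)
    then have "u T - kd xv ws b T - u' T \<in> G e"
      using cc(1) u'G T by (auto simp: chn_def intro!: gr_diff)
    ultimately show "u T - kd xv ws b T - u' T \<in> II e" using f T by simp
  qed
  ultimately show ?thesis by (intro exI conjI)
qed

lemma chn_reduce:
  assumes "chn n k (G e \<inter> Dx t) u" "cyc xv ws k (II (e + 1)) u" "int t < e"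
  shows "\<exists>b u'. chn n (Suc k) (G (e - 1) \<inter> Dx t) b \<and> chn n k (S e) u' \<and>
    chn n k (II e) (\<lambda>T. u T - kd xv ws b T - u' T)"
  using assms
proof (induction t arbitrary: u)
  case 0
  have "chn n k (S e) u" using 0(1) gr_Dx_0 unfolding chn_def by blast
  then show ?case
    by (intro exI[of _ "\<lambda>_. 0"] exI[of _ u] conjI) (simp_all add: chn_def kd_zero[OF ops_xv] I'(2))
next
  case (Suc t)
  obtain b u1 where b: "chn n (Suc k) (G (e - 1) \<inter> Dx (Suc t)) b" "chn n k (G e \<inter> Dx t) u1"
    "chn n k (II e) (\<lambda>T. u T - kd xv ws b T - u1 T)"
    using chn_reduce_step[OF Suc.prems] by blast
  have "cyc xv ws k (II (e + 1)) (\<lambda>T. u T - kd xv ws b T)"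
    by (rule cyc_diff[OF ops_xv gmI Suc.prems(2) cyc_kd[OF ops_xv gmI]])
  moreover have "chn n k (II e) (\<lambda>T. u1 T - (u T - kd xv ws b T))"
    using chn_uminus[OF gmI b(3)] by simp
  ultimately have "cyc xv ws k (II (e + 1)) u1" by (rule cyc_mod[OF ops_xv gmI])
  then obtain b' u' where b': "chn n (Suc k) (G (e - 1) \<inter> Dx t) b'" "chn n k (S e) u'"
    "chn n k (II e) (\<lambda>T. u1 T - kd xv ws b' T - u' T)"
    using Suc.IH[OF b(2)] Suc.prems(3) by auto
  have "chn n (Suc k) (G (e - 1) \<inter> Dx (Suc t)) (\<lambda>S. b S + b' S)"
  proof (rule chn_add[OF gmDx b(1) chn_mono[OF b'(1)]])
    show "G (e - 1) \<inter> Dx t \<subseteq> G (e - 1) \<inter> Dx (Suc t)" using Dx_mono by fastforce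
  qed
  moreover have "chn n k (II e) (\<lambda>T. u T - kd xv ws (\<lambda>S. b S + b' S) T - u' T)"
    using chn_add[OF gmI b(3) b'(3)] by (simp add: kd_add[OF ops_xv] algebra_simps)
  ultimately show ?case using b'(2) by (intro exI conjI)
qed

theorem koszul_elimination:
  assumes k: "k < p" and e: "2 \<le> e"
  shows "hzero xv ws S (igr W J) k e"
proof (rule hzeroI)
  fix \<omega> assume \<omega>: "chn n k (S e) \<omega>" "cyc xv ws k (igr W J (e + 1)) \<omega>"
  have JI: "igr W J d \<subseteq> II d" for d using SG by (auto simp: J_def)
  have \<omega>G: "chn n k (G e) \<omega>" using chn_mono[OF \<omega>(1) SG] .
  have \<omega>I: "cyc xv ws k (II (e + 1)) \<omega>" using \<omega>(2) JI chn_mono unfolding cyc_def by blast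
  obtain t0 where t0: "\<And>e. e \<ge> t0 \<Longrightarrow> hzero xv ws (gr W) (igr W J) k e"
    using koszul_large_degree[OF set_ws(1) J_hom_ideal] by blast
  \<comment> \<open>Chosen so that degree e + t lies in the range where the homology of S/J is
    already known to vanish.\<close>
  define t where "t = nat (t0 - e)"
  have t: "e + int t \<ge> t0" by (simp add: t_def)
  have x0t: "(x0 ^^ t) f = var 0 ^ t * f" for f by (rule x0_power)
  have mult: "kd xv ws (\<lambda>S. (x0 ^^ t) (\<alpha> S)) T = (x0 ^^ t) (kd xv ws \<alpha> T)" for T \<alpha>
    unfolding x0t by (rule kd_hom[symmetric]) (simp_all add: xv_def algebra_simps)
  have powG: "chn n l (G (d + int t)) (\<lambda>S. (x0 ^^ t) (\<alpha> S))" if "chn n l (G d) \<alpha>" for l d \<alpha>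
    using that by (simp add: chn_def x0t gr_var_power)
  have powI': "chn n l (II (d + int t)) (\<lambda>S. (x0 ^^ t) (\<alpha> S))" if "chn n l (II d) \<alpha>" for l d \<alpha>
    using that by (simp add: chn_def x0t gr_var_power powI)
  define u where "u = (\<lambda>T. (x0 ^^ t) (\<omega> T))"
  have u1: "chn n k (G (e + int t) \<inter> Dx t) u"
    unfolding chn_def
  proof
    fix T assume T: "T \<in> cells n k"
    then have "\<omega> T \<in> S e" using \<omega>(1) by (simp add: chn_def)
    then have "u T \<in> Dx (t + 0)"
      unfolding u_def x0t by (intro Dx_mult Dx_power polys_Dx[of _ N] gr_polys)
    then show "u T \<in> G (e + int t) \<inter> Dx t"
      using powG[OF \<omega>G] T by (simp add: u_def chn_def)
  qed
  have u2: "cyc xv ws k (II (e + int t + 1)) u"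
    unfolding cyc_def
  proof (intro allI impI)
    fix l assume "k = Suc l"
    then have "chn n l (II (e + 1)) (kd xv ws \<omega>)" using \<omega>I by (simp add: cyc_Suc)
    from powI'[OF this] show "chn n l (II (e + int t + 1)) (kd xv ws u)"
      unfolding u_def chn_def mult by (simp add: algebra_simps)
  qed
  have "int t < e + int t" using e by simp
  from chn_reduce[OF u1 u2 this] obtain b c0 where b: "chn n (Suc k) (G (e + int t - 1) \<inter> Dx t) b"
    and c0: "chn n k (S (e + int t)) c0" and ub: "chn n k (II (e + int t)) (\<lambda>T. u T - kd xv ws b T - c0 T)"
    by blast
  have "cyc xv ws k (II (e + int t + 1)) (\<lambda>T. u T - kd xv ws b T)"
    by (rule cyc_diff[OF ops_xv gmI u2 cyc_kd[OF ops_xv gmI]])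
  moreover have "chn n k (II (e + int t)) (\<lambda>T. c0 T - (u T - kd xv ws b T))"
    using chn_uminus[OF gmI ub] by simp
  ultimately have "cyc xv ws k (II (e + int t + 1)) c0" by (rule cyc_mod[OF ops_xv gmI])
  then have "cyc xv ws k (igr W J (e + int t + 1)) c0"
    using kd_chn[OF gmS, of _ "e + int t" c0] c0 S_I unfolding cyc_def chn_def by blast
  from hzeroD[OF t0[OF t] c0 this] obtain \<eta>0 where \<eta>0: "chn n (Suc k) (S (e + int t - 1)) \<eta>0"
    "chn n k (igr W J (e + int t)) (\<lambda>T. c0 T - kd xv ws \<eta>0 T)" by blast
  \<comment> \<open>w' bounds x_0^t \<omega> modulo I and has x_0-degree at most t; the degree bound
    is what \<open>filtration_strict\<close> will use.\<close>
  define w' where "w' = (\<lambda>S. b S + \<eta>0 S)"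
  have w'G: "chn n (Suc k) (G (e + int t - 1) \<inter> Dx t) w'"
    unfolding chn_def
  proof
    fix T assume T: "T \<in> cells n (Suc k)"
    then have S: "\<eta>0 T \<in> S (e + int t - 1)" using \<eta>0(1) by (simp add: chn_def)
    then have "\<eta>0 T \<in> Dx t" by (intro Dx_mono[OF polys_Dx[OF gr_polys]]) simp_all
    then show "w' T \<in> G (e + int t - 1) \<inter> Dx t"
      using b T S SG by (auto simp: w'_def chn_def intro: gr_add Dx_add)
  qed
  have uw': "chn n k (II (e + int t)) (\<lambda>T. u T - kd xv ws w' T)"
    using chn_add[OF gmI ub chn_mono[OF \<eta>0(2) JI]] by (simp add: w'_def kd_add[OF ops_xv] algebra_simps)
  have w'G': "chn n (Suc k) (G (e + int t - 1)) w'" by (rule chn_mono[OF w'G]) blast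
  have kp: "Suc k \<le> p" using k by simp
  obtain w where w: "chn n (Suc k) (G (e - 1)) w" "chn n k (II e) (\<lambda>T. \<omega> T - kd xv ws w T)"
    using koszul_inj_power[OF \<omega>G \<omega>I w'G' uw'[unfolded u_def] kp e] by blast
  \<comment> \<open>w bounds \<omega>, but only with coefficients in R. Modulo I both x_0^t w and w'
    bound x_0^t \<omega>, so y is a (k+1)-cycle, which can be divided by x_0^t up to a
    boundary.\<close>
  define y where "y = (\<lambda>T. (x0 ^^ t) (w T) - w' T)"
  have y1: "chn n (Suc k) (G (e - 1 + int t)) y"
    using chn_diff[OF gmG powG[OF w(1)], of w'] w'G' by (simp add: y_def algebra_simps)
  have y2: "cyc xv ws (Suc k) (II (e - 1 + int t + 1)) y"
  proof -
    have "chn n k (II (e + int t)) (\<lambda>T. (u T - kd xv ws w' T) - (x0 ^^ t) (\<omega> T - kd xv ws w T))"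
      by (rule chn_diff[OF gmI uw' powI'[OF w(2)]])
    moreover have "(u T - kd xv ws w' T) - (x0 ^^ t) (\<omega> T - kd xv ws w T) = kd xv ws y T" for T
      unfolding y_def kd_diff[OF ops_xv] mult u_def by (simp add: x0t algebra_simps)
    ultimately show ?thesis by (simp add: cyc_Suc chn_def)
  qed
  have "1 \<le> e - 1" using e by simp
  from koszul_surj_power[OF y1 y2 kp this] obtain v z where v: "chn n (Suc k) (G (e - 1)) v"
    "cyc xv ws (Suc k) (II (e - 1 + 1)) v" and z: "chn n (Suc (Suc k)) (G (e - 1 + int t - 1)) z"
    and yvz: "chn n (Suc k) (II (e - 1 + int t)) (\<lambda>T. y T - (kd xv ws z T + (x0 ^^ t) (v T)))" by blast
  \<comment> \<open>Splitting z at x_0^t sorts the error: \<open>z1\<close> will be absorbed into w,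
    and \<open>z2\<close> into the chain of low x_0-degree.\<close>
  have "\<forall>T\<in>cells n (Suc (Suc k)). \<exists>ab. fst ab \<in> G (e - 2) \<and> snd ab \<in> G (e - 1 + int t - 1) \<inter> Dx t \<and>
      z T = var 0 ^ t * fst ab + snd ab"
  proof
    fix T assume "T \<in> cells n (Suc (Suc k))"
    then have "z T \<in> G (e - 1 + int t - 1)" using z by (simp add: chn_def)
    from split_power[OF this, of t] obtain f h where f: "f \<in> G (e - 1 + int t - 1 - int t)"
      "h \<in> G (e - 1 + int t - 1) \<inter> Dx t" "z T = var 0 ^ t * f + h" by blast
    have "e - 1 + int t - 1 - int t = e - 2" by simp
    then show "\<exists>ab. fst ab \<in> G (e - 2) \<and> snd ab \<in> G (e - 1 + int t - 1) \<inter> Dx t \<and> z T = var 0 ^ t * fst ab + snd ab"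
      using f by (intro exI[of _ "(f, h)"]) simp
  qed
  then obtain ab where ab: "\<forall>T\<in>cells n (Suc (Suc k)). fst (ab T) \<in> G (e - 2) \<and>
      snd (ab T) \<in> G (e - 1 + int t - 1) \<inter> Dx t \<and> z T = var 0 ^ t * fst (ab T) + snd (ab T)"
    by (rule bchoice[THEN exE])
  define z1 where "z1 = (\<lambda>T. fst (ab T))"
  define z2 where "z2 = (\<lambda>T. snd (ab T))"
  have z1: "chn n (Suc (Suc k)) (G (e - 2)) z1" and z2: "chn n (Suc (Suc k)) (G (e - 1 + int t - 1) \<inter> Dx t) z2"
    and z12: "\<And>T. T \<in> cells n (Suc (Suc k)) \<Longrightarrow> z T = (x0 ^^ t) (z1 T) + z2 T"
    using ab by (simp_all add: chn_def z1_def z2_def x0t)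
  \<comment> \<open>Modulo I, f has the same boundary as w, since v is a cycle; and x_0^t f is
    congruent to h, of x_0-degree at most t. Hence f is congruent to a chain over S.\<close>
  define f where "f = (\<lambda>T. w T - v T - kd xv ws z1 T)"
  define h where "h = (\<lambda>T. w' T + kd xv ws z2 T)"
  have fG: "chn n (Suc k) (G (e - 1)) f"
  proof -
    have "chn n (Suc k) (G (e - 2 + 1)) (kd xv ws z1)" by (rule kd_chn[OF gmG z1])
    then have "chn n (Suc k) (G (e - 1)) (kd xv ws z1)" by simp
    from chn_diff[OF gmG chn_diff[OF gmG w(1) v(1)] this] show ?thesis by (simp add: f_def)
  qed
  have hG: "chn n (Suc k) (G (e - 1 + int t) \<inter> Dx t) h"
  proof -
    have "chn n (Suc k) (G (e - 1 + int t - 1 + 1) \<inter> Dx t) (kd xv ws z2)" by (rule kd_chn[OF gmDx z2])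
    then have "chn n (Suc k) (G (e - 1 + int t) \<inter> Dx t) (kd xv ws z2)" by (simp only: diff_add_cancel)
    moreover have eq: "e + int t - 1 = e - 1 + int t" by simp
    ultimately show ?thesis
      unfolding h_def by (intro chn_add[OF gmDx w'G[unfolded eq]])
  qed
  have fh: "var 0 ^ t * f T - h T \<in> I" if T: "T \<in> cells n (Suc k)" for T
  proof -
    have "kd xv ws z T = kd xv ws (\<lambda>T. (x0 ^^ t) (z1 T) + z2 T) T"
      by (rule kd_cong[OF ops_xv _ T]) (simp only: z12)
    also have "\<dots> = (x0 ^^ t) (kd xv ws z1 T) + kd xv ws z2 T"
      by (simp only: kd_add[OF ops_xv] mult)
    finally have "var 0 ^ t * f T - h T = y T - (kd xv ws z T + (x0 ^^ t) (v T))"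
      by (simp add: f_def h_def y_def x0t algebra_simps)
    then show ?thesis using yvz T by (simp add: chn_def)
  qed
  have "\<forall>T\<in>cells n (Suc k). \<exists>s. s \<in> S (e - 1) \<and> f T - s \<in> I"
  proof
    fix T assume T: "T \<in> cells n (Suc k)"
    have "f T \<in> G (e - 1)" "h T \<in> G (e - 1 + int t) \<inter> Dx t" using fG hG T by (simp_all add: chn_def)
    from filtration_strict[OF this fh[OF T]] show "\<exists>s. s \<in> S (e - 1) \<and> f T - s \<in> I" by blast
  qed
  then obtain s where s: "\<forall>T\<in>cells n (Suc k). s T \<in> S (e - 1) \<and> f T - s T \<in> I"
    by (rule bchoice[THEN exE])
  have sS: "chn n (Suc k) (S (e - 1)) s" using s by (simp add: chn_def)
  have "chn n (Suc k) (II (e - 1)) (\<lambda>T. f T - s T)"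
    using s fG SG[of "e - 1"] by (auto simp: chn_def intro!: gr_diff)
  from chn_kd_diff[OF ops_xv gmI this]
  have fs: "chn n k (II e) (\<lambda>T. kd xv ws f T - kd xv ws s T)" by simp
  have "kd xv ws f T = kd xv ws w T - kd xv ws v T" for T
    unfolding f_def kd_diff[OF ops_xv] kd_kd[OF ops_xv] by simp
  then have "chn n k (II e) (\<lambda>T. kd xv ws w T - kd xv ws s T)"
    using chn_add[OF gmI fs, of "kd xv ws v"] v(2) by (simp add: cyc_Suc algebra_simps)
  from chn_add[OF gmI w(2) this]
  have \<omega>s: "chn n k (II e) (\<lambda>T. \<omega> T - kd xv ws s T)" by simp
  have "chn n k (igr W J e) (\<lambda>T. \<omega> T - kd xv ws s T)"
    unfolding chn_def
  proof
    fix T assume T: "T \<in> cells n k"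
    have "kd xv ws s T \<in> S (e - 1 + 1)" using kd_chn[OF gmS sS] T by (simp add: chn_def)
    then have "\<omega> T - kd xv ws s T \<in> S e" using \<omega>(1) T by (auto simp: chn_def intro: gr_diff)
    then show "\<omega> T - kd xv ws s T \<in> igr W J e" using \<omega>s T by (intro S_I) (simp_all add: chn_def)
  qed
  then show "\<exists>\<eta>. chn n (Suc k) (S (e - 1)) \<eta> \<and> chn n k (igr W J e) (\<lambda>T. \<omega> T - kd xv ws \<eta> T)"
    using sS by (intro exI conjI)
qed

lemma tor_vanishes_elimination:
  assumes "k < p" "2 \<le> j"
  shows "tor_vanishes W J k (k + j)"
  by (rule tor_vanishes_of_koszul[OF distinct_ws set_ws(1) J_hom_ideal koszul_elimination assms])

end

section \<open>Substitution homomorphisms\<close>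

definition rhom :: "('a::comm_ring_1 \<Rightarrow> 'b::comm_ring_1) \<Rightarrow> bool" where
  "rhom \<phi> \<longleftrightarrow> \<phi> 1 = 1 \<and> (\<forall>a b. \<phi> (a + b) = \<phi> a + \<phi> b) \<and> (\<forall>a b. \<phi> (a * b) = \<phi> a * \<phi> b)"

lemma rhomI: "\<phi> 1 = 1 \<Longrightarrow> (\<And>a b. \<phi> (a + b) = \<phi> a + \<phi> b) \<Longrightarrow> (\<And>a b. \<phi> (a * b) = \<phi> a * \<phi> b) \<Longrightarrow> rhom \<phi>"
  by (simp add: rhom_def)

lemma rhomD: "rhom \<phi> \<Longrightarrow> \<phi> 1 = 1" "rhom \<phi> \<Longrightarrow> \<phi> (a + b) = \<phi> a + \<phi> b" "rhom \<phi> \<Longrightarrow> \<phi> (a * b) = \<phi> a * \<phi> b"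
  by (simp_all add: rhom_def)

lemma rhom_zero: "rhom \<phi> \<Longrightarrow> \<phi> 0 = 0"
  using rhomD(2)[of \<phi> 0 0] by simp

lemma rhom_uminus: "rhom \<phi> \<Longrightarrow> \<phi> (- a) = - \<phi> a"
  using rhomD(2)[of \<phi> a "- a"] by (simp add: rhom_zero eq_neg_iff_add_eq_0 add.commute)

lemma rhom_diff: "rhom \<phi> \<Longrightarrow> \<phi> (a - b) = \<phi> a - \<phi> b"
  using rhomD(2)[of \<phi> a "- b"] by (simp add: rhom_uminus)

lemma rhom_sum: "rhom \<phi> \<Longrightarrow> \<phi> (sum f A) = (\<Sum>a\<in>A. \<phi> (f a))"
  by (induction A rule: infinite_finite_induct) (simp_all add: rhom_zero rhomD)

lemma rhom_power: "rhom \<phi> \<Longrightarrow> \<phi> (a ^ n) = \<phi> a ^ n"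
  by (induction n) (simp_all add: rhomD)

lemma rhom_prod: "rhom \<phi> \<Longrightarrow> \<phi> (prod f A) = (\<Prod>a\<in>A. \<phi> (f a))"
  by (induction A rule: infinite_finite_induct) (simp_all add: rhomD)

lemma rhom_comp: "rhom \<phi> \<Longrightarrow> rhom \<psi> \<Longrightarrow> rhom (\<lambda>a. \<psi> (\<phi> a))"
  by (simp add: rhom_def)

lemma rhom_id: "rhom (\<lambda>a. a)"
  by (simp add: rhom_def)

lemma rhom_const: "rhom (const :: 'k::field \<Rightarrow> 'k mpoly)"
  by (simp add: rhom_def const_add const_mult)

lemma rhom_coef_0: "rhom (\<lambda>f :: 'k::field mpoly. coef f 0)"
  by (simp add: rhom_def lookup_add coef_mult_0)

definition mval :: "(nat \<Rightarrow> 'a::comm_ring_1) \<Rightarrow> (nat \<Rightarrow>\<^sub>0 nat) \<Rightarrow> 'a" where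
  "mval x m = (\<Prod>i\<in>supp m. x i ^ coef m i)"

lemma mval_superset: "finite A \<Longrightarrow> supp m \<subseteq> A \<Longrightarrow> mval x m = (\<Prod>i\<in>A. x i ^ coef m i)"
  unfolding mval_def by (intro prod.mono_neutral_left) (auto simp: in_keys_iff)

lemma mval_zero [simp]: "mval x 0 = 1"
  by (simp add: mval_def)

lemma mval_add: "mval x (a + b) = mval x a * mval x b"
proof -
  let ?A = "supp a \<union> supp b"
  have "mval x (a + b) = (\<Prod>i\<in>?A. x i ^ coef (a + b) i)"
    by (intro mval_superset) (simp_all add: supp_monom_add)
  moreover have "mval x a = (\<Prod>i\<in>?A. x i ^ coef a i)" by (intro mval_superset) auto
  moreover have "mval x b = (\<Prod>i\<in>?A. x i ^ coef b i)" by (intro mval_superset) auto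
  ultimately show ?thesis by (simp add: lookup_add power_add prod.distrib)
qed

lemma mval_cong: "(\<And>i. i \<in> supp m \<Longrightarrow> x i = y i) \<Longrightarrow> mval x m = mval y m"
  unfolding mval_def by (intro prod.cong) auto

lemma eval_via_mval: "eval_via h x f = (\<Sum>m\<in>supp f. h (coef f m) * mval x m)"
  by (simp add: eval_via_def mval_def)

lemma eval_via_superset:
  "rhom h \<Longrightarrow> finite A \<Longrightarrow> supp f \<subseteq> A \<Longrightarrow> eval_via h x f = (\<Sum>m\<in>A. h (coef f m) * mval x m)"
  unfolding eval_via_mval by (intro sum.mono_neutral_left) (auto simp: in_keys_iff rhom_zero)

lemma eval_via_single: "rhom h \<Longrightarrow> eval_via h x (Poly_Mapping.single m c) = h c * mval x m"
  by (subst eval_via_superset[of h "{m}"]) auto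

lemma eval_via_add: "rhom h \<Longrightarrow> eval_via h x (f + g) = eval_via h x f + eval_via h x g"
proof -
  assume h: "rhom h"
  let ?A = "supp f \<union> supp g"
  have "eval_via h x (f + g) = (\<Sum>m\<in>?A. h (coef (f + g) m) * mval x m)"
    using Poly_Mapping.keys_add[of f g] by (intro eval_via_superset[OF h]) auto
  moreover have "eval_via h x f = (\<Sum>m\<in>?A. h (coef f m) * mval x m)" by (intro eval_via_superset[OF h]) auto
  moreover have "eval_via h x g = (\<Sum>m\<in>?A. h (coef g m) * mval x m)" by (intro eval_via_superset[OF h]) auto
  ultimately show ?thesis by (simp add: lookup_add rhomD(2)[OF h] distrib_right sum.distrib)
qed

lemma rhom_eval_via:
  fixes h :: "'k::field \<Rightarrow> 'a::comm_ring_1"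
  assumes h: "rhom h"
  shows "rhom (eval_via h x)"
proof (rule rhomI)
  have 1: "(1 :: 'k mpoly) = Poly_Mapping.single 0 1" by simp
  show "eval_via h x 1 = 1"
    unfolding 1 by (subst eval_via_single[OF h]) (simp add: rhomD(1)[OF h])
  show "eval_via h x (f + g) = eval_via h x f + eval_via h x g" for f g by (rule eval_via_add[OF h])
  show "eval_via h x (f * g) = eval_via h x f * eval_via h x g" for f g
  proof (induction f rule: mpoly_induct)
    case (monom m c)
    show ?case
    proof (induction g rule: mpoly_induct)
      case (monom m' c')
      show ?case
        by (simp add: mult_single eval_via_single[OF h] mval_add rhomD(3)[OF h])
    next
      case (add f g)
      then show ?case by (simp add: distrib_left eval_via_add[OF h])
    qed
  next
    case (add f1 f2)
    then show ?case by (simp add: distrib_right eval_via_add[OF h])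
  qed
qed

lemma eval_via_const: "rhom h \<Longrightarrow> eval_via h x (const c) = h c"
  by (simp add: const_def eval_via_single)

lemma eval_via_var: "rhom h \<Longrightarrow> eval_via h x (var i) = x i"
  by (simp add: var_def eval_via_single rhomD mval_def)

lemma var_power: "var i ^ n = (Poly_Mapping.single (Poly_Mapping.single i n) 1 :: 'k::field mpoly)"
  by (induction n) (simp_all add: var_def mult_single single_add[symmetric])

lemma mval_var: "mval var m = (Poly_Mapping.single m 1 :: 'k::field mpoly)"
proof -
  have "(\<Prod>i\<in>A. var i ^ n i) = (Poly_Mapping.single (\<Sum>i\<in>A. Poly_Mapping.single i (n i)) 1 :: 'k mpoly)"
    if "finite A" for A and n :: "nat \<Rightarrow> nat"
    using that by induction (simp_all add: var_power mult_single)
  then show ?thesis unfolding mval_def by (simp add: sum_monomials[of m, symmetric])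
qed

text \<open>The composition laws for \<open>eval\<close> and \<open>subst\<close> are all read off
  from this normal form.\<close>

lemma rhom_unique:
  fixes \<Phi> :: "'k::field mpoly \<Rightarrow> 'a::comm_ring_1"
  assumes \<Phi>: "rhom \<Phi>"
  shows "\<Phi> f = eval_via (\<lambda>c. \<Phi> (const c)) (\<lambda>i. \<Phi> (var i)) f"
proof -
  have h: "rhom (\<lambda>c. \<Phi> (const c))" by (rule rhom_comp[OF rhom_const \<Phi>])
  show ?thesis
  proof (induction f rule: mpoly_induct)
    case (monom m c)
    have "Poly_Mapping.single m c = const c * mval var m"
      by (simp add: mval_var const_def mult_single)
    then have "\<Phi> (Poly_Mapping.single m c) = \<Phi> (const c) * mval (\<lambda>i. \<Phi> (var i)) m"
      by (simp add: rhomD(3)[OF \<Phi>] mval_def rhom_prod[OF \<Phi>] rhom_power[OF \<Phi>])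
    then show ?case by (simp add: eval_via_single[OF h])
  next
    case (add f g)
    then show ?case by (simp add: rhomD(2)[OF \<Phi>] eval_via_add[OF h])
  qed
qed

lemma eval_via_cong:
  "f \<in> polys V \<Longrightarrow> (\<And>i. i \<in> V \<Longrightarrow> x i = y i) \<Longrightarrow> eval_via h x f = eval_via h y f"
  unfolding eval_via_mval polys_def by (intro sum.cong arg_cong2[of _ _ _ _ "(*)"] mval_cong) auto

lemma rhom_eval: "rhom (eval x)"
  unfolding eval_def by (rule rhom_eval_via[OF rhom_id])

lemma rhom_subst: "rhom (subst y)"
  unfolding subst_def by (rule rhom_eval_via[OF rhom_const])

lemma eval_const [simp]: "eval x (const c) = c"
  unfolding eval_def by (rule eval_via_const[OF rhom_id])

lemma eval_var [simp]: "eval x (var i) = x i"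
  unfolding eval_def by (rule eval_via_var[OF rhom_id])

lemma subst_const [simp]: "subst y (const c) = const c"
  unfolding subst_def by (rule eval_via_const[OF rhom_const])

lemma subst_var [simp]: "subst y (var i) = y i"
  unfolding subst_def by (rule eval_via_var[OF rhom_const])

lemma eval_subst: "eval x (subst y f) = eval (\<lambda>i. eval x (y i)) f"
  using rhom_unique[OF rhom_comp[OF rhom_subst rhom_eval], of x y f] by (simp add: eval_def[symmetric])

lemma subst_subst: "subst z (subst y f) = subst (\<lambda>i. subst z (y i)) f"
  using rhom_unique[OF rhom_comp[OF rhom_subst rhom_subst], of z y f] by (simp add: subst_def[symmetric])

lemma subst_id: "subst var f = f"
  using rhom_unique[OF rhom_id, of f] by (simp add: subst_def)

lemma subst_cong: "f \<in> polys V \<Longrightarrow> (\<And>i. i \<in> V \<Longrightarrow> y i = z i) \<Longrightarrow> subst y f = subst z f"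
  unfolding subst_def by (rule eval_via_cong)

lemma eval_cong: "f \<in> polys V \<Longrightarrow> (\<And>i. i \<in> V \<Longrightarrow> x i = y i) \<Longrightarrow> eval x f = eval y f"
  unfolding eval_def by (rule eval_via_cong)

lemma subst_monomials: "subst y f = (\<Sum>m\<in>supp f. const (coef f m) * mval y m)"
  by (simp add: subst_def eval_via_mval)

lemma subst_polys:
  assumes "f \<in> polys V" "\<And>i. i \<in> V \<Longrightarrow> y i \<in> polys W"
  shows "subst y f \<in> polys W"
  unfolding subst_monomials mval_def
proof (intro polys_sum polys_mult polys_prod polys_power polys_const)
  fix m i assume "m \<in> supp f" "i \<in> supp m"
  then have "i \<in> V" using assms(1) by (auto simp: polys_def)
  then show "y i \<in> polys W" by (rule assms(2))
qed

lemma mval_gr: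
  assumes "\<And>i. i \<in> supp m \<Longrightarrow> y i \<in> gr W 1"
  shows "mval y m \<in> gr W (int (mdeg m))"
proof -
  have "(\<Prod>i\<in>A. y i ^ coef m i) \<in> gr W (int (\<Sum>i\<in>A. coef m i))" if "finite A" "A \<subseteq> supp m" for A
    using that
  proof induction
    case empty
    then show ?case using gr_const[of 1 W] by simp
  next
    case (insert i A)
    have "y i ^ coef m i \<in> gr W (int (coef m i) * 1)" using insert.prems assms by (intro gr_power) auto
    then show ?case using insert gr_mult[of "y i ^ coef m i" W "int (coef m i)" "\<Prod>i\<in>A. y i ^ coef m i"] by simp
  qed
  from this[of "supp m"] show ?thesis by (simp add: mval_def mdeg_def)
qed

lemma subst_gr:
  assumes f: "f \<in> gr V d" and y: "\<And>i. i \<in> V \<Longrightarrow> y i \<in> gr W 1"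
  shows "subst y f \<in> gr W d"
  unfolding subst_monomials
proof (rule gr_sum)
  fix m assume "m \<in> supp f"
  then have "int (mdeg m) = d" "supp m \<subseteq> V" using f by (auto simp: gr_def polys_def)
  then show "const (coef f m) * mval y m \<in> gr W d"
    using mval_gr[of m y W] y by (intro gr_const_mult) auto
qed

text \<open>The constant term is the value at the origin, and the substituted polynomials vanish
  there.\<close>

lemma coef_0_subst:
  fixes f :: "'a::field mpoly"
  assumes f: "f \<in> polys V" and y: "\<And>i. i \<in> V \<Longrightarrow> coef (y i) 0 = 0"
  shows "coef (subst y f) 0 = coef f 0"
proof -
  have "Poly_Mapping.single i (Suc 0) \<noteq> 0" for i :: nat
    using lookup_single_eq[of i "Suc 0"] by (metis lookup_zero nat.distinct(1))
  then have v: "coef (var i :: 'a mpoly) 0 = 0" for i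
    by (simp add: var_def lookup_single when_def)
  have con: "coef (const c) 0 = c" for c :: 'a by (simp add: const_def)
  have "coef (subst y f) 0 = eval_via (\<lambda>c. c) (\<lambda>i. coef (y i) 0) f"
    using rhom_unique[OF rhom_comp[OF rhom_subst rhom_coef_0], of y f] by (simp add: con)
  also have "\<dots> = eval_via (\<lambda>c. c) (\<lambda>i. coef (var i :: 'a mpoly) 0) f"
    by (rule eval_via_cong[OF f]) (simp add: y v)
  also have "\<dots> = coef f 0"
    using rhom_unique[OF rhom_coef_0, of f] by (simp add: con)
  finally show ?thesis .
qed

lemma coef_0_gr_1: "f \<in> gr V 1 \<Longrightarrow> coef f 0 = 0"
  by (rule ccontr) (force simp: gr_def in_keys_iff)

section \<open>Linear changes of coordinates\<close>

text \<open>Both mutually inverse substitutions are part of the data, so \<open>flip\<close> yields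
  every fact for the inverse as well.\<close>

locale coordinate_change =
  fixes V :: "nat set" and y z :: "nat \<Rightarrow> 'k::field mpoly"
  assumes y: "i \<in> V \<Longrightarrow> y i \<in> gr V 1" and z: "i \<in> V \<Longrightarrow> z i \<in> gr V 1"
    and zy: "i \<in> V \<Longrightarrow> subst z (y i) = var i" and yz: "i \<in> V \<Longrightarrow> subst y (z i) = var i"
begin

lemma inverse: "f \<in> polys V \<Longrightarrow> subst z (subst y f) = f" "f \<in> polys V \<Longrightarrow> subst y (subst z f) = f"
  using subst_cong[of f V "\<lambda>i. subst z (y i)" var] subst_cong[of f V "\<lambda>i. subst y (z i)" var]
  by (simp_all add: subst_subst zy yz subst_id)

lemma closed: "f \<in> polys V \<Longrightarrow> subst y f \<in> polys V" "f \<in> polys V \<Longrightarrow> subst z f \<in> polys V"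
  using gr_polys[OF y] gr_polys[OF z] by (auto intro: subst_polys)

lemma graded: "f \<in> gr V d \<Longrightarrow> subst y f \<in> gr V d" "f \<in> gr V d \<Longrightarrow> subst z f \<in> gr V d"
  by (auto intro: subst_gr y z)

lemma coef_0: "f \<in> polys V \<Longrightarrow> coef (subst y f) 0 = coef f 0"
  by (rule coef_0_subst) (auto intro: coef_0_gr_1 y)

lemma eq_0: "f \<in> polys V \<Longrightarrow> subst y f = 0 \<longleftrightarrow> f = 0"
  using inverse(1)[of f] rhom_zero[OF rhom_subst, of y] rhom_zero[OF rhom_subst, of z] by auto

lemma flip: "coordinate_change V z y"
  by unfold_locales (auto intro: y z simp: zy yz)

lemma mem_image: "I \<subseteq> polys V \<Longrightarrow> f \<in> polys V \<Longrightarrow> subst y f \<in> subst y ` I \<longleftrightarrow> f \<in> I"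
  using inverse(1) by (metis (no_types, lifting) imageE image_eqI subset_iff)

lemma image_eq: "I \<subseteq> polys V \<Longrightarrow> f \<in> polys V \<Longrightarrow> f \<in> subst y ` I \<longleftrightarrow> subst z f \<in> I"
  using mem_image[of I "subst z f"] closed(2)[of f] inverse(2)[of f] by simp

lemma is_ideal_image:
  assumes "is_ideal V I"
  shows "is_ideal V (subst y ` I)"
  unfolding is_ideal_def
proof (intro conjI ballI)
  note I = is_idealD[OF assms]
  show "subst y ` I \<subseteq> polys V" using I(1) closed(1) by blast
  show "0 \<in> subst y ` I" using I(2) rhom_zero[OF rhom_subst] by (metis image_eqI)
  show "f + g \<in> subst y ` I" if fg: "f \<in> subst y ` I" "g \<in> subst y ` I" for f g
  proof -
    obtain f' g' where fg: "f' \<in> I" "g' \<in> I" "f = subst y f'" "g = subst y g'"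
      using fg by blast
    have "f + g = subst y (f' + g')" by (simp add: rhomD(2)[OF rhom_subst] fg)
    then show ?thesis using I(3)[OF fg(1,2)] by blast
  qed
  show "r * f \<in> subst y ` I" if r: "r \<in> polys V" and f: "f \<in> subst y ` I" for r f
  proof -
    obtain g where g: "g \<in> I" "f = subst y g" using f by blast
    have "r * f = subst y (subst z r * g)" by (simp add: rhomD(3)[OF rhom_subst] inverse(2)[OF r] g(2))
    then show ?thesis using I(4)[OF closed(2)[OF r] g(1)] by blast
  qed
qed

lemma hc_subst:
  assumes "f \<in> polys V"
  shows "hc d (subst y f) = subst y (hc d f)"
proof -
  define D where "D = (\<lambda>m. int (mdeg m)) ` supp f"
  have f: "f = (\<Sum>e\<in>D. hc e f)" by (rule sum_hc) (auto simp: D_def)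
  have t: "hc d (subst y (hc e f)) = (if e = d then subst y (hc e f) else 0)" for e
    using hc_id[OF graded(1)[OF hc_gr[OF assms]], of d] hc_other[OF graded(1)[OF hc_gr[OF assms]], of e d] by auto
  have "hc d (subst y f) = hc d (subst y (\<Sum>e\<in>D. hc e f))" using f by simp
  also have "\<dots> = (\<Sum>e\<in>D. hc d (subst y (hc e f)))" by (simp add: rhom_sum[OF rhom_subst] hc_sum)
  also have "\<dots> = (if d \<in> D then subst y (hc d f) else 0)"
    unfolding t by (simp add: D_def sum.delta)
  also have "\<dots> = subst y (hc d f)"
  proof (cases "d \<in> D")
    case False
    then have "hc d f = 0" unfolding hc_def by (intro part_none) (auto simp: D_def)
    then show ?thesis using False by (simp add: rhom_zero[OF rhom_subst])
  qed simp
  finally show ?thesis .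
qed

lemma hom_ideal_image:
  assumes "hom_ideal V I"
  shows "hom_ideal V (subst y ` I)"
proof -
  have "hc d f \<in> subst y ` I" if "f \<in> subst y ` I" for f d
  proof -
    obtain g where g: "g \<in> I" "f = subst y g" using \<open>f \<in> subst y ` I\<close> by blast
    have "g \<in> polys V" using g(1) is_idealD(1)[OF hom_idealD(1)[OF assms]] by blast
    then show ?thesis using hom_idealD(2)[OF assms g(1), of d] by (simp add: g(2) hc_subst)
  qed
  then show ?thesis using is_ideal_image[OF hom_idealD(1)[OF assms]] by (simp add: hom_ideal_def)
qed

lemma free_module_subst:
  assumes "u \<in> free_module V B"
  shows "(\<lambda>b. subst y (u b)) \<in> free_module V B" "{b. subst y (u b) \<noteq> 0} = {b. u b \<noteq> 0}"
proof -
  show *: "{b. subst y (u b) \<noteq> 0} = {b. u b \<noteq> 0}" using free_moduleD(1)[OF assms] eq_0 by blast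
  show "(\<lambda>b. subst y (u b)) \<in> free_module V B"
    using assms unfolding free_module_def by (simp add: * closed(1))
qed

lemma free_map_subst:
  assumes "u \<in> free_module V B"
  shows "free_map (\<lambda>b c. subst y (M b c)) (\<lambda>b. subst y (u b)) = (\<lambda>c. subst y (free_map M u c))"
  unfolding free_map_def free_module_subst(2)[OF assms]
  by (simp add: rhom_sum[OF rhom_subst] rhomD(3)[OF rhom_subst])

lemma free_module_image: "(free_module V B :: (nat \<Rightarrow> 'k mpoly) set) = (\<lambda>u b. subst y (u b)) ` free_module V B"
proof
  show "(\<lambda>u b. subst y (u b)) ` free_module V B \<subseteq> (free_module V B :: (nat \<Rightarrow> 'k mpoly) set)" using free_module_subst(1) by blast
  show "(free_module V B :: (nat \<Rightarrow> 'k mpoly) set) \<subseteq> (\<lambda>u b. subst y (u b)) ` free_module V B"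
  proof
    fix u :: "nat \<Rightarrow> 'k mpoly" assume u: "u \<in> free_module V B"
    have "u = (\<lambda>b. subst y (subst z (u b)))" using free_moduleD(1)[OF u] by (simp add: inverse(2))
    then show "u \<in> (\<lambda>u b. subst y (u b)) ` free_module V B"
      by (rule image_eqI[where f = "\<lambda>u b. subst y (u b)" and x = "\<lambda>b. subst z (u b)"])
        (rule coordinate_change.free_module_subst(1)[OF flip u])
  qed
qed

text \<open>Substituting in all matrix entries transports the resolution. Linear forms have no
  constant term, so the constant parts of the entries, and with them the complex computing Tor, stay
  the same.\<close>

lemma tor_vanishes_image:
  assumes I: "is_ideal V I" and "tor_vanishes V I i e"
  shows "tor_vanishes V (subst y ` I) i e"
proof -
  obtain B d M a where res: "graded_free_resolution V I B d M a"
    and tor: "tor_cycles B d M i e = tor_boundaries B d M i e"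
    using assms(2) by (auto simp: tor_vanishes_def)
  define M' where "M' = (\<lambda>i b c. subst y (M i b c))"
  define a' where "a' = (\<lambda>b. subst y (a b))"
  have IV: "I \<subseteq> polys V" by (rule is_idealD(1)[OF I])
  have a: "a b \<in> forms V (d 0 b)" if "b \<in> B 0" for b using res that by (simp add: graded_free_resolution_def)
  have gm: "graded_map V (B (Suc n)) (d (Suc n)) (B n) (d n) (M n)" for n
    using res by (simp add: graded_free_resolution_def)
  have aug: "aug a' (\<lambda>b. subst y (u b)) = subst y (aug a u)" if "u \<in> free_module V (B 0)" for u
    unfolding aug_def free_module_subst(2)[OF that]
    by (simp add: a'_def rhom_sum[OF rhom_subst] rhomD(3)[OF rhom_subst])
  have augV: "aug a u \<in> polys V" if "u \<in> free_module V (B 0)" for u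
    unfolding aug_def using free_moduleD(1,3)[OF that] a
    by (intro polys_sum polys_mult) (auto simp: forms_def)
  have fm: "free_map (M' n) (\<lambda>b. subst y (u b)) = (\<lambda>c. subst y (free_map (M n) u c))"
    if "u \<in> free_module V (B (Suc n))" for n u
    unfolding M'_def by (rule free_map_subst[OF that])
  have fmV: "free_map (M n) u \<in> free_module V (B n)" if "u \<in> free_module V (B (Suc n))" for n u
    using free_map_in[OF graded_mapD(1)[OF gm] that] .
  have im: "free_map (M' n) ` free_module V (B (Suc n)) =
      (\<lambda>u b. subst y (u b)) ` free_map (M n) ` free_module V (B (Suc n))" for n
    by (subst free_module_image) (auto simp: image_image fm)
  have "graded_free_resolution V (subst y ` I) B d M' a'"
    unfolding graded_free_resolution_def
  proof (intro conjI ballI allI)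
    show "a' b \<in> forms V (d 0 b)" if "b \<in> B 0" for b
      using graded(1)[of "a b" "int (d 0 b)"] a[OF that] by (simp add: gr_of_nat a'_def)
    show "graded_map V (B (Suc n)) (d (Suc n)) (B n) (d n) (M' n)" for n
    proof (rule graded_mapI)
      fix b assume b: "b \<in> B (Suc n)"
      show "M' n b \<in> gF V (B n) (d n) (int (d (Suc n) b))"
        unfolding M'_def
        by (rule gFI[OF free_module_subst(1)[OF graded_mapD(1)[OF gm b]] graded(1)[OF graded_mapD(2)[OF gm b]]])
    qed
    show "\<exists>u\<in>free_module V (B 0). f - (\<Sum>b\<in>{b. u b \<noteq> 0}. u b * a' b) \<in> subst y ` I" if f: "f \<in> polys V" for f
    proof -
      obtain u where u: "u \<in> free_module V (B 0)" "subst z f - aug a u \<in> I"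
        using res closed(2)[OF f] unfolding graded_free_resolution_def aug_def by blast
      have "f - aug a' (\<lambda>b. subst y (u b)) = subst y (subst z f - aug a u)"
        by (simp add: aug[OF u(1)] rhom_diff[OF rhom_subst] inverse(2)[OF f])
      then have "f - aug a' (\<lambda>b. subst y (u b)) \<in> subst y ` I" using u(2) by simp
      then show ?thesis unfolding aug_def by (rule bexI[OF _ free_module_subst(1)[OF u(1)]])
    qed
    have "aug a' (\<lambda>b. subst y (u b)) \<in> subst y ` I \<longleftrightarrow> aug a u \<in> I" if "u \<in> free_module V (B 0)" for u
      by (simp only: aug[OF that] mem_image[OF IV augV[OF that]])
    then have "{u \<in> free_module V (B 0). aug a' u \<in> subst y ` I} =
        (\<lambda>u b. subst y (u b)) ` {u \<in> free_module V (B 0). aug a u \<in> I}"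
      by (subst (1) free_module_image) auto
    then show "{u \<in> free_module V (B 0). (\<Sum>b\<in>{b. u b \<noteq> 0}. u b * a' b) \<in> subst y ` I} =
        free_map (M' 0) ` free_module V (B 1)"
      using res im[of 0] unfolding graded_free_resolution_def aug_def by simp
    show "{u \<in> free_module V (B (Suc n)). free_map (M' n) u = (\<lambda>_. 0)} =
        free_map (M' (Suc n)) ` free_module V (B (Suc (Suc n)))" for n
    proof -
      have "free_map (M' n) (\<lambda>b. subst y (u b)) = (\<lambda>_. 0) \<longleftrightarrow> free_map (M n) u = (\<lambda>_. 0)"
        if "u \<in> free_module V (B (Suc n))" for u
        using free_moduleD(1)[OF fmV[OF that]] eq_0 by (simp add: fm[OF that] fun_eq_iff)
      then have "{u \<in> free_module V (B (Suc n)). free_map (M' n) u = (\<lambda>_. 0)} =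
          (\<lambda>u b. subst y (u b)) ` {u \<in> free_module V (B (Suc n)). free_map (M n) u = (\<lambda>_. 0)}"
        by (subst (1) free_module_image) auto
      then show ?thesis using res im[of "Suc n"] unfolding graded_free_resolution_def by simp
    qed
  qed
  moreover have mv: "free_map (mod_vars (M' n)) v = free_map (mod_vars (M n)) v" if v: "v \<in> strand B d (Suc n) e" for n v
  proof
    fix c
    show "free_map (mod_vars (M' n)) v c = free_map (mod_vars (M n)) v c"
      unfolding free_map_def
    proof (rule sum.cong)
      fix b assume "b \<in> {b. v b \<noteq> 0}"
      then have "b \<in> B (Suc n)" using v by (auto simp: strand_def)
      then have "M n b c \<in> polys V" by (intro gr_polys[OF graded_mapD(2)[OF gm]])
      then show "v b * mod_vars (M' n) b c = v b * mod_vars (M n) b c"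
        by (simp add: mod_vars_def M'_def coef_0)
    qed simp
  qed
  have "tor_cycles B d M' i e = tor_cycles B d M i e"
    unfolding tor_cycles_def using mv by (cases i) auto
  moreover have "tor_boundaries B d M' i e = tor_boundaries B d M i e"
    unfolding tor_boundaries_def using mv by (auto intro: image_cong)
  ultimately show ?thesis using tor unfolding tor_vanishes_def by metis
qed

end

section \<open>Orders of vanishing\<close>

text \<open>The n-th power of the ideal of all variables.\<close>

definition ordm :: "nat \<Rightarrow> 'k::field mpoly set" where
  "ordm n = {f. \<forall>m\<in>supp f. n \<le> mdeg m}"

lemma ordm_zero [simp]: "0 \<in> ordm n" by (simp add: ordm_def)
lemma ordm_0 [simp]: "f \<in> ordm 0" by (simp add: ordm_def)

lemma ordm_add: "f \<in> ordm n \<Longrightarrow> g \<in> ordm n \<Longrightarrow> f + g \<in> ordm n"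
  using Poly_Mapping.keys_add[of f g] by (auto simp: ordm_def)

lemma ordm_uminus: "f \<in> ordm n \<Longrightarrow> - f \<in> ordm n"
  by (simp add: ordm_def in_keys_iff)

lemma ordm_diff: "f \<in> ordm n \<Longrightarrow> g \<in> ordm n \<Longrightarrow> f - g \<in> ordm n"
  using ordm_add[of f n "- g"] ordm_uminus[of g n] by simp

lemma ordm_mult: "f \<in> ordm a \<Longrightarrow> g \<in> ordm b \<Longrightarrow> f * g \<in> ordm (a + b)"
  unfolding ordm_def by (auto elim!: supp_mult_elim simp: mdeg_add add_mono)

lemma ordm_mult_right: "f \<in> ordm n \<Longrightarrow> f * g \<in> ordm n"
  using ordm_mult[of f n g 0] by simp

lemma ordm_mult_left: "f \<in> ordm n \<Longrightarrow> g * f \<in> ordm n"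
  using ordm_mult[of g 0 f n] by simp

lemma ordm_mono: "f \<in> ordm n \<Longrightarrow> k \<le> n \<Longrightarrow> f \<in> ordm k"
  by (auto simp: ordm_def)

lemma ordm_sum: "(\<And>a. a \<in> A \<Longrightarrow> f a \<in> ordm n) \<Longrightarrow> sum f A \<in> ordm n"
  by (induction A rule: infinite_finite_induct) (auto intro: ordm_add)

lemma ordm_gr: "f \<in> gr V (int n) \<Longrightarrow> f \<in> ordm n"
  by (auto simp: ordm_def gr_def)

lemma ordm_var: "var i \<in> ordm 1"
  by (simp add: ordm_def var_def)

lemma monomial_induct [case_names zero add]:
  assumes "P 0" "\<And>m j. supp m \<subseteq> V \<Longrightarrow> j \<in> V \<Longrightarrow> P m \<Longrightarrow> P (m + Poly_Mapping.single j (Suc 0))"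
    and "supp m \<subseteq> V"
  shows "P (m :: nat \<Rightarrow>\<^sub>0 nat)"
  using assms(3)
proof (induction "mdeg m" arbitrary: m)
  case 0
  then show ?case using assms(1) by (simp add: mdeg_eq_0_iff)
next
  case (Suc n)
  then have "supp m \<noteq> {}" by (auto simp: mdeg_def)
  then obtain j where j: "j \<in> supp m" by blast
  then have "0 < coef m j" by (simp add: in_keys_iff)
  then obtain m' where m: "m = Poly_Mapping.single j (Suc 0) + m'" using monom_split by blast
  have "mdeg m' = n" using Suc.hyps(2) by (simp add: m mdeg_add)
  moreover have "supp m' \<subseteq> V" using Suc.prems by (simp add: m supp_monom_add)
  ultimately have "P (m' + Poly_Mapping.single j (Suc 0))"
    using Suc.hyps(1) assms(2) j Suc.prems by blast
  then show ?case by (simp add: m add.commute)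
qed

lemma mval_single: "mval x (Poly_Mapping.single j (Suc 0)) = x j"
  by (simp add: mval_def)

text \<open>To first order s is the identity, so it preserves the part of lowest degree.\<close>

lemma substitution_lead:
  fixes s :: "nat \<Rightarrow> 'k::field mpoly"
  assumes s: "\<And>i. s i - var i \<in> ordm 2"
  shows "f \<in> ordm n \<Longrightarrow> subst s f - f \<in> ordm (Suc n)"
proof -
  have mono: "mval s m - mval var m \<in> ordm (Suc (mdeg m))" for m
  proof (induction rule: monomial_induct[where V = UNIV])
    case (add m j)
    have e: "mval s (m + Poly_Mapping.single j (Suc 0)) - mval var (m + Poly_Mapping.single j (Suc 0)) =
        (mval s m - mval var m) * s j + mval var m * (s j - var j)"
      by (simp add: mval_add mval_single algebra_simps)
    have sj: "s j \<in> ordm 1"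
      using ordm_add[OF ordm_mono[OF s[of j], of 1] ordm_var[of j]] by simp
    have "mval var m \<in> (ordm (mdeg m) :: 'k mpoly set)"
      by (simp add: mval_var ordm_def)
    then have "mval var m * (s j - var j) \<in> ordm (mdeg m + 2)" by (rule ordm_mult[OF _ s])
    moreover have "(mval s m - mval var m) * s j \<in> ordm (Suc (mdeg m) + 1)"
      by (rule ordm_mult[OF add(3) sj])
    ultimately show ?case unfolding e by (simp add: mdeg_add ordm_add)
  qed simp_all
  assume f: "f \<in> ordm n"
  have "subst s f - f = subst s f - subst var f" by (simp add: subst_id)
  also have "\<dots> = (\<Sum>m\<in>supp f. const (coef f m) * (mval s m - mval var m))"
    by (simp add: subst_monomials sum_subtractf right_diff_distrib)
  also have "\<dots> \<in> ordm (Suc n)"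
  proof (rule ordm_sum)
    fix m assume "m \<in> supp f"
    then have "n \<le> mdeg m" using f by (simp add: ordm_def)
    then show "const (coef f m) * (mval s m - mval var m) \<in> ordm (Suc n)"
      by (intro ordm_mult_left ordm_mono[OF mono]) simp
  qed
  finally show ?thesis .
qed

text \<open>The error r - s(r') is its own preimage to leading order; adding it to r' raises the
  order of the error by one.\<close>

lemma substitution_surj:
  assumes "\<And>i. s i - var i \<in> ordm 2"
  shows "\<exists>r'. r - subst s r' \<in> ordm n"
proof (induction n)
  case (Suc n)
  then obtain r' where r': "r - subst s r' \<in> ordm n" by blast
  have "r - subst s (r' + (r - subst s r')) = - (subst s (r - subst s r') - (r - subst s r'))"
    by (simp add: rhomD(2)[OF rhom_subst])
  also have "\<dots> \<in> ordm (Suc n)" by (intro ordm_uminus substitution_lead[OF assms r'])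
  finally show ?case by blast
qed simp

text \<open>
  If the linear parts of the generators are the variables in \<open>U\<close>, then the initial form of an element
  of the ideal lies in the ideal generated by \<open>U\<close>: substituting the generators for these variables is
  an automorphism modulo any power of the maximal ideal, and it is the identity on initial forms.
\<close>

lemma initial_form_mon:
  fixes g :: "'k::field mpoly"
  assumes U: "finite U" and s: "\<And>i. i \<in> U \<Longrightarrow> s i - var i \<in> ordm 2"
    and g: "g \<in> gr V (int n)" "a \<noteq> 0"
    and rep: "const a * g - (\<Sum>i\<in>U. r i * s i) \<in> ordm (Suc n)"
  shows "g \<in> mon U"
proof -
  define s' where "s' = (\<lambda>i. if i \<in> U then s i else var i)"
  have s': "s' i - var i \<in> ordm 2" for i using s by (simp add: s'_def)
  obtain r' where r': "\<And>i. r i - subst s' (r' i) \<in> ordm (Suc n)"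
    using substitution_surj[OF s', of "r _" "Suc n"] by metis
  define F where "F = (\<Sum>i\<in>U. r' i * var i)"
  have "subst s' F = (\<Sum>i\<in>U. subst s' (r' i) * s i)"
    by (simp add: F_def rhom_sum[OF rhom_subst] rhomD(3)[OF rhom_subst] s'_def)
  then have "(\<Sum>i\<in>U. r i * s i) - subst s' F = (\<Sum>i\<in>U. (r i - subst s' (r' i)) * s i)"
    by (simp add: sum_subtractf left_diff_distrib)
  also have "\<dots> \<in> ordm (Suc n)" by (intro ordm_sum ordm_mult_right r')
  finally have gF: "const a * g - subst s' F \<in> ordm (Suc n)"
    using ordm_add[OF rep] by fastforce
  have ag: "const a * g \<in> ordm n" by (intro ordm_mult_left ordm_gr[OF g(1)])
  have sF: "subst s' F \<in> ordm n" using ordm_diff[OF ag ordm_mono[OF gF, of n]] by simp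
  \<comment> \<open>If F has order k < n, it differs from its image, which has order n, only in
    order k + 1; so F has order k + 1 too.\<close>
  have "F \<in> ordm k" if "k \<le> n" for k
    using that
  proof (induction k)
    case (Suc k)
    have "subst s' F - F \<in> ordm (Suc k)" using Suc by (intro substitution_lead[OF s']) simp
    from ordm_diff[OF ordm_mono[OF sF Suc.prems] this] show ?case by simp
  qed simp
  then have "subst s' F - F \<in> ordm (Suc n)" by (intro substitution_lead[OF s']) simp
  from ordm_add[OF gF this] have gF': "const a * g - F \<in> ordm (Suc n)" by simp
  have "F \<in> mon U" unfolding F_def by (intro mon_sum) (simp add: mult.commute mon_var)
  have "m \<in> supp F" if "m \<in> supp g" for m
  proof (rule ccontr)
    assume "m \<notin> supp F"
    then have "coef (const a * g - F) m = a * coef g m"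
      by (simp add: lookup_minus coef_const_mult in_keys_iff)
    then have "m \<in> supp (const a * g - F)" using that g(2) by (simp add: in_keys_iff)
    moreover have "mdeg m = n" using that g(1) by (simp add: gr_def)
    ultimately show False using gF' by (auto simp: ordm_def)
  qed
  then show ?thesis using \<open>F \<in> mon U\<close> by (simp add: mon_def)
qed

section \<open>Taylor expansion to first order\<close>

text \<open>The value at q of the i-th partial derivative of a monomial; for exponent 0 the
  truncated subtraction is masked by the factor 0.\<close>

definition dmono :: "(nat \<Rightarrow> 'k::field) \<Rightarrow> nat \<Rightarrow> (nat \<Rightarrow>\<^sub>0 nat) \<Rightarrow> 'k" where
  "dmono q i m = of_nat (coef m i) * mval q (m - Poly_Mapping.single i 1)"

lemma eval_partial_deriv: "eval q (partial_deriv i f) = (\<Sum>m\<in>supp f. coef f m * dmono q i m)"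
  unfolding partial_deriv_def rhom_sum[OF rhom_eval]
  by (simp add: eval_def eval_via_single[OF rhom_id] dmono_def mult.commute mult.left_commute mult.assoc)

lemma eval_mval: "eval q f = (\<Sum>m\<in>supp f. coef f m * mval q m)"
  by (simp add: eval_def eval_via_mval)

lemma dmono_mult: "q i * dmono q i m = of_nat (coef m i) * mval q m"
proof (cases "coef m i = 0")
  case False
  then obtain m' where m: "m = Poly_Mapping.single i (Suc 0) + m'" using monom_split by blast
  then show ?thesis by (simp add: dmono_def mval_add mval_single)
qed (simp add: dmono_def)

text \<open>Leibniz rule for multiplication by x_j.\<close>

lemma dmono_add_single:
  "dmono q i (m + Poly_Mapping.single j (Suc 0)) = dmono q i m * q j + (if i = j then mval q m else 0)"
proof (cases "i = j")
  case True
  have "dmono q i (m + Poly_Mapping.single i (Suc 0)) = of_nat (Suc (coef m i)) * mval q m"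
    by (simp add: dmono_def lookup_add)
  then show ?thesis using True dmono_mult[of q i m] by (simp add: algebra_simps)
next
  case False
  then have c: "coef (m + Poly_Mapping.single j (Suc 0)) i = coef m i"
    by (simp add: lookup_add lookup_single)
  show ?thesis
  proof (cases "coef m i = 0")
    case True
    then show ?thesis using False c by (simp add: dmono_def)
  next
    case m0: False
    then obtain m' where m: "m = Poly_Mapping.single i (Suc 0) + m'" using monom_split by blast
    then have "m + Poly_Mapping.single j (Suc 0) - Poly_Mapping.single i (Suc 0) = m' + Poly_Mapping.single j (Suc 0)"
      by (simp add: add.assoc)
    then show ?thesis using False c m by (simp add: dmono_def mval_add mval_single)
  qed
qed

text \<open>Euler's formula, monomial by monomial. For a form vanishing at q it makes the gradient
  at q orthogonal to q.\<close>

lemma euler: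
  fixes g :: "'k::field mpoly"
  assumes "finite V" "g \<in> gr V (int d)"
  shows "(\<Sum>i\<in>V. q i * eval q (partial_deriv i g)) = of_nat d * eval q g"
proof -
  have "(\<Sum>i\<in>V. q i * eval q (partial_deriv i g)) = (\<Sum>m\<in>supp g. \<Sum>i\<in>V. q i * (coef g m * dmono q i m))"
    unfolding eval_partial_deriv sum_distrib_left by (rule sum.swap)
  also have "\<dots> = (\<Sum>m\<in>supp g. of_nat d * (coef g m * mval q m))"
  proof (rule sum.cong)
    fix m assume "m \<in> supp g"
    then have m: "mdeg m = d" "supp m \<subseteq> V" using assms(2) by (auto simp: gr_def polys_def)
    have "(\<Sum>i\<in>V. q i * (coef g m * dmono q i m)) = (\<Sum>i\<in>V. coef g m * (of_nat (coef m i) * mval q m))"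
      by (intro sum.cong) (simp_all add: dmono_mult[symmetric] mult.left_commute)
    also have "\<dots> = of_nat (\<Sum>i\<in>V. coef m i) * (coef g m * mval q m)"
      by (simp add: sum_distrib_left sum_distrib_right mult.left_commute)
    also have "(\<Sum>i\<in>V. coef m i) = d" using mdeg_superset[OF assms(1) m(2)] m(1) by simp
    finally show "(\<Sum>i\<in>V. q i * (coef g m * dmono q i m)) = of_nat d * (coef g m * mval q m)" .
  qed simp
  finally show ?thesis by (simp add: eval_mval sum_distrib_left)
qed

text \<open>Induction on monomials: multiplying by one more factor produces, beyond the Leibniz
  terms, only products of two linear terms and multiples of the earlier error.\<close>

lemma taylor:
  fixes v :: "nat \<Rightarrow> 'k::field mpoly"
  assumes V: "finite V" and v: "\<And>i. i \<in> V \<Longrightarrow> v i \<in> ordm 1" and f: "f \<in> polys V"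
  shows "subst (\<lambda>i. const (q i) + v i) f - (const (eval q f) + (\<Sum>i\<in>V. const (eval q (partial_deriv i f)) * v i)) \<in> ordm 2"
proof -
  let ?s = "\<lambda>i. const (q i) + v i"
  let ?L = "\<lambda>m. \<Sum>i\<in>V. const (dmono q i m) * v i"
  have mono: "mval ?s m - (const (mval q m) + ?L m) \<in> ordm 2" if "supp m \<subseteq> V" for m
  proof (rule monomial_induct[where V = V and P = "\<lambda>m. mval ?s m - (const (mval q m) + ?L m) \<in> ordm 2", OF _ _ that])
    show "mval ?s 0 - (const (mval q 0) + ?L 0) \<in> ordm 2" by (simp add: dmono_def)
  next
    fix m j assume add: "supp m \<subseteq> V" "j \<in> V" "mval ?s m - (const (mval q m) + ?L m) \<in> ordm 2"
    have L: "?L m \<in> ordm 1" using v by (intro ordm_sum ordm_mult_left)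
    have "?L (m + Poly_Mapping.single j (Suc 0)) = ?L m * const (q j) + const (mval q m) * v j"
    proof -
      have "?L (m + Poly_Mapping.single j (Suc 0)) =
          (\<Sum>i\<in>V. const (dmono q i m) * v i * const (q j) + (if i = j then const (mval q m) * v j else 0))"
        by (intro sum.cong) (auto simp: dmono_add_single const_add const_mult algebra_simps)
      then show ?thesis using add(2) V by (simp add: sum.distrib sum_distrib_right)
    qed
    then have eq: "mval ?s (m + Poly_Mapping.single j (Suc 0)) -
        (const (mval q (m + Poly_Mapping.single j (Suc 0))) + ?L (m + Poly_Mapping.single j (Suc 0))) =
        (mval ?s m - (const (mval q m) + ?L m)) * ?s j + ?L m * v j"
      by (simp add: mval_add mval_single const_mult algebra_simps)
    have "?L m * v j \<in> ordm (1 + 1)" by (rule ordm_mult[OF L v[OF add(2)]])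
    then have "?L m * v j \<in> ordm 2" by (simp only: one_add_one)
    moreover have "(mval ?s m - (const (mval q m) + ?L m)) * ?s j \<in> ordm 2"
      by (rule ordm_mult_right[OF add(3)])
    ultimately show "mval ?s (m + Poly_Mapping.single j (Suc 0)) -
        (const (mval q (m + Poly_Mapping.single j (Suc 0))) + ?L (m + Poly_Mapping.single j (Suc 0))) \<in> ordm 2"
      unfolding eq by (rule ordm_add[rotated])
  qed
  have "const (eval q f) + (\<Sum>i\<in>V. const (eval q (partial_deriv i f)) * v i) =
      (\<Sum>m\<in>supp f. const (coef f m) * (const (mval q m) + ?L m))"
  proof -
    have "(\<Sum>i\<in>V. const (eval q (partial_deriv i f)) * v i) =
        (\<Sum>i\<in>V. \<Sum>m\<in>supp f. const (coef f m) * (const (dmono q i m) * v i))"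
      by (simp add: eval_partial_deriv rhom_sum[OF rhom_const] const_mult sum_distrib_right mult.assoc)
    also have "\<dots> = (\<Sum>m\<in>supp f. const (coef f m) * ?L m)"
      by (subst sum.swap) (simp add: sum_distrib_left)
    finally show ?thesis
      by (simp add: eval_mval rhom_sum[OF rhom_const] const_mult distrib_left sum.distrib)
  qed
  then have "subst ?s f - (const (eval q f) + (\<Sum>i\<in>V. const (eval q (partial_deriv i f)) * v i)) =
      (\<Sum>m\<in>supp f. const (coef f m) * (mval ?s m - (const (mval q m) + ?L m)))"
    by (simp add: subst_monomials sum_subtractf right_diff_distrib)
  also have "\<dots> \<in> ordm 2"
    using f by (intro ordm_sum ordm_mult_left mono) (auto simp: polys_def)
  finally show ?thesis .
qed

section \<open>Linear algebra\<close>

definition triv_ker :: "nat \<Rightarrow> (nat \<Rightarrow> nat \<Rightarrow> 'k::field) \<Rightarrow> bool" where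
  "triv_ker n W \<longleftrightarrow> (\<forall>v. (\<forall>i<n. (\<Sum>j<n. W i j * v j) = 0) \<longrightarrow> (\<forall>j<n. v j = 0))"

lemma triv_ker_inverse:
  fixes W :: "nat \<Rightarrow> nat \<Rightarrow> 'k::field"
  assumes "triv_ker n W"
  obtains U where "\<And>i j. i < n \<Longrightarrow> j < n \<Longrightarrow> (\<Sum>k<n. W i k * U k j) = (if i = j then 1 else 0)"
    "\<And>i j. i < n \<Longrightarrow> j < n \<Longrightarrow> (\<Sum>k<n. U i k * W k j) = (if i = j then 1 else 0)"
proof -
  define A where "A = mat n n (\<lambda>(i, j). W i j)"
  have A: "A \<in> carrier_mat n n" by (simp add: A_def)
  have "det A \<noteq> 0"
  proof
    assume "det A = 0"
    then obtain v where v: "v \<in> carrier_vec n" "v \<noteq> 0\<^sub>v n" "A *\<^sub>v v = 0\<^sub>v n"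
      using det_0_iff_vec_prod_zero_field[OF A] by blast
    have "(\<Sum>j<n. W i j * v $ j) = 0" if "i < n" for i
    proof -
      have "(A *\<^sub>v v) $ i = (\<Sum>j<n. W i j * v $ j)"
        using that v(1) by (simp add: A_def scalar_prod_def atLeast0LessThan)
      then show ?thesis using v(3) that by simp
    qed
    then have "v $ j = 0" if "j < n" for j using assms that unfolding triv_ker_def by simp
    then have "v = 0\<^sub>v n" using v(1) by (intro eq_vecI) auto
    then show False using v(2) by blast
  qed
  from det_non_zero_imp_unit[OF A this, where b = "()"]
  obtain B where B: "B \<in> carrier_mat n n" "B * A = 1\<^sub>m n" "A * B = 1\<^sub>m n"
    by (auto simp: Units_def ring_mat_def)
  have "(\<Sum>k<n. W i k * B $$ (k, j)) = (if i = j then 1 else 0)" if "i < n" "j < n" for i j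
  proof -
    have "(A * B) $$ (i, j) = (\<Sum>k<n. W i k * B $$ (k, j))"
      using that B(1) by (simp add: A_def scalar_prod_def atLeast0LessThan)
    then show ?thesis using B(3) that by simp
  qed
  moreover have "(\<Sum>k<n. B $$ (i, k) * W k j) = (if i = j then 1 else 0)" if "i < n" "j < n" for i j
  proof -
    have "(B * A) $$ (i, j) = (\<Sum>k<n. B $$ (i, k) * W k j)"
      using that B(1) by (simp add: A_def scalar_prod_def atLeast0LessThan)
    then show ?thesis using B(2) that by simp
  qed
  ultimately show ?thesis by (rule that[of "\<lambda>i j. B $$ (i, j)"])
qed

text \<open>W sends q to the first unit vector, so the inverse of W sends that vector back to
  q.\<close>

lemma inverse_column:
  fixes W U :: "nat \<Rightarrow> nat \<Rightarrow> 'k::field"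
  assumes UW: "\<And>i j. i < Suc N \<Longrightarrow> j < Suc N \<Longrightarrow> (\<Sum>k<Suc N. U i k * W k j) = (if i = j then 1 else 0)"
    and W0: "(\<Sum>j<Suc N. W 0 j * q j) = 1" and Wq: "\<And>i. 1 \<le> i \<Longrightarrow> i \<le> N \<Longrightarrow> (\<Sum>j<Suc N. W i j * q j) = 0"
    and i: "i < Suc N"
  shows "U i 0 = q i"
proof -
  have "q i = (\<Sum>j<Suc N. (if i = j then 1 else 0) * q j)"
    using i by (simp add: if_distrib[of "\<lambda>x. x * _"] cong: if_cong del: sum.lessThan_Suc)
  also have "\<dots> = (\<Sum>j<Suc N. (\<Sum>k<Suc N. U i k * W k j) * q j)"
    using UW[OF i] by (intro sum.cong) auto
  also have "\<dots> = (\<Sum>j<Suc N. \<Sum>k<Suc N. U i k * (W k j * q j))"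
    by (simp only: sum_distrib_right mult.assoc)
  also have "\<dots> = (\<Sum>k<Suc N. U i k * (\<Sum>j<Suc N. W k j * q j))"
    by (subst sum.swap) (simp only: sum_distrib_left)
  also have "\<dots> = (\<Sum>k<Suc N. if k = 0 then U i 0 else 0)"
    using W0 Wq by (intro sum.cong) (auto simp del: sum.lessThan_Suc)
  also have "\<dots> = U i 0" by (simp del: sum.lessThan_Suc)
  finally show ?thesis by simp
qed

text \<open>Steinitz exchange among linear functionals. Row 0 stays in place: it has value 1 at q,
  where the other rows and all \<open>lam k\<close> vanish, so it never occurs in the expansion of a
  \<open>lam k\<close>.\<close>

lemma extend_rows:
  fixes W lam :: "nat \<Rightarrow> nat \<Rightarrow> 'k::field"
  assumes "triv_ker (Suc N) W" and "(\<Sum>j<Suc N. W 0 j * q j) = 1"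
    and "\<And>i. 1 \<le> i \<Longrightarrow> i \<le> N \<Longrightarrow> (\<Sum>j<Suc N. W i j * q j) = 0"
    and "\<And>k. k < c \<Longrightarrow> (\<Sum>j<Suc N. lam k j * q j) = 0"
    and "\<And>a. (\<And>i. i < Suc N \<Longrightarrow> (\<Sum>k<c. a k * lam k i) = 0) \<Longrightarrow> (\<And>k. k < c \<Longrightarrow> a k = 0)"
  shows "c \<le> N \<and> (\<exists>W'. triv_ker (Suc N) W' \<and> W' 0 = W 0 \<and>
    (\<forall>i. 1 \<le> i \<longrightarrow> i \<le> N \<longrightarrow> (\<Sum>j<Suc N. W' i j * q j) = 0) \<and> (\<forall>k<c. W' (Suc k) = lam k))"
  using assms(4,5)
proof (induction c)
  case 0
  then show ?case using assms(1,3) by auto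
next
  case (Suc c)
  have indep: "a k = 0" if "\<And>i. i < Suc N \<Longrightarrow> (\<Sum>k<c. a k * lam k i) = 0" "k < c" for a k
    using Suc.prems(2)[of "\<lambda>k. if k < c then a k else 0" k] that by simp
  obtain W' where cN: "c \<le> N" and W': "triv_ker (Suc N) W'" "W' 0 = W 0"
    "\<And>i. 1 \<le> i \<Longrightarrow> i \<le> N \<Longrightarrow> (\<Sum>j<Suc N. W' i j * q j) = 0" "\<And>k. k < c \<Longrightarrow> W' (Suc k) = lam k"
    using Suc.IH Suc.prems(1) indep by (auto simp del: sum.lessThan_Suc)
  obtain U where U: "\<And>i j. i < Suc N \<Longrightarrow> j < Suc N \<Longrightarrow> (\<Sum>k<Suc N. U i k * W' k j) = (if i = j then 1 else 0)"
    using triv_ker_inverse[OF W'(1)] by metis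
  \<comment> \<open>The coordinates of \<open>lam c\<close> in the basis formed by the rows of
    \<open>W'\<close>.\<close>
  define a where "a = (\<lambda>k. \<Sum>i<Suc N. lam c i * U i k)"
  have "(\<Sum>j<Suc N. W' 0 j * q j) = 1" using assms(2) W'(2) by simp
  from inverse_column[OF U this W'(3)] have Uq: "U i 0 = q i" if "i < Suc N" for i using that by blast
  have a0: "a 0 = 0"
  proof -
    have "a 0 = (\<Sum>i<Suc N. lam c i * q i)" unfolding a_def using Uq by (intro sum.cong) auto
    then show ?thesis using Suc.prems(1)[of c] by simp
  qed
  have comb: "lam c j = (\<Sum>k<Suc N. a k * W' k j)" if j: "j < Suc N" for j
  proof -
    have "(\<Sum>k<Suc N. a k * W' k j) = (\<Sum>k<Suc N. \<Sum>i<Suc N. lam c i * (U i k * W' k j))"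
      unfolding a_def by (simp only: sum_distrib_right mult.assoc)
    also have "\<dots> = (\<Sum>i<Suc N. lam c i * (\<Sum>k<Suc N. U i k * W' k j))"
      by (subst sum.swap) (simp only: sum_distrib_left)
    also have "\<dots> = (\<Sum>i<Suc N. lam c i * (if i = j then 1 else 0))"
      using U[OF _ j] by (intro sum.cong) (auto simp del: sum.lessThan_Suc)
    also have "\<dots> = lam c j" using j by (simp add: if_distrib[of "\<lambda>x. _ * x"] cong: if_cong del: sum.lessThan_Suc)
    finally show ?thesis by simp
  qed
  \<comment> \<open>Otherwise \<open>lam c\<close> would be a combination of the functionals already
    placed in rows 1 to c.\<close>
  have "\<exists>k. c < k \<and> k \<le> N \<and> a k \<noteq> 0"
  proof (rule ccontr)
    assume "\<not> ?thesis"
    then have z: "a k = 0" if "c < k" "k \<le> N" for k using that by blast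
    have "(\<Sum>k<Suc c. (if k = c then -1 else a (Suc k)) * lam k i) = 0" if i: "i < Suc N" for i
    proof -
      have "lam c i = (\<Sum>k\<in>{1..c}. a k * W' k i)"
        unfolding comb[OF i]
      proof (rule sum.mono_neutral_right)
        show "\<forall>k\<in>{..<Suc N} - {1..c}. a k * W' k i = 0"
        proof
          fix k assume "k \<in> {..<Suc N} - {1..c}"
          then have "k = 0 \<or> c < k \<and> k \<le> N" by auto
          then show "a k * W' k i = 0" using z a0 by auto
        qed
      qed (use cN in auto)
      also have "\<dots> = (\<Sum>k<c. a (Suc k) * lam k i)"
        using W'(4) by (simp add: sum.atLeast1_atMost_eq)
      finally show ?thesis by simp
    qed
    from Suc.prems(2)[OF this, of c] show False by simp
  qed
  then obtain k where k: "c < k" "k \<le> N" "a k \<noteq> 0" by blast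
  \<comment> \<open>Row k is discarded: \<open>lam c\<close> takes position c + 1, and the row
    previously there moves to position k.\<close>
  define W'' where "W'' = (W'(k := W' (Suc c)))(Suc c := lam c)"
  have "triv_ker (Suc N) W''"
    unfolding triv_ker_def
  proof (rule allI, rule impI)
    fix v assume v: "\<forall>i<Suc N. (\<Sum>j<Suc N. W'' i j * v j) = 0"
    have z: "(\<Sum>j<Suc N. W' i j * v j) = 0" if "i < Suc N" "i \<noteq> k" for i
    proof (cases "i = Suc c")
      case True
      then show ?thesis using v[rule_format, of k] k that by (simp add: W''_def del: sum.lessThan_Suc)
    next
      case False
      then show ?thesis using v[rule_format, of i] that by (simp add: W''_def del: sum.lessThan_Suc)
    qed
    have "0 = (\<Sum>j<Suc N. lam c j * v j)"
      using v[rule_format, of "Suc c"] k by (simp add: W''_def del: sum.lessThan_Suc)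
    also have "\<dots> = (\<Sum>j<Suc N. (\<Sum>l<Suc N. a l * W' l j) * v j)"
      using comb by (intro sum.cong) (auto simp del: sum.lessThan_Suc)
    also have "\<dots> = (\<Sum>l<Suc N. a l * (\<Sum>j<Suc N. W' l j * v j))"
      unfolding sum_distrib_right sum_distrib_left mult.assoc by (rule sum.swap)
    also have "\<dots> = (\<Sum>l<Suc N. if l = k then a k * (\<Sum>j<Suc N. W' k j * v j) else 0)"
      using z by (intro sum.cong) (auto simp del: sum.lessThan_Suc)
    also have "\<dots> = a k * (\<Sum>j<Suc N. W' k j * v j)" using k by (simp del: sum.lessThan_Suc)
    finally have "(\<Sum>j<Suc N. W' k j * v j) = 0" using k by (simp del: sum.lessThan_Suc)
    then have "\<forall>i<Suc N. (\<Sum>j<Suc N. W' i j * v j) = 0" using z by blast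
    then show "\<forall>j<Suc N. v j = 0" using W'(1) unfolding triv_ker_def by blast
  qed
  moreover have "W'' 0 = W 0" using W'(2) k by (simp add: W''_def)
  moreover have "(\<Sum>j<Suc N. W'' i j * q j) = 0" if "1 \<le> i" "i \<le> N" for i
    using W'(3)[OF that] W'(3)[of "Suc c"] Suc.prems(1)[of c] k by (simp add: W''_def del: sum.lessThan_Suc)
  moreover have "W'' (Suc l) = lam l" if "l < Suc c" for l
    using W'(4)[of l] that k by (auto simp: W''_def less_Suc_eq)
  ultimately show ?case using k by (intro conjI exI[of _ W'']) auto
qed

section \<open>Ideals generated by forms\<close>

lemma ideal_gen_induct [consumes 2, case_names zero gen add mult]:
  assumes "f \<in> ideal_gen V G" "G \<subseteq> polys V"
    and "P 0" "\<And>g. g \<in> G \<Longrightarrow> P g"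
    and "\<And>a b. a \<in> polys V \<Longrightarrow> b \<in> polys V \<Longrightarrow> P a \<Longrightarrow> P b \<Longrightarrow> P (a + b)"
    and "\<And>r a. r \<in> polys V \<Longrightarrow> a \<in> polys V \<Longrightarrow> P a \<Longrightarrow> P (r * a)"
  shows "P f"
proof -
  have "is_ideal V {f \<in> polys V. P f}"
    unfolding is_ideal_def
  proof (intro conjI ballI)
    show "r * a \<in> {f \<in> polys V. P f}" if "r \<in> polys V" "a \<in> {f \<in> polys V. P f}" for r a
      using that assms(6)[of r a] by (simp add: polys_mult)
    show "a + b \<in> {f \<in> polys V. P f}" if "a \<in> {f \<in> polys V. P f}" "b \<in> {f \<in> polys V. P f}" for a b
      using that assms(5)[of a b] by (simp add: polys_add)
  qed (use assms(3) in auto)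
  moreover have "G \<subseteq> {f \<in> polys V. P f}" using assms(2,4) by auto
  ultimately have "ideal_gen V G \<subseteq> {f \<in> polys V. P f}"
    unfolding ideal_gen_def by (intro hull_minimal)
  then show ?thesis using assms(1) by blast
qed

lemma is_ideal_gen:
  assumes "G \<subseteq> polys V"
  shows "is_ideal V (ideal_gen V G)"
proof -
  have mem: "f \<in> ideal_gen V G \<longleftrightarrow> (\<forall>t. is_ideal V t \<longrightarrow> G \<subseteq> t \<longrightarrow> f \<in> t)" for f
    by (auto simp: ideal_gen_def hull_def)
  have "is_ideal V (polys V)" by (simp add: is_ideal_def polys_add polys_mult)
  then have "ideal_gen V G \<subseteq> polys V" using assms mem by blast
  moreover have "0 \<in> ideal_gen V G" unfolding mem using is_idealD(2) by blast
  moreover have "f + g \<in> ideal_gen V G" if "f \<in> ideal_gen V G" "g \<in> ideal_gen V G" for f g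
    unfolding mem
  proof (intro allI impI)
    fix t assume "is_ideal V t" "G \<subseteq> t"
    then show "f + g \<in> t" using that is_idealD(3)[of V t f g] by (simp add: mem)
  qed
  moreover have "r * f \<in> ideal_gen V G" if "r \<in> polys V" "f \<in> ideal_gen V G" for r f
    unfolding mem
  proof (intro allI impI)
    fix t assume "is_ideal V t" "G \<subseteq> t"
    then show "r * f \<in> t" using that is_idealD(4)[of V t r f] by (simp add: mem)
  qed
  ultimately show ?thesis unfolding is_ideal_def by blast
qed

lemma ideal_gen_subset: "G \<subseteq> ideal_gen V G"
  unfolding ideal_gen_def by (rule hull_subset)

lemma forms_polys: "G \<subseteq> (\<Union>d. forms V d) \<Longrightarrow> G \<subseteq> polys V"
  by (auto simp: forms_def)

lemma hom_ideal_gen: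
  assumes G: "G \<subseteq> (\<Union>d. forms V d)"
  shows "hom_ideal V (ideal_gen V G)"
proof -
  note GV = forms_polys[OF G]
  note I = is_ideal_gen[OF GV]
  have "\<forall>d. hc d f \<in> ideal_gen V G" if "f \<in> ideal_gen V G" for f
    using that GV
  proof (induction rule: ideal_gen_induct)
    case zero
    then show ?case using is_idealD(2)[OF I] by simp
  next
    case (gen g)
    then obtain e where "g \<in> gr V (int e)" using G gr_of_nat by blast
    then have "hc d g = (if d = int e then g else 0)" for d using hc_id hc_other by fastforce
    then show ?case using gen ideal_gen_subset is_idealD(2)[OF I] by auto
  next
    case (add a b)
    then show ?case using is_idealD(3)[OF I] by (simp add: hc_add)
  next
    case (mult r a)
    define D where "D = (\<lambda>m. int (mdeg m)) ` supp r"
    have r: "r = (\<Sum>e\<in>D. hc e r)" by (rule sum_hc) (auto simp: D_def)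
    show ?case
    proof
      fix d
      have "hc d (r * a) = hc d (\<Sum>e\<in>D. hc e r * a)" by (subst r) (simp add: sum_distrib_right)
      also have "\<dots> = (\<Sum>e\<in>D. hc e r * hc (d - e) a)"
        by (simp add: hc_sum hc_mult[OF hc_gr[OF mult(1)]])
      also have "\<dots> \<in> ideal_gen V G"
        using mult by (intro is_ideal_sum[OF I] is_idealD(4)[OF I] gr_polys[OF hc_gr]) auto
      finally show "hc d (r * a) \<in> ideal_gen V G" .
    qed
  qed
  then show ?thesis using I by (simp add: hom_ideal_def)
qed

lemma ideal_gen_finite:
  assumes "f \<in> ideal_gen V (g ` {..<c})" "\<And>j. j < c \<Longrightarrow> g j \<in> polys V"
  shows "\<exists>r. f = (\<Sum>j<(c::nat). r j * g j)"
proof -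
  have "g ` {..<c} \<subseteq> polys V" using assms(2) by auto
  with assms(1) show ?thesis
  proof (induction rule: ideal_gen_induct)
    case zero
    show ?case by (intro exI[of _ "\<lambda>_. 0"]) simp
  next
    case (gen a)
    then obtain j where j: "j < c" "a = g j" by auto
    then show ?case
      by (intro exI[of _ "\<lambda>i. if i = j then 1 else 0"]) (simp add: if_distrib[of "\<lambda>x. x * _"] cong: if_cong)
  next
    case (add a b)
    then obtain r s where "a = (\<Sum>j<c. r j * g j)" "b = (\<Sum>j<c. s j * g j)" by blast
    then show ?case by (intro exI[of _ "\<lambda>j. r j + s j"]) (simp add: distrib_right sum.distrib)
  next
    case (mult t a)
    then obtain r where "a = (\<Sum>j<c. r j * g j)" by blast
    then show ?case by (intro exI[of _ "\<lambda>j. t * r j"]) (simp add: sum_distrib_left mult.assoc)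
  qed
qed

section \<open>Coordinates adapted to a smooth point\<close>

text \<open>Passage to the chart x_0 = 1, where (1:0:...:0) is the origin.\<close>

definition dehom :: "nat \<Rightarrow> 'k::field mpoly" where
  "dehom i = (if i = 0 then 1 else var i)"

lemma mval_dehom: "mval dehom m \<in> (ordm (mdeg m - coef m 0) :: 'k::field mpoly set)"
proof (rule monomial_induct[where V = UNIV and P = "\<lambda>m. mval dehom m \<in> ordm (mdeg m - coef m 0)"])
  fix m :: "nat \<Rightarrow>\<^sub>0 nat" and j
  assume IH: "mval dehom m \<in> (ordm (mdeg m - coef m 0) :: 'k mpoly set)"
  show "mval dehom (m + Poly_Mapping.single j (Suc 0)) \<in>
      (ordm (mdeg (m + Poly_Mapping.single j (Suc 0)) - coef (m + Poly_Mapping.single j (Suc 0)) 0) :: 'k mpoly set)"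
  proof (cases "j = 0")
    case True
    then show ?thesis using IH by (simp add: mval_add mval_single dehom_def mdeg_add lookup_add)
  next
    case False
    have "mval dehom m * var j \<in> (ordm (mdeg m - coef m 0 + 1) :: 'k mpoly set)"
      by (rule ordm_mult[OF IH ordm_var])
    then have "mval dehom m * var j \<in> (ordm (mdeg m + 1 - coef m 0) :: 'k mpoly set)"
      by (rule ordm_mono) simp
    then show ?thesis using False
      by (simp add: mval_add mval_single dehom_def mdeg_add lookup_add lookup_single)
  qed
qed simp_all

lemma dehom_id: "f \<in> polys {1..N} \<Longrightarrow> subst dehom f = f"
  using subst_cong[of f "{1..N}" dehom var] by (simp add: subst_id dehom_def)

text \<open>A monomial of h has degree n + t + 1 and at most t factors x_0, so at least n + 1
  factors survive in the chart; g is the part of degree n.\<close>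

lemma dehom_lead:
  assumes g: "g \<in> gr {1..N} (int n)" and h: "h \<in> gr {0..N} (int n + int (Suc t))" "h \<in> Dx t"
  shows "subst dehom (var 0 ^ Suc t * g + h) - g \<in> ordm (Suc n)"
proof -
  have "subst dehom (var 0 ^ Suc t * g + h) - g = subst dehom h"
    using dehom_id[OF gr_polys[OF g]]
    by (simp only: rhomD[OF rhom_subst] rhom_power[OF rhom_subst] subst_var) (simp add: dehom_def)
  also have "\<dots> \<in> ordm (Suc n)"
    unfolding subst_monomials
  proof (intro ordm_sum ordm_mult_left)
    fix m assume "m \<in> supp h"
    then have "int (mdeg m) = int n + int (Suc t)" "coef m 0 \<le> t" using h by (auto simp: gr_def Dx_def)
    then show "mval dehom m \<in> ordm (Suc n)" by (intro ordm_mono[OF mval_dehom]) simp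
  qed
  finally show ?thesis .
qed

lemma gr_lin: "(\<Sum>k<Suc N. const (a k) * var k) \<in> gr {0..N} 1"
  by (intro gr_sum gr_const_mult gr_var) auto

lemma subst_lin: "subst s (\<Sum>k<n. const (a k) * var k) = (\<Sum>k<n. const (a k) * s k)"
  by (simp add: rhom_sum[OF rhom_subst] rhomD(3)[OF rhom_subst] del: sum.lessThan_Suc)

lemma eval_lin: "eval x (\<Sum>k<n. const (a k) * var k) = (\<Sum>k<n. a k * x k)"
  by (simp add: rhom_sum[OF rhom_eval] rhomD(3)[OF rhom_eval] del: sum.lessThan_Suc)

lemma lin_comp:
  assumes "i < Suc N" "\<And>j. j < Suc N \<Longrightarrow> (\<Sum>k<Suc N. A i k * B k j) = (if i = j then 1 else 0)"
  shows "(\<Sum>k<Suc N. const (A i k) * (\<Sum>j<Suc N. const (B k j) * var j)) = (var i :: 'k::field mpoly)"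
proof -
  have "(\<Sum>k<Suc N. const (A i k) * (\<Sum>j<Suc N. const (B k j) * var j)) =
      (\<Sum>k<Suc N. \<Sum>j<Suc N. const (A i k * B k j) * (var j :: 'k mpoly))"
    by (simp only: sum_distrib_left const_mult mult.assoc)
  also have "\<dots> = (\<Sum>j<Suc N. const (\<Sum>k<Suc N. A i k * B k j) * var j)"
    by (subst sum.swap) (simp only: rhom_sum[OF rhom_const] sum_distrib_right)
  also have "\<dots> = (\<Sum>j<Suc N. if j = i then var i else 0)"
    using assms(2) by (intro sum.cong) (auto simp del: sum.lessThan_Suc)
  also have "\<dots> = var i" using assms(1) by (simp del: sum.lessThan_Suc)
  finally show ?thesis .
qed

lemma coordinate_change_matrix:
  fixes W U :: "nat \<Rightarrow> nat \<Rightarrow> 'k::field"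
  assumes WU: "\<And>i j. i < Suc N \<Longrightarrow> j < Suc N \<Longrightarrow> (\<Sum>k<Suc N. W i k * U k j) = (if i = j then 1 else 0)"
    and UW: "\<And>i j. i < Suc N \<Longrightarrow> j < Suc N \<Longrightarrow> (\<Sum>k<Suc N. U i k * W k j) = (if i = j then 1 else 0)"
  shows "coordinate_change {0..N} (\<lambda>j. \<Sum>k<Suc N. const (U j k) * var k) (\<lambda>i. \<Sum>j<Suc N. const (W i j) * var j)"
    (is "coordinate_change _ ?y ?z")
proof
  fix i assume "i \<in> {0..N}"
  then have iN: "i < Suc N" by simp
  show "?y i \<in> gr {0..N} 1" "?z i \<in> gr {0..N} 1" by (rule gr_lin)+
  show "subst ?z (?y i) = var i"
    unfolding subst_lin by (rule lin_comp[where A = U and B = W, OF iN UW[OF iN]])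
  show "subst ?y (?z i) = var i"
    unfolding subst_lin by (rule lin_comp[where A = W and B = U, OF iN WU[OF iN]])
qed

text \<open>Column 0 of U is q, and row j + 1 of W is the gradient of \<open>g j\<close> at q; in
  the coordinates given by W, q is (1:0:...:0) and the tangent equations are x_1, ..., x_c. A
  \<open>g j\<close> lies in \<open>I0\<close> only after multiplication by a power of x_{i0}, as
  \<open>I0\<close> need not be saturated.\<close>

locale smooth_coordinates =
  fixes N c i0 :: nat and I0 Gen :: "'k::field mpoly set" and q :: "nat \<Rightarrow> 'k"
    and g :: "nat \<Rightarrow> 'k mpoly" and W U :: "nat \<Rightarrow> nat \<Rightarrow> 'k"
  assumes Gen: "Gen \<subseteq> forms {0..N} 2" "I0 = ideal_gen {0..N} Gen"
    and vanish: "f \<in> I0 \<Longrightarrow> eval q f = 0"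
    and loc_gen: "f \<in> I0 \<Longrightarrow> \<exists>h\<in>polys {0..N}. eval q h \<noteq> 0 \<and> h * f \<in> ideal_gen {0..N} (g ` {..<c})"
    and g: "j < c \<Longrightarrow> g j \<in> polys {0..N}" "j < c \<Longrightarrow> eval q (g j) = 0"
      "j < c \<Longrightarrow> \<exists>m. var i0 ^ m * g j \<in> I0"
    and WU: "i < Suc N \<Longrightarrow> j < Suc N \<Longrightarrow> (\<Sum>k<Suc N. W i k * U k j) = (if i = j then 1 else 0)"
    and UW: "i < Suc N \<Longrightarrow> j < Suc N \<Longrightarrow> (\<Sum>k<Suc N. U i k * W k j) = (if i = j then 1 else 0)"
    and W: "j < c \<Longrightarrow> i < Suc N \<Longrightarrow> W (Suc j) i = eval q (partial_deriv i (g j))"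
    and U: "i < Suc N \<Longrightarrow> U i 0 = q i"
    and i0: "i0 < Suc N" "q i0 \<noteq> 0"
    and c: "c \<le> N"
begin

abbreviation "V \<equiv> {0..N}"

definition yy :: "nat \<Rightarrow> 'k mpoly" where "yy j = (\<Sum>k<Suc N. const (U j k) * var k)"
definition zz :: "nat \<Rightarrow> 'k mpoly" where "zz i = (\<Sum>j<Suc N. const (W i j) * var j)"
text \<open>\<open>yy j\<close> without its x_0-term: in the chart, \<open>yy j\<close> becomes q_j
  + v_j.\<close>

definition v :: "nat \<Rightarrow> 'k mpoly" where "v j = (\<Sum>k\<in>{1..N}. const (U j k) * var k)"

definition I :: "'k mpoly set" where "I = subst yy ` I0"

text \<open>The expression of f in the affine chart with origin q, so that \<open>ordm\<close>
  measures the order of vanishing at q.\<close>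

definition theta :: "'k mpoly \<Rightarrow> 'k mpoly" where "theta f = subst dehom (subst yy f)"

lemma lessThan_V: "{..<Suc N} = V"
  by auto

sublocale coordinate_change V yy zz
  unfolding yy_def[abs_def] zz_def[abs_def] by (rule coordinate_change_matrix[OF WU UW])

lemma I0_hom: "hom_ideal V I0"
  unfolding Gen(2) using Gen(1) by (intro hom_ideal_gen) blast

lemma I_hom: "hom_ideal V I"
  unfolding I_def by (rule hom_ideal_image[OF I0_hom])

lemma I0_polys: "I0 \<subseteq> polys V"
  by (rule is_idealD(1)[OF hom_idealD(1)[OF I0_hom]])

lemma rhom_theta: "rhom theta"
  using rhom_comp[OF rhom_subst rhom_subst] unfolding theta_def .

lemma v_ordm: "v j \<in> ordm 1"
  unfolding v_def by (intro ordm_sum ordm_mult_left ordm_var)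

lemma theta_eq: "f \<in> polys V \<Longrightarrow> theta f = subst (\<lambda>i. const (q i) + v i) f"
proof -
  assume f: "f \<in> polys V"
  have "theta f = subst (\<lambda>i. subst dehom (yy i)) f" by (simp add: theta_def subst_subst)
  also have "\<dots> = subst (\<lambda>i. const (q i) + v i) f"
  proof (rule subst_cong[OF f])
    fix i assume "i \<in> V"
    then have i: "i < Suc N" by simp
    have "subst dehom (yy i) = (\<Sum>k<Suc N. const (U i k) * dehom k)"
      unfolding yy_def by (rule subst_lin)
    also have "\<dots> = const (U i 0) * dehom 0 + (\<Sum>k<N. const (U i (Suc k)) * dehom (Suc k))"
      by (rule sum.lessThan_Suc_shift)
    also have "(\<Sum>k<N. const (U i (Suc k)) * dehom (Suc k)) = v i"
      by (simp add: v_def sum.atLeast1_atMost_eq dehom_def)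
    finally have "subst dehom (yy i) = const (U i 0) * dehom 0 + v i" .
    moreover have "dehom 0 = (1 :: 'k mpoly)" by (simp add: dehom_def)
    ultimately show "subst dehom (yy i) = const (q i) + v i" using U[OF i] by simp
  qed
  finally show ?thesis .
qed

lemma theta_const: "f \<in> polys V \<Longrightarrow> theta f - const (eval q f) \<in> ordm 1"
proof -
  assume f: "f \<in> polys V"
  have "theta f - (const (eval q f) + (\<Sum>i\<in>V. const (eval q (partial_deriv i f)) * v i)) \<in> ordm 2"
    unfolding theta_eq[OF f] by (rule taylor[OF _ v_ordm f]) simp
  then have 1: "theta f - (const (eval q f) + (\<Sum>i\<in>V. const (eval q (partial_deriv i f)) * v i)) \<in> ordm 1"
    by (rule ordm_mono) simp
  have "(\<Sum>i\<in>V. const (eval q (partial_deriv i f)) * v i) \<in> ordm 1"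
    by (intro ordm_sum ordm_mult_left v_ordm)
  from ordm_add[OF 1 this] show ?thesis by simp
qed

text \<open>In the Taylor expansion the gradient of \<open>g j\<close> is a row of W, and W U = 1
  collapses the linear part to one variable.\<close>

lemma theta_g:
  assumes j: "j < c"
  shows "theta (g j) - var (Suc j) \<in> ordm 2"
proof -
  have "theta (g j) - (const (eval q (g j)) + (\<Sum>i\<in>V. const (eval q (partial_deriv i (g j))) * v i)) \<in> ordm 2"
    unfolding theta_eq[OF g(1)[OF j]] by (rule taylor[OF _ v_ordm g(1)[OF j]]) simp
  moreover have "(\<Sum>i\<in>V. const (eval q (partial_deriv i (g j))) * v i) = var (Suc j)"
  proof -
    have "(\<Sum>i\<in>V. const (eval q (partial_deriv i (g j))) * v i) =
        (\<Sum>i<Suc N. \<Sum>k\<in>{1..N}. const (W (Suc j) i * U i k) * var k)"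
      unfolding lessThan_V v_def sum_distrib_left using W[OF j]
      by (intro sum.cong) (auto simp: const_mult mult.assoc)
    also have "\<dots> = (\<Sum>k\<in>{1..N}. const (\<Sum>i<Suc N. W (Suc j) i * U i k) * var k)"
      by (subst sum.swap) (simp only: rhom_sum[OF rhom_const] sum_distrib_right)
    also have "\<dots> = (\<Sum>k\<in>{1..N}. if k = Suc j then var (Suc j) else 0)"
      using WU[of "Suc j"] j c by (intro sum.cong) (auto simp del: sum.lessThan_Suc)
    also have "\<dots> = var (Suc j)" using j c by simp
    finally show ?thesis .
  qed
  ultimately show ?thesis using g(2)[OF j] by simp
qed

text \<open>In the chart, \<open>gg\<close> is the lowest part of the element \<open>f0\<close>. A
  multiple of \<open>f0\<close> by some \<open>hh\<close> with nonzero value at q is a combination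
  of the \<open>g j\<close>, whose linear parts are x_1, ..., x_c; so
  \<open>initial_form_mon\<close> applies.\<close>

lemma lead_mon:
  assumes gg: "gg \<in> gr {1..N} (e - int (Suc t))" and h: "h \<in> gr V e" "h \<in> Dx t"
    and f: "var 0 ^ Suc t * gg + h \<in> I"
  shows "gg \<in> mon {1..c}"
proof (cases "e - int (Suc t) < 0")
  case True
  then have "gr {1..N} (e - int (Suc t)) = ({0} :: 'k mpoly set)" by (rule gr_neg)
  then show ?thesis using gg by auto
next
  case False
  define n where "n = nat (e - int (Suc t))"
  have n: "e - int (Suc t) = int n" "e = int n + int (Suc t)" using False by (simp_all add: n_def)
  obtain f0 where f0: "f0 \<in> I0" "var 0 ^ Suc t * gg + h = subst yy f0" using f unfolding I_def by blast
  obtain hh where hh: "hh \<in> polys V" "eval q hh \<noteq> 0" "hh * f0 \<in> ideal_gen V (g ` {..<c})"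
    using loc_gen[OF f0(1)] by blast
  obtain r where r: "hh * f0 = (\<Sum>j<c. r j * g j)" using ideal_gen_finite[OF hh(3) g(1)] by blast
  have th: "theta hh * theta f0 = (\<Sum>j<c. theta (r j) * theta (g j))"
    unfolding rhomD(3)[OF rhom_theta, symmetric] r rhom_sum[OF rhom_theta] ..
  have gn: "gg \<in> gr {1..N} (int n)" using gg n(1) by simp
  have lead: "theta f0 - gg \<in> ordm (Suc n)"
    using dehom_lead[OF gn, of h t] h n(2) by (simp add: theta_def f0(2)[symmetric])
  have "theta f0 \<in> ordm n"
    using ordm_add[OF ordm_mono[OF lead, of n] ordm_gr[OF gn]] by simp
  from ordm_mult[OF theta_const[OF hh(1)] this]
  have 1: "(theta hh - const (eval q hh)) * theta f0 \<in> ordm (Suc n)" by simp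
  have 2: "const (eval q hh) * (theta f0 - gg) \<in> ordm (Suc n)" by (rule ordm_mult_left[OF lead])
  show ?thesis
  proof (rule initial_form_mon[OF _ _ gn hh(2), where s = "\<lambda>i. theta (g (i - 1))" and r = "\<lambda>i. theta (r (i - 1))"])
    show "theta (g (i - 1)) - var i \<in> ordm 2" if "i \<in> {1..c}" for i
    proof -
      have "i - 1 < c" "Suc (i - 1) = i" using that by auto
      then show ?thesis using theta_g[of "i - 1"] by simp
    qed
    have "(\<Sum>i\<in>{1..c}. theta (r (i - 1)) * theta (g (i - 1))) = theta hh * theta f0"
      unfolding th by (simp add: sum.atLeast1_atMost_eq)
    then have "const (eval q hh) * gg - (\<Sum>i\<in>{1..c}. theta (r (i - 1)) * theta (g (i - 1))) =
        - (const (eval q hh) * (theta f0 - gg) + (theta hh - const (eval q hh)) * theta f0)"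
      by (simp add: algebra_simps)
    also have "\<dots> \<in> ordm (Suc n)" by (intro ordm_uminus ordm_add 1 2)
    finally show "const (eval q hh) * gg - (\<Sum>i\<in>{1..c}. theta (r (i - 1)) * theta (g (i - 1))) \<in> ordm (Suc n)" .
  qed simp
qed

section \<open>Quadrics through q and the tangent space\<close>

declare single_numeral [simp del]

lemma eval_e0:
  assumes "(F :: 'k mpoly) \<in> gr V 2"
  shows "eval (\<lambda>i. if i = 0 then 1 else 0) F = coef F (Poly_Mapping.single 0 2)"
proof -
  let ?e = "\<lambda>i. if i = 0 then 1 else 0 :: 'k"
  have z: "mval ?e m = 0" if "m \<in> supp F" "m \<noteq> Poly_Mapping.single 0 2" for m
  proof -
    have d: "mdeg m = 2" using assms that by (simp add: gr_def)
    have "\<exists>i\<in>supp m. i \<noteq> 0"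
    proof (rule ccontr)
      assume "\<not> ?thesis"
      then have s: "supp m \<subseteq> {0}" by auto
      have c0: "coef m 0 = 2" using d mdeg_superset[OF _ s] by simp
      have "m = Poly_Mapping.single 0 2"
      proof (rule poly_mapping_eqI)
        fix k
        show "coef m k = coef (Poly_Mapping.single 0 2) k"
        proof (cases "k = 0")
          case False
          then have "k \<notin> supp m" using s by blast
          then show ?thesis using False by (simp add: in_keys_iff lookup_single)
        qed (simp add: c0)
      qed
      with that(2) show False by contradiction
    qed
    then obtain i where i: "i \<in> supp m" "i \<noteq> 0" by blast
    have "?e i ^ coef m i = 0" using i by (simp add: in_keys_iff)
    then show ?thesis unfolding mval_def using i(1) finite_keys[of m] by (intro prod_zero bexI[of _ i])
  qed
  have "eval ?e F = (\<Sum>m\<in>supp F. if m = Poly_Mapping.single 0 2 then coef F m else 0)"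
    unfolding eval_mval
  proof (rule sum.cong)
    fix m assume "m \<in> supp F"
    then show "coef F m * mval ?e m = (if m = Poly_Mapping.single 0 2 then coef F m else 0)"
      using z[of m] by (cases "m = Poly_Mapping.single 0 2") (simp_all add: mval_def)
  qed simp
  then show ?thesis by (simp add: in_keys_iff)
qed

lemma eval_e0_yy:
  assumes i: "i < Suc N"
  shows "eval (\<lambda>i. if i = 0 then 1 else 0) (yy i) = q i"
proof -
  have "eval (\<lambda>i. if i = 0 then 1 else 0) (yy i) = (\<Sum>k<Suc N. U i k * (if k = 0 then 1 else 0))"
    unfolding yy_def by (rule eval_lin)
  also have "\<dots> = U i 0" by (simp add: if_distrib[of "\<lambda>x. _ * x"] cong: if_cong del: sum.lessThan_Suc)
  finally show ?thesis using U[OF i] by simp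
qed

text \<open>Vanishing at q means that x_0^2 does not occur, which leaves x_0-degree at most
  1.\<close>

lemma quadric_split:
  assumes F: "F \<in> gr V 2" "F \<in> I"
  shows "\<exists>l\<in>gr {1..N} 1. \<exists>Q\<in>gr {1..N} 2. F = var 0 * l + Q"
proof -
  obtain f where f: "f \<in> I0" "F = subst yy f" using F(2) unfolding I_def by blast
  have "eval (\<lambda>i. if i = 0 then 1 else 0) F = eval q f"
    unfolding f(2) eval_subst using I0_polys f(1) by (intro eval_cong[of f V] eval_e0_yy) auto
  then have z: "coef F (Poly_Mapping.single 0 2) = 0" using vanish[OF f(1)] eval_e0[OF F(1)] by simp
  have "F \<in> Dx 1"
    unfolding Dx_def
  proof (intro CollectI ballI)
    fix m assume m: "m \<in> supp F"
    have d: "mdeg m = 2" using F(1) m by (simp add: gr_def)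
    show "coef m 0 \<le> 1"
    proof (rule ccontr)
      assume "\<not> ?thesis"
      then obtain m' where m': "m = Poly_Mapping.single 0 (Suc 0) + m'" "0 < coef m' 0"
        using monom_split[of m 0] by (auto simp: lookup_add)
      then obtain m'' where "m' = Poly_Mapping.single 0 (Suc 0) + m''" using monom_split by blast
      with m' have m2: "m = Poly_Mapping.single 0 2 + m''" 
        by (simp add: add.assoc[symmetric] single_add[symmetric] numeral_2_eq_2)
      then have "m'' = 0" using d by (simp add: mdeg_add mdeg_eq_0_iff)
      then show False using m2 m z by (simp add: in_keys_iff)
    qed
  qed
  then obtain l h where l: "l \<in> gr {1..N} (2 - int (Suc 0))" "h \<in> gr V 2 \<inter> Dx 0" "F = var 0 ^ Suc 0 * l + h"
    using split_lead[OF F(1), of 0] by auto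
  then have "h \<in> gr {1..N} 2" by (intro gr_Dx_0) auto
  then show ?thesis using l by auto
qed

text \<open>This is where quadratic generation of \<open>I0\<close> enters: for generators it is
  \<open>quadric_split\<close>, and multiplication by r only scales the linear part by r(q), because
  elements of \<open>I0\<close> vanish at q.\<close>

lemma linear_part:
  assumes "f \<in> I0"
  shows "\<exists>l\<in>gr {1..N} 1. \<exists>Q\<in>gr {1..N} 2. var 0 * l + Q \<in> I \<and> theta f - l \<in> ordm 2"
proof -
  note I' = is_idealD[OF hom_idealD(1)[OF I_hom]]
  have GV: "Gen \<subseteq> polys V" using Gen(1) by (auto simp: forms_def)
  have "f \<in> ideal_gen V Gen" using assms by (simp add: Gen(2))
  from this GV show ?thesis
  proof (induction rule: ideal_gen_induct)
    case zero
    show ?case using I'(2) by (intro bexI[of _ 0] conjI) (simp_all add: rhom_zero[OF rhom_theta])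
  next
    case (gen a)
    have a0: "a \<in> I0" using gen ideal_gen_subset unfolding Gen(2) by blast
    then have aI: "subst yy a \<in> I" unfolding I_def by blast
    have "a \<in> gr V (int 2)" using gen Gen(1) unfolding gr_of_nat by blast
    then have "subst yy a \<in> gr V 2" using graded(1) by simp
    from quadric_split[OF this aI] obtain l Q where lQ: "l \<in> gr {1..N} 1" "Q \<in> gr {1..N} 2" "subst yy a = var 0 * l + Q"
      by blast
    have "theta a = l + Q"
      unfolding theta_def lQ(3) rhomD[OF rhom_subst] dehom_id[OF gr_polys[OF lQ(1)]] dehom_id[OF gr_polys[OF lQ(2)]]
      by (simp add: dehom_def)
    moreover have "Q \<in> ordm 2" using lQ(2) by (intro ordm_gr[of _ "{1..N}"]) simp
    ultimately have "theta a - l \<in> ordm 2" by simp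
    then show ?case using lQ aI by metis
  next
    case (add a b)
    obtain l Q where a: "l \<in> gr {1..N} 1" "Q \<in> gr {1..N} 2" "var 0 * l + Q \<in> I" "theta a - l \<in> ordm 2"
      using add(3) by blast
    obtain l' Q' where b: "l' \<in> gr {1..N} 1" "Q' \<in> gr {1..N} 2" "var 0 * l' + Q' \<in> I" "theta b - l' \<in> ordm 2"
      using add(4) by blast
    have eq: "var 0 * (l + l') + (Q + Q') = (var 0 * l + Q) + (var 0 * l' + Q')" by (simp add: algebra_simps)
    have "var 0 * (l + l') + (Q + Q') \<in> I" unfolding eq by (rule I'(3)[OF a(3) b(3)])
    moreover have "theta (a + b) - (l + l') \<in> ordm 2"
      using ordm_add[OF a(4) b(4)] by (simp add: rhomD(2)[OF rhom_theta] algebra_simps)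
    ultimately show ?case using gr_add[OF a(1) b(1)] gr_add[OF a(2) b(2)] by blast
  next
    case (mult r a)
    obtain l Q where a: "l \<in> gr {1..N} 1" "Q \<in> gr {1..N} 2" "var 0 * l + Q \<in> I" "theta a - l \<in> ordm 2"
      using mult(3) by blast
    define k where "k = eval q r"
    have "var 0 * (const k * l) + const k * Q = const k * (var 0 * l + Q)" by (simp add: algebra_simps)
    then have "var 0 * (const k * l) + const k * Q \<in> I" using I'(4)[OF _ a(3), of "const k"] by simp
    moreover have "theta (r * a) - const k * l \<in> ordm 2"
    proof -
      have eq: "theta (r * a) - const k * l = theta r * (theta a - l) + (theta r - const k) * l"
        by (simp add: rhomD(3)[OF rhom_theta] algebra_simps)
      have "l \<in> ordm 1" using a(1) by (intro ordm_gr[of _ "{1..N}"]) simp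
      then have "(theta r - const k) * l \<in> ordm (1 + 1)"
        unfolding k_def by (rule ordm_mult[OF theta_const[OF mult(1)]])
      then have "(theta r - const k) * l \<in> ordm 2" by (simp only: one_add_one)
      then show ?thesis unfolding eq by (rule ordm_add[OF ordm_mult_left[OF a(4)]])
    qed
    ultimately show ?case using gr_const_mult[OF a(1)] gr_const_mult[OF a(2)] by blast
  qed
qed

text \<open>\<open>linear_part\<close>, applied to x_{i0}^m g_{j-1}, gives a quadric with linear
  part a x_j, where a = q_{i0}^m is nonzero.\<close>

lemma tangent_quadric:
  assumes j: "j \<in> {1..c}"
  shows "\<exists>Q\<in>gr {1..N} 2. var 0 * var j + Q \<in> I"
proof -
  note I' = is_idealD[OF hom_idealD(1)[OF I_hom]]
  have j1: "j - 1 < c" "Suc (j - 1) = j" using j by auto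
  obtain m where m: "var i0 ^ m * g (j - 1) \<in> I0" using g(3)[OF j1(1)] by blast
  obtain l Q where l: "l \<in> gr {1..N} 1" "Q \<in> gr {1..N} 2" "var 0 * l + Q \<in> I"
    "theta (var i0 ^ m * g (j - 1)) - l \<in> ordm 2"
    using linear_part[OF m] by blast
  define a where "a = q i0 ^ m"
  have a0: "a \<noteq> 0" using i0(2) by (simp add: a_def)
  have "var i0 ^ m \<in> polys V" using i0(1) by (intro polys_power) simp
  then have 1: "theta (var i0 ^ m) - const a \<in> ordm 1"
    using theta_const[of "var i0 ^ m"] by (simp add: a_def rhom_power[OF rhom_eval])
  have x: "theta (g (j - 1)) - var j \<in> ordm 2" using theta_g[OF j1(1)] j1(2) by simp
  have "theta (g (j - 1)) \<in> ordm 1"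
    using ordm_add[OF ordm_mono[OF x, of 1] ordm_var[of j]] by simp
  then have "(theta (var i0 ^ m) - const a) * theta (g (j - 1)) \<in> ordm (1 + 1)" by (rule ordm_mult[OF 1])
  then have 2: "(theta (var i0 ^ m) - const a) * theta (g (j - 1)) \<in> ordm 2" by (simp only: one_add_one)
  have "l - const a * var j = (theta (var i0 ^ m) - const a) * theta (g (j - 1))
      + const a * (theta (g (j - 1)) - var j) - (theta (var i0 ^ m * g (j - 1)) - l)"
    by (simp add: rhomD(3)[OF rhom_theta] algebra_simps)
  also have "\<dots> \<in> ordm 2" by (rule ordm_diff[OF ordm_add[OF 2 ordm_mult_left[OF x]] l(4)])
  finally have o: "l - const a * var j \<in> ordm 2" .
  have "j \<in> {1..N}" using j c by auto
  then have g1: "l - const a * var j \<in> gr {1..N} 1"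
    by (intro gr_diff[OF l(1)] gr_const_mult gr_var)
  \<comment> \<open>A linear form of order 2 is zero.\<close>
  have "supp (l - const a * var j) = {}"
  proof (rule ccontr)
    assume "supp (l - const a * var j) \<noteq> {}"
    then obtain m where m: "m \<in> supp (l - const a * var j)" by blast
    have "mdeg m = 1" using g1 m by (simp add: gr_def)
    moreover have "2 \<le> mdeg m" using o m by (simp add: ordm_def)
    ultimately show False by simp
  qed
  then have lj: "l = const a * var j" by simp
  have "const (inverse a) * (var 0 * l + Q) \<in> I" using I'(4)[OF _ l(3), of "const (inverse a)"] by simp
  moreover have "const (inverse a) * (var 0 * l + Q) = var 0 * var j + const (inverse a) * Q"
  proof -
    have "const (inverse a) * const a = (1 :: 'k mpoly)" using a0 by (simp add: const_mult[symmetric])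
    moreover have "const (inverse a) * (var 0 * l + Q) =
        var 0 * ((const (inverse a) * const a) * var j) + const (inverse a) * Q"
      unfolding lj by (simp only: distrib_left mult.assoc mult.left_commute[of "const (inverse a)" "var 0"])
    ultimately show ?thesis by simp
  qed
  ultimately have "var 0 * var j + const (inverse a) * Q \<in> I" by simp
  with gr_const_mult[OF l(2)] show ?thesis by (rule bexI[rotated])
qed

lemma tor_vanishes_projection:
  assumes tor: "\<And>i j. i \<le> p \<Longrightarrow> 2 \<le> j \<Longrightarrow> tor_vanishes V I0 i (i + j)"
    and k: "k < p" "2 \<le> j"
  shows "tor_vanishes {1..N} (I \<inter> polys {1..N}) k (k + j)"
proof -
  interpret E: elimination N I c p
  proof
    show "hom_ideal {0..N} I" by (rule I_hom)
    show "c \<le> N" by (rule c)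
    show "\<exists>Q\<in>gr {1..N} 2. var 0 * var j + Q \<in> I" if "j \<in> {1..c}" for j by (rule tangent_quadric[OF that])
    show "gg \<in> mon {1..c}" if "gg \<in> gr {1..N} (e - int (Suc t))" "h \<in> gr {0..N} e" "h \<in> Dx t"
      "var 0 ^ Suc t * gg + h \<in> I" for gg e t h
      by (rule lead_mon[OF that])
    show "hzero xv [0..<Suc N] (gr {0..N}) (igr {0..N} I) (Suc i) e" if "Suc i \<le> p" "2 \<le> e" for i e
    proof -
      have "tor_vanishes V I0 (Suc i) (Suc i + nat e)" using that by (intro tor) auto
      then have "tor_vanishes V I (Suc i) (Suc i + nat e)"
        unfolding I_def by (rule tor_vanishes_image[OF hom_idealD(1)[OF I0_hom]])
      from tor_vanishes_hzero[OF this I_hom, of "[0..<Suc N]"]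
      have "hzero xv [0..<Suc N] (gr V) (igr V I) (Suc i) (int (Suc i + nat e) - int (Suc i))"
        using distinct_upt[of 0 "Suc N"] lessThan_V by (simp only: set_upt atLeast0LessThan simp_thms)
      moreover have "int (Suc i + nat e) - int (Suc i) = e" using that by simp
      ultimately show ?thesis by simp
    qed
  qed
  show ?thesis using E.tor_vanishes_elimination[OF k] by (simp only: E.J_def)
qed

end

section \<open>Quadratic generation from linear first syzygies\<close>

text \<open>A form f of J of degree at least 3 is a sum of x_v a_v, and the a_v form a 1-cycle
  modulo J. As this cycle is a boundary modulo J, the a_v can be replaced by elements of J without
  changing f; induction on the degree reduces to quadrics.\<close>

lemma quadratic_ideal_of_tor:
  fixes J :: "'k::field mpoly set"
  assumes V: "finite V" and J: "hom_ideal V J"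
    and tor: "\<And>j. 2 \<le> j \<Longrightarrow> tor_vanishes V J 1 (1 + j)"
    and low: "\<And>f. f \<in> J \<Longrightarrow> f \<in> gr V 0 \<Longrightarrow> f = 0" "\<And>f. f \<in> J \<Longrightarrow> f \<in> gr V 1 \<Longrightarrow> f = 0"
  shows "quadratic_ideal V J"
proof -
  note J' = is_idealD[OF hom_idealD(1)[OF J]]
  define L where "L = ideal_gen V (J \<inter> forms V 2)"
  have G: "J \<inter> forms V 2 \<subseteq> polys V" by (auto simp: forms_def)
  have L: "is_ideal V L" unfolding L_def by (rule is_ideal_gen[OF G])
  note L' = is_idealD[OF L]
  define vs where "vs = sorted_list_of_set V"
  have vs: "distinct vs" "set vs = V" using V by (simp_all add: vs_def)
  have gL: "gmod xv vs (\<lambda>_. L)"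
  proof (rule gmodI)
    show "xv v a \<in> L" if "v \<in> set vs" "a \<in> L" for v and a :: "'k mpoly"
      using L'(4)[of "var v" a] that vs(2) by (simp add: xv_def)
  qed (use L'(2,3) is_ideal_uminus[OF L] in simp_all)
  define T where "T = replicate (length vs) False"
  have T: "T \<in> cells (length vs) 0" "cells (length vs) 0 = {T}"
    unfolding T_def by (rule replicate_False_cells cells_n_0)+
  have step: "\<forall>f. f \<in> J \<longrightarrow> f \<in> gr V (int d) \<longrightarrow> f \<in> L" for d
  proof (induction d)
    case 0
    show ?case using low(1) L'(2) by auto
  next
    case (Suc d)
    show ?case
    proof (intro allI impI)
      fix f :: "'k mpoly" assume f: "f \<in> J" "f \<in> gr V (int (Suc d))"
      consider "d = 0" | "d = 1" | "2 \<le> d" by linarith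
      then show "f \<in> L"
      proof cases
        case 1
        then show ?thesis using low(2)[OF f(1)] f(2) L'(2) by simp
      next
        case 2
        then have "f \<in> forms V 2" using f(2) unfolding gr_of_nat by (simp add: numeral_2_eq_2)
        then show ?thesis using f(1) ideal_gen_subset unfolding L_def by blast
      next
        case 3
        have "f \<in> mon (set vs \<union> {})"
          unfolding mon_def
        proof (intro CollectI ballI)
          fix m assume m: "m \<in> supp f"
          have "int (mdeg m) = int (Suc d)" using f(2) m unfolding gr_def by blast
          then have "m \<noteq> 0" by auto
          then obtain u where u: "coef m u \<noteq> 0" by (metis lookup_zero poly_mapping_eqI)
          have "supp m \<subseteq> V" using gr_polys[OF f(2)] m by (simp add: polys_def)
          then have "u \<in> V" using u by (auto simp: in_keys_iff)
          then show "\<exists>u\<in>set vs \<union> {}. 0 < coef m u" using u vs(2) by (intro bexI[of _ u]) simp_all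
        qed
        from mon_imp_boundary[OF _ f(2) this T(1)] vs(2)
        obtain \<gamma> where \<gamma>: "chn (length vs) 1 (gr V (int (Suc d) - 1)) \<gamma>" "f - kd xv vs \<gamma> T \<in> mon {}"
          by auto
        have fk: "f = kd xv vs \<gamma> T" using \<gamma>(2) unfolding mon_empty by simp
        have \<gamma>': "chn (length vs) (Suc 0) (gr V (int d)) \<gamma>" using \<gamma>(1) by simp
        have "tor_vanishes V J (Suc 0) (1 + d)" using tor[OF 3] by simp
        from tor_vanishes_hzero[OF this J vs]
        have hz: "hzero xv vs (gr V) (igr V J) (Suc 0) (int d)" by simp
        have "cyc xv vs (Suc 0) (igr V J (int d + 1)) \<gamma>"
          unfolding cyc_Suc chn_def T(2) using f fk by (simp add: add.commute)
        from hzeroD[OF hz \<gamma>' this]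
        obtain \<eta> where \<eta>: "chn (length vs) (Suc 0) (igr V J (int d)) (\<lambda>S. \<gamma> S - kd xv vs \<eta> S)"
          by blast
        have "igr V J (int d) \<subseteq> L" using Suc.IH by blast
        from chn_mono[OF \<eta> this] have "chn (length vs) 0 L (kd xv vs (\<lambda>S. \<gamma> S - kd xv vs \<eta> S))"
          by (rule kd_chn[OF gL])
        from chnD[OF this T(1)] have "kd xv vs \<gamma> T - kd xv vs (kd xv vs \<eta>) T \<in> L"
          by (simp only: kd_diff[OF ops_xv])
        then show ?thesis unfolding fk by (simp add: kd_kd[OF ops_xv])
      qed
    qed
  qed
  have "f \<in> L" if f: "f \<in> J" for f :: "'k mpoly"
  proof -
    have "f = (\<Sum>d\<in>(\<lambda>m. int (mdeg m)) ` supp f. hc d f)" by (rule sum_hc) simp_all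
    also have "\<dots> \<in> L"
    proof (rule is_ideal_sum[OF L])
      fix d assume "d \<in> (\<lambda>m. int (mdeg m)) ` supp f"
      then obtain n where d: "d = int n" by blast
      have "hc d f \<in> J" "hc d f \<in> gr V d" using hom_idealD(2)[OF J f] hc_gr J'(1) f by blast+
      then show "hc d f \<in> L" using step[of n] d by blast
    qed
    finally show ?thesis .
  qed
  moreover have "L \<subseteq> J"
    unfolding L_def ideal_gen_def by (rule hull_minimal) (use hom_idealD(1)[OF J] in auto)
  ultimately have "J = L" by blast
  then show ?thesis unfolding quadratic_ideal_def L_def by (intro exI[of _ "J \<inter> forms V 2"]) simp
qed

section \<open>Homogeneous coordinates and vanishing ideals\<close>

lemma eval_scale:
  fixes f :: "'k::field mpoly"
  assumes "f \<in> gr V (int d)"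
  shows "eval (\<lambda>i. a * x i) f = a ^ d * eval x f"
proof -
  have "mval (\<lambda>i. a * x i) m = a ^ d * mval x m" if "m \<in> supp f" for m
  proof -
    have "mdeg m = d" using assms that by (simp add: gr_def)
    then show ?thesis unfolding mval_def mdeg_def
      by (simp add: power_mult_distrib prod.distrib power_sum[symmetric])
  qed
  then show ?thesis unfolding eval_mval sum_distrib_left by (intro sum.cong) simp_all
qed

text \<open>f(a x) is a polynomial in a whose coefficients are the values of the homogeneous
  components at x, and it has infinitely many zeros.\<close>

lemma eval_hc_eq_0:
  fixes f :: "'k::field_char_0 mpoly"
  assumes f: "f \<in> polys V" and z: "\<And>a. a \<noteq> 0 \<Longrightarrow> eval (\<lambda>i. a * x i) f = 0"
  shows "eval x (hc (int d) f) = 0"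
proof -
  define D where "D = insert d (mdeg ` supp f)"
  have D: "finite D" by (simp add: D_def)
  define P where "P = (\<Sum>n\<in>D. Polynomial.monom (eval x (hc (int n) f)) n)"
  have P: "poly P a = eval (\<lambda>i. a * x i) f" for a
  proof -
    have "f = (\<Sum>n\<in>int ` D. hc n f)" by (rule sum_hc) (auto simp: D_def)
    also have "\<dots> = (\<Sum>n\<in>D. hc (int n) f)" by (simp add: sum.reindex)
    finally have "eval (\<lambda>i. a * x i) f = (\<Sum>n\<in>D. eval (\<lambda>i. a * x i) (hc (int n) f))"
      by (simp only: rhom_sum[OF rhom_eval, symmetric])
    also have "\<dots> = (\<Sum>n\<in>D. a ^ n * eval x (hc (int n) f))"
      by (intro sum.cong refl eval_scale[OF hc_gr[OF f]])
    finally show ?thesis by (simp add: P_def poly_sum poly_monom mult.commute)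
  qed
  have "infinite (UNIV - {0 :: 'k})" by (simp add: infinite_UNIV_char_0)
  moreover have "UNIV - {0} \<subseteq> {a. poly P a = 0}" using z by (auto simp: P)
  ultimately have "P = 0" using poly_roots_finite[of P] finite_subset by blast
  have "eval x (hc (int d) f) = (\<Sum>n\<in>D. if n = d then eval x (hc (int n) f) else 0)"
    using D by (simp add: D_def)
  also have "\<dots> = Polynomial.coeff P d"
    unfolding P_def Polynomial.coeff_sum by (intro sum.cong) simp_all
  finally show ?thesis by (simp add: \<open>P = 0\<close>)
qed

text \<open>The closure is cut out by forms, while the vanishing ideal admits all polynomials;
  invariance of Y under scaling bridges the gap through homogeneous components.\<close>

lemma vanishing_ideal_closure:
  fixes Y :: "(nat \<Rightarrow> 'k::field_char_0) set"
  assumes Y: "Y \<subseteq> proj_space V" and scale: "\<And>x a. x \<in> Y \<Longrightarrow> a \<noteq> 0 \<Longrightarrow> (\<lambda>i. a * x i) \<in> Y"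
  shows "vanishing_ideal V (zariski_closure V Y) = vanishing_ideal V Y"
proof
  have "Y \<subseteq> zariski_closure V Y" by (auto simp: zariski_closure_def)
  then show "vanishing_ideal V (zariski_closure V Y) \<subseteq> vanishing_ideal V Y"
    by (auto simp: vanishing_ideal_def)
  show "vanishing_ideal V Y \<subseteq> vanishing_ideal V (zariski_closure V Y)"
  proof
    fix f :: "'k mpoly" assume "f \<in> vanishing_ideal V Y"
    then have f: "f \<in> polys V" "\<And>x. x \<in> Y \<Longrightarrow> eval x f = 0" by (simp_all add: vanishing_ideal_def)
    define H where "H = range (\<lambda>d. hc (int d) f)"
    have "H \<subseteq> (\<Union>d. forms V d)"
      using hc_gr[OF f(1)] unfolding H_def gr_of_nat[symmetric] by blast
    then have "zariski_closed V (zeros V H)" unfolding zariski_closed_def by blast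
    moreover have "Y \<subseteq> zeros V H"
    proof
      fix x assume x: "x \<in> Y"
      have "eval x (hc (int d) f) = 0" for d
        by (rule eval_hc_eq_0[OF f(1)]) (rule f(2)[OF scale[OF x]])
      then show "x \<in> zeros V H" using x Y by (auto simp: zeros_def H_def)
    qed
    ultimately have sub: "zariski_closure V Y \<subseteq> zeros V H" by (auto simp: zariski_closure_def)
    have "eval x f = 0" if "x \<in> zariski_closure V Y" for x
    proof -
      have x: "\<And>d. eval x (hc (int d) f) = 0" using that sub by (auto simp: zeros_def H_def)
      have "f = (\<Sum>n\<in>int ` mdeg ` supp f. hc n f)" by (rule sum_hc) auto
      then have "eval x f = (\<Sum>n\<in>int ` mdeg ` supp f. eval x (hc n f))"
        by (simp only: rhom_sum[OF rhom_eval, symmetric])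
      also have "\<dots> = 0" using x by (intro sum.neutral) auto
      finally show ?thesis .
    qed
    then show "f \<in> vanishing_ideal V (zariski_closure V Y)" using f(1) by (simp add: vanishing_ideal_def)
  qed
qed

text \<open>At a point with nonzero x_i a power of x_i can be cancelled, so the vanishing ideal
  absorbs the localizations and equality on charts reduces to these two conditions.\<close>

lemma same_ideal_sheaf_vanishing:
  fixes X :: "(nat \<Rightarrow> 'k::field) set"
  assumes X: "X \<subseteq> proj_space V" and I: "I \<subseteq> polys V"
  shows "same_ideal_sheaf V I (vanishing_ideal V X) \<longleftrightarrow>
    I \<subseteq> vanishing_ideal V X \<and> (\<forall>f\<in>vanishing_ideal V X. \<forall>i\<in>V. \<exists>n. var i ^ n * f \<in> I)"
proof
  assume same: "same_ideal_sheaf V I (vanishing_ideal V X)"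
  then have eq: "\<And>i. i \<in> V \<Longrightarrow> chart_ideal V i I = chart_ideal V i (vanishing_ideal V X)"
    by (simp add: same_ideal_sheaf_def)
  have "I \<subseteq> vanishing_ideal V X"
  proof
    fix f :: "'k mpoly" assume f: "f \<in> I"
    have "eval x f = 0" if x: "x \<in> X" for x
    proof -
      obtain i where i: "i \<in> V" "x i \<noteq> 0" using x X by (auto simp: proj_space_def)
      have "var i ^ 0 * f \<in> I" using f by simp
      then have "f \<in> chart_ideal V i I" using f I unfolding chart_ideal_def by blast
      then have "f \<in> chart_ideal V i (vanishing_ideal V X)" by (simp only: eq[OF i(1)])
      then obtain n where "var i ^ n * f \<in> vanishing_ideal V X"
        unfolding chart_ideal_def by blast
      then have "eval x (var i ^ n * f) = 0" using x by (simp add: vanishing_ideal_def)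
      then show ?thesis using i(2) by (simp add: rhomD(3)[OF rhom_eval] rhom_power[OF rhom_eval])
    qed
    then show "f \<in> vanishing_ideal V X" using f I by (auto simp: vanishing_ideal_def)
  qed
  moreover have "\<exists>n. var i ^ n * f \<in> I" if f: "f \<in> vanishing_ideal V X" and i: "i \<in> V" for f :: "'k mpoly" and i
  proof -
    have "f \<in> polys V" using f by (simp add: vanishing_ideal_def)
    moreover have "var i ^ 0 * f \<in> vanishing_ideal V X" using f by simp
    ultimately have "f \<in> chart_ideal V i (vanishing_ideal V X)" unfolding chart_ideal_def by blast
    then have "f \<in> chart_ideal V i I" by (simp only: eq[OF i])
    then show ?thesis unfolding chart_ideal_def by blast
  qed
  ultimately show "I \<subseteq> vanishing_ideal V X \<and> (\<forall>f\<in>vanishing_ideal V X. \<forall>i\<in>V. \<exists>n. var i ^ n * f \<in> I)"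
    by blast
next
  assume *: "I \<subseteq> vanishing_ideal V X \<and> (\<forall>f\<in>vanishing_ideal V X. \<forall>i\<in>V. \<exists>n. var i ^ n * f \<in> I)"
  show "same_ideal_sheaf V I (vanishing_ideal V X)"
    unfolding same_ideal_sheaf_def
  proof
    fix i assume i: "i \<in> V"
    show "chart_ideal V i I = chart_ideal V i (vanishing_ideal V X)"
    proof
      show "chart_ideal V i I \<subseteq> chart_ideal V i (vanishing_ideal V X)"
        using * unfolding chart_ideal_def by blast
      show "chart_ideal V i (vanishing_ideal V X) \<subseteq> chart_ideal V i I"
      proof
        fix f :: "'k mpoly" assume "f \<in> chart_ideal V i (vanishing_ideal V X)"
        then obtain n where n: "f \<in> polys V" "var i ^ n * f \<in> vanishing_ideal V X"
          unfolding chart_ideal_def by blast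
        then obtain m where "var i ^ m * (var i ^ n * f) \<in> I" using * i by blast
        then have "var i ^ (m + n) * f \<in> I" by (simp add: power_add mult.assoc)
        then show "f \<in> chart_ideal V i I" using n(1) unfolding chart_ideal_def by blast
      qed
    qed
  qed
qed

lemma linear_form:
  fixes l :: "'k::field mpoly"
  assumes V: "finite V" and l: "l \<in> gr V 1"
  shows "l = (\<Sum>i\<in>V. const (coef l (Poly_Mapping.single i 1)) * var i)"
proof -
  let ?s = "\<lambda>i. Poly_Mapping.single i (1 :: nat)"
  have sub: "supp l \<subseteq> ?s ` V"
  proof
    fix m assume m: "m \<in> supp l"
    have d: "mdeg m = 1" using l m by (simp add: gr_def)
    then have "m \<noteq> 0" by auto
    then obtain u where u: "coef m u \<noteq> 0" by (metis lookup_zero poly_mapping_eqI)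
    then obtain m' where m': "m = Poly_Mapping.single u (Suc 0) + m'" using monom_split[of m u] by auto
    then have "m' = 0" using d by (simp add: mdeg_add mdeg_eq_0_iff)
    then have "m = ?s u" using m' by simp
    moreover have "supp m \<subseteq> V" using gr_polys[OF l] m by (simp add: polys_def)
    then have "u \<in> V" using u by (auto simp: in_keys_iff)
    ultimately show "m \<in> ?s ` V" by blast
  qed
  have inj: "inj_on ?s V" by (rule inj_onI) (metis One_nat_def lookup_single_eq lookup_single_not_eq zero_neq_one)
  have "l = (\<Sum>m\<in>supp l. Poly_Mapping.single m (coef l m))" by (rule sum_monomials)
  also have "\<dots> = (\<Sum>m\<in>?s ` V. Poly_Mapping.single m (coef l m))"
    using V sub by (intro sum.mono_neutral_left) (simp_all add: in_keys_iff)
  also have "\<dots> = (\<Sum>i\<in>V. Poly_Mapping.single (?s i) (coef l (?s i)))"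
    by (simp only: sum.reindex[OF inj] o_def)
  also have "\<dots> = (\<Sum>i\<in>V. const (coef l (?s i)) * var i)"
    by (intro sum.cong refl) (simp add: const_def var_def Poly_Mapping.mult_single)
  finally show ?thesis .
qed

text \<open>By the binomial theorem, the polynomials with a power multiplying r into I are closed
  under sums, so from the variables one reaches every linear form.\<close>

lemma power_linear_mem:
  fixes r :: "'k::field mpoly"
  assumes V: "finite V" and I: "is_ideal V I" and r: "r \<in> polys V" and l: "l \<in> gr V 1"
    and var: "\<And>i. i \<in> V \<Longrightarrow> \<exists>n. var i ^ n * r \<in> I"
  shows "\<exists>n. l ^ n * r \<in> I"
proof -
  note I' = is_idealD[OF I]
  define R where "R = {h \<in> polys V. \<exists>n. h ^ n * r \<in> I}"
  have add: "a + b \<in> R" if a: "a \<in> R" and b: "b \<in> R" for a b :: "'k mpoly"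
  proof -
    obtain m where m: "a \<in> polys V" "a ^ m * r \<in> I" using a by (auto simp: R_def)
    obtain n where n: "b \<in> polys V" "b ^ n * r \<in> I" using b by (auto simp: R_def)
    have "(a + b) ^ (m + n) * r = (\<Sum>k\<le>m + n. (of_nat (m + n choose k) * a ^ k * b ^ (m + n - k)) * r)"
      by (simp only: binomial_ring sum_distrib_right)
    also have "\<dots> \<in> I"
    proof (rule is_ideal_sum[OF I])
      fix k assume k: "k \<in> {..m + n}"
      have nat: "of_nat t \<in> polys V" for t :: nat by (induction t) (simp_all add: polys_add)
      show "(of_nat (m + n choose k) * a ^ k * b ^ (m + n - k)) * r \<in> I"
      proof (cases "m \<le> k")
        case True
        then have "a ^ k = a ^ (k - m) * a ^ m" by (simp add: power_add[symmetric])
        then have "(of_nat (m + n choose k) * a ^ k * b ^ (m + n - k)) * r =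
            (of_nat (m + n choose k) * a ^ (k - m) * b ^ (m + n - k)) * (a ^ m * r)"
          by (simp add: mult_ac)
        then show ?thesis by (simp only: I'(4)[OF _ m(2)] polys_mult polys_power nat m(1) n(1))
      next
        case False
        then have "b ^ (m + n - k) = b ^ (m - k) * b ^ n" by (simp add: power_add[symmetric])
        then have "(of_nat (m + n choose k) * a ^ k * b ^ (m + n - k)) * r =
            (of_nat (m + n choose k) * a ^ k * b ^ (m - k)) * (b ^ n * r)"
          by (simp add: mult_ac)
        then show ?thesis by (simp only: I'(4)[OF _ n(2)] polys_mult polys_power nat m(1) n(1))
      qed
    qed
    finally have "(a + b) ^ (m + n) * r \<in> I" .
    then show ?thesis using m(1) n(1) by (auto simp: R_def intro: polys_add)
  qed
  have zero: "0 \<in> R"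
  proof -
    have "0 ^ 1 * r \<in> I" using I'(2) by simp
    then show ?thesis unfolding R_def using polys_zero by blast
  qed
  have "const a * var i \<in> R" if i: "i \<in> V" for a i
  proof -
    obtain n where n: "var i ^ n * r \<in> I" using var[OF i] by blast
    have "(const a * var i) ^ n * r = const a ^ n * (var i ^ n * r)" by (simp add: power_mult_distrib mult.assoc)
    also have "\<dots> \<in> I" by (rule I'(4)[OF polys_power[OF polys_const] n])
    finally show ?thesis using i by (auto simp: R_def intro: polys_mult)
  qed
  then have "(\<Sum>i\<in>A. const (coef l (Poly_Mapping.single i 1)) * var i) \<in> R" if "A \<subseteq> V" for A
    using that by (induction A rule: infinite_finite_induct) (simp_all add: zero add)
  from this[of V] have "l \<in> R" using linear_form[OF V l] by simp
  then show ?thesis by (auto simp: R_def)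
qed

section \<open>Inner projections\<close>

lemma elimination_ideal_sheaf:
  fixes X :: "(nat \<Rightarrow> 'k::field_char_0) set"
  assumes X: "zariski_closed {0..N} X" and proj: "projection_from N q y"
    and I: "is_ideal {0..N} I" and same: "same_ideal_sheaf {0..N} I (vanishing_ideal {0..N} X)"
  shows "same_ideal_sheaf {1..N} (elimination_ideal N y I) (vanishing_ideal {1..N} (inner_projection N y X q))"
proof -
  let ?V = "{0..N}" and ?W = "{1..N}"
  let ?Y = "proj_map N y ` {x \<in> X. \<not> same_point x q}"
  obtain F where F: "F \<subseteq> (\<Union>d. forms ?V d)" "X = zeros ?V F" using X unfolding zariski_closed_def by blast
  have XV: "X \<subseteq> proj_space ?V" unfolding F(2) by (auto simp: zeros_def)
  have y: "y j \<in> gr ?V 1" if "j \<in> ?W" for j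
    using proj that gr_of_nat[of ?V 1] by (auto simp: projection_from_def)
  have y0: "(\<forall>j\<in>?W. eval x (y j) = 0) \<longleftrightarrow> same_point x q" if "x \<in> X" for x
    using proj that XV unfolding projection_from_def by blast
  have Xs: "(\<lambda>i. a * x i) \<in> X" if x: "x \<in> X" and a: "a \<noteq> 0" for x a
  proof -
    have "eval (\<lambda>i. a * x i) f = 0" if f: "f \<in> F" for f
    proof -
      obtain d where "f \<in> gr ?V (int d)" using F(1) f unfolding gr_of_nat by blast
      from eval_scale[OF this, of a x] show ?thesis using x f by (simp add: F(2) zeros_def)
    qed
    moreover have "(\<lambda>i. a * x i) \<in> proj_space ?V" using x XV a by (auto simp: proj_space_def)
    ultimately show ?thesis by (simp add: F(2) zeros_def)
  qed
  have Y: "?Y \<subseteq> proj_space ?W"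
  proof
    fix z assume "z \<in> ?Y"
    then obtain x where x: "x \<in> X" "\<not> same_point x q" "z = proj_map N y x" by blast
    then obtain j where "j \<in> ?W" "eval x (y j) \<noteq> 0" using y0 by blast
    then show "z \<in> proj_space ?W" by (auto simp: x(3) proj_space_def proj_map_def intro!: exI[of _ j])
  qed
  have Ys: "(\<lambda>i. a * z i) \<in> ?Y" if z: "z \<in> ?Y" and a: "a \<noteq> 0" for z a
  proof -
    obtain x where x: "x \<in> X" "\<not> same_point x q" "z = proj_map N y x" using z by blast
    have e: "eval (\<lambda>i. a * x i) (y j) = a * eval x (y j)" if "j \<in> ?W" for j
      using eval_scale[of "y j" ?V 1 a x] y[OF that] by simp
    have "(\<lambda>i. a * z i) = proj_map N y (\<lambda>i. a * x i)" by (auto simp: x(3) proj_map_def e)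
    moreover have "\<not> same_point (\<lambda>i. a * x i) q"
      using y0[OF Xs[OF x(1) a]] y0[OF x(1)] x(2) e a by auto
    ultimately show ?thesis using Xs[OF x(1) a] by blast
  qed
  have eval_proj: "eval x (subst y f) = eval (proj_map N y x) f" if "f \<in> polys ?W" for x f
    unfolding eval_subst by (rule eval_cong[OF that]) (simp add: proj_map_def)
  have KW: "vanishing_ideal ?W (inner_projection N y X q) = vanishing_ideal ?W ?Y"
    unfolding inner_projection_def by (rule vanishing_ideal_closure[OF Y Ys])
  have I1: "I \<subseteq> vanishing_ideal ?V X"
    and I2: "\<And>f i. f \<in> vanishing_ideal ?V X \<Longrightarrow> i \<in> ?V \<Longrightarrow> \<exists>n. var i ^ n * f \<in> I"
    using same_ideal_sheaf_vanishing[OF XV is_idealD(1)[OF I]] same by blast+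
  have E: "elimination_ideal N y I \<subseteq> polys ?W" by (auto simp: elimination_ideal_def)
  show ?thesis
    unfolding KW same_ideal_sheaf_vanishing[OF Y E]
  proof (intro conjI subsetI ballI)
    fix f assume "f \<in> elimination_ideal N y I"
    then have f: "f \<in> polys ?W" "subst y f \<in> vanishing_ideal ?V X"
      using I1 by (auto simp: elimination_ideal_def)
    then show "f \<in> vanishing_ideal ?W ?Y" by (auto simp: vanishing_ideal_def eval_proj)
  next
    fix f j assume fv: "f \<in> vanishing_ideal ?W ?Y" and j: "j \<in> ?W"
    then have f: "f \<in> polys ?W" by (simp add: vanishing_ideal_def)
    have sf: "subst y f \<in> polys ?V" by (rule subst_polys[OF f gr_polys[OF y]])
    have yj: "y j * subst y f \<in> polys ?V" by (rule polys_mult[OF gr_polys[OF y[OF j]] sf])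
    have "eval x (y j * subst y f) = 0" if x: "x \<in> X" for x
    proof (cases "same_point x q")
      case True
      then have "eval x (y j) = 0" using y0[OF x] j by blast
      then show ?thesis by (simp add: rhomD(3)[OF rhom_eval])
    next
      case False
      then have "eval (proj_map N y x) f = 0" using fv x by (auto simp: vanishing_ideal_def)
      then show ?thesis by (simp add: rhomD(3)[OF rhom_eval] eval_proj[OF f])
    qed
    then have "y j * subst y f \<in> vanishing_ideal ?V X" using yj by (simp add: vanishing_ideal_def)
    \<comment> \<open>Powers of the variables in R carry y_j f(y) into I; what is needed is a power
      of y_j, the image of x_j under the substitution.\<close>
    from power_linear_mem[OF _ I yj y[OF j] I2[OF this]]
    obtain n where n: "y j ^ n * (y j * subst y f) \<in> I" by auto
    have "var j ^ Suc n * f \<in> polys ?W" using f j by (intro polys_mult polys_power polys_var)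
    moreover have "subst y (var j ^ Suc n * f) = y j ^ n * (y j * subst y f)"
      by (simp add: rhomD(3)[OF rhom_subst] rhom_power[OF rhom_subst] mult_ac)
    ultimately have "var j ^ Suc n * f \<in> elimination_ideal N y I" using n by (simp add: elimination_ideal_def)
    then show "\<exists>n. var j ^ n * f \<in> elimination_ideal N y I" by blast
  qed
qed

text \<open>For a linear form the value at (1:0:...:0) is the coefficient of x_0.\<close>

lemma gr_drop_0:
  fixes l :: "'k::field mpoly"
  assumes l: "l \<in> gr {0..N} 1" and e: "eval (\<lambda>i. if i = 0 then 1 else 0) l = 0"
  shows "l \<in> gr {1..N} 1"
proof -
  define a where "a i = coef l (Poly_Mapping.single i 1)" for i
  have lf: "l = (\<Sum>i<Suc N. const (a i) * var i)"
    using linear_form[OF _ l] unfolding a_def by (simp add: atLeast0AtMost lessThan_Suc_atMost del: sum.lessThan_Suc)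
  have "0 = (\<Sum>i<Suc N. a i * (if i = 0 then 1 else 0))" using e unfolding lf eval_lin by simp
  also have "\<dots> = a 0" by (simp add: if_distrib[of "\<lambda>x. _ * x"] cong: if_cong del: sum.lessThan_Suc)
  finally have "l = (\<Sum>i<N. const (a (Suc i)) * var (Suc i))"
    unfolding lf sum.lessThan_Suc_shift by simp
  also have "\<dots> \<in> gr {1..N} 1" by (intro gr_sum gr_const_mult gr_var) auto
  finally show ?thesis .
qed

text \<open>Two coordinate systems with q = (1:0:...:0) are compared, one in which y_j is x_j and
  one adapted to the tangent space. Their transition preserves the span of x_1, ..., x_N, the linear
  forms vanishing at q, so it carries the ideal J of the second system to the elimination
  ideal.\<close>

lemma smooth_projection:
  fixes X :: "(nat \<Rightarrow> 'k::field_char_0) set"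
  assumes X: "X \<subseteq> proj_space {0..N}" and nondeg: "nondegenerate {0..N} X" and q: "q \<in> X"
    and smooth: "smooth_point {0..N} (vanishing_ideal {0..N} X) q"
    and proj: "projection_from N q y"
    and Gen: "Gen \<subseteq> forms {0..N} 2" "I0 = ideal_gen {0..N} Gen"
    and same: "same_ideal_sheaf {0..N} I0 (vanishing_ideal {0..N} X)"
    and tor: "\<And>i j. i \<le> p \<Longrightarrow> 2 \<le> j \<Longrightarrow> tor_vanishes {0..N} I0 i (i + j)" and p: "2 \<le> p"
  shows "quadratic_ideal {1..N} (elimination_ideal N y I0) \<and>
    (\<forall>i<p. \<forall>j\<ge>2. tor_vanishes {1..N} (elimination_ideal N y I0) i (i + j))"
proof -
  let ?V = "{0..N}" and ?W = "{1..N}" and ?K = "vanishing_ideal {0..N} X" and ?e = "\<lambda>i. if i = 0 then 1 else 0 :: 'k"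
  have I0: "is_ideal ?V I0" unfolding Gen(2) by (rule is_ideal_gen) (use Gen(1) in \<open>auto simp: forms_def\<close>)
  have I1: "I0 \<subseteq> ?K" and I2: "\<And>f i. f \<in> ?K \<Longrightarrow> i \<in> ?V \<Longrightarrow> \<exists>n. var i ^ n * f \<in> I0"
    using same_ideal_sheaf_vanishing[OF X is_idealD(1)[OF I0]] same by blast+
  have y: "y j \<in> gr ?V 1" if "j \<in> ?W" for j
    using proj that gr_of_nat[of ?V 1] by (auto simp: projection_from_def)
  have qV: "q \<in> proj_space ?V" using q X by blast
  have "same_point q q" unfolding same_point_def by (rule exI[of _ 1]) simp
  then have yq: "eval q (y j) = 0" if "j \<in> ?W" for j
    using proj qV that unfolding projection_from_def by blast
  from qV obtain i0 where "i0 \<in> ?V" and i0': "q i0 \<noteq> 0" unfolding proj_space_def by blast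
  then have i0: "i0 < Suc N" "q i0 \<noteq> 0" by simp_all
  from smooth obtain c :: nat and g :: "nat \<Rightarrow> 'k mpoly"
    where sm: "\<forall>j<c. g j \<in> ?K \<and> (\<exists>d. g j \<in> forms ?V d)"
      "\<forall>f\<in>?K. \<exists>h\<in>polys ?V. eval q h \<noteq> 0 \<and> h * f \<in> ideal_gen ?V (g ` {..<c})"
      "\<forall>a. (\<forall>i\<in>?V. (\<Sum>j<c. a j * eval q (partial_deriv i (g j))) = 0) \<longrightarrow> (\<forall>j<c. a j = 0)"
    unfolding smooth_point_def by (elim conjE exE)
  have g: "g j \<in> ?K" "\<exists>d. g j \<in> forms ?V d" if "j < c" for j
    using sm(1) that by simp_all
  note loc = bspec[OF sm(2)] and ind = mp[OF spec[OF sm(3)]]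
  have gq: "eval q (g j) = 0" "g j \<in> polys ?V" if "j < c" for j
    using g(1)[OF that] q by (simp_all add: vanishing_ideal_def)

  \<comment> \<open>Row 0 is a linear form with value 1 at q; the other rows are the y_j, which
    vanish at q.\<close>
  define W0 where "W0 r i = (if r = 0 then if i = i0 then inverse (q i0) else 0
    else coef (y r) (Poly_Mapping.single i 1))" for r i :: nat
  have yW0: "y j = (\<Sum>i<Suc N. const (W0 j i) * var i)" if "j \<in> ?W" for j
  proof -
    have "y j = (\<Sum>i\<in>?V. const (coef (y j) (Poly_Mapping.single i 1)) * var i)"
      by (rule linear_form[OF _ y[OF that]]) simp
    also have "?V = {..<Suc N}" by auto
    finally show ?thesis using that by (simp add: W0_def del: sum.lessThan_Suc)
  qed
  have eval_y: "eval x (y j) = (\<Sum>i<Suc N. W0 j i * x i)" if "j \<in> ?W" for j x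
    unfolding yW0[OF that] by (rule eval_lin)
  have row0: "(\<Sum>i<Suc N. W0 0 i * x i) = inverse (q i0) * x i0" for x
  proof -
    have "(\<Sum>i<Suc N. W0 0 i * x i) = (\<Sum>i<Suc N. if i = i0 then inverse (q i0) * x i0 else 0)"
      by (rule sum.cong) (simp_all add: W0_def)
    then show ?thesis using i0(1) by (simp del: sum.lessThan_Suc)
  qed
  have row0q: "(\<Sum>i<Suc N. W0 0 i * q i) = 1" unfolding row0 using i0(2) by simp
  have rowq: "(\<Sum>i<Suc N. W0 r i * q i) = 0" if "1 \<le> r" "r \<le> N" for r
    using eval_y[of r q] yq[of r] that by simp
  \<comment> \<open>A common zero of the y_j is a multiple of q, and row 0 does not vanish
    there.\<close>
  have ker: "triv_ker (Suc N) W0"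
    unfolding triv_ker_def
  proof (intro allI impI)
    fix v :: "nat \<Rightarrow> 'k" and j
    assume v: "\<forall>i<Suc N. (\<Sum>j<Suc N. W0 i j * v j) = 0" and j: "j < Suc N"
    show "v j = 0"
    proof (rule ccontr)
      assume vj: "v j \<noteq> 0"
      define x where "x i = (if i < Suc N then v i else 0)" for i
      have xv: "(\<Sum>i<Suc N. W0 r i * x i) = 0" if "r < Suc N" for r
      proof -
        have "(\<Sum>i<Suc N. W0 r i * x i) = (\<Sum>i<Suc N. W0 r i * v i)"
          by (rule sum.cong) (simp_all add: x_def)
        then show ?thesis using v that by simp
      qed
      have "x \<in> proj_space ?V" using vj j by (auto simp: proj_space_def x_def intro!: bexI[of _ j])
      moreover have "\<forall>j\<in>?W. eval x (y j) = 0" using eval_y xv by simp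
      ultimately have "same_point x q" using proj unfolding projection_from_def by blast
      then obtain a where "a \<noteq> 0" "x = (\<lambda>i. a * q i)" unfolding same_point_def by blast
      then have "x i0 \<noteq> 0" using i0(2) by simp
      moreover have "inverse (q i0) * x i0 = 0" using xv[of 0] unfolding row0 by simp
      ultimately show False using i0(2) by simp
    qed
  qed
  obtain U0 where WU0: "\<And>i j. i < Suc N \<Longrightarrow> j < Suc N \<Longrightarrow> (\<Sum>k<Suc N. W0 i k * U0 k j) = (if i = j then 1 else 0)"
    and UW0: "\<And>i j. i < Suc N \<Longrightarrow> j < Suc N \<Longrightarrow> (\<Sum>k<Suc N. U0 i k * W0 k j) = (if i = j then 1 else 0)"
    using triv_ker_inverse[OF ker] by blast
  have U0q: "U0 i 0 = q i" if "i < Suc N" for i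
    by (rule inverse_column[OF UW0 row0q rowq that])

  define lam where "lam k i = eval q (partial_deriv i (g k))" for k i
  \<comment> \<open>Euler's formula, since \<open>g k\<close> vanishes at q.\<close>
  have lamq: "(\<Sum>j<Suc N. lam k j * q j) = 0" if k: "k < c" for k
  proof -
    obtain d where "g k \<in> gr ?V (int d)" using g(2)[OF k] unfolding gr_of_nat by blast
    from euler[OF _ this, of q] have "(\<Sum>i\<in>?V. q i * lam k i) = 0"
      using gq(1)[OF k] by (simp add: lam_def)
    moreover have "?V = {..<Suc N}" by auto
    ultimately show ?thesis by (simp add: mult.commute del: sum.lessThan_Suc)
  qed
  have lami: "\<forall>a. (\<forall>i<Suc N. (\<Sum>k<c. a k * lam k i) = 0) \<longrightarrow> (\<forall>k<c. a k = 0)"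
  proof (intro allI impI)
    fix a k assume a: "\<forall>i<Suc N. (\<Sum>k<c. a k * lam k i) = 0" and k: "k < c"
    have "\<forall>i\<in>?V. (\<Sum>j<c. a j * eval q (partial_deriv i (g j))) = 0"
      using a by (simp add: lam_def)
    from ind[OF this] k show "a k = 0" by blast
  qed
  have "c \<le> N \<and> (\<exists>W'. triv_ker (Suc N) W' \<and> W' 0 = W0 0 \<and>
    (\<forall>i. 1 \<le> i \<longrightarrow> i \<le> N \<longrightarrow> (\<Sum>j<Suc N. W' i j * q j) = 0) \<and> (\<forall>k<c. W' (Suc k) = lam k))"
  proof (rule extend_rows[OF ker row0q rowq lamq])
    show "a k = 0" if "\<And>i. i < Suc N \<Longrightarrow> (\<Sum>k<c. a k * lam k i) = 0" "k < c" for a k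
      using mp[OF spec[OF lami, of a]] that by blast
  qed
  then obtain W where c: "c \<le> N" and kerW: "triv_ker (Suc N) W" and W0': "W 0 = W0 0"
    and Wq: "\<And>i. 1 \<le> i \<Longrightarrow> i \<le> N \<Longrightarrow> (\<Sum>j<Suc N. W i j * q j) = 0"
    and Wlam: "\<And>k. k < c \<Longrightarrow> W (Suc k) = lam k" by blast
  obtain U where WU: "\<And>i j. i < Suc N \<Longrightarrow> j < Suc N \<Longrightarrow> (\<Sum>k<Suc N. W i k * U k j) = (if i = j then 1 else 0)"
    and UW: "\<And>i j. i < Suc N \<Longrightarrow> j < Suc N \<Longrightarrow> (\<Sum>k<Suc N. U i k * W k j) = (if i = j then 1 else 0)"
    using triv_ker_inverse[OF kerW] by blast
  have row0W: "(\<Sum>i<Suc N. W 0 i * q i) = 1" unfolding W0' by (rule row0q)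
  have Uq: "U i 0 = q i" if "i < Suc N" for i
    by (rule inverse_column[OF UW row0W Wq that])

  interpret S: smooth_coordinates N c i0 I0 Gen q g W U
  proof
    show "eval q f = 0" if "f \<in> I0" for f using that I1 q by (auto simp: vanishing_ideal_def)
    show "\<exists>h\<in>polys ?V. eval q h \<noteq> 0 \<and> h * f \<in> ideal_gen ?V (g ` {..<c})" if "f \<in> I0" for f
      using that I1 by (intro loc) blast
    show "\<exists>m. var i0 ^ m * g j \<in> I0" if "j < c" for j
      using I2[OF g(1)[OF that]] i0(1) by simp
    show "W (Suc j) i = eval q (partial_deriv i (g j))" if "j < c" "i < Suc N" for i j
      using Wlam[OF that(1)] by (simp add: lam_def)
  qed (fact Gen gq WU UW Uq i0 c)+

  define yy0 where "yy0 j = (\<Sum>k<Suc N. const (U0 j k) * var k)" for j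
  define ww0 where "ww0 i = (\<Sum>j<Suc N. const (W0 i j) * var j)" for i
  interpret B: coordinate_change ?V yy0 ww0
    unfolding yy0_def[abs_def] ww0_def[abs_def] by (rule coordinate_change_matrix[OF WU0 UW0])
  have WV: "j \<in> ?V" if "j \<in> ?W" for j using that by auto
  have ww0: "ww0 j = y j" if "j \<in> ?W" for j unfolding ww0_def by (rule yW0[OF that, symmetric])
  \<comment> \<open>\<alpha> expresses the y_j in the tangent coordinates, \<beta> the tangent
    coordinates in the y_j; no x_0 occurs, since all these forms vanish at q.\<close>
  define \<alpha> where "\<alpha> j = subst S.yy (y j)" for j
  define \<beta> where "\<beta> j = subst yy0 (S.zz j)" for j
  have e0: "eval ?e (yy0 i) = q i" if "i < Suc N" for i
  proof -
    have "eval ?e (yy0 i) = (\<Sum>k<Suc N. U0 i k * ?e k)" unfolding yy0_def by (rule eval_lin)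
    also have "\<dots> = U0 i 0" by (simp add: if_distrib[of "\<lambda>x. _ * x"] cong: if_cong del: sum.lessThan_Suc)
    finally show ?thesis using U0q[OF that] by simp
  qed
  have \<alpha>: "\<alpha> j \<in> gr ?W 1" if j: "j \<in> ?W" for j
  proof (rule gr_drop_0)
    show "\<alpha> j \<in> gr ?V 1" unfolding \<alpha>_def by (rule S.graded(1)[OF y[OF j]])
    have "eval ?e (\<alpha> j) = eval q (y j)" unfolding \<alpha>_def eval_subst
      by (rule eval_cong[OF gr_polys[OF y[OF j]]]) (simp add: S.eval_e0_yy)
    then show "eval ?e (\<alpha> j) = 0" using yq[OF j] by simp
  qed
  have \<beta>: "\<beta> j \<in> gr ?W 1" if j: "j \<in> ?W" for j
  proof (rule gr_drop_0)
    have z: "S.zz j \<in> gr ?V 1" by (rule S.z[OF WV[OF j]])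
    show "\<beta> j \<in> gr ?V 1" unfolding \<beta>_def by (rule B.graded(1)[OF z])
    have "eval ?e (\<beta> j) = eval q (S.zz j)" unfolding \<beta>_def eval_subst
      by (rule eval_cong[OF gr_polys[OF z]]) (simp add: e0)
    also have "\<dots> = (\<Sum>i<Suc N. W j i * q i)" unfolding S.zz_def by (rule eval_lin)
    finally show "eval ?e (\<beta> j) = 0" using Wq j by simp
  qed
  have sub\<alpha>: "subst S.yy (subst y f) = subst \<alpha> f" for f unfolding subst_subst \<alpha>_def ..
  interpret D: coordinate_change ?W \<beta> \<alpha>
  proof
    fix j assume j: "j \<in> ?W"
    show "\<beta> j \<in> gr ?W 1" "\<alpha> j \<in> gr ?W 1" by (rule \<beta>[OF j] \<alpha>[OF j])+
    have "subst \<alpha> (\<beta> j) = subst S.yy (subst y (\<beta> j))" by (rule sub\<alpha>[symmetric])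
    also have "subst y (\<beta> j) = subst ww0 (\<beta> j)"
      by (rule subst_cong[OF gr_polys[OF \<beta>[OF j]]]) (simp add: ww0)
    also have "\<dots> = S.zz j" unfolding \<beta>_def by (rule B.inverse(1)[OF gr_polys[OF S.z[OF WV[OF j]]]])
    also have "subst S.yy (S.zz j) = var j" by (rule S.yz[OF WV[OF j]])
    finally show "subst \<alpha> (\<beta> j) = var j" .
    have "subst \<beta> (\<alpha> j) = subst yy0 (subst S.zz (\<alpha> j))" unfolding subst_subst \<beta>_def[abs_def] ..
    also have "subst S.zz (\<alpha> j) = y j" unfolding \<alpha>_def by (rule S.inverse(1)[OF gr_polys[OF y[OF j]]])
    also have "\<dots> = ww0 j" by (rule ww0[OF j, symmetric])
    also have "subst yy0 (ww0 j) = var j" by (rule B.yz[OF WV[OF j]])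
    finally show "subst \<beta> (\<alpha> j) = var j" .
  qed
  define J where "J = S.I \<inter> polys ?W"
  have J: "hom_ideal ?W J" unfolding J_def by (rule hom_ideal_restrict[OF S.I_hom]) auto
  have JW: "J \<subseteq> polys ?W" by (simp add: J_def)
  let ?E = "elimination_ideal N y I0"
  have sy: "subst y f \<in> polys ?V" if "f \<in> polys ?W" for f by (rule subst_polys[OF that gr_polys[OF y]])
  have E: "?E = subst \<beta> ` J"
  proof (rule Set.set_eqI)
    fix f :: "'k mpoly"
    show "f \<in> ?E \<longleftrightarrow> f \<in> subst \<beta> ` J"
    proof (cases "f \<in> polys ?W")
      case True
      have "f \<in> ?E \<longleftrightarrow> subst y f \<in> I0" using True by (simp add: elimination_ideal_def)
      also have "\<dots> \<longleftrightarrow> subst S.yy (subst y f) \<in> subst S.yy ` I0"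
        by (rule S.mem_image[OF S.I0_polys sy[OF True], symmetric])
      also have "\<dots> \<longleftrightarrow> subst \<alpha> f \<in> J"
        unfolding sub\<alpha> J_def S.I_def using D.closed(2)[OF True] by blast
      also have "\<dots> \<longleftrightarrow> f \<in> subst \<beta> ` J" by (rule D.image_eq[OF JW True, symmetric])
      finally show ?thesis .
    next
      case False
      then have "f \<notin> subst \<beta> ` J" using D.closed(1) JW by blast
      with False show ?thesis by (simp add: elimination_ideal_def)
    qed
  qed
  have hE: "hom_ideal ?W ?E" unfolding E by (rule D.hom_ideal_image[OF J])
  have torE: "tor_vanishes ?W ?E k (k + j)" if "k < p" "2 \<le> j" for k j
    unfolding E
  proof (rule D.tor_vanishes_image[OF hom_idealD(1)[OF J]])
    show "tor_vanishes ?W J k (k + j)"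
      unfolding J_def by (rule S.tor_vanishes_projection[OF tor that])
  qed
  have "quadratic_ideal ?W ?E"
  proof (rule quadratic_ideal_of_tor[OF _ hE])
    \<comment> \<open>Only k < p is available, so p \<ge> 2 is what provides Tor_1.\<close>
    show "tor_vanishes ?W ?E 1 (1 + j)" if "2 \<le> j" for j using p that by (intro torE) simp_all
    show "f = 0" if f: "f \<in> ?E" "f \<in> gr ?W 0" for f
    proof -
      define a where "a = coef f 0"
      have fa: "f = const a" unfolding a_def by (rule gr_0_eq[OF f(2)])
      have "const a \<in> I0" using f(1) unfolding fa elimination_ideal_def by simp
      then have "const a \<in> ?K" using I1 by blast
      then have "eval q (const a) = 0" using q unfolding vanishing_ideal_def by blast
      then show ?thesis by (simp add: fa)
    qed
    \<comment> \<open>A nonzero linear form in the elimination ideal would give a hyperplane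
      containing X.\<close>
    show "f = 0" if f: "f \<in> ?E" "f \<in> gr ?W 1" for f
    proof -
      have fI: "subst y f \<in> I0" using f(1) by (simp add: elimination_ideal_def)
      have "subst y f \<in> gr ?V (int 1)" using subst_gr[OF f(2) y] by simp
      then have l: "subst y f \<in> forms ?V 1" unfolding gr_of_nat .
      have "X \<subseteq> zeros ?V {subst y f}" using fI I1 X by (auto simp: zeros_def vanishing_ideal_def)
      then have "subst y f = 0" using nondeg l unfolding nondegenerate_def by blast
      then have "subst \<alpha> f = 0" unfolding sub\<alpha>[symmetric] by (simp add: rhom_zero[OF rhom_subst])
      then show ?thesis using D.inverse(2)[OF gr_polys[OF f(2)]] by (simp add: rhom_zero[OF rhom_subst])
    qed
  qed simp
  then show ?thesis using torE by blast
qed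

theorem corollary3p4:
  fixes X :: "(nat \<Rightarrow> 'k :: {alg_closed_field, field_char_0}) set"
    and q :: "nat \<Rightarrow> 'k" and y :: "nat \<Rightarrow> 'k mpoly" and N p :: nat
    and Xq :: "(nat \<Rightarrow> 'k) set"
  assumes "zariski_closed {0..N} X"
    and "nondegenerate {0..N} X"
    and "quadratic_scheme {0..N} (vanishing_ideal {0..N} X)"
    and "p \<ge> 2"
    and "property_N2 {0..N} p (vanishing_ideal {0..N} X)"
    and "q \<in> X"
    and "smooth_point {0..N} (vanishing_ideal {0..N} X) q"
    and "projection_from N q y"
    and "Xq = inner_projection N y X q"
  shows "(\<forall>I. homogeneous_ideal {0..N} I \<and> same_ideal_sheaf {0..N} I (vanishing_ideal {0..N} X) \<longrightarrow>
              same_ideal_sheaf {1..N} (elimination_ideal N y I) (vanishing_ideal {1..N} Xq)) \<and>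
         quadratic_scheme {1..N} (vanishing_ideal {1..N} Xq) \<and>
         property_N2 {1..N} (p - 1) (vanishing_ideal {1..N} Xq)"
proof -
  let ?V = "{0..N}" and ?W = "{1..N}" and ?K = "vanishing_ideal {1..N} Xq"
  have sheaf: "same_ideal_sheaf ?W (elimination_ideal N y I) ?K"
    if "is_ideal ?V I" "same_ideal_sheaf ?V I (vanishing_ideal ?V X)" for I
    unfolding assms(9) by (rule elimination_ideal_sheaf[OF assms(1,8) that])
  obtain I0 where I0: "quadratic_ideal ?V I0" "same_ideal_sheaf ?V I0 (vanishing_ideal ?V X)"
    "\<forall>i\<le>p. \<forall>j\<ge>2. tor_vanishes ?V I0 i (i + j)"
    using assms(5) unfolding property_N2_def by blast
  obtain Gen where Gen: "Gen \<subseteq> forms ?V 2" "I0 = ideal_gen ?V Gen"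
    using I0(1) unfolding quadratic_ideal_def by blast
  have "is_ideal ?V I0" unfolding Gen(2) by (rule is_ideal_gen) (use Gen(1) in \<open>auto simp: forms_def\<close>)
  note E = sheaf[OF this I0(2)]
  have X: "X \<subseteq> proj_space ?V" using assms(1) by (auto simp: zariski_closed_def zeros_def)
  have "quadratic_ideal ?W (elimination_ideal N y I0) \<and>
    (\<forall>i<p. \<forall>j\<ge>2. tor_vanishes ?W (elimination_ideal N y I0) i (i + j))"
    using I0(3) by (intro smooth_projection[OF X assms(2,6,7,8) Gen I0(2) _ assms(4)]) blast
  then have Q: "quadratic_ideal ?W (elimination_ideal N y I0)"
    and T: "\<forall>i\<le>p - 1. \<forall>j\<ge>2. tor_vanishes ?W (elimination_ideal N y I0) i (i + j)"
    using assms(4) by auto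
  show ?thesis
  proof (intro conjI allI impI)
    fix I assume "homogeneous_ideal ?V I \<and> same_ideal_sheaf ?V I (vanishing_ideal ?V X)"
    then show "same_ideal_sheaf ?W (elimination_ideal N y I) ?K"
      using sheaf[of I] by (simp add: homogeneous_ideal_def)
  next
    show "quadratic_scheme ?W ?K" unfolding quadratic_scheme_def using Q E by blast
    show "property_N2 ?W (p - 1) ?K" unfolding property_N2_def using Q E T by blast
  qed
qed

end
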